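(* Let $n,k\ge0$ be integers with $n+k\ge1$. There is a poset equivalence (isomorphism of posets) $F_{n,k}\to\mathbb Z^k\times(\mathbb Z/2)^k$, where the poset structure on $\mathbb Z^k\times(\mathbb Z/2)^k$ is defined by $(\bar z,\bar p)\le(\bar z',\bar p')$ if and only if for every $i$ either $p_i=p_i'$ and $z_i=z_i'$, or $p_i<p_i'$ and ($z_i=z_i'$ or $z_i=z_i'+1$) (with $\mathbb Z/2=\{0,1\}$, $0<1$). Moreover, the realization of the poset $\mathbb Z^k\times(\mathbb Z/2)^k$ is homeomorphic to $\mathbb R^k$, and the $\mathbb Z^k$-action on $F_{n,k}$ translates to the canonical $\mathbb Z^k$-action on $\mathbb R^k$ (by translations).
   Context: A *graph* is a pointed, connected (finite) one-dimensional CW-complex; its basepoint, a vertex, is denoted $*$. $S^1$ is the circle with basepoint $\circ$. **Groups.** $G_{n,k}$ is the graph with basepoint $*$ consisting of $n$ loops at $*$ and, for each $j=1,\dots,k$, an edge (stem) from $*$ to another vertex with a circle $C_j$ attached at that vertex; $\kappa_j:S^1\to G_{n,k}$ identifies $S^1$ with $C_j$, sending $\circ$ to the endpoint of the $j$th stem. $A_{n,k}$ is the group of path components of the space of basepointed self homotopy equivalences of $G_{n,k}$ fixing every $C_j$ pointwise, and $A_n^k$ the analogous group with homotopy equivalences fixing the circles up to a rotation. There is a central extension $1\to\mathbb Z^k\to A_{n,k}\to A_n^k\to1$; the $j$th generator of $\mathbb Z^k$ is the class of the map that is the identity except that it winds the $j$th stem once around $C_j$. **$L_{n,k}$.** An $(n,k)$-graph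 $(\Gamma,\underline l)$ is a graph $\Gamma$ of genus (rank of $\pi_1$) $n+k$ with no separating edges, equipped with embeddings $l_j:S^1\to\Gamma$, $j=1,\dots,k$, such that: (1) each $\circ_j:=l_j(\circ)$ is a vertex; (2) all vertices have valence at least $2$, and a vertex of valence $2$ is equal to $*$ or some $\circ_j$; (3) any two cycles $\mathbb S_j:=l_j(S^1)$ meet in at most a point and the dual graph of the $\mathbb S_j$'s (bipartite graph with one vertex per cycle and one vertex per point lying on at least two cycles, with an edge when the point lies on the cycle) is a forest. A marked $(n,k)$-graph is a graph $\Gamma$ with a pointed homotopy equivalence $\phi:G_{n,k}\to\Gamma$ such that $(\Gamma,(\phi\circ\kappa_j)_j)$ is an $(n,k)$-graph; $(\Gamma^1,\phi^1)$, $(\Gamma^2,\phi^2)$ are equivalent if there is a graph isomorphism $\psi:\Gamma^1\to\Gamma^2$ with $\psi\phi^1(C_j)=\phi^2(C_j)$ for all $j$ and $\psi\phi^1\simeq\phi^2$ relative to all $C_j$ (and the basepoint). Let $\hat\Gamma$ be obtained from $\Gamma$ by collapsing all edges in the cycles; an edge may be collapsed if it is not a loop in $\Gamma$ or in $\hat\Gamma$, and a forest collapse is a sequence of such edge collapses (markings are composed with the collapse). $L_{n,k}$ is the poset of equivalence classes of marked $(n,k)$-graphs, with $(\Gamma^1,\phi^1)\le(\Gamma^2,\phi^2)$ if $(\Gamma^1,\phi^1)$ is equivalent to a forest collapse of $(\Gamma^2,\phi^2)$. $A_{n,k}$ acts by $\lambda\cdot(\Gamma,\phi)=(\Gamma,\phi\circ\lambda^{-1})$.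 **$L_n^k$ and $F_{n,k}$.** $L_n^k$ is the poset defined in the same way with the following changes: the points $\circ_j$ are not required to be vertices, every vertex other than $*$ has valence at least $3$ (and $*$ has valence at least $2$), and in the equivalence relation the homotopy $\psi\phi^1\simeq\phi^2$ is relative to each $C_j$ only up to a rotation of $C_j$. Forgetting the basepoints $\circ_j$ of the cycles gives a poset map $L_{n,k}\to L_n^k$. $F_{n,k}$ is the fiber (preimage, with induced order) of this map over the element $(R_{n+k},id)$, where $R_{n+k}$ is the rose with $n+k$ petals and the marking $G_{n,k}\to R_{n+k}$ collapses the stems. It carries the $\mathbb Z^k$-action obtained by restricting the action of $A_{n,k}$ on $L_{n,k}$ to the central subgroup $\mathbb Z^k$.
   Formalization: Homotopies "relative to all C_j" (also used to straighten a marking after a collapse) keep each cycle's image setwise, fixing ∘_j (free to rotate for L_n^k), instead of being pointwise constant on C_j; read pointwise, F_{n,k} would be uncountable for k≥1. *)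

theory Defs
  imports "HOL-Analysis.Analysis" "HOL-Algebra.Generated_Groups"
begin

section \<open>Graphs\<close>

text \<open>
  A finite one-dimensional CW-complex with a base vertex is given by its cells and attaching maps.
  Each edge \<^term>\<open>e\<close> comes with a characteristic map from the unit interval that starts at
  \<^term>\<open>src\<close> and ends at \<^term>\<open>tgt\<close>; the orientation carries no information, since
  isomorphisms of graphs (below) may reverse edges. Every finite graph is isomorphic to one whose cells
  are labelled by natural numbers.
\<close>

record pgraph =
  verts :: "nat set"
  edges :: "nat set"
  src :: "nat \<Rightarrow> nat"
  tgt :: "nat \<Rightarrow> nat"
  base :: nat

text \<open>Points of the space: vertices, and points \<open>Inner e t\<close> with \<open>0 < t < 1\<close> inside the edge \<open>e\<close>.\<close>

datatype gpoint = Vert nat | Inner nat real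

definition edge_pt :: "pgraph \<Rightarrow> nat \<Rightarrow> real \<Rightarrow> gpoint" where
  "edge_pt \<Gamma> e t =
     (if t \<le> 0 then Vert (src \<Gamma> e) else if t \<ge> 1 then Vert (tgt \<Gamma> e) else Inner e t)"

definition open_edge :: "nat \<Rightarrow> gpoint set" where
  "open_edge e = Inner e ` {0<..<1}"

definition points :: "pgraph \<Rightarrow> gpoint set" where
  "points \<Gamma> = Vert ` verts \<Gamma> \<union> (\<Union>e\<in>edges \<Gamma>. open_edge e)"

text \<open>The quotient topology from the disjoint union of the (discrete) vertex set and one copy of the
  unit interval for each edge.\<close>

definition space_of :: "pgraph \<Rightarrow> gpoint topology" where
  "space_of \<Gamma> = topology (\<lambda>U. U \<subseteq> points \<Gamma> \<and>
     (\<forall>e\<in>edges \<Gamma>. openin (top_of_set {0..1}) {t\<in>{0..1}. edge_pt \<Gamma> e t \<in> U}))"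

lemma openin_space_of:
  "openin (space_of \<Gamma>) U \<longleftrightarrow> U \<subseteq> points \<Gamma> \<and>
     (\<forall>e\<in>edges \<Gamma>. openin (top_of_set {0..1}) {t\<in>{0..1}. edge_pt \<Gamma> e t \<in> U})"
proof -
  have "istopology (\<lambda>U. U \<subseteq> points \<Gamma> \<and>
     (\<forall>e\<in>edges \<Gamma>. openin (top_of_set {0..1}) {t\<in>{0..1}. edge_pt \<Gamma> e t \<in> U}))"
    unfolding istopology_def
  proof (intro conjI allI impI ballI)
    fix S T e
    assume "S \<subseteq> points \<Gamma> \<and> (\<forall>e\<in>edges \<Gamma>. openin (top_of_set {0..1}) {t\<in>{0..1}. edge_pt \<Gamma> e t \<in> S})"
      "T \<subseteq> points \<Gamma> \<and> (\<forall>e\<in>edges \<Gamma>. openin (top_of_set {0..1}) {t\<in>{0..1}. edge_pt \<Gamma> e t \<in> T})"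
      "e \<in> edges \<Gamma>"
    then have "openin (top_of_set {0..1})
        ({t\<in>{0..1}. edge_pt \<Gamma> e t \<in> S} \<inter> {t\<in>{0..1}. edge_pt \<Gamma> e t \<in> T})"
      by (intro openin_Int) auto
    moreover have "{t\<in>{0..1}. edge_pt \<Gamma> e t \<in> S} \<inter> {t\<in>{0..1}. edge_pt \<Gamma> e t \<in> T}
        = {t\<in>{0..1}. edge_pt \<Gamma> e t \<in> S \<inter> T}" by auto
    ultimately show "openin (top_of_set {0..1}) {t\<in>{0..1}. edge_pt \<Gamma> e t \<in> S \<inter> T}" by simp
  next
    fix K e
    assume "\<forall>S\<in>K. S \<subseteq> points \<Gamma> \<and> (\<forall>e\<in>edges \<Gamma>. openin (top_of_set {0..1}) {t\<in>{0..1}. edge_pt \<Gamma> e t \<in> S})"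
      "e \<in> edges \<Gamma>"
    then have "openin (top_of_set {0..1}) (\<Union>S\<in>K. {t\<in>{0..1}. edge_pt \<Gamma> e t \<in> S})"
      by (intro openin_Union) auto
    moreover have "(\<Union>S\<in>K. {t\<in>{0..1}. edge_pt \<Gamma> e t \<in> S}) = {t\<in>{0..1}. edge_pt \<Gamma> e t \<in> \<Union>K}"
      by auto
    ultimately show "openin (top_of_set {0..1}) {t\<in>{0..1}. edge_pt \<Gamma> e t \<in> \<Union>K}" by simp
  qed auto
  then show ?thesis
    by (simp add: space_of_def topology_inverse')
qed

definition base_pt :: "pgraph \<Rightarrow> gpoint" where
  "base_pt \<Gamma> = Vert (base \<Gamma>)"

definition graph :: "pgraph \<Rightarrow> bool" where
  "graph \<Gamma> \<longleftrightarrow> finite (verts \<Gamma>) \<and> finite (edges \<Gamma>) \<and>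
     src \<Gamma> ` edges \<Gamma> \<subseteq> verts \<Gamma> \<and> tgt \<Gamma> ` edges \<Gamma> \<subseteq> verts \<Gamma> \<and>
     base \<Gamma> \<in> verts \<Gamma> \<and> connected_space (space_of \<Gamma>)"

definition valence :: "pgraph \<Rightarrow> nat \<Rightarrow> nat" where
  "valence \<Gamma> v = card {e\<in>edges \<Gamma>. src \<Gamma> e = v} + card {e\<in>edges \<Gamma>. tgt \<Gamma> e = v}"

definition separating :: "pgraph \<Rightarrow> nat \<Rightarrow> bool" where
  "separating \<Gamma> e \<longleftrightarrow> \<not> connectedin (space_of \<Gamma>) (points \<Gamma> - open_edge e)"

definition graph_iso :: "pgraph \<Rightarrow> pgraph \<Rightarrow> (gpoint \<Rightarrow> gpoint) \<Rightarrow> bool" where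
  "graph_iso \<Gamma> \<Gamma>' \<psi> \<longleftrightarrow> homeomorphic_map (space_of \<Gamma>) (space_of \<Gamma>') \<psi> \<and>
     \<psi> ` Vert ` verts \<Gamma> = Vert ` verts \<Gamma>' \<and> \<psi> (base_pt \<Gamma>) = base_pt \<Gamma>'"


section \<open>Fundamental group and genus\<close>

definition loops :: "'a topology \<Rightarrow> 'a \<Rightarrow> (real \<Rightarrow> 'a) set" where
  "loops X x = {p. pathin X p \<and> p 0 = x \<and> p 1 = x}"

definition loop_class :: "'a topology \<Rightarrow> 'a \<Rightarrow> (real \<Rightarrow> 'a) \<Rightarrow> (real \<Rightarrow> 'a) set" where
  "loop_class X x p =
     {q. homotopic_with (\<lambda>r. r 0 = x \<and> r 1 = x) (top_of_set {0..1}) X p q}"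

definition loop_concat :: "(real \<Rightarrow> 'a) \<Rightarrow> (real \<Rightarrow> 'a) \<Rightarrow> real \<Rightarrow> 'a" where
  "loop_concat p q t = (if t \<le> 1/2 then p (2 * t) else q (2 * t - 1))"

definition pi1 :: "'a topology \<Rightarrow> 'a \<Rightarrow> (real \<Rightarrow> 'a) set monoid" where
  "pi1 X x = \<lparr>carrier = loop_class X x ` loops X x,
              mult = (\<lambda>a b. \<Union>p\<in>a. \<Union>q\<in>b. loop_class X x (loop_concat p q)),
              one = loop_class X x (\<lambda>_. x)\<rparr>"

definition has_rank :: "('a, 'b) monoid_scheme \<Rightarrow> nat \<Rightarrow> bool" where
  "has_rank G r \<longleftrightarrow>
     (\<exists>S\<subseteq>carrier G. finite S \<and> card S = r \<and> generate G S = carrier G) \<and>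
     (\<forall>S\<subseteq>carrier G. finite S \<and> generate G S = carrier G \<longrightarrow> r \<le> card S)"


section \<open>The graph \<open>G\<^sub>n\<^sub>,\<^sub>k\<close> and the group \<open>A\<^sub>n\<^sub>,\<^sub>k\<close>\<close>

text \<open>
  The index \<open>j\<close> of the circles ranges over \<open>{..<k}\<close>. Edges \<open>{..<n}\<close> are the loops at the base vertex
  \<open>0\<close>, edge \<open>n + j\<close> is the stem from \<open>0\<close> to the vertex \<open>Suc j\<close>, and edge \<open>n + k + j\<close> is the circle
  \<open>C\<^sub>j\<close> at \<open>Suc j\<close>.
\<close>

definition Gnk :: "nat \<Rightarrow> nat \<Rightarrow> pgraph" where
  "Gnk n k = \<lparr>verts = {..k}, edges = {..<n + k + k},
     src = (\<lambda>e. if e < n + k then 0 else Suc (e - (n + k))),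
     tgt = (\<lambda>e. if e < n then 0 else if e < n + k then Suc (e - n) else Suc (e - (n + k))),
     base = 0\<rparr>"

text \<open>\<open>S\<^sup>1\<close> is the unit circle in the complex plane, with basepoint \<open>1\<close>.\<close>

definition S1 :: "complex topology" where
  "S1 = top_of_set (sphere 0 1)"

definition kappa :: "nat \<Rightarrow> nat \<Rightarrow> nat \<Rightarrow> complex \<Rightarrow> gpoint" where
  "kappa n k j z = edge_pt (Gnk n k) (n + k + j) (Arg2pi z / (2 * pi))"

definition circ :: "nat \<Rightarrow> nat \<Rightarrow> nat \<Rightarrow> gpoint set" where
  "circ n k j = kappa n k j ` sphere 0 1"

definition pointed_homotopy_equivalence ::
    "'a topology \<Rightarrow> 'a \<Rightarrow> 'b topology \<Rightarrow> 'b \<Rightarrow> ('a \<Rightarrow> 'b) \<Rightarrow> bool" where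
  "pointed_homotopy_equivalence X x Y y f \<longleftrightarrow> continuous_map X Y f \<and> f x = y \<and>
     (\<exists>g. continuous_map Y X g \<and> g y = x \<and>
          homotopic_with (\<lambda>h. h x = x) X X (g \<circ> f) id \<and>
          homotopic_with (\<lambda>h. h y = y) Y Y (f \<circ> g) id)"

definition fixes_circles :: "nat \<Rightarrow> nat \<Rightarrow> (gpoint \<Rightarrow> gpoint) \<Rightarrow> bool" where
  "fixes_circles n k f \<longleftrightarrow> f (base_pt (Gnk n k)) = base_pt (Gnk n k) \<and>
     (\<forall>j<k. \<forall>x\<in>circ n k j. f x = x)"

definition A_maps :: "nat \<Rightarrow> nat \<Rightarrow> (gpoint \<Rightarrow> gpoint) set" where
  "A_maps n k = {f. pointed_homotopy_equivalence (space_of (Gnk n k)) (base_pt (Gnk n k))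
                      (space_of (Gnk n k)) (base_pt (Gnk n k)) f \<and> fixes_circles n k f}"

text \<open>Path components of the mapping space are homotopy classes.\<close>

definition A_class :: "nat \<Rightarrow> nat \<Rightarrow> (gpoint \<Rightarrow> gpoint) \<Rightarrow> (gpoint \<Rightarrow> gpoint) set" where
  "A_class n k f =
     {g. homotopic_with (fixes_circles n k) (space_of (Gnk n k)) (space_of (Gnk n k)) f g}"

definition A_group :: "nat \<Rightarrow> nat \<Rightarrow> (gpoint \<Rightarrow> gpoint) set monoid" where
  "A_group n k = \<lparr>carrier = A_class n k ` A_maps n k,
                  mult = (\<lambda>a b. \<Union>f\<in>a. \<Union>g\<in>b. A_class n k (f \<circ> g)),
                  one = A_class n k id\<rparr>"

text \<open>The \<open>j\<close>-th stem is sent to the stem followed by one turn around \<open>C\<^sub>j\<close>.\<close>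

definition wind :: "nat \<Rightarrow> nat \<Rightarrow> nat \<Rightarrow> gpoint \<Rightarrow> gpoint" where
  "wind n k j x = (case x of Vert v \<Rightarrow> Vert v
     | Inner e t \<Rightarrow> if e = n + j
         then (if t \<le> 1/2 then edge_pt (Gnk n k) (n + j) (2 * t)
               else edge_pt (Gnk n k) (n + k + j) (2 * t - 1))
         else Inner e t)"

definition Zk :: "nat \<Rightarrow> (nat \<Rightarrow> int) set" where
  "Zk k = {m. \<forall>i\<ge>k. m i = 0}"

text \<open>The inclusion of \<open>\<int>\<^sup>k\<close>: \<open>m\<close> goes to the product over \<open>j\<close> of the \<open>m j\<close>-th powers of the
  generators, which commute.\<close>

definition Zk_to_A :: "nat \<Rightarrow> nat \<Rightarrow> (nat \<Rightarrow> int) \<Rightarrow> (gpoint \<Rightarrow> gpoint) set" where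
  "Zk_to_A n k m =
     foldr (\<lambda>j a. (A_class n k (wind n k j) [^]\<^bsub>A_group n k\<^esub> m j) \<otimes>\<^bsub>A_group n k\<^esub> a)
       [0..<k] \<one>\<^bsub>A_group n k\<^esub>"


section \<open>The posets \<open>L\<^sub>n\<^sub>,\<^sub>k\<close> and \<open>L\<^sub>n\<^sup>k\<close>\<close>

text \<open>The flag \<open>b\<close> is \<open>True\<close> for \<open>L\<^sub>n\<^sub>,\<^sub>k\<close> (cycles with basepoints) and \<open>False\<close> for \<open>L\<^sub>n\<^sup>k\<close>.\<close>

definition forest :: "('a \<Rightarrow> 'a \<Rightarrow> bool) \<Rightarrow> bool" where
  "forest adj \<longleftrightarrow> \<not> (\<exists>xs. 3 \<le> length xs \<and> distinct xs \<and>
     (\<forall>i<length xs. adj (xs ! i) (xs ! (Suc i mod length xs))))"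

definition dual_adj :: "nat \<Rightarrow> (nat \<Rightarrow> 'a set) \<Rightarrow> nat + 'a \<Rightarrow> nat + 'a \<Rightarrow> bool" where
  "dual_adj k S x y \<longleftrightarrow> (\<exists>j<k. \<exists>p\<in>S j. (\<exists>i<k. i \<noteq> j \<and> p \<in> S i) \<and> {x, y} = {Inl j, Inr p})"

definition nk_graph ::
    "bool \<Rightarrow> nat \<Rightarrow> nat \<Rightarrow> pgraph \<Rightarrow> (nat \<Rightarrow> complex \<Rightarrow> gpoint) \<Rightarrow> bool" where
  "nk_graph b n k \<Gamma> l \<longleftrightarrow> graph \<Gamma> \<and>
     has_rank (pi1 (space_of \<Gamma>) (base_pt \<Gamma>)) (n + k) \<and>
     (\<forall>e\<in>edges \<Gamma>. \<not> separating \<Gamma> e) \<and>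
     (\<forall>j<k. embedding_map S1 (space_of \<Gamma>) (l j)) \<and>
     (b \<longrightarrow> (\<forall>j<k. l j 1 \<in> Vert ` verts \<Gamma>)) \<and>
     (\<forall>v\<in>verts \<Gamma>. valence \<Gamma> v \<ge> 2 \<and>
        (valence \<Gamma> v = 2 \<longrightarrow> v = base \<Gamma> \<or> (b \<and> (\<exists>j<k. Vert v = l j 1)))) \<and>
     (\<forall>i<k. \<forall>j<k. i \<noteq> j \<longrightarrow> (\<exists>p. l i ` sphere 0 1 \<inter> l j ` sphere 0 1 \<subseteq> {p})) \<and>
     forest (dual_adj k (\<lambda>j. l j ` sphere 0 1))"

definition marked :: "bool \<Rightarrow> nat \<Rightarrow> nat \<Rightarrow> (pgraph \<times> (gpoint \<Rightarrow> gpoint)) set" where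
  "marked b n k = {(\<Gamma>, \<phi>).
     pointed_homotopy_equivalence (space_of (Gnk n k)) (base_pt (Gnk n k))
       (space_of \<Gamma>) (base_pt \<Gamma>) \<phi> \<and>
     nk_graph b n k \<Gamma> (\<lambda>j. \<phi> \<circ> kappa n k j)}"

text \<open>
  Homotopy of maps \<open>f, g\<close> from \<open>G\<^sub>n\<^sub>,\<^sub>k\<close> to \<open>\<Gamma>\<close> relative to the circles (\<open>b = True\<close>), or relative to the
  circles up to rotation (\<open>b = False\<close>). The circles are parametrised cycles, and parametrisations only
  matter up to isotopy: were the homotopy required to be constant on \<open>C\<^sub>j\<close>, the positions in
  \<open>S\<^sup>1\<close> of the vertices lying on a cycle would be a continuous invariant of a marked graph, and
  composing a marking with the collapse of an edge of a cycle would no longer embed that cycle. So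
  throughout the homotopy \<open>C\<^sub>j\<close> is sent onto the fixed cycle \<open>g(C\<^sub>j)\<close>, and its basepoint is kept fixed
  when \<open>b\<close> holds; without the latter condition \<open>C\<^sub>j\<close> may rotate along the cycle.
\<close>

definition homotopic_rel_circles ::
    "bool \<Rightarrow> nat \<Rightarrow> nat \<Rightarrow> pgraph \<Rightarrow> (gpoint \<Rightarrow> gpoint) \<Rightarrow> (gpoint \<Rightarrow> gpoint) \<Rightarrow> bool" where
  "homotopic_rel_circles b n k \<Gamma> f g \<longleftrightarrow>
     homotopic_with
       (\<lambda>h. h (base_pt (Gnk n k)) = base_pt \<Gamma> \<and>
            (\<forall>j<k. h ` circ n k j = g ` circ n k j \<and> (b \<longrightarrow> h (kappa n k j 1) = g (kappa n k j 1))))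
       (space_of (Gnk n k)) (space_of \<Gamma>) f g"

definition marked_equiv :: "bool \<Rightarrow> nat \<Rightarrow> nat \<Rightarrow>
    ((pgraph \<times> (gpoint \<Rightarrow> gpoint)) \<times> (pgraph \<times> (gpoint \<Rightarrow> gpoint))) set" where
  "marked_equiv b n k = {((\<Gamma>1, \<phi>1), (\<Gamma>2, \<phi>2)).
     (\<Gamma>1, \<phi>1) \<in> marked b n k \<and> (\<Gamma>2, \<phi>2) \<in> marked b n k \<and>
     (\<exists>\<psi>. graph_iso \<Gamma>1 \<Gamma>2 \<psi> \<and> homotopic_rel_circles b n k \<Gamma>2 (\<psi> \<circ> \<phi>1) \<phi>2)}"

definition Lnk :: "bool \<Rightarrow> nat \<Rightarrow> nat \<Rightarrow> (pgraph \<times> (gpoint \<Rightarrow> gpoint)) set set" where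
  "Lnk b n k = marked b n k // marked_equiv b n k"

text \<open>Collapsing every edge in \<open>A\<close>: the vertices of the new graph are the least elements of the
  components of the subgraph spanned by \<open>A\<close>.\<close>

definition rep :: "pgraph \<Rightarrow> nat set \<Rightarrow> nat \<Rightarrow> nat" where
  "rep \<Gamma> A v = (LEAST w. (v, w) \<in> (\<Union>e\<in>A. {(src \<Gamma> e, tgt \<Gamma> e), (tgt \<Gamma> e, src \<Gamma> e)})\<^sup>*)"

definition collapse :: "pgraph \<Rightarrow> nat set \<Rightarrow> pgraph" where
  "collapse \<Gamma> A = \<lparr>verts = rep \<Gamma> A ` verts \<Gamma>, edges = edges \<Gamma> - A,
     src = rep \<Gamma> A \<circ> src \<Gamma>, tgt = rep \<Gamma> A \<circ> tgt \<Gamma>, base = rep \<Gamma> A (base \<Gamma>)\<rparr>"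

definition collapse_map :: "pgraph \<Rightarrow> nat set \<Rightarrow> gpoint \<Rightarrow> gpoint" where
  "collapse_map \<Gamma> A x = (case x of Vert v \<Rightarrow> Vert (rep \<Gamma> A v)
     | Inner e t \<Rightarrow> if e \<in> A then Vert (rep \<Gamma> A (src \<Gamma> e)) else Inner e t)"

definition is_loop :: "pgraph \<Rightarrow> nat \<Rightarrow> bool" where
  "is_loop \<Gamma> e \<longleftrightarrow> e \<in> edges \<Gamma> \<and> src \<Gamma> e = tgt \<Gamma> e"

definition cycle_edges :: "nat \<Rightarrow> nat \<Rightarrow> pgraph \<Rightarrow> (gpoint \<Rightarrow> gpoint) \<Rightarrow> nat set" where
  "cycle_edges n k \<Gamma> \<phi> = {e\<in>edges \<Gamma>. \<exists>j<k. edge_pt \<Gamma> e ` {0..1} \<subseteq> \<phi> ` circ n k j}"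

definition hat :: "nat \<Rightarrow> nat \<Rightarrow> pgraph \<Rightarrow> (gpoint \<Rightarrow> gpoint) \<Rightarrow> pgraph" where
  "hat n k \<Gamma> \<phi> = collapse \<Gamma> (cycle_edges n k \<Gamma> \<phi>)"

text \<open>One edge collapse. The composite of a marking with the collapse map is an embedding on the circles
  only after a homotopy relative to the circles in the above sense.\<close>

definition edge_collapse :: "bool \<Rightarrow> nat \<Rightarrow> nat \<Rightarrow>
    ((pgraph \<times> (gpoint \<Rightarrow> gpoint)) \<times> (pgraph \<times> (gpoint \<Rightarrow> gpoint))) set" where
  "edge_collapse b n k = {((\<Gamma>, \<phi>), (\<Gamma>', \<phi>')).
     (\<Gamma>, \<phi>) \<in> marked b n k \<and> (\<Gamma>', \<phi>') \<in> marked b n k \<and>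
     (\<exists>e\<in>edges \<Gamma>. \<not> is_loop \<Gamma> e \<and> \<not> is_loop (hat n k \<Gamma> \<phi>) e \<and> \<Gamma>' = collapse \<Gamma> {e} \<and>
        homotopic_rel_circles b n k \<Gamma>' (collapse_map \<Gamma> {e} \<circ> \<phi>) \<phi>')}"

definition L_le :: "bool \<Rightarrow> nat \<Rightarrow> nat \<Rightarrow>
    (pgraph \<times> (gpoint \<Rightarrow> gpoint)) set \<Rightarrow> (pgraph \<times> (gpoint \<Rightarrow> gpoint)) set \<Rightarrow> bool" where
  "L_le b n k x y \<longleftrightarrow> (\<exists>m1\<in>x. \<exists>m2\<in>y. \<exists>m. (m2, m) \<in> (edge_collapse b n k)\<^sup>* \<and> (m, m1) \<in> marked_equiv b n k)"

definition act :: "nat \<Rightarrow> nat \<Rightarrow> (gpoint \<Rightarrow> gpoint) set \<Rightarrow>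
    (pgraph \<times> (gpoint \<Rightarrow> gpoint)) set \<Rightarrow> (pgraph \<times> (gpoint \<Rightarrow> gpoint)) set" where
  "act n k a x = {m. \<exists>(\<Gamma>, \<phi>)\<in>x. \<exists>g\<in>inv\<^bsub>A_group n k\<^esub> a. ((\<Gamma>, \<phi> \<circ> g), m) \<in> marked_equiv True n k}"


section \<open>The fiber \<open>F\<^sub>n\<^sub>,\<^sub>k\<close>\<close>

text \<open>Forgetting the basepoints of the cycles turns the bivalent vertices other than the base vertex into
  interior points of edges; the space and the marking do not change.\<close>

definition forgets_to ::
    "nat \<Rightarrow> nat \<Rightarrow> pgraph \<times> (gpoint \<Rightarrow> gpoint) \<Rightarrow> pgraph \<times> (gpoint \<Rightarrow> gpoint) \<Rightarrow> bool" where
  "forgets_to n k m m' \<longleftrightarrow> (case (m, m') of ((\<Gamma>, \<phi>), (\<Gamma>', \<phi>')) \<Rightarrow>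
     (\<exists>h. homeomorphic_map (space_of \<Gamma>) (space_of \<Gamma>') h \<and>
          h ` Vert ` {v\<in>verts \<Gamma>. v = base \<Gamma> \<or> valence \<Gamma> v \<noteq> 2} = Vert ` verts \<Gamma>' \<and>
          h (base_pt \<Gamma>) = base_pt \<Gamma>' \<and>
          (\<forall>x\<in>points (Gnk n k). \<phi>' x = h (\<phi> x))))"

definition forget :: "nat \<Rightarrow> nat \<Rightarrow>
    (pgraph \<times> (gpoint \<Rightarrow> gpoint)) set \<Rightarrow> (pgraph \<times> (gpoint \<Rightarrow> gpoint)) set" where
  "forget n k x = {m'. \<exists>m\<in>x. \<exists>m0. forgets_to n k m m0 \<and> (m0, m') \<in> marked_equiv False n k}"

definition rose :: "nat \<Rightarrow> pgraph" where
  "rose r = \<lparr>verts = {0}, edges = {..<r}, src = (\<lambda>_. 0), tgt = (\<lambda>_. 0), base = 0\<rparr>"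

definition rose_marking :: "nat \<Rightarrow> nat \<Rightarrow> gpoint \<Rightarrow> gpoint" where
  "rose_marking n k x = (case x of Vert v \<Rightarrow> Vert 0
     | Inner e t \<Rightarrow> if e < n then Inner e t else if e < n + k then Vert 0 else Inner (e - k) t)"

definition Fnk :: "nat \<Rightarrow> nat \<Rightarrow> (pgraph \<times> (gpoint \<Rightarrow> gpoint)) set set" where
  "Fnk n k = {x \<in> Lnk True n k.
     forget n k x = marked_equiv False n k `` {(rose (n + k), rose_marking n k)}}"

abbreviation F_le :: "nat \<Rightarrow> nat \<Rightarrow>
    (pgraph \<times> (gpoint \<Rightarrow> gpoint)) set \<Rightarrow> (pgraph \<times> (gpoint \<Rightarrow> gpoint)) set \<Rightarrow> bool" where
  "F_le n k \<equiv> L_le True n k"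

definition Zk_act :: "nat \<Rightarrow> nat \<Rightarrow> (nat \<Rightarrow> int) \<Rightarrow>
    (pgraph \<times> (gpoint \<Rightarrow> gpoint)) set \<Rightarrow> (pgraph \<times> (gpoint \<Rightarrow> gpoint)) set" where
  "Zk_act n k m = act n k (Zk_to_A n k m)"


section \<open>Posets and their realizations\<close>

definition poset_iso ::
    "'a set \<Rightarrow> ('a \<Rightarrow> 'a \<Rightarrow> bool) \<Rightarrow> 'b set \<Rightarrow> ('b \<Rightarrow> 'b \<Rightarrow> bool) \<Rightarrow> ('a \<Rightarrow> 'b) \<Rightarrow> bool" where
  "poset_iso P r Q r' f \<longleftrightarrow>
     bij_betw f P Q \<and> (\<forall>x\<in>P. \<forall>y\<in>P. r x y \<longleftrightarrow> r' (f x) (f y))"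

text \<open>The poset \<open>\<int>\<^sup>k \<times> (\<int>/2)\<^sup>k\<close>, with \<open>\<int>/2 = {0, 1}\<close> and \<open>0 < 1\<close>.\<close>

definition ZP :: "nat \<Rightarrow> ((nat \<Rightarrow> int) \<times> (nat \<Rightarrow> nat)) set" where
  "ZP k = Zk k \<times> {p. (\<forall>i<k. p i \<in> {0, 1}) \<and> (\<forall>i\<ge>k. p i = 0)}"

definition ZP_le ::
    "nat \<Rightarrow> (nat \<Rightarrow> int) \<times> (nat \<Rightarrow> nat) \<Rightarrow> (nat \<Rightarrow> int) \<times> (nat \<Rightarrow> nat) \<Rightarrow> bool" where
  "ZP_le k x y \<longleftrightarrow> (case (x, y) of ((z, p), (z', p')) \<Rightarrow>
     \<forall>i<k. (p i = p' i \<and> z i = z' i) \<or> (p i < p' i \<and> (z i = z' i \<or> z i = z' i + 1)))"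

definition poset_chains :: "'a set \<Rightarrow> ('a \<Rightarrow> 'a \<Rightarrow> bool) \<Rightarrow> 'a set set" where
  "poset_chains P r = {\<sigma>. \<sigma> \<subseteq> P \<and> finite \<sigma> \<and> \<sigma> \<noteq> {} \<and> (\<forall>x\<in>\<sigma>. \<forall>y\<in>\<sigma>. r x y \<or> r y x)}"

text \<open>The closed simplex spanned by a finite set, in barycentric coordinates.\<close>

definition simplex_of :: "'a set \<Rightarrow> ('a \<Rightarrow> real) set" where
  "simplex_of \<sigma> = {t. (\<forall>x\<in>\<sigma>. 0 \<le> t x) \<and> (\<forall>x. x \<notin> \<sigma> \<longrightarrow> t x = 0) \<and> sum t \<sigma> = 1}"

text \<open>Geometric realization of the simplicial complex of finite chains, with the weak topology; each
  closed simplex has the topology of pointwise convergence, which is its Euclidean topology.\<close>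

definition realization :: "'a set \<Rightarrow> ('a \<Rightarrow> 'a \<Rightarrow> bool) \<Rightarrow> ('a \<Rightarrow> real) topology" where
  "realization P r = topology (\<lambda>U. U \<subseteq> (\<Union>\<sigma>\<in>poset_chains P r. simplex_of \<sigma>) \<and>
     (\<forall>\<sigma>\<in>poset_chains P r. openin (top_of_set (simplex_of \<sigma>)) (U \<inter> simplex_of \<sigma>)))"

lemma openin_realization:
  "openin (realization P r) U \<longleftrightarrow> U \<subseteq> (\<Union>\<sigma>\<in>poset_chains P r. simplex_of \<sigma>) \<and>
     (\<forall>\<sigma>\<in>poset_chains P r. openin (top_of_set (simplex_of \<sigma>)) (U \<inter> simplex_of \<sigma>))"
proof -
  let ?open = "\<lambda>U \<sigma>. openin (top_of_set (simplex_of \<sigma>)) (U \<inter> simplex_of \<sigma>)"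
  have int: "?open (S \<inter> T) \<sigma>" if "?open S \<sigma>" "?open T \<sigma>" for S T \<sigma>
    proof -
    have "S \<inter> T \<inter> simplex_of \<sigma> = (S \<inter> simplex_of \<sigma>) \<inter> (T \<inter> simplex_of \<sigma>)" by blast
    with openin_Int[OF that] show ?thesis by (simp only:)
  qed
  have un: "?open (\<Union>K) \<sigma>" if "\<And>S. S \<in> K \<Longrightarrow> ?open S \<sigma>" for K \<sigma>
  proof -
    have "openin (top_of_set (simplex_of \<sigma>)) (\<Union>S\<in>K. S \<inter> simplex_of \<sigma>)"
      using that by (intro openin_Union) auto
    then show ?thesis unfolding Int_Union2 .
  qed
  let ?pts = "\<Union>\<sigma>\<in>poset_chains P r. simplex_of \<sigma>"
  have "istopology (\<lambda>U. U \<subseteq> ?pts \<and> (\<forall>\<sigma>\<in>poset_chains P r. ?open U \<sigma>))" (is "istopology ?T")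
    unfolding istopology_def
  proof (rule conjI; intro allI impI)
    fix S T
    assume S: "?T S" and T: "?T T"
    show "?T (S \<inter> T)"
    proof (rule conjI)
      show "S \<inter> T \<subseteq> ?pts"
        by (rule subset_trans[OF Int_lower1 conjunct1[OF S]])
      show "\<forall>\<sigma>\<in>poset_chains P r. ?open (S \<inter> T) \<sigma>"
        by (rule ballI, rule int, erule bspec[OF conjunct2[OF S]], erule bspec[OF conjunct2[OF T]])
    qed
  next
    fix K
    assume K: "\<forall>S\<in>K. ?T S"
    show "?T (\<Union>K)"
    proof (rule conjI)
      show "\<Union>K \<subseteq> ?pts"
        by (rule Union_least, erule conjunct1[OF bspec[OF K]])
      show "\<forall>\<sigma>\<in>poset_chains P r. ?open (\<Union>K) \<sigma>"
        by (rule ballI, rule un, erule (1) bspec[OF conjunct2[OF bspec[OF K]]])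
    qed
  qed
  then show ?thesis
    by (simp only: realization_def topology_inverse')
qed

text \<open>The map on realizations induced by \<open>f\<close>, linear on simplices.\<close>

definition realization_map :: "('a \<Rightarrow> 'b) \<Rightarrow> ('a \<Rightarrow> real) \<Rightarrow> 'b \<Rightarrow> real" where
  "realization_map f t y = sum t {x. t x \<noteq> 0 \<and> f x = y}"

end

theory Submission
  imports Defs "HOL-Analysis.Analysis" "HOL-Algebra.Generated_Groups"
begin

text \<open>
  A marked graph in the fiber is a rose with \<open>n + k\<close> petals on which the basepoint of the \<open>j\<close>-th cycle
  has been pushed along the petal. Lifting the \<open>j\<close>-th stem to the universal cover of its petal records
  the position of that basepoint as a real number \<open>x\<^sub>j\<close>, and conversely each \<open>x\<close> gives a map from
  \<open>G\<^sub>n\<^sub>,\<^sub>k\<close> to the rose. Two such vectors describe equivalent marked graphs iff for each \<open>j\<close> they are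
  the same integer or lie in the same open unit interval, so the fiber is the set of cells of the cubical
  subdivision of \<open>\<real>\<^sup>k\<close>: an integral coordinate means that \<open>\<circ>\<^sub>j\<close> is the base vertex, otherwise
  \<open>\<circ>\<^sub>j\<close> splits its petal into two edges, and collapsing one of them rounds \<open>x\<^sub>j\<close> down or up. Winding
  the \<open>j\<close>-th stem around its circle adds \<open>1\<close> to \<open>x\<^sub>j\<close>. The realization of the poset of cells is the
  barycentric subdivision of the cubical complex.
\<close>

text \<open>A homotopy relative to the circles only keeps the image of each circle and its
  basepoint, so neither the parametrization of a circle nor its degree is given in advance. Degree
  and position are therefore read off from lifts of angle functions: the increment of a lift is
  unchanged along a homotopy as long as the quotient of the end angles stays constant. The angles
  embed the rose in a torus, so continuity of a map into a rose becomes continuity of complex-valued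
  functions. The action composes with an inverse, so \<open>m\<close> sends \<open>x\<close> to
  \<open>x - m\<close>; the code of a cell is built from the floor of \<open>-x\<close>, which turns
  this into addition of \<open>m\<close>. That the constructed graphs belong to the poset requires
  the rank of the fundamental group of a rose: generation comes from cutting a loop into short
  pieces, minimality from winding numbers mod 2. In the realization \<open>(z, p)\<close> is put at
  \<open>z + p/2\<close>. The barycentric coordinates of a point are lengths of level sets of its
  tent coordinates, which inverts the map without choosing an order of the coordinates.\<close>

abbreviation I01 :: "real topology" where
 "I01 \<equiv> top_of_set {0..1}"

section \<open>Topology of finite graphs\<close>

definition finite_graph :: "pgraph => bool" where
 "finite_graph \<Gamma> \<longleftrightarrow> finite (verts \<Gamma>) \<and> finite (edges \<Gamma>) \<and>
   src \<Gamma> ` edges \<Gamma> \<subseteq> verts \<Gamma> \<and> tgt \<Gamma> ` edges \<Gamma> \<subseteq> verts \<Gamma> \<and> base \<Gamma> \<in> verts \<Gamma>"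

text \<open>Connectedness is split off because compactness, the Hausdorff property and the
  continuity criteria need only finiteness; for subdivided roses it is derived later from a
  homeomorphism.\<close>

lemma graph_iff: "graph \<Gamma> \<longleftrightarrow> finite_graph \<Gamma> \<and> connected_space (space_of \<Gamma>)"
 by (auto simp: graph_def finite_graph_def)

lemma edge_pt_simps [simp]:
 "edge_pt \<Gamma> e 0 = Vert (src \<Gamma> e)" "edge_pt \<Gamma> e 1 = Vert (tgt \<Gamma> e)"
 "0 < t ==> t < 1 ==> edge_pt \<Gamma> e t = Inner e t"
 by (auto simp: edge_pt_def)

lemma points_cases:
 assumes "x \<in> points \<Gamma>"
 obtains v where "v \<in> verts \<Gamma>" "x = Vert v"
  | e t where "e \<in> edges \<Gamma>" "0 < t" "t < 1" "x = Inner e t"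
 using assms unfolding points_def open_edge_def by auto

lemma Vert_in_points [simp]: "Vert v \<in> points \<Gamma> \<longleftrightarrow> v \<in> verts \<Gamma>"
 by (auto simp: points_def open_edge_def)

lemma Inner_in_points [simp]: "Inner e t \<in> points \<Gamma> \<longleftrightarrow> e \<in> edges \<Gamma> \<and> 0 < t \<and> t < 1"
 by (auto simp: points_def open_edge_def image_iff)

lemma edge_pt_in_points:
 "finite_graph \<Gamma> ==> e \<in> edges \<Gamma> ==> edge_pt \<Gamma> e t \<in> points \<Gamma>"
 by (auto simp: edge_pt_def finite_graph_def)

lemma openin_I01_self: "openin I01 {t. 0 \<le> t \<and> t \<le> 1}"
 using openin_topspace[of I01] by (simp add: atLeastAtMost_def atLeast_def atMost_def Collect_conj_eq)

lemma topspace_space_of: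
 assumes "finite_graph \<Gamma>" shows "topspace (space_of \<Gamma>) = points \<Gamma>"
proof -
 have "openin (space_of \<Gamma>) (points \<Gamma>)"
  using edge_pt_in_points[OF assms] by (simp add: openin_space_of openin_I01_self)
 moreover have "topspace (space_of \<Gamma>) \<subseteq> points \<Gamma>"
  using openin_space_of openin_topspace by blast
 ultimately show ?thesis using openin_subset by fastforce
qed

lemma continuous_map_edge_pt:
 assumes "finite_graph \<Gamma>" "e \<in> edges \<Gamma>"
 shows "continuous_map I01 (space_of \<Gamma>) (edge_pt \<Gamma> e)"
 unfolding continuous_map_def
 using assms by (auto simp: topspace_space_of edge_pt_in_points openin_space_of)

text \<open>Universal property of the quotient topology: continuity is tested on the characteristic
  maps of the edges. The condition on vertices accounts for those that are not an end of any
  edge.\<close>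

lemma continuous_map_space_of_iff:
 assumes "finite_graph \<Gamma>"
 shows "continuous_map (space_of \<Gamma>) Y f \<longleftrightarrow>
  (\<forall>v\<in>verts \<Gamma>. f (Vert v) \<in> topspace Y) \<and> (\<forall>e\<in>edges \<Gamma>. continuous_map I01 Y (%s. f (edge_pt \<Gamma> e s)))"
  (is "?L \<longleftrightarrow> ?R")
proof
 assume L: ?L
 show ?R
 proof (intro conjI ballI)
  fix v assume "v \<in> verts \<Gamma>"
  then have "Vert v \<in> topspace (space_of \<Gamma>)" by (simp add: topspace_space_of assms)
  then show "f (Vert v) \<in> topspace Y" using L by (auto simp: continuous_map_def)
 next
  fix e assume "e \<in> edges \<Gamma>"
  then show "continuous_map I01 Y (%s. f (edge_pt \<Gamma> e s))"
   using continuous_map_compose[OF continuous_map_edge_pt[OF assms] L] by (simp add: o_def)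
 qed
next
 assume R: ?R
 have img: "f x \<in> topspace Y" if "x \<in> points \<Gamma>" for x
  using that
 proof (cases rule: points_cases)
  case (2 e t)
  have "(%s. f (edge_pt \<Gamma> e s)) \<in> {0..1} \<rightarrow> topspace Y"
   using R \<open>e \<in> edges \<Gamma>\<close> by (simp add: continuous_map_def)
  then have "f (edge_pt \<Gamma> e t) \<in> topspace Y" using 2 by (auto simp: Pi_iff simp del: edge_pt_simps)
  then show ?thesis using 2 by simp
 qed (use R in auto)
 show ?L
  unfolding continuous_map_def
 proof (intro conjI allI impI)
  show "f \<in> topspace (space_of \<Gamma>) \<rightarrow> topspace Y"
   using img by (simp add: topspace_space_of assms)
  fix U assume U: "openin Y U"
  have "openin I01 {t \<in> {0..1}. edge_pt \<Gamma> e t \<in> {x \<in> points \<Gamma>. f x \<in> U}}" if "e \<in> edges \<Gamma>" for e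
  proof -
   have "openin I01 {t \<in> topspace I01. f (edge_pt \<Gamma> e t) \<in> U}"
    using R U that by (auto simp: continuous_map_def)
   moreover have "{t \<in> topspace I01. f (edge_pt \<Gamma> e t) \<in> U} = {t \<in> {0..1}. edge_pt \<Gamma> e t \<in> {x \<in> points \<Gamma>. f x \<in> U}}"
    using edge_pt_in_points[OF assms that] by (auto simp del: edge_pt_simps)
   ultimately show ?thesis by simp
  qed
  then show "openin (space_of \<Gamma>) {x \<in> topspace (space_of \<Gamma>). f x \<in> U}"
   by (auto simp: topspace_space_of assms openin_space_of)
 qed
qed

text \<open>Finitely many vertices and finitely many images of the unit interval. Together with the
  Hausdorff property this turns continuous bijections of graphs into homeomorphisms.\<close>

lemma compact_space_space_of:
 assumes "finite_graph \<Gamma>" shows "compact_space (space_of \<Gamma>)"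
proof -
 have "compactin (space_of \<Gamma>) (Vert ` verts \<Gamma>)"
  using assms by (intro finite_imp_compactin) (auto simp: topspace_space_of finite_graph_def)
 moreover have "compactin (space_of \<Gamma>) (\<Union>((%e. edge_pt \<Gamma> e ` {0..1}) ` edges \<Gamma>))"
  using assms
  by (intro compactin_Union)
   (auto simp: finite_graph_def[of \<Gamma>] intro!: image_compactin[OF _ continuous_map_edge_pt] simp: compactin_subtopology)
 moreover have "points \<Gamma> = Vert ` verts \<Gamma> \<union> (\<Union>((%e. edge_pt \<Gamma> e ` {0..1}) ` edges \<Gamma>))"
 proof
  show "points \<Gamma> \<subseteq> Vert ` verts \<Gamma> \<union> (\<Union>((%e. edge_pt \<Gamma> e ` {0..1}) ` edges \<Gamma>))"
  proof
   fix x assume "x \<in> points \<Gamma>"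
   then show "x \<in> Vert ` verts \<Gamma> \<union> (\<Union>((%e. edge_pt \<Gamma> e ` {0..1}) ` edges \<Gamma>))"
   proof (cases rule: points_cases)
    case (2 e t)
    then have "x = edge_pt \<Gamma> e t" "t \<in> {0..1}" by auto
    then show ?thesis using 2 by blast
   qed auto
  qed
  show "Vert ` verts \<Gamma> \<union> (\<Union>((%e. edge_pt \<Gamma> e ` {0..1}) ` edges \<Gamma>)) \<subseteq> points \<Gamma>"
   using edge_pt_in_points[OF assms] by auto
 qed
 ultimately show ?thesis
  by (simp add: compact_space_def topspace_space_of assms compactin_Un)
qed

lemma Hausdorff_space_if_separated_by_functions:
 assumes "!!x y. x \<in> topspace X ==> y \<in> topspace X ==> x \<noteq> y ==>
   \<exists>f. continuous_map X euclideanreal f \<and> f x \<noteq> f y"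
 shows "Hausdorff_space X"
 unfolding Hausdorff_space_def
proof (intro allI impI, elim conjE)
 fix x y assume xy: "x \<in> topspace X" "y \<in> topspace X" "x \<noteq> y"
 then obtain f where f: "continuous_map X euclideanreal f" "f x \<noteq> f y" using assms by blast
 obtain A B where AB: "open A" "open B" "f x \<in> A" "f y \<in> B" "A \<inter> B = {}"
  using hausdorff[OF f(2)] by blast
 show "\<exists>U V. openin X U \<and> openin X V \<and> x \<in> U \<and> y \<in> V \<and> disjnt U V"
  using AB xy f(1)
  by (intro exI[of _ "{z \<in> topspace X. f z \<in> A}"] exI[of _ "{z \<in> topspace X. f z \<in> B}"])
   (auto simp: disjnt_iff intro!: openin_continuous_map_preimage)
qed

definition graph_fun :: "(nat => real) => (nat => real => real) => gpoint => real" where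
 "graph_fun a b x = (case x of Vert v => a v | Inner e t => b e t)"

lemma continuous_map_graph_fun:
 assumes "finite_graph \<Gamma>" "!!e. continuous_on {0..1} (b e)"
  and "!!e. e \<in> edges \<Gamma> ==> b e 0 = a (src \<Gamma> e)" "!!e. e \<in> edges \<Gamma> ==> b e 1 = a (tgt \<Gamma> e)"
 shows "continuous_map (space_of \<Gamma>) euclideanreal (graph_fun a b)"
 unfolding continuous_map_space_of_iff[OF assms(1)]
proof (intro conjI ballI)
 fix e assume e: "e \<in> edges \<Gamma>"
 have "continuous_map I01 euclideanreal (b e)" using assms by simp
 then show "continuous_map I01 euclideanreal (%s. graph_fun a b (edge_pt \<Gamma> e s))"
  by (rule continuous_map_eq) (use e assms in \<open>auto simp: graph_fun_def edge_pt_def\<close>)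
qed auto

text \<open>Points are separated by real functions: piecewise linear hat functions for two vertices,
  and on an edge the bumps \<open>t * (1 - t)\<close> and \<open>t ^ 2 * (1 - t)\<close>, whose
  quotient recovers \<open>t\<close>.\<close>

lemma Hausdorff_space_space_of:
 assumes "finite_graph \<Gamma>" shows "Hausdorff_space (space_of \<Gamma>)"
proof (rule Hausdorff_space_if_separated_by_functions)
 fix x y assume "x \<in> topspace (space_of \<Gamma>)" "y \<in> topspace (space_of \<Gamma>)" and neq: "x \<noteq> y"
 then have xy: "x \<in> points \<Gamma>" "y \<in> points \<Gamma>" by (simp_all add: topspace_space_of assms)
 have bump: "continuous_map (space_of \<Gamma>) euclideanreal (graph_fun (%v. 0) (%e' t. of_bool (e' = e) * (t ^ m * (1 - t))))"
  if "m > 0" for e and m :: nat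
  by (rule continuous_map_graph_fun[OF assms]) (use that in \<open>auto intro!: continuous_on_mult continuous_on_power continuous_on_diff continuous_on_id continuous_on_const\<close>)
 have vert: "continuous_map (space_of \<Gamma>) euclideanreal
   (graph_fun (%u. of_bool (u = v)) (%e t. (1 - t) * of_bool (src \<Gamma> e = v) + t * of_bool (tgt \<Gamma> e = v)))" for v
  by (rule continuous_map_graph_fun[OF assms]) (auto intro!: continuous_on_add continuous_on_mult continuous_on_diff continuous_on_id continuous_on_const)
 consider v w where "x = Vert v" "y = Vert w" | e t where "x = Inner e t" "0 < t" "t < 1"
  | e t where "y = Inner e t" "0 < t" "t < 1"
  using xy by (auto elim!: points_cases)
 then show "\<exists>f. continuous_map (space_of \<Gamma>) euclideanreal f \<and> f x \<noteq> f y"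
 proof cases
  case (1 v w)
  then show ?thesis using neq by - (rule exI, rule conjI, rule vert[of v], auto simp: graph_fun_def)
 next
  case (2 e t)
  show ?thesis
  proof (cases "\<exists>t'. y = Inner e t' \<and> t * (1 - t) = t' * (1 - t')")
   case True
   then obtain t' where t': "y = Inner e t'" "t * (1 - t) = t' * (1 - t')" by auto
   have "0 < t * (1 - t)" using 2 by auto
   then have "t ^ 2 * (1 - t) \<noteq> t' ^ 2 * (1 - t')"
    unfolding power2_eq_square mult.assoc t'(2)[symmetric] using t'(1) neq 2 by auto
   then show ?thesis using t' 2 by - (rule exI, rule conjI, rule bump[of 2 e], auto simp: graph_fun_def)
  next
   case False
   let ?f = "graph_fun (%v. 0) (%e' t. of_bool (e' = e) * (t ^ 1 * (1 - t)))"
   have "continuous_map (space_of \<Gamma>) euclideanreal ?f" by (rule bump) simp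
   moreover have "?f x \<noteq> ?f y"
    using False 2 by (cases "y") (auto simp: graph_fun_def)
   ultimately show ?thesis by (intro exI[of _ ?f] conjI)
  qed
 next
  case (3 e t)
  show ?thesis
  proof (cases "\<exists>t'. x = Inner e t' \<and> t * (1 - t) = t' * (1 - t')")
   case True
   then obtain t' where t': "x = Inner e t'" "t * (1 - t) = t' * (1 - t')" by auto
   have "0 < t * (1 - t)" using 3 by auto
   then have "t ^ 2 * (1 - t) \<noteq> t' ^ 2 * (1 - t')"
    unfolding power2_eq_square mult.assoc t'(2)[symmetric] using t'(1) neq 3 by auto
   then show ?thesis using t' 3 by - (rule exI, rule conjI, rule bump[of 2 e], auto simp: graph_fun_def)
  next
   case False
   let ?f = "graph_fun (%v. 0) (%e' t. of_bool (e' = e) * (t ^ 1 * (1 - t)))"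
   have "continuous_map (space_of \<Gamma>) euclideanreal ?f" by (rule bump) simp
   moreover have "?f x \<noteq> ?f y"
    using False 3 by (cases "x") (auto simp: graph_fun_def)
   ultimately show ?thesis by (intro exI[of _ ?f] conjI)
  qed
 qed
qed

section \<open>Homotopies assembled edge by edge\<close>

lemma points_eq_closed_edges:
 "points \<Gamma> \<subseteq> Vert ` verts \<Gamma> \<union> (\<Union>e\<in>edges \<Gamma>. edge_pt \<Gamma> e ` {0..1})"
proof
 fix x assume "x \<in> points \<Gamma>"
 then show "x \<in> Vert ` verts \<Gamma> \<union> (\<Union>e\<in>edges \<Gamma>. edge_pt \<Gamma> e ` {0..1})"
 proof (cases rule: points_cases)
  case (2 e t)
  then have "x = edge_pt \<Gamma> e t" "t \<in> {0..1}" by auto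
  then show ?thesis using 2 by blast
 qed auto
qed

text \<open>The product of the interval with the graph is covered by finitely many closed pieces,
  one for each edge and each vertex, so continuity on each piece suffices.\<close>

lemma continuous_map_homotopy_space_of:
 assumes \<Gamma>: "finite_graph \<Gamma>"
  and edge: "!!e. e \<in> edges \<Gamma> ==>
   continuous_map (top_of_set ({0..1} \<times> {0..1})) Y (%(t, s). K (t, edge_pt \<Gamma> e s))"
  and vert: "!!v. v \<in> verts \<Gamma> ==> continuous_map I01 Y (%t. K (t, Vert v))"
 shows "continuous_map (prod_topology I01 (space_of \<Gamma>)) Y K"
proof -
 let ?X = "space_of \<Gamma>"
 have H: "Hausdorff_space ?X" by (rule Hausdorff_space_space_of[OF \<Gamma>])
 have top: "topspace ?X = points \<Gamma>" by (rule topspace_space_of[OF \<Gamma>])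
 define T where "T = (%i. case i of Inl e => {0..1::real} \<times> edge_pt \<Gamma> e ` {0..1} | Inr v => {0..1} \<times> {Vert v})"
 have clE: "closedin ?X (edge_pt \<Gamma> e ` {0..1})" if "e \<in> edges \<Gamma>" for e
  using image_compactin[OF _ continuous_map_edge_pt[OF \<Gamma> that], of "{0..1}"]
  by (intro compactin_imp_closedin[OF H]) (simp add: compactin_subtopology)
 show ?thesis
 proof (rule pasting_lemma_closed[where I = "Inl ` edges \<Gamma> \<union> Inr ` verts \<Gamma>" and T = T and f = "%_. K"])
  show "finite (Inl ` edges \<Gamma> \<union> Inr ` verts \<Gamma>)" using \<Gamma> by (auto simp: finite_graph_def)
  fix i assume i: "i \<in> Inl ` edges \<Gamma> \<union> Inr ` verts \<Gamma>"
  show "closedin (prod_topology I01 ?X) (T i)"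
   using i clE H by (auto simp: T_def closedin_prod_Times_iff top intro!: closedin_Hausdorff_singleton)
  show "continuous_map (subtopology (prod_topology I01 ?X) (T i)) Y K"
  proof (cases i)
   case (Inl e)
   then have e: "e \<in> edges \<Gamma>" using i by auto
   let ?E = "subtopology ?X (edge_pt \<Gamma> e ` {0..1})"
   have E: "continuous_map I01 ?E (edge_pt \<Gamma> e)"
    using continuous_map_edge_pt[OF \<Gamma> e] by (auto simp: continuous_map_in_subtopology)
   have topE: "topspace ?E = edge_pt \<Gamma> e ` {0..1}"
    using edge_pt_in_points[OF \<Gamma> e] by (auto simp: top simp del: edge_pt_simps)
   \<comment> \<open>A product with a quotient map need not be a quotient map in general; here it is
     one because it is a continuous surjection from a compact space onto a Hausdorff space.\<close>
   have "quotient_map (prod_topology I01 I01) (prod_topology I01 ?E) (%(t, s). (t, edge_pt \<Gamma> e s))"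
   proof (rule continuous_imp_quotient_map)
    show "continuous_map (prod_topology I01 I01) (prod_topology I01 ?E) (%(t, s). (t, edge_pt \<Gamma> e s))"
     using continuous_map_prod_top[of I01 I01 I01 ?E id "edge_pt \<Gamma> e"] E by (simp add: id_def)
    show "compact_space (prod_topology I01 I01)"
     by (simp add: compact_space_prod_topology compact_space_subtopology del: prod_topology_subtopology_eu)
    show "Hausdorff_space (prod_topology I01 ?E)"
     using H by (simp add: Hausdorff_space_prod_topology Hausdorff_space_subtopology)
    show "(%(t, s). (t, edge_pt \<Gamma> e s)) ` topspace (prod_topology I01 I01) = topspace (prod_topology I01 ?E)"
     unfolding topspace_prod_topology topE by auto
   qed
   moreover have "continuous_map (prod_topology I01 I01) Y (K \<circ> (%(t, s). (t, edge_pt \<Gamma> e s)))"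
    using edge[OF e] by (simp add: prod_topology_subtopology_eu o_def case_prod_unfold)
   ultimately have "continuous_map (prod_topology I01 ?E) Y K"
    using continuous_compose_quotient_map by blast
   moreover have "subtopology (prod_topology I01 ?X) (T i) = prod_topology I01 ?E"
    by (simp add: T_def Inl subtopology_Times subtopology_subtopology)
   ultimately show ?thesis by simp
  next
   case (Inr v)
   then have v: "v \<in> verts \<Gamma>" using i by auto
   have 1: "continuous_map (subtopology (prod_topology I01 ?X) (T i)) I01 fst"
    by (intro continuous_map_from_subtopology continuous_map_fst)
   have "continuous_map (subtopology (prod_topology I01 ?X) (T i)) Y (%p. K (fst p, Vert v))"
    using continuous_map_compose[OF 1 vert[OF v]] by (simp add: o_def)
   then show ?thesis
    by (rule continuous_map_eq) (auto simp: T_def Inr)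
  qed
 next
  fix x assume "x \<in> topspace (prod_topology I01 ?X)"
  then obtain t y where x: "x = (t, y)" "t \<in> {0..1}" "y \<in> points \<Gamma>" by (auto simp: top)
  with points_eq_closed_edges[of \<Gamma>]
  have "(\<exists>v\<in>verts \<Gamma>. y = Vert v) \<or> (\<exists>e\<in>edges \<Gamma>. y \<in> edge_pt \<Gamma> e ` {0..1})" by blast
  then show "\<exists>j. j \<in> Inl ` edges \<Gamma> \<union> Inr ` verts \<Gamma> \<and> x \<in> T j \<and> K x = K x"
  proof
   assume "\<exists>v\<in>verts \<Gamma>. y = Vert v"
   then obtain v where "v \<in> verts \<Gamma>" "y = Vert v" by blast
   then show ?thesis using x by (intro exI[of _ "Inr v"]) (auto simp: T_def)
  next
   assume "\<exists>e\<in>edges \<Gamma>. y \<in> edge_pt \<Gamma> e ` {0..1}"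
   then obtain e where "e \<in> edges \<Gamma>" "y \<in> edge_pt \<Gamma> e ` {0..1}" by blast
   then show ?thesis using x by (intro exI[of _ "Inl e"]) (auto simp: T_def)
  qed
 qed auto
qed

lemma homotopic_withI:
 assumes "continuous_map (prod_topology I01 X) Y (%(t, x). K t x)"
  and "!!x. x \<in> topspace X ==> K 0 x = f x" "!!x. x \<in> topspace X ==> K 1 x = g x"
  and "!!t. t \<in> {0..1} ==> P (K t)"
  and "!!h k. (!!x. x \<in> topspace X ==> h x = k x) ==> P h = P k"
 shows "homotopic_with P X Y f g"
proof -
 have *: "homotopic_with P X Y f g \<longleftrightarrow>
  (\<exists>h. continuous_map (prod_topology I01 X) Y h \<and> (\<forall>x\<in>topspace X. h (0, x) = f x) \<and>
   (\<forall>x\<in>topspace X. h (1, x) = g x) \<and> (\<forall>t\<in>{0..1}. P (%x. h (t, x))))"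
  by (rule homotopic_with) (rule assms(5))
 show ?thesis
  unfolding * by (rule exI[of _ "%(t, x). K t x"]) (use assms(1-4) in simp)
qed

section \<open>Roses\<close>

text \<open>The universal covering of the \<open>i\<close>-th petal, with the integers lying over
  the base vertex. Lifts through this map are the source of all coordinates.\<close>

definition petal :: "nat => real => gpoint" where
 "petal i x = (if frac x = 0 then Vert 0 else Inner i (frac x))"

text \<open>The map from the rose to the unit circle that wraps petal \<open>i\<close> once around
  and collapses all other petals to 1.\<close>

definition ang :: "nat => gpoint => complex" where
 "ang i x = (case x of Vert v => 1 | Inner e t => if e = i then cis (2 * pi * t) else 1)"

lemma finite_graph_rose [simp]: "finite_graph (rose r)"
 by (auto simp: finite_graph_def rose_def)

lemma rose_simps [simp]: "verts (rose r) = {0}" "edges (rose r) = {..<r}" "src (rose r) e = 0"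
  "tgt (rose r) e = 0" "base (rose r) = 0" "base_pt (rose r) = Vert 0"
 by (simp_all add: rose_def base_pt_def)

lemma cis_2pi_eq_iff: "cis (2 * pi * x) = cis (2 * pi * y) \<longleftrightarrow> x - y \<in> \<int>"
proof -
 have "cis (2 * pi * x) = cis (2 * pi * y) \<longleftrightarrow>
   sin (2 * pi * x) = sin (2 * pi * y) \<and> cos (2 * pi * x) = cos (2 * pi * y)"
  by (auto simp: complex_eq_iff)
 also have "\<dots> \<longleftrightarrow> (\<exists>n::int. 2 * pi * x = 2 * pi * y + 2 * pi * n)"
  by (rule sin_cos_eq_iff)
 also have "\<dots> \<longleftrightarrow> (\<exists>n::int. x = y + n)"
  by (metis (no_types, opaque_lifting) distrib_left mult_cancel_left pi_neq_zero zero_neq_numeral mult_eq_0_iff)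
 also have "\<dots> \<longleftrightarrow> x - y \<in> \<int>"
  by (metis Ints_cases Ints_of_int add.commute add_diff_cancel_left' diff_add_cancel)
 finally show ?thesis .
qed

lemma frac_eq_iff_diff: "frac x = frac y \<longleftrightarrow> x - y \<in> \<int>" for x y :: real
proof
 assume "frac x = frac y"
 then have "x - y = of_int (\<lfloor>x\<rfloor> - \<lfloor>y\<rfloor>)" by (simp add: frac_def)
 then show "x - y \<in> \<int>" by (metis Ints_of_int)
next
 assume "x - y \<in> \<int>"
 then obtain m where "x = y + of_int m" by (metis Ints_cases add.commute diff_add_cancel)
 then show "frac x = frac y" by (simp add: frac_def)
qed

lemma petal_eq_iff: "petal i x = petal i y \<longleftrightarrow> x - y \<in> \<int>"
 unfolding frac_eq_iff_diff[symmetric] petal_def by (auto simp del: frac_eq_0_iff)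

lemma petal_Ints: "x \<in> \<int> ==> petal i x = Vert 0"
 by (simp add: petal_def frac_eq_0_iff)

lemma petal_0 [simp]: "petal i 0 = Vert 0" and petal_1 [simp]: "petal i 1 = Vert 0"
 by (simp_all add: petal_Ints)

lemma petal_eq_Vert_iff: "petal i x = Vert v \<longleftrightarrow> v = 0 \<and> x \<in> \<int>"
 by (auto simp: petal_def frac_eq_0_iff)

lemma petal_eq_petal_neq: "i \<noteq> j ==> petal i x = petal j y \<longleftrightarrow> x \<in> \<int> \<and> y \<in> \<int>"
 by (auto simp: petal_def frac_eq_0_iff)

lemma petal_Inner: "0 < t ==> t < 1 ==> petal i t = Inner i t"
 by (simp add: petal_def frac_eq)

lemma petal_eq_Inner_iff: "petal i x = Inner e t \<longleftrightarrow> e = i \<and> x \<notin> \<int> \<and> t = frac x"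
 by (auto simp: petal_def frac_eq_0_iff)

lemma edge_pt_rose: "0 \<le> t ==> t \<le> 1 ==> edge_pt (rose r) i t = petal i t"
 by (cases "t = 0"; cases "t = 1") (auto simp: petal_Inner)

lemma petal_in_points: "i < r ==> petal i x \<in> points (rose r)"
 using frac_lt_1[of x] by (auto simp: petal_def le_less frac_ge_0)

lemma ang_petal_same [simp]: "ang i (petal i x) = cis (2 * pi * x)"
proof (cases "frac x = 0")
 case True
 then have "cis (2 * pi * x) = cis (2 * pi * 0)"
  unfolding cis_2pi_eq_iff by (simp add: frac_eq_0_iff)
 with True show ?thesis by (simp add: petal_def ang_def)
next
 case False
 have "cis (2 * pi * frac x) = cis (2 * pi * x)"
  unfolding cis_2pi_eq_iff by (simp add: frac_def)
 with False show ?thesis by (simp add: petal_def ang_def)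
qed

lemma ang_petal_other [simp]: "i \<noteq> j ==> ang j (petal i x) = 1"
 by (simp add: petal_def ang_def)

lemma ang_Vert [simp]: "ang i (Vert v) = 1"
 by (simp add: ang_def)

lemma norm_ang [simp]: "norm (ang i x) = 1" and ang_nonzero [simp]: "ang i x \<noteq> 0"
 by (auto simp: ang_def cis_neq_zero split: gpoint.split)

lemma rose_point_cases:
 assumes "x \<in> points (rose r)"
 obtains "x = Vert 0" | i t where "i < r" "0 < t" "t < 1" "x = petal i t"
 using assms by (cases rule: points_cases) (auto simp: petal_Inner)

text \<open>At a point other than the base vertex exactly one angle differs from 1, and this angle
  determines the petal and the position on it.\<close>

lemma ang_inject:
 assumes "x \<in> points (rose r)" "y \<in> points (rose r)" "!!i. i < r ==> ang i x = ang i y"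
 shows "x = y"
proof -
 have notint: "t \<notin> \<int>" if "0 < t" "t < 1" for t :: real
  using that by (metis Ints_cases of_int_0_less_iff of_int_less_1_iff zless_imp_add1_zle linorder_not_less add_0)
 have ne: "cis (2 * pi * t) \<noteq> 1" if "0 < t" "t < 1" for t
  using cis_2pi_eq_iff[of t 0] notint[OF that] by simp
 from assms(1) show ?thesis
 proof (cases rule: rose_point_cases)
  case 1
  from assms(2) show ?thesis
  proof (cases rule: rose_point_cases)
   case (2 i t)
   then show ?thesis using 1 assms(3)[of i] ne[of t] by simp
  qed (use 1 in simp)
 next
  case (2 i t)
  note x = this
  from assms(2) show ?thesis
  proof (cases rule: rose_point_cases)
   case 1
   then show ?thesis using x assms(3)[of i] ne[of t] by simp
  next
   case (2 j s)
   show ?thesis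
   proof (cases "i = j")
    case True
    then show ?thesis using x 2 assms(3)[of i] by (simp add: petal_eq_iff cis_2pi_eq_iff)
   next
    case False
    then show ?thesis using x 2 assms(3)[of i] ne[of t] by simp
   qed
  qed
 qed
qed

lemma continuous_map_ang:
 assumes "i < r" shows "continuous_map (space_of (rose r)) euclidean (ang i)"
 unfolding continuous_map_space_of_iff[OF finite_graph_rose]
proof (intro conjI ballI)
 fix e
 have "continuous_map I01 euclidean (%s. if e = i then cis (2 * pi * s) else 1)"
  by (cases "e = i") (auto intro!: continuous_intros)
 then show "continuous_map I01 euclidean (%s. ang i (edge_pt (rose r) e s))"
  by (rule continuous_map_eq) (auto simp: edge_pt_rose)
qed auto

text \<open>The angles embed the compact rose in a finite product of complex planes, so continuity
  into the rose can be tested one angle at a time.\<close>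

lemma continuous_map_rose_iff:
 "continuous_map Z (space_of (rose r)) f \<longleftrightarrow>
   f \<in> topspace Z \<rightarrow> points (rose r) \<and> (\<forall>i<r. continuous_map Z euclidean (%z. ang i (f z)))"
  (is "?L \<longleftrightarrow> ?R")
proof
 assume ?L
 then show ?R
  using continuous_map_compose[OF \<open>?L\<close> continuous_map_ang]
  by (auto simp: continuous_map_def topspace_space_of o_def Pi_iff)
next
 assume R: ?R
 define emb where "emb x = (\<lambda>i\<in>{..<r}. ang i x)" for x
 let ?P = "product_topology (%_. euclidean :: complex topology) {..<r}"
 have "embedding_map (space_of (rose r)) ?P emb"
 proof (rule continuous_imp_embedding_map)
  show "continuous_map (space_of (rose r)) ?P emb"
   unfolding continuous_map_componentwise
  proof (intro conjI ballI)
   show "emb ` topspace (space_of (rose r)) \<subseteq> extensional {..<r}" by (auto simp: emb_def)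
   fix i assume "i \<in> {..<r}"
   then show "continuous_map (space_of (rose r)) euclidean (%x. emb x i)"
    using continuous_map_ang[of i r] by (simp add: emb_def)
  qed
  show "compact_space (space_of (rose r))" by (simp add: compact_space_space_of)
  show "Hausdorff_space ?P" by (simp add: Hausdorff_space_product_topology)
  show "inj_on emb (topspace (space_of (rose r)))"
  proof (rule inj_onI)
   fix x y assume *: "x \<in> topspace (space_of (rose r))" "y \<in> topspace (space_of (rose r))" "emb x = emb y"
   show "x = y"
   proof (rule ang_inject[of _ r])
    fix i assume "i < r"
    then show "ang i x = ang i y" using fun_cong[OF *(3), of i] by (simp add: emb_def)
   qed (use * in \<open>auto simp: topspace_space_of\<close>)
  qed
 qed
 then obtain g where g: "homeomorphic_maps (space_of (rose r)) (subtopology ?P (emb ` topspace (space_of (rose r)))) emb g"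
  by (auto simp: embedding_map_def homeomorphic_map_maps)
 have "continuous_map Z (subtopology ?P (emb ` topspace (space_of (rose r)))) (%z. emb (f z))"
  unfolding continuous_map_in_subtopology continuous_map_componentwise
 proof (intro conjI ballI)
  show "(%z. emb (f z)) ` topspace Z \<subseteq> extensional {..<r}" by (auto simp: emb_def)
  show "(%z. emb (f z)) \<in> topspace Z \<rightarrow> emb ` topspace (space_of (rose r))"
   using R by (auto simp: topspace_space_of)
  fix i assume "i \<in> {..<r}"
  then show "continuous_map Z euclidean (%z. emb (f z) i)" using R by (simp add: emb_def)
 qed
 then have "continuous_map Z (space_of (rose r)) (g \<circ> (%z. emb (f z)))"
  using g unfolding homeomorphic_maps_def by (blast intro: continuous_map_compose)
 moreover have "g (emb (f z)) = f z" if "z \<in> topspace Z" for z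
  using g R that by (auto simp: homeomorphic_maps_def topspace_space_of)
 ultimately show ?L by (auto elim: continuous_map_eq)
qed

lemma continuous_map_petal:
 assumes "continuous_map Z euclideanreal u" "i < r"
 shows "continuous_map Z (space_of (rose r)) (%z. petal i (u z))"
 unfolding continuous_map_rose_iff
proof (intro conjI allI impI)
 show "(%z. petal i (u z)) \<in> topspace Z \<rightarrow> points (rose r)"
  using assms by (auto simp: petal_in_points)
 fix j
 have "continuous_map euclideanreal euclidean (%x. cis (2 * pi * x))"
  by (auto intro!: continuous_intros)
 from continuous_map_compose[OF assms(1) this]
 have 1: "continuous_map Z euclidean (%z. cis (2 * pi * u z))" by (simp add: o_def)
 show "continuous_map Z euclidean (%z. ang j (petal i (u z)))"
  by (cases "i = j") (use 1 in auto)
qed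

section \<open>Lifts of angles and the invariance of their increments\<close>

text \<open>A nowhere vanishing function on a contractible set has a continuous logarithm. Values of
  norm 1 make its real part vanish, and the imaginary part divided by \<open>2 * pi\<close> is the
  lift.\<close>

lemma lift_ang:
 fixes S :: "'a::real_normed_vector set"
 assumes "continuous_map (top_of_set S) (space_of (rose r)) f" "contractible S" "i < r"
 obtains u where "continuous_on S u" "!!x. x \<in> S ==> ang i (f x) = cis (2 * pi * u x)"
proof -
 have "continuous_on S (%x. ang i (f x))"
  using assms by (simp add: continuous_map_rose_iff)
 then obtain g where g: "continuous_on S g" "!!x. x \<in> S ==> ang i (f x) = exp (g x)"
  using continuous_logarithm_on_contractible[of S "%x. ang i (f x)"] assms(2) by auto
 have "ang i (f x) = cis (2 * pi * (Im (g x) / (2 * pi)))" if "x \<in> S" for x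
 proof -
  have "norm (exp (g x)) = 1" using g(2)[OF that] norm_ang by metis
  then have "Re (g x) = 0" by simp
  then show ?thesis using g(2)[OF that] by (simp add: exp_eq_polar)
 qed
 moreover have "continuous_on S (%x. Im (g x) / (2 * pi))"
  using g(1) by (auto intro!: continuous_intros)
 ultimately show ?thesis using that by blast
qed

lemma lift_petal:
 fixes S :: "'a::real_normed_vector set"
 assumes f: "continuous_map (top_of_set S) (space_of (rose r)) f" and S: "contractible S"
  and i: "i < r" and im: "!!x. x \<in> S ==> f x \<in> range (petal i)"
 obtains u where "continuous_on S u" "!!x. x \<in> S ==> f x = petal i (u x)"
proof -
 obtain u where u: "continuous_on S u" "!!x. x \<in> S ==> ang i (f x) = cis (2 * pi * u x)"
  using lift_ang[OF f S i] by blast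
 have "f x = petal i (u x)" if x: "x \<in> S" for x
 proof -
  obtain y where y: "f x = petal i y" using im[OF x] by blast
  then show ?thesis using u(2)[OF x] by (simp add: petal_eq_iff cis_2pi_eq_iff)
 qed
 then show ?thesis by (rule that[OF u(1)])
qed

text \<open>If the values at two points differed, connectedness would produce the value of an
  integer plus 1/2 in between.\<close>

lemma continuous_Ints_constant:
 fixes u :: "'a::topological_space => real"
 assumes "connected S" "continuous_on S u" "!!x. x \<in> S ==> u x \<in> \<int>" "x \<in> S" "y \<in> S"
 shows "u x = u y"
proof -
 have "u x \<le> u y" if xy: "x \<in> S" "y \<in> S" for x y
 proof (rule ccontr)
  assume less: "\<not> u x \<le> u y"
  have "connected (u ` S)" using assms connected_continuous_image by blast
  then have "{u y..u x} \<subseteq> u ` S" using that by (intro connected_contains_Icc) auto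
  obtain a b :: int where ab: "u x = of_int a" "u y = of_int b" using assms(3)[OF xy(1)] assms(3)[OF xy(2)] by (auto elim!: Ints_cases)
  then have "b + 1 \<le> a" using less by simp
  then have "of_int b + 1/2 \<in> {u y..u x}" using ab by auto
  then obtain w where "w \<in> S" "u w = of_int b + 1/2"
   using \<open>{u y..u x} \<subseteq> u ` S\<close> by (metis imageE subsetD)
  then have "of_int b + (1/2::real) \<in> \<int>" using assms(3) by metis
  then have "of_int b + (1/2::real) - of_int b \<in> \<int>" by (intro Ints_diff Ints_of_int)
  then obtain z :: int where "1/2 = (of_int z :: real)" by (auto elim!: Ints_cases)
  then have "of_int (2 * z) = (of_int 1 :: real)" by simp
  then have "2 * z = 1" unfolding of_int_eq_iff .
  then show False by presburger
 qed
 then show ?thesis using assms(4,5) by (simp add: order_antisym)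
qed

lemma lift_unique:
 fixes u v :: "'a::topological_space => real"
 assumes "connected S" "continuous_on S u" "continuous_on S v" "!!x. x \<in> S ==> u x - v x \<in> \<int>" "x \<in> S" "y \<in> S"
 shows "u x - u y = v x - v y"
 using continuous_Ints_constant[of S "%x. u x - v x" x y] assms by (simp add: continuous_on_diff)

text \<open>Invariance of the winding number, extended to paths whose ends move. Since the quotient
  \<open>c\<close> of the angles at the two ends is independent of \<open>t\<close>, the increment
  of a lift stays in one coset of the integers and is therefore constant. Closed curves with a
  moving basepoint are the case \<open>c = 1\<close>.\<close>

lemma increment_homotopy_invariant:
 fixes K :: "real \<times> real => gpoint" and u0 u1 :: "real => real"
 assumes K: "continuous_map (top_of_set ({0..1} \<times> {0..1})) (space_of (rose r)) K" and i: "i < r"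
  and u0: "continuous_on {0..1} u0" "!!s. s \<in> {0..1} ==> ang i (K (0, s)) = cis (2 * pi * u0 s)"
  and u1: "continuous_on {0..1} u1" "!!s. s \<in> {0..1} ==> ang i (K (1, s)) = cis (2 * pi * u1 s)"
  and c: "!!t. t \<in> {0..1} ==> ang i (K (t, 1)) = c * ang i (K (t, 0))"
 shows "u0 1 - u0 0 = u1 1 - u1 0"
proof -
 have "convex ({0..1::real} \<times> {0..1::real})" by (intro convex_Times convex_real_interval)
 then have "contractible ({0..1::real} \<times> {0..1::real})" by (rule convex_imp_contractible)
 then obtain L where L: "continuous_on ({0..1} \<times> {0..1}) L"
  "!!x. x \<in> {0..1} \<times> {0..1} ==> ang i (K x) = cis (2 * pi * L x)"
  using lift_ang[OF K _ i] by blast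
 have cont: "continuous_on {0..1} (%s. L (f s, g s))"
  if "continuous_on {0..1} f" "continuous_on {0..1} g" "f ` {0..1} \<subseteq> {0..1}" "g ` {0..1} \<subseteq> {0..1}"
  for f g :: "real => real"
  by (rule continuous_on_compose2[OF L(1), of _ "%s. (f s, g s)"]) (use that in \<open>auto intro!: continuous_intros\<close>)
 have conn: "connected {0..1::real}" by simp
 have e0: "L (0, 1) - L (0, 0) = u0 1 - u0 0"
  by (rule lift_unique[OF conn, of "%s. L (0, s)" u0])
   (use u0 L(2) in \<open>auto intro!: cont continuous_intros simp: cis_2pi_eq_iff[symmetric]\<close>)
 have e1: "L (1, 1) - L (1, 0) = u1 1 - u1 0"
  by (rule lift_unique[OF conn, of "%s. L (1, s)" u1])
   (use u1 L(2) in \<open>auto intro!: cont continuous_intros simp: cis_2pi_eq_iff[symmetric]\<close>)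
 have cc: "cis (2 * pi * (L (t, 1) - L (t, 0))) = c" if "t \<in> {0..1}" for t
 proof -
  have "cis (2 * pi * L (t, 1)) = c * cis (2 * pi * L (t, 0))"
   using c[OF that] L(2) that by simp
  then show ?thesis by (simp add: cis_divide[symmetric] right_diff_distrib)
 qed
 define g where "g t = L (t, 1) - L (t, 0) - (L (1, 1) - L (1, 0))" for t
 have "g 0 = g 1"
 proof (rule continuous_Ints_constant[OF conn, of g])
  show "continuous_on {0..1} g"
   unfolding g_def by (intro continuous_intros cont) auto
  fix t :: real assume "t \<in> {0..1}"
  then show "g t \<in> \<int>"
   using cc[of t] cc[of 1] by (simp add: cis_2pi_eq_iff[symmetric] g_def)
 qed auto
 with e0 e1 show ?thesis by (simp add: g_def)
qed

section \<open>Maps from \<open>G\<^sub>n\<^sub>,\<^sub>k\<close> to the rose\<close>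

lemma Gnk_simps [simp]: "verts (Gnk n k) = {..k}" "edges (Gnk n k) = {..<n + k + k}"
  "base (Gnk n k) = 0" "base_pt (Gnk n k) = Vert 0"
 by (simp_all add: Gnk_def base_pt_def)

lemma src_Gnk: "src (Gnk n k) e = (if e < n + k then 0 else Suc (e - (n + k)))"
 and tgt_Gnk: "tgt (Gnk n k) e = (if e < n then 0 else if e < n + k then Suc (e - n) else Suc (e - (n + k)))"
 by (simp_all add: Gnk_def)

lemma finite_graph_Gnk [simp]: "finite_graph (Gnk n k)"
 by (auto simp: finite_graph_def src_Gnk tgt_Gnk)

lemma topspace_Gnk [simp]: "topspace (space_of (Gnk n k)) = points (Gnk n k)"
 by (simp add: topspace_space_of)

lemma topspace_rose [simp]: "topspace (space_of (rose r)) = points (rose r)"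
 by (simp add: topspace_space_of)

lemma continuous_map_edgewise_homotopy:
 assumes \<Gamma>: "finite_graph \<Gamma>"
  and edge: "!!e. e \<in> edges \<Gamma> ==> continuous_map (top_of_set ({0..1} \<times> {0..1})) Y (%(t, s). E e t s)"
  and vert: "!!v. v \<in> verts \<Gamma> ==> continuous_map I01 Y (%t. V t v)"
  and ends: "!!e t. e \<in> edges \<Gamma> ==> t \<in> {0..1} ==> E e t 0 = V t (src \<Gamma> e)"
   "!!e t. e \<in> edges \<Gamma> ==> t \<in> {0..1} ==> E e t 1 = V t (tgt \<Gamma> e)"
 shows "continuous_map (prod_topology I01 (space_of \<Gamma>)) Y
  (%(t, x). case x of Vert v => V t v | Inner e s => E e t s)"
proof (rule continuous_map_homotopy_space_of[OF \<Gamma>])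
 fix e assume e: "e \<in> edges \<Gamma>"
 show "continuous_map (top_of_set ({0..1} \<times> {0..1})) Y
   (%(t, s). case (t, edge_pt \<Gamma> e s) of (t, x) => case x of Vert v => V t v | Inner e s => E e t s)"
  by (rule continuous_map_eq[OF edge[OF e]]) (use ends[OF e] in \<open>auto simp: edge_pt_def\<close>)
qed (use vert in simp)

lemma cis_Arg2pi_unique: "0 \<le> t ==> t < 1 ==> Arg2pi (cis (2 * pi * t)) = 2 * pi * t"
 by (rule Arg2pi_unique[of 1]) (auto simp: cis_conv_exp)

lemma kappa_cis: "0 \<le> t ==> t < 1 ==> kappa n k j (cis (2 * pi * t)) = edge_pt (Gnk n k) (n + k + j) t"
 by (simp add: kappa_def cis_Arg2pi_unique)

lemma kappa_1: "kappa n k j 1 = Vert (Suc j)"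
 using kappa_cis[of 0 n k j] by (simp add: src_Gnk)

lemma circ_eq: "circ n k j = edge_pt (Gnk n k) (n + k + j) ` {0..1}"
proof
 show "circ n k j \<subseteq> edge_pt (Gnk n k) (n + k + j) ` {0..1}"
 proof -
  have "Arg2pi z / (2 * pi) \<in> {0..1}" for z
   using Arg2pi_ge_0[of z] Arg2pi_lt_2pi[of z] by (simp add: field_simps)
  then show ?thesis unfolding circ_def kappa_def by blast
 qed
 show "edge_pt (Gnk n k) (n + k + j) ` {0..1} \<subseteq> circ n k j"
 proof
  fix x assume "x \<in> edge_pt (Gnk n k) (n + k + j) ` {0..1}"
  then obtain t where t: "0 \<le> t" "t \<le> 1" "x = edge_pt (Gnk n k) (n + k + j) t" by auto
  show "x \<in> circ n k j"
  proof (cases "t = 1")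
   case True
   then have "x = kappa n k j (cis 0)" using t by (simp add: kappa_1 tgt_Gnk)
   then show ?thesis unfolding circ_def by (rule image_eqI) simp
  next
   case False
   then have "x = kappa n k j (cis (2 * pi * t))" using t by (simp add: kappa_cis)
   then show ?thesis unfolding circ_def by (rule image_eqI) simp
  qed
 qed
qed

lemma kappa_in_circ: "kappa n k j z \<in> circ n k j"
proof -
 have "Arg2pi z / (2 * pi) \<in> {0..1}"
  using Arg2pi_ge_0[of z] Arg2pi_lt_2pi[of z] by (simp add: field_simps)
 then show ?thesis unfolding circ_eq kappa_def by blast
qed

lemma circ_subset_points: "j < k ==> circ n k j \<subseteq> points (Gnk n k)"
 by (auto simp: circ_eq edge_pt_in_points simp del: edge_pt_simps)

lemma Vert_in_circ: "j < k ==> Vert (Suc j) \<in> circ n k j"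
 using kappa_in_circ[of n k j 1] by (simp add: kappa_1)

section \<open>Maps to the rose described by lifts on the edges\<close>

text \<open>The petal that receives the edge \<open>e\<close>; the stem \<open>n + j\<close> and the
  circle \<open>n + k + j\<close> share the petal \<open>n + j\<close>.\<close>

definition pidx :: "nat => nat => nat => nat" where
 "pidx n k e = (if e < n + k then e else e - k)"

text \<open>The map whose restriction to the edge \<open>e\<close> has the real function
  \<open>L e\<close> as lift. The vertex of the \<open>j\<close>-th circle takes its image from the
  start of the circle.\<close>

definition lmap :: "nat => nat => (nat => real => real) => gpoint => gpoint" where
 "lmap n k L x = (case x of
   Vert v => if v = 0 then Vert 0 else petal (n + (v - 1)) (L (n + k + (v - 1)) 0)
  | Inner e s => petal (pidx n k e) (L e s))"

text \<open>Compatibility at the vertices, where lifts need to agree only mod integers, together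
  with degree one on each circle. The degree condition makes the image of the circle the whole
  petal.\<close>

definition lift_data :: "nat => nat => (nat => real => real) => bool" where
 "lift_data n k L \<longleftrightarrow> (\<forall>e<n+k. L e 0 \<in> \<int>) \<and> (\<forall>e<n. L e 1 \<in> \<int>) \<and>
   (\<forall>j<k. L (n + j) 1 - L (n + k + j) 0 \<in> \<int> \<and> L (n + k + j) 1 = L (n + k + j) 0 + 1)"

lemma lmap_edge_pt:
 assumes "lift_data n k L" "e < n + k + k" "s \<in> {0..1}"
 shows "lmap n k L (edge_pt (Gnk n k) e s) = petal (pidx n k e) (L e s)"
proof -
 consider "e < n" | j where "j < k" "e = n + j" | j where "j < k" "e = n + k + j"
 proof -
  have "e < n \<or> (\<exists>j<k. e = n + j) \<or> (\<exists>j<k. e = n + k + j)"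
   using assms(2) by (metis add_less_cancel_left le_add_diff_inverse linorder_not_le)
  then show ?thesis using that by blast
 qed
 then show ?thesis
 proof cases
  case 1
  then show ?thesis using assms
   by (auto simp: edge_pt_def lmap_def src_Gnk tgt_Gnk lift_data_def petal_Ints pidx_def)
 next
  case (2 j)
  then have "petal (n + j) (L (n + k + j) 0) = petal (n + j) (L (n + j) 1)"
   using assms(1) by (metis lift_data_def petal_eq_iff Ints_minus minus_diff_eq)
  then show ?thesis using assms 2
   by (auto simp: edge_pt_def lmap_def src_Gnk tgt_Gnk lift_data_def petal_Ints pidx_def)
 next
  case (3 j)
  then have "petal (n + j) (L (n + k + j) 0) = petal (n + j) (L (n + k + j) 1)"
   using assms(1) by (simp add: lift_data_def petal_eq_iff)
  then show ?thesis using assms 3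
   by (auto simp: edge_pt_def lmap_def src_Gnk tgt_Gnk lift_data_def petal_Ints pidx_def)
 qed
qed

lemma pidx_less: "e < n + k + k ==> pidx n k e < n + k"
 by (auto simp: pidx_def)

lemma pidx_circle [simp]: "pidx n k (n + k + j) = n + j"
 by (simp add: pidx_def)

lemma pidx_stem [simp]: "j < k ==> pidx n k (n + j) = n + j"
 by (simp add: pidx_def)

lemma pidx_loop [simp]: "e < n ==> pidx n k e = e"
 by (simp add: pidx_def)

lemma lmap_Vert [simp]: "lmap n k L (Vert 0) = Vert 0"
  "lmap n k L (Vert (Suc j)) = petal (n + j) (L (n + k + j) 0)"
 by (simp_all add: lmap_def)

text \<open>By the intermediate value theorem a lift that rises by 1 meets every residue class mod
  integers.\<close>

lemma petal_image_unit:
 assumes "continuous_on {0..1} u" "u 1 = u 0 + 1"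
 shows "petal i ` u ` {0..1::real} = range (petal i)"
proof
 show "range (petal i) \<subseteq> petal i ` u ` {0..1}"
 proof
  fix y assume "y \<in> range (petal i)"
  then obtain x where x: "y = petal i x" by blast
  have "u 0 \<le> u 0 + frac (x - u 0) \<and> u 0 + frac (x - u 0) \<le> u 1"
   using assms(2) frac_ge_0[of "x - u 0"] frac_lt_1[of "x - u 0"] by linarith
  then obtain s where s: "0 \<le> s" "s \<le> 1" "u s = u 0 + frac (x - u 0)"
   using IVT'[of u 0 "u 0 + frac (x - u 0)" 1] assms(1) by auto
  have "petal i (u s) = y" unfolding x petal_eq_iff s(3) by (simp add: frac_def)
  then show "y \<in> petal i ` u ` {0..1}" using s by force
 qed
qed auto

lemma lmap_circ:
 assumes "lift_data n k L" "j < k" "continuous_on {0..1} (L (n + k + j))"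
 shows "lmap n k L ` circ n k j = range (petal (n + j))"
proof -
 have "lmap n k L ` circ n k j = petal (n + j) ` L (n + k + j) ` {0..1}"
  unfolding circ_eq image_image
  using assms by (intro image_cong) (auto simp: lmap_edge_pt simp del: edge_pt_simps)
 then show ?thesis
  using petal_image_unit[OF assms(3), of "n + j"] assms(1,2) by (simp add: lift_data_def)
qed

lemma continuous_map_lmap_homotopy:
 fixes L :: "real => nat => real => real"
 assumes L: "!!t. t \<in> {0..1} ==> lift_data n k (L t)"
  and cont: "!!e. e < n + k + k ==> continuous_on ({0..1} \<times> {0..1}) (%(t, s). L t e s)"
 shows "continuous_map (prod_topology I01 (space_of (Gnk n k))) (space_of (rose (n + k))) (%(t, x). lmap n k (L t) x)"
proof (rule continuous_map_homotopy_space_of[OF finite_graph_Gnk])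
 fix e assume "e \<in> edges (Gnk n k)"
 then have e: "e < n + k + k" by simp
 have "continuous_map (top_of_set ({0..1} \<times> {0..1})) (space_of (rose (n + k)))
  (%z. petal (pidx n k e) ((%(t, s). L t e s) z))"
  by (rule continuous_map_petal) (use cont[OF e] pidx_less[OF e] in auto)
 then show "continuous_map (top_of_set ({0..1} \<times> {0..1})) (space_of (rose (n + k)))
   (%(t, s). case (t, edge_pt (Gnk n k) e s) of (t, x) => lmap n k (L t) x)"
  by (rule continuous_map_eq) (use e L in \<open>auto simp: lmap_edge_pt simp del: edge_pt_simps\<close>)
next
 fix v assume v: "v \<in> verts (Gnk n k)"
 show "continuous_map I01 (space_of (rose (n + k))) (%t. case (t, Vert v) of (t, x) => lmap n k (L t) x)"
 proof (cases v)
  case 0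
  then show ?thesis by simp
 next
  case (Suc j)
  then have j: "j < k" using v by simp
  have "continuous_on {0..1} (%t. (%(t, s). L t (n + k + j) s) (t, 0))"
   by (rule continuous_on_compose2[OF cont[of "n + k + j"], of _ "%t. (t, 0)"])
    (use j in \<open>auto intro!: continuous_intros\<close>)
  then have "continuous_map I01 (space_of (rose (n + k))) (%t. petal (n + j) (L t (n + k + j) 0))"
   using j by (intro continuous_map_petal) auto
  then show ?thesis by (simp add: Suc)
 qed
qed

lemma continuous_map_lmap:
 assumes "lift_data n k L" "!!e. e < n + k + k ==> continuous_on {0..1} (L e)"
 shows "continuous_map (space_of (Gnk n k)) (space_of (rose (n + k))) (lmap n k L)"
 unfolding continuous_map_space_of_iff[OF finite_graph_Gnk]
proof (intro conjI ballI)
 fix v assume "v \<in> verts (Gnk n k)"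
 then show "lmap n k L (Vert v) \<in> topspace (space_of (rose (n + k)))"
  by (cases v) (auto simp: petal_in_points)
next
 fix e assume "e \<in> edges (Gnk n k)"
 then have e: "e < n + k + k" by simp
 have "continuous_map I01 (space_of (rose (n + k))) (%s. petal (pidx n k e) (L e s))"
  by (rule continuous_map_petal) (use assms(2)[OF e] pidx_less[OF e] in auto)
 then show "continuous_map I01 (space_of (rose (n + k))) (%s. lmap n k L (edge_pt (Gnk n k) e s))"
  by (rule continuous_map_eq) (use e assms(1) in \<open>auto simp: lmap_edge_pt simp del: edge_pt_simps\<close>)
qed

section \<open>Homotopies relative to the circles\<close>

definition rel_circles :: "bool => nat => nat => gpoint => (gpoint => gpoint) => (gpoint => gpoint) => bool" where
 "rel_circles b n k c g h \<longleftrightarrow> h (Vert 0) = c \<and>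
   (\<forall>j<k. h ` circ n k j = g ` circ n k j \<and> (b --> h (kappa n k j 1) = g (kappa n k j 1)))"

lemma htpy_rel_alt:
 "homotopic_rel_circles b n k \<Gamma> f g \<longleftrightarrow>
   homotopic_with (rel_circles b n k (base_pt \<Gamma>) g) (space_of (Gnk n k)) (space_of \<Gamma>) f g"
 by (simp add: homotopic_rel_circles_def rel_circles_def[abs_def])

lemma rel_circles_cong:
 assumes "!!x. x \<in> points (Gnk n k) ==> h x = h' x"
 shows "rel_circles b n k c g h \<longleftrightarrow> rel_circles b n k c g h'"
  and "rel_circles b n k c h g \<longleftrightarrow> rel_circles b n k c h' g"
proof -
 have "h ` circ n k j = h' ` circ n k j" "h (Vert (Suc j)) = h' (Vert (Suc j))" if "j < k" for j
  using assms circ_subset_points[OF that, of n] that by (auto intro!: image_cong)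
 moreover have "h (Vert 0) = h' (Vert 0)" using assms by simp
 ultimately show "rel_circles b n k c g h \<longleftrightarrow> rel_circles b n k c g h'"
  and "rel_circles b n k c h g \<longleftrightarrow> rel_circles b n k c h' g"
  by (auto simp: rel_circles_def kappa_1)
qed

text \<open>The condition on the stages refers to the final map only through its images of the
  circles and of their basepoints. The homotopy preserves these, so the initial map defines the same
  condition.\<close>

lemma htpy_rel_sym:
 assumes "homotopic_rel_circles b n k \<Gamma> f g" shows "homotopic_rel_circles b n k \<Gamma> g f"
proof -
 have "rel_circles b n k (base_pt \<Gamma>) g f"
  using assms homotopic_with_imp_property unfolding htpy_rel_alt by blast
 then have "rel_circles b n k (base_pt \<Gamma>) g = rel_circles b n k (base_pt \<Gamma>) f"
  by (auto simp: rel_circles_def fun_eq_iff)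
 then show ?thesis
  using assms unfolding htpy_rel_alt by (metis homotopic_with_symD)
qed

lemma htpy_rel_trans:
 assumes "homotopic_rel_circles b n k \<Gamma> f g" "homotopic_rel_circles b n k \<Gamma> g h"
 shows "homotopic_rel_circles b n k \<Gamma> f h"
proof -
 have "rel_circles b n k (base_pt \<Gamma>) h g"
  using assms(2) homotopic_with_imp_property unfolding htpy_rel_alt by blast
 then have "rel_circles b n k (base_pt \<Gamma>) h = rel_circles b n k (base_pt \<Gamma>) g"
  by (auto simp: rel_circles_def fun_eq_iff)
 then show ?thesis
  using assms unfolding htpy_rel_alt by (metis homotopic_with_trans)
qed

lemma htpy_rel_refl:
 "continuous_map (space_of (Gnk n k)) (space_of \<Gamma>) f ==> f (Vert 0) = base_pt \<Gamma> ==>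
  homotopic_rel_circles b n k \<Gamma> f f"
 by (simp add: htpy_rel_alt rel_circles_def)

lemma htpy_rel_mono:
 "homotopic_rel_circles True n k \<Gamma> f g ==> homotopic_rel_circles b n k \<Gamma> f g"
 unfolding htpy_rel_alt by (erule homotopic_with_mono) (auto simp: rel_circles_def)

lemma htpy_rel_eq:
 assumes "homotopic_rel_circles b n k \<Gamma> f g"
  "!!x. x \<in> points (Gnk n k) ==> f' x = f x" "!!x. x \<in> points (Gnk n k) ==> g' x = g x"
 shows "homotopic_rel_circles b n k \<Gamma> f' g'"
proof -
 have "rel_circles b n k (base_pt \<Gamma>) g = rel_circles b n k (base_pt \<Gamma>) g'"
  using rel_circles_cong(2)[of n k g g' b "base_pt \<Gamma>"] assms(3) by (simp add: fun_eq_iff)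
 then have "homotopic_with (rel_circles b n k (base_pt \<Gamma>) g') (space_of (Gnk n k)) (space_of \<Gamma>) f g"
  using assms(1) by (simp add: htpy_rel_alt)
 then show ?thesis
  unfolding htpy_rel_alt
  by (rule homotopic_with_eq) (use assms(2,3) in \<open>auto intro!: rel_circles_cong\<close>)
qed

lemma htpy_rel_compose_left:
 assumes "homotopic_rel_circles b n k \<Gamma> f g" "continuous_map (space_of \<Gamma>) (space_of \<Gamma>') \<psi>"
  "\<psi> (base_pt \<Gamma>) = base_pt \<Gamma>'"
 shows "homotopic_rel_circles b n k \<Gamma>' (\<psi> \<circ> f) (\<psi> \<circ> g)"
proof -
 have "rel_circles b n k (base_pt \<Gamma>') (\<psi> \<circ> g) (\<psi> \<circ> h)" if "rel_circles b n k (base_pt \<Gamma>) g h" for h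
 proof -
  have "(\<psi> \<circ> h) ` circ n k j = (\<psi> \<circ> g) ` circ n k j" if "j < k" for j
   using \<open>rel_circles b n k (base_pt \<Gamma>) g h\<close> that unfolding rel_circles_def by (metis image_comp)
  then show ?thesis using that assms(3) by (simp add: rel_circles_def)
 qed
 with assms(1,2) show ?thesis
  unfolding htpy_rel_alt by (rule homotopic_with_compose_continuous_map_left)
qed

lemma htpy_rel_imp:
 assumes "homotopic_rel_circles b n k \<Gamma> f g"
 shows "continuous_map (space_of (Gnk n k)) (space_of \<Gamma>) f" "continuous_map (space_of (Gnk n k)) (space_of \<Gamma>) g"
  "f (Vert 0) = base_pt \<Gamma>" "g (Vert 0) = base_pt \<Gamma>"
  "j < k ==> f ` circ n k j = g ` circ n k j"
  "j < k ==> b ==> f (Vert (Suc j)) = g (Vert (Suc j))"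
 using homotopic_with_imp_continuous_maps[OF assms[unfolded htpy_rel_alt]]
  homotopic_with_imp_property[OF assms[unfolded htpy_rel_alt]]
 by (auto simp: rel_circles_def kappa_1)

text \<open>A continuous family of lift data is automatically a homotopy relative to the circles:
  each stage covers the whole petal because its degree is one. Only the basepoint condition has to
  be required, and it says that the start of a circle is constant mod integers.\<close>

lemma htpy_rel_lmap:
 fixes L :: "real => nat => real => real"
 assumes L: "!!t. t \<in> {0..1} ==> lift_data n k (L t)"
  and cont: "!!e. e < n + k + k ==> continuous_on ({0..1} \<times> {0..1}) (%(t, s). L t e s)"
  and b: "!!t j. b ==> t \<in> {0..1} ==> j < k ==> L t (n + k + j) 0 - L 1 (n + k + j) 0 \<in> \<int>"
  and fg: "!!x. x \<in> points (Gnk n k) ==> f x = lmap n k (L 0) x"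
   "!!x. x \<in> points (Gnk n k) ==> g x = lmap n k (L 1) x"
 shows "homotopic_rel_circles b n k (rose (n + k)) f g"
proof -
 have "homotopic_rel_circles b n k (rose (n + k)) (lmap n k (L 0)) (lmap n k (L 1))"
  unfolding htpy_rel_alt
 proof (rule homotopic_withI)
  show "continuous_map (prod_topology I01 (space_of (Gnk n k))) (space_of (rose (n + k))) (%(t, x). lmap n k (L t) x)"
   by (rule continuous_map_lmap_homotopy[OF L cont])
  fix t :: real assume t: "t \<in> {0..1}"
  have c: "continuous_on {0..1} (L t' e)" if "e < n + k + k" "t' \<in> {0..1}" for t' e
  proof -
   have c1: "continuous_on {0..1} (%s::real. (t', s))"
    by (rule continuous_on_Pair[OF continuous_on_const continuous_on_id])
   have c2: "(%s::real. (t', s)) ` {0..1} \<subseteq> {0..1} \<times> {0..1}" using that by auto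
   show ?thesis using continuous_on_compose2[OF cont[OF that(1)] c1 c2] by simp
  qed
  have "lmap n k (L t) ` circ n k j = lmap n k (L 1) ` circ n k j" if "j < k" for j
   using lmap_circ[OF L[OF t] that] lmap_circ[OF L[of 1] that] c that t by simp
  then show "rel_circles b n k (base_pt (rose (n + k))) (lmap n k (L 1)) (lmap n k (L t))"
   using b[OF _ t] by (auto simp: rel_circles_def kappa_1 petal_eq_iff)
 qed (auto intro!: rel_circles_cong)
 then show ?thesis by (rule htpy_rel_eq) (use fg in auto)
qed

text \<open>Lifts of the normal form with coordinates \<open>x\<close>: the stem runs linearly from
  0 to \<open>x j\<close> in the universal cover of its petal, and the circle makes one turn
  starting from there.\<close>

definition Fdata :: "nat => nat => (nat => real) => nat => real => real" where
 "Fdata n k x e s = (if e < n then s else if e < n + k then s * x (e - n) else x (e - (n + k)) + s)"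

definition Fmap :: "nat => nat => (nat => real) => gpoint => gpoint" where
 "Fmap n k x = lmap n k (Fdata n k x)"

lemma Fdata_simps [simp]: "e < n ==> Fdata n k x e s = s" "j < k ==> Fdata n k x (n + j) s = s * x j"
  "Fdata n k x (n + k + j) s = x j + s"
 by (auto simp: Fdata_def)

lemma lift_data_Fdata [simp]: "lift_data n k (Fdata n k x)"
 by (auto simp: lift_data_def) (auto simp: Fdata_def)

lemma continuous_on_Fdata: "continuous_on S (Fdata n k x e)"
 unfolding Fdata_def[abs_def] by (cases "e < n"; cases "e < n + k") (auto intro!: continuous_intros)

lemma continuous_map_Fmap: "continuous_map (space_of (Gnk n k)) (space_of (rose (n + k))) (Fmap n k x)"
 unfolding Fmap_def by (intro continuous_map_lmap lift_data_Fdata continuous_on_Fdata)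

lemma Fmap_Vert [simp]: "Fmap n k x (Vert 0) = Vert 0" "Fmap n k x (Vert (Suc j)) = petal (n + j) (x j)"
 by (simp_all add: Fmap_def)

lemma Fmap_edge_pt:
 "e < n + k + k ==> s \<in> {0..1} ==> Fmap n k x (edge_pt (Gnk n k) e s) = petal (pidx n k e) (Fdata n k x e s)"
 unfolding Fmap_def by (rule lmap_edge_pt) auto

lemma Fmap_circ: "j < k ==> Fmap n k x ` circ n k j = range (petal (n + j))"
 unfolding Fmap_def by (rule lmap_circ[OF lift_data_Fdata _ continuous_on_Fdata])

lemma rose_marking_eq: "x \<in> points (Gnk n k) ==> rose_marking n k x = Fmap n k (%_. 0) x"
proof (cases rule: points_cases, assumption)
 fix v assume "v \<in> verts (Gnk n k)" "x = Vert v"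
 then show ?thesis by (cases v) (auto simp: rose_marking_def)
next
 fix e t assume "e \<in> edges (Gnk n k)" "0 < t" "t < 1" "x = Inner e t"
 then show ?thesis
  by (auto simp: rose_marking_def Fmap_def lmap_def Fdata_def pidx_def petal_Inner petal_Ints)
qed

text \<open>Once circles may rotate, the coordinates can be interpolated linearly. This is why all
  normal forms lie over the same element of \<open>Lnk False n k\<close>.\<close>

lemma Fmap_homotopic_False: "homotopic_rel_circles False n k (rose (n + k)) (Fmap n k x) (Fmap n k y)"
proof (rule htpy_rel_lmap[where L = "%t. Fdata n k (%j. (1 - t) * x j + t * y j)"])
 fix e assume "e < n + k + k"
 show "continuous_on ({0..1} \<times> {0..1}) (%(t, s). Fdata n k (%j. (1 - t) * x j + t * y j) e s)"
  unfolding case_prod_unfold Fdata_def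
  by (cases "e < n"; cases "e < n + k") (auto intro!: continuous_intros)
qed (auto simp: Fmap_def)

section \<open>Normal forms of markings of the rose\<close>

lemma continuous_map_homotopy_edge:
 assumes "continuous_map (prod_topology I01 (space_of \<Gamma>)) Y h" "finite_graph \<Gamma>" "e \<in> edges \<Gamma>"
 shows "continuous_map (top_of_set ({0..1} \<times> {0..1})) Y (%(t, s). h (t, edge_pt \<Gamma> e s))"
proof -
 have "continuous_map (prod_topology I01 I01) (prod_topology I01 (space_of \<Gamma>)) (%(t, s). (id t, edge_pt \<Gamma> e s))"
  unfolding continuous_map_prod_top using continuous_map_edge_pt[OF assms(2,3)] by simp
 from continuous_map_compose[OF this assms(1)] show ?thesis
  by (simp add: o_def case_prod_unfold)
qed

lemma continuous_map_homotopy_vertex: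
 assumes "continuous_map (prod_topology I01 (space_of \<Gamma>)) Y h" "finite_graph \<Gamma>" "v \<in> verts \<Gamma>"
 shows "continuous_map I01 Y (%t. h (t, Vert v))"
proof -
 have "continuous_map I01 (prod_topology I01 (space_of \<Gamma>)) (%t. (t, Vert v))"
  using assms(2,3) by (auto intro!: continuous_map_pairedI simp: topspace_space_of)
 from continuous_map_compose[OF this assms(1)] show ?thesis by (simp add: o_def)
qed

lemma homotopic_rel_circlesE:
 assumes "homotopic_rel_circles b n k \<Gamma> f g"
 obtains h where "continuous_map (prod_topology I01 (space_of (Gnk n k))) (space_of \<Gamma>) h"
  "!!x. h (0, x) = f x" "!!x. h (1, x) = g x"
  "!!t. t \<in> {0..1} ==> h (t, Vert 0) = base_pt \<Gamma>"
  "!!t j. t \<in> {0..1} ==> j < k ==> (%x. h (t, x)) ` circ n k j = g ` circ n k j"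
  "!!t j. b ==> t \<in> {0..1} ==> j < k ==> h (t, Vert (Suc j)) = g (Vert (Suc j))"
proof -
 obtain h where "continuous_map (prod_topology I01 (space_of (Gnk n k))) (space_of \<Gamma>) h"
  "\<forall>x. h (0, x) = f x" "\<forall>x. h (1, x) = g x"
  "\<forall>t\<in>{0..1}. rel_circles b n k (base_pt \<Gamma>) g (%x. h (t, x))"
  using assms unfolding htpy_rel_alt homotopic_with_def by blast
 then show ?thesis by (intro that[of h]) (simp_all add: rel_circles_def kappa_1)
qed

lemma Gnk_edge_cases:
 fixes e n k :: nat
 assumes "e < n + k + k"
 obtains "e < n" | j where "j < k" "e = n + j" | j where "j < k" "e = n + k + j"
proof -
 show ?thesis
 proof (cases "e < n")
  case ge: False
  show ?thesis
  proof (cases "e < n + k")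
   case True
   then show ?thesis using that(2)[of "e - n"] ge by simp
  next
   case False
   then show ?thesis using that(3)[of "e - (n + k)"] assms by simp
  qed
 qed (rule that(1))
qed

lemma connected_unit: "connected {0..1::real}" "contractible {0..1::real}" "contractible (UNIV::real set)"
 by (auto intro!: convex_imp_contractible)

text \<open>The given homotopy lets the circles rotate. Lifting the track of the basepoint of the
  \<open>j\<close>-th circle so that it ends at 0, its starting value is the coordinate
  \<open>x j\<close>: dragging the stem back along this track corrects the homotopy to one that
  keeps the basepoints.\<close>

lemma homotopic_to_Fmap:
 assumes "homotopic_rel_circles False n k (rose (n + k)) f (Fmap n k (%_. 0))"
 obtains x where "homotopic_rel_circles True n k (rose (n + k)) f (Fmap n k x)"
proof -
 let ?G = "Gnk n k" and ?R = "rose (n + k)" and ?\<rho> = "Fmap n k (%_. 0)"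
 obtain h where h: "continuous_map (prod_topology I01 (space_of ?G)) (space_of ?R) h"
  "!!x. h (0, x) = f x" "!!x. h (1, x) = ?\<rho> x" "!!t. t \<in> {0..1} ==> h (t, Vert 0) = Vert 0"
  "!!t j. t \<in> {0..1} ==> j < k ==> (%x. h (t, x)) ` circ n k j = ?\<rho> ` circ n k j"
  by (rule homotopic_rel_circlesE[OF assms]) auto
 note hE = continuous_map_homotopy_edge[OF h(1) finite_graph_Gnk]
 note hV = continuous_map_homotopy_vertex[OF h(1) finite_graph_Gnk]
 have contf: "continuous_map (space_of ?G) (space_of ?R) f" by (rule htpy_rel_imp(1)[OF assms])
 have f0: "f (Vert 0) = Vert 0" using h(4)[of 0] by (simp add: h(2))
 have in_petal: "h (t, y) \<in> range (petal (n + j))" if "t \<in> {0..1}" "j < k" "y \<in> circ n k j" for t j y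
  using h(5)[OF that(1,2)] that Fmap_circ[of j k n "%_. 0"] by auto
 \<comment> \<open>\<open>T\<close> lifts the track of the vertex of the circle. At time 1 the map
   is the normal form of 0, so the lift can be normalised to end at 0.\<close>
 have "\<exists>T. continuous_on {0..1} T \<and> (\<forall>t\<in>{0..1}. h (t, Vert (Suc j)) = petal (n + j) (T t)) \<and> T 1 = 0"
  if j: "j < k" for j
 proof -
  have "continuous_map I01 (space_of ?R) (%t. h (t, Vert (Suc j)))" using hV j by simp
  then obtain T where T: "continuous_on {0..1} T" "!!t. t \<in> {0..1} ==> h (t, Vert (Suc j)) = petal (n + j) (T t)"
   using lift_petal[of "{0..1}" "n + k" _ "n + j"] in_petal[OF _ j Vert_in_circ[OF j]] connected_unit(2) j
   by (metis (no_types, lifting) add_less_cancel_left)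
  have "T 1 \<in> \<int>" using T(2)[of 1] by (simp add: h(3) petal_eq_Vert_iff eq_commute[of "Vert 0"])
  then show ?thesis using T
   by (intro exI[of _ "%t. T t - T 1"]) (auto intro!: continuous_intros simp: petal_eq_iff)
 qed
 then obtain T where T: "!!j. j < k ==> continuous_on {0..1} (T j)"
  "!!j t. j < k ==> t \<in> {0..1} ==> h (t, Vert (Suc j)) = petal (n + j) (T j t)" "!!j. j < k ==> T j 1 = 0"
  by metis
 have "\<exists>g. continuous_on {0..1} g \<and> (\<forall>s\<in>{0..1}. f (edge_pt ?G (n + k + j) s) = petal (n + j) (g s)) \<and>
   g 0 = T j 0 \<and> g 1 = g 0 + 1" if j: "j < k" for j
 proof -
  have e: "n + k + j \<in> edges ?G" using j by simp
  have "continuous_map I01 (space_of ?R) (%s. f (edge_pt ?G (n + k + j) s))"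
   using continuous_map_compose[OF continuous_map_edge_pt[OF finite_graph_Gnk e] contf] by (simp add: o_def)
  moreover have "f (edge_pt ?G (n + k + j) s) \<in> range (petal (n + j))" if "s \<in> {0..1}" for s
   using in_petal[of 0 j "edge_pt ?G (n + k + j) s"] j that by (auto simp: h(2) circ_eq simp del: edge_pt_simps)
  ultimately obtain g where g: "continuous_on {0..1} g"
   "!!s. s \<in> {0..1} ==> f (edge_pt ?G (n + k + j) s) = petal (n + j) (g s)"
   using lift_petal[of "{0..1}" "n + k" _ "n + j"] connected_unit(2) j by (metis (no_types, lifting) add_less_cancel_left)
  have "petal (n + j) (g 0) = petal (n + j) (T j 0)"
   using g(2)[of 0] T(2)[OF j, of 0] by (simp add: h(2) src_Gnk)
  then have int: "g 0 - T j 0 \<in> \<int>" by (simp add: petal_eq_iff)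
  \<comment> \<open>The circle is closed at all times although its basepoint moves, so
    \<open>c = 1\<close> applies and the lift of \<open>f\<close> has the increment 1 of the normal
    form.\<close>
  have "g 1 - g 0 = (%s. s) 1 - (%s. s) 0"
  proof (rule increment_homotopy_invariant[OF hE[OF e], where i = "n + j" and c = 1])
   fix s :: real assume s: "s \<in> {0..1}"
   show "ang (n + j) (case (0, s) of (t, s) => h (t, edge_pt ?G (n + k + j) s)) = cis (2 * pi * g s)"
    using g(2)[OF s] by (simp add: h(2))
   show "ang (n + j) (case (1, s) of (t, s) => h (t, edge_pt ?G (n + k + j) s)) = cis (2 * pi * s)"
    using j s by (simp add: h(3) Fmap_edge_pt del: edge_pt_simps)
  qed (use j g in \<open>auto simp: src_Gnk tgt_Gnk\<close>)
  then show ?thesis using g int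
   by (intro exI[of _ "%s. g s - (g 0 - T j 0)"]) (auto intro!: continuous_intros simp: petal_eq_iff)
 qed
 then obtain g where g: "!!j. j < k ==> continuous_on {0..1} (g j)"
  "!!j s. j < k ==> s \<in> {0..1} ==> f (edge_pt ?G (n + k + j) s) = petal (n + j) (g j s)"
  "!!j. j < k ==> g j 0 = T j 0" "!!j. j < k ==> g j 1 = g j 0 + 1"
  by metis
 define x where "x j = T j 0" for j
 define b c :: "real => real" where "b s = min 1 (min (3 * s) (3 - 3 * s))" and "c s = max 0 (min 1 (3 * s - 1))" for s
 define W where "W j s = T j (min 1 (3 - 3 * s))" for j and s :: real
 define L where "L e s = (if e < n then s else if e < n + k then W (e - n) s else g (e - (n + k)) s)" for e and s :: real
 have Lsimps: "e < n ==> L e s = s" "j < k ==> L (n + j) s = W j s" "L (n + k + j) s = g j s" for e j s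
  by (auto simp: L_def)
 have W01: "W j 0 = 0" "W j 1 = x j" if "j < k" for j using T(3)[OF that] by (auto simp: W_def x_def)
 have contW: "continuous_on {0..1} (W j)" if "j < k" for j
  unfolding W_def[abs_def]
  by (rule continuous_on_compose2[OF T(1)[OF that]]) (auto intro!: continuous_intros)
 have contL: "continuous_on {0..1} (L e)" if "e < n + k + k" for e
  using that
 proof (cases rule: Gnk_edge_cases)
  case 1
  then have "L e = (%s. s)" by (simp add: Lsimps fun_eq_iff)
  then show ?thesis by (simp add: continuous_on_id)
 next
  case (2 j)
  then have "L e = W j" by (simp add: Lsimps fun_eq_iff)
  then show ?thesis using contW 2 by simp
 next
  case (3 j)
  then have "L e = g j" by (simp add: Lsimps fun_eq_iff)
  then show ?thesis using g(1) 3 by simp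
 qed
 have lift_data_L: "lift_data n k L"
  unfolding lift_data_def
 proof (intro conjI allI impI)
  fix e assume e: "e < n + k"
  then have "e < n + k + k" by simp
  then show "L e 0 \<in> \<int>" by (cases rule: Gnk_edge_cases) (use e W01 in \<open>auto simp: Lsimps\<close>)
 qed (use g(3,4) W01 in \<open>auto simp: Lsimps x_def\<close>)
 have bc: "b s \<in> {0..1}" "c s \<in> {0..1}" if "s \<in> {0..1}" for s using that by (auto simp: b_def c_def)
 have fv: "f (Vert v) = lmap n k L (Vert v)" if "v \<le> k" for v
  using that T(2)[of "v - 1" 0] g(3) f0 by (cases v) (auto simp: h(2) Lsimps)
 \<comment> \<open>On a stem the segment \<open>(0, s)\<close> is pushed in a straight line inside
   the square to the three other sides, with its ends fixed. Loops follow \<open>h\<close>, and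
   circles are kept equal to \<open>f\<close>.\<close>
 define E where "E e t s = (if e < n then h (t, edge_pt ?G e s)
  else if e < n + k then h (t * b s, edge_pt ?G e ((1 - t) * s + t * c s)) else f (edge_pt ?G e s))" for e t s
 have 1: "homotopic_rel_circles True n k ?R f (lmap n k L)"
  unfolding htpy_rel_alt
 proof (rule homotopic_withI)
  have sq: "(1 - t) * s + t * c s \<in> {0..1}" "t * b s \<in> {0..1}" if "t \<in> {0..1}" "s \<in> {0..1}" for t s
  proof -
   have "(1 - t) *\<^sub>R s + t *\<^sub>R c s \<in> {0..1}"
    by (rule convexD) (use that bc in auto)
   then show "(1 - t) * s + t * c s \<in> {0..1}" by simp
   show "t * b s \<in> {0..1}" using that bc[of s] mult_le_one[of t "b s"] by auto
  qed
  show "continuous_map (prod_topology I01 (space_of ?G)) (space_of ?R)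
    (%(t, y). (case y of Vert v => f (Vert v) | Inner e s => E e t s))"
  proof (rule continuous_map_edgewise_homotopy[OF finite_graph_Gnk, where V = "%t v. f (Vert v)"])
   fix v assume "v \<in> verts ?G"
   then have "Vert v \<in> topspace (space_of ?G)" by simp
   then have "f (Vert v) \<in> topspace (space_of ?R)" using contf by (auto simp: continuous_map_def simp del: topspace_Gnk topspace_rose)
   then show "continuous_map I01 (space_of ?R) (%t. f (Vert v))" by simp
  next
   fix e assume e: "e \<in> edges ?G"
   then have "e < n + k + k" by simp
   then show "continuous_map (top_of_set ({0..1} \<times> {0..1})) (space_of ?R) (%(t, s). E e t s)"
   proof (cases rule: Gnk_edge_cases)
    case 1
    then show ?thesis using hE[OF e] by (simp add: E_def)
   next
    case (2 j)
    have "continuous_map (top_of_set ({0..1} \<times> {0..1})) (top_of_set ({0..1} \<times> {0..1}))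
      (%(t, s). (t * b s, (1 - t) * s + t * c s))"
     unfolding continuous_map_subtopology_eu using sq
     by (auto simp: b_def c_def case_prod_unfold intro!: continuous_intros simp del: atLeastAtMost_iff)
    from continuous_map_compose[OF this hE[OF e]] show ?thesis
     using 2 by (simp add: E_def o_def case_prod_unfold)
   next
    case (3 j)
    have "continuous_map (top_of_set ({0..1} \<times> {0..1})) I01 snd"
     by (auto simp: continuous_map_subtopology_eu intro!: continuous_intros)
    from continuous_map_compose[OF this continuous_map_compose[OF continuous_map_edge_pt[OF finite_graph_Gnk e] contf]]
    show ?thesis using 3 by (simp add: E_def o_def case_prod_unfold)
   qed
   fix t :: real assume t: "t \<in> {0..1}"
   have bc01: "b 0 = 0" "c 0 = 0" "b 1 = 0" "c 1 = 1" by (auto simp: b_def c_def)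
   have h0: "h (t, Vert 0) = Vert 0" by (rule h(4)[OF t])
   from \<open>e < n + k + k\<close> have "E e t 0 = f (Vert (src ?G e)) \<and> E e t 1 = f (Vert (tgt ?G e))"
    by (cases rule: Gnk_edge_cases) (auto simp: E_def src_Gnk tgt_Gnk h(2) h0 f0 bc01)
   then show "E e t 0 = f (Vert (src ?G e))" "E e t 1 = f (Vert (tgt ?G e))" by auto
  qed
  fix y assume "y \<in> topspace (space_of ?G)"
  then have y: "y \<in> points ?G" by simp
  then show "(case y of Vert v => f (Vert v) | Inner e s => E e 0 s) = f y"
   by (cases rule: points_cases) (auto simp: E_def h(2))
  from y show "(case y of Vert v => f (Vert v) | Inner e s => E e 1 s) = lmap n k L y"
  proof (cases rule: points_cases)
   case (1 v)
   then show ?thesis using fv by simp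
  next
   case (2 e s)
   then have s: "s \<in> {0..1}" by simp
   have "lmap n k L y = petal (pidx n k e) (L e s)"
    using lmap_edge_pt[OF lift_data_L, of e s] 2 s by simp
   moreover from 2 have "e < n + k + k" by simp
   then have "E e 1 s = petal (pidx n k e) (L e s)"
   proof (cases rule: Gnk_edge_cases)
    case 1
    then show ?thesis using s by (simp add: E_def h(3) Fmap_edge_pt Lsimps del: edge_pt_simps)
   next
    case (2 j)
    consider "s \<le> 1/3" | "1/3 \<le> s" "s \<le> 2/3" | "2/3 \<le> s" by linarith
    then have "h (b s, edge_pt ?G (n + j) (c s)) = petal (n + j) (W j s)"
    proof cases
     case 1
     then have "c s = 0" "W j s = 0" using s T(3) 2 by (auto simp: c_def W_def)
     then show ?thesis using h(4)[OF bc(1)[OF s]] 2 by (simp add: src_Gnk)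
    next
     case 2
     then have "b s = 1" "W j s = 0" using s T(3) \<open>j < k\<close> by (auto simp: b_def W_def)
     then show ?thesis using \<open>j < k\<close> bc(2)[OF s] by (simp add: h(3) Fmap_edge_pt del: edge_pt_simps)
    next
     case 3
     then have "b s = 3 - 3 * s" "c s = 1" "min 1 (3 - 3 * s) = 3 - 3 * s" by (auto simp: b_def c_def)
     then show ?thesis using T(2)[OF \<open>j < k\<close>, of "3 - 3 * s"] bc(1)[OF s] \<open>j < k\<close>
      by (simp add: W_def tgt_Gnk)
    qed
    then show ?thesis using 2 by (simp add: E_def Lsimps)
   next
    case (3 j)
    then show ?thesis using g(2)[of j s] s by (simp add: E_def Lsimps)
   qed
   ultimately show ?thesis using 2 by simp
  qed
 next
  fix t :: real assume t: "t \<in> {0..1}"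
  show "rel_circles True n k (base_pt ?R) (lmap n k L) (%y. case y of Vert v => f (Vert v) | Inner e s => E e t s)"
   unfolding rel_circles_def
  proof (intro conjI allI impI)
   show "(case Vert 0 of Vert v => f (Vert v) | Inner e s => E e t s) = base_pt ?R" using f0 by simp
   fix j assume j: "j < k"
   show "(case kappa n k j 1 of Vert v => f (Vert v) | Inner e s => E e t s) = lmap n k L (kappa n k j 1)"
    using fv[of "Suc j"] j by (simp add: kappa_1)
   show "(%y. case y of Vert v => f (Vert v) | Inner e s => E e t s) ` circ n k j = lmap n k L ` circ n k j"
   proof (rule image_cong[OF refl])
    fix y assume "y \<in> circ n k j"
    then obtain s where s: "s \<in> {0..1}" "y = edge_pt ?G (n + k + j) s" by (auto simp: circ_eq)
    have "lmap n k L y = f y" using lmap_edge_pt[OF lift_data_L, of "n + k + j" s] s j g(2)[OF j s(1)] by (simp add: Lsimps)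
    moreover have "(case y of Vert v => f (Vert v) | Inner e s => E e t s) = f y"
     using s by (auto simp: edge_pt_def E_def)
    ultimately show "(case y of Vert v => f (Vert v) | Inner e s => E e t s) = lmap n k L y" by simp
   qed
  qed
 qed (auto intro!: rel_circles_cong)
 have convex_self: "(1 - t) * a + t * a = a" for t a :: real by (simp add: algebra_simps)
 \<comment> \<open>The lifts of \<open>lmap n k L\<close> and of the normal form now have the same
   values at the ends, so they can be interpolated linearly.\<close>
 have 2: "homotopic_rel_circles True n k ?R (lmap n k L) (Fmap n k x)"
 proof (rule htpy_rel_lmap[where L = "%t e s. (1 - t) * L e s + t * Fdata n k x e s"])
  fix t :: real
  have "(1 - t) * a + t * a = a" "(1 - t) * (a + 1) + t * (a + 1) = a + 1" for a :: real by (auto simp: algebra_simps)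
  then show "lift_data n k (%e s. (1 - t) * L e s + t * Fdata n k x e s)"
   unfolding lift_data_def
  proof (intro conjI allI impI)
   fix e assume e: "e < n + k"
   then have "e < n + k + k" by simp
   then show "(1 - t) * L e 0 + t * Fdata n k x e 0 \<in> \<int>"
    by (cases rule: Gnk_edge_cases) (use e W01 in \<open>auto simp: Lsimps\<close>)
  qed (use g(3,4) W01 in \<open>auto simp: Lsimps x_def\<close>)
 next
  fix e assume e: "e < n + k + k"
  have "continuous_on ({0..1} \<times> {0..1}) (%p. L e (snd p))" for A :: "real set"
   by (rule continuous_on_compose2[OF contL[OF e]]) (auto intro!: continuous_intros)
  moreover have "continuous_on ({0..1} \<times> {0..1}) (%p. Fdata n k x e (snd p))"
   by (rule continuous_on_compose2[OF continuous_on_Fdata[of UNIV]]) (auto intro!: continuous_intros)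
  ultimately show "continuous_on ({0..1} \<times> {0..1}) (%(t, s). (1 - t) * L e s + t * Fdata n k x e s)"
   unfolding case_prod_unfold by (auto intro!: continuous_intros)
 qed (use g(3) in \<open>auto simp: Lsimps x_def Fmap_def convex_self\<close>)
 show ?thesis by (rule that[OF htpy_rel_trans[OF 1 2]])
qed

section \<open>Self-maps of the rose\<close>

text \<open>The translation by 1 does not change the point of the petal, so it changes the lift by
  an integer that is the same everywhere. This \<open>d\<close> is the degree on the petal.\<close>

lemma lift_self_map:
 assumes \<theta>: "continuous_map (space_of (rose r)) (space_of (rose r)) \<theta>" and \<theta>0: "\<theta> (Vert 0) = Vert 0"
  and i: "i < r" and im: "!!z. \<theta> (petal i z) \<in> range (petal i)"
 obtains q d where "continuous_on UNIV q" "!!z. \<theta> (petal i z) = petal i (q z)" "q 0 = 0"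
  "!!z. q (z + 1) = q z + d"
proof -
 have "continuous_map (top_of_set UNIV) (space_of (rose r)) (%z. \<theta> (petal i z))"
  using continuous_map_compose[OF continuous_map_petal[OF continuous_map_id i] \<theta>] by (simp add: o_def id_def)
 then obtain q0 where q0: "continuous_on UNIV q0" "!!z. z \<in> UNIV ==> \<theta> (petal i z) = petal i (q0 z)"
  using lift_petal[of UNIV r "%z. \<theta> (petal i z)" i] connected_unit(3) i im by blast
 define q where "q z = q0 z - q0 0" for z
 have "petal i (q0 0) = Vert 0" using q0(2)[of 0] \<theta>0 by simp
 then have int: "q0 0 \<in> \<int>" by (simp add: petal_eq_Vert_iff)
 have q: "\<theta> (petal i z) = petal i (q z)" for z
  using q0(2)[of z] int by (simp add: q_def petal_eq_iff)
 have cont: "continuous_on UNIV q" unfolding q_def[abs_def] using q0(1) by (intro continuous_intros)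
 have "q (z + 1) = q z + q 1" for z
 proof -
  have "q (z + 1) - q (0 + 1) = q z - q 0"
  proof (rule lift_unique[of UNIV "%z. q (z + 1)" q z 0])
   show "continuous_on UNIV (%z. q (z + 1))"
    by (rule continuous_on_compose2[OF cont]) (auto intro!: continuous_intros)
   fix z
   have "petal i (q (z + 1)) = petal i (q z)"
    unfolding q[symmetric] by (rule arg_cong[of _ _ \<theta>]) (simp add: petal_eq_iff)
   then show "q (z + 1) - q z \<in> \<int>" by (simp add: petal_eq_iff)
  qed (use cont in auto)
  then show ?thesis by (simp add: q_def)
 qed
 with cont q show ?thesis by (intro that[of q "q 1"]) (auto simp: q_def)
qed

lemma periodic_add_int:
 fixes q :: "real => real"
 assumes "!!z. q (z + 1) = q z + 1"
 shows "q (z + of_int m) = q z + of_int m"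
proof -
 have nat: "q (z + of_nat N) = q z + of_nat N" for z N
 proof (induction N)
  case (Suc N)
  then show ?case using assms[of "z + of_nat N"] by (simp add: algebra_simps)
 qed simp
 show ?thesis
 proof (cases "0 \<le> m")
  case True
  then show ?thesis using nat[of z "nat m"] by simp
 next
  case False
  then show ?thesis using nat[of "z + of_int m" "nat (- m)"] by simp
 qed
qed

lemma Fmap_cong:
 assumes "!!j. j < k ==> x j = y j" "z \<in> points (Gnk n k)"
 shows "Fmap n k x z = Fmap n k y z"
 using assms(2)
proof (cases rule: points_cases)
 case (1 v)
 then show ?thesis using assms(1) by (cases v) auto
next
 case (2 e s)
 then have "e < n + k + k" by simp
 then have "Fdata n k x e s = Fdata n k y e s"
  by (cases rule: Gnk_edge_cases) (use assms(1) in auto)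
 then show ?thesis using 2 by (simp add: Fmap_def lmap_def)
qed

text \<open>A self-map of degree one on every petal turns the lifts of a normal form into lifts with
  the ends of the normal form at \<open>q (n + j) (x j)\<close>, and a linear interpolation keeps
  these ends.\<close>

lemma Fmap_compose_self_map:
 assumes \<theta>0: "\<theta> (Vert 0) = Vert 0"
  and q: "!!i. i < n + k ==> continuous_on UNIV (q i)" "!!i z. i < n + k ==> \<theta> (petal i z) = petal i (q i z)"
   "!!i. i < n + k ==> q i 0 = 0" "!!i z. i < n + k ==> q i (z + 1) = q i z + (1::real)"
 shows "homotopic_rel_circles True n k (rose (n + k)) (\<theta> \<circ> Fmap n k x) (Fmap n k (%j. q (n + j) (x j)))"
proof -
 let ?x' = "%j. q (n + j) (x j)"
 define L where "L t e s = (1 - t) * q (pidx n k e) (Fdata n k x e s) + t * Fdata n k ?x' e s" for t e s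
 have q1: "q i 1 = 1" if "i < n + k" for i using q(4)[OF that, of 0] q(3)[OF that] by simp
 have convex_self: "(1 - t) * a + t * a = a" for t a :: real by (simp add: algebra_simps)
 show ?thesis
 proof (rule htpy_rel_lmap[where L = L])
  fix t :: real
  show "lift_data n k (L t)"
   unfolding lift_data_def
  proof (intro conjI allI impI)
   fix e assume e: "e < n + k"
   then have "e < n + k + k" by simp
   then show "L t e 0 \<in> \<int>"
    by (cases rule: Gnk_edge_cases) (use e q(3) in \<open>auto simp: L_def\<close>)
  qed (auto simp: L_def q1 q(3,4) convex_self distrib_left)
 next
  fix e assume e: "e < n + k + k"
  have "continuous_on ({0..1} \<times> {0..1}) (%p::real\<times>real. Fdata n k y e (snd p))" for y
   by (rule continuous_on_compose2[OF continuous_on_Fdata[of UNIV]]) (auto intro!: continuous_intros)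
  moreover from this have "continuous_on ({0..1} \<times> {0..1}) (%p::real\<times>real. q (pidx n k e) (Fdata n k x e (snd p)))"
   using continuous_on_compose2[OF q(1)[OF pidx_less[OF e]]] by blast
  ultimately show "continuous_on ({0..1} \<times> {0..1}) (%(t, s). L t e s)"
   unfolding case_prod_unfold L_def by (intro continuous_intros) auto
 next
  fix y assume y: "y \<in> points (Gnk n k)"
  have ld: "lift_data n k (L 0)" "lift_data n k (L 1)"
  proof -
   have "lift_data n k (L t)" for t
    unfolding lift_data_def
   proof (intro conjI allI impI)
    fix e assume e: "e < n + k"
    then have "e < n + k + k" by simp
    then show "L t e 0 \<in> \<int>"
     by (cases rule: Gnk_edge_cases) (use e q(3) in \<open>auto simp: L_def\<close>)
   qed (auto simp: L_def q1 q(3,4) convex_self distrib_left)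
   then show "lift_data n k (L 0)" "lift_data n k (L 1)" by auto
  qed
  from y show "(\<theta> \<circ> Fmap n k x) y = lmap n k (L 0) y"
  proof (cases rule: points_cases)
   case (1 v)
   then show ?thesis using \<theta>0 q(2) by (cases v) (auto simp: L_def)
  next
   case (2 e s)
   then have "Fmap n k x y = petal (pidx n k e) (Fdata n k x e s)"
    using Fmap_edge_pt[of e n k s x] by simp
   moreover have "lmap n k (L 0) y = petal (pidx n k e) (L 0 e s)"
    using lmap_edge_pt[OF ld(1), of e s] 2 by simp
   ultimately show ?thesis using q(2)[OF pidx_less] 2 by (simp add: L_def)
  qed
  have "L 1 = Fdata n k ?x'" by (simp add: L_def fun_eq_iff)
  then show "Fmap n k ?x' y = lmap n k (L 1) y" by (simp add: Fmap_def)
 qed (auto simp: L_def q(3,4) convex_self)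
qed

text \<open>Both numbers are the same integer, or both lie in the same open interval between
  consecutive integers.\<close>

definition same_cell :: "real => real => bool" where
 "same_cell a b \<longleftrightarrow> \<lfloor>a\<rfloor> = \<lfloor>b\<rfloor> \<and> (a \<in> \<int> \<longleftrightarrow> b \<in> \<int>)"

lemma Ints_between_0_1: "0 < t ==> t < 1 ==> t \<notin> \<int>" for t :: real
 by (metis Ints_cases of_int_0_less_iff of_int_less_1_iff zless_imp_add1_zle linorder_not_less add_0)

text \<open>On petal \<open>n + j\<close> the homeomorphism lifts to a map \<open>q\<close> of the
  line. The circle shows that \<open>q\<close> has degree one, the stem that it sends
  \<open>x j\<close> to \<open>y j\<close>, and injectivity that it preserves the integers and the
  open unit intervals.\<close>

lemma same_cell_of_homeomorphism:
 assumes \<theta>: "homeomorphic_map (space_of (rose (n + k))) (space_of (rose (n + k))) \<theta>" and \<theta>0: "\<theta> (Vert 0) = Vert 0"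
  and hom: "homotopic_rel_circles True n k (rose (n + k)) (\<theta> \<circ> Fmap n k x) (Fmap n k y)" and j: "j < k"
 shows "same_cell (x j) (y j)"
proof -
 let ?i = "n + j" and ?R = "rose (n + k)" and ?G = "Gnk n k"
 have i: "?i < n + k" using j by simp
 have cont\<theta>: "continuous_map (space_of ?R) (space_of ?R) \<theta>" using \<theta> by (rule homeomorphic_imp_continuous_map)
 have inj\<theta>: "inj_on \<theta> (points ?R)" using homeomorphic_imp_injective_map[OF \<theta>] by simp
 have "(\<theta> \<circ> Fmap n k x) ` circ n k j = Fmap n k y ` circ n k j"
  by (rule htpy_rel_imp(5)[OF hom j])
 then have "\<theta> ` range (petal ?i) = range (petal ?i)"
  unfolding image_comp[symmetric] Fmap_circ[OF j] .
 then have "\<theta> (petal ?i z) \<in> range (petal ?i)" for z by blast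
 then obtain q d where q: "continuous_on UNIV q" "!!z. \<theta> (petal ?i z) = petal ?i (q z)" "q 0 = 0"
  "!!z. q (z + 1) = q z + d"
  using lift_self_map[OF cont\<theta> \<theta>0 i] by blast
 obtain h where h: "continuous_map (prod_topology I01 (space_of ?G)) (space_of ?R) h"
  "!!z. h (0, z) = (\<theta> \<circ> Fmap n k x) z" "!!z. h (1, z) = Fmap n k y z" "!!t. t \<in> {0..1} ==> h (t, Vert 0) = Vert 0"
  "!!t j. t \<in> {0..1} ==> j < k ==> h (t, Vert (Suc j)) = Fmap n k y (Vert (Suc j))"
  by (rule homotopic_rel_circlesE[OF hom]) auto
 note hE = continuous_map_homotopy_edge[OF h(1) finite_graph_Gnk]
 have contq: "continuous_on {0..1} (%s. q (f s))" if "continuous_on {0..1} f" for f :: "real => real"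
  by (rule continuous_on_compose2[OF q(1) that]) auto
 \<comment> \<open>The image of the circle is closed at every time, so \<open>c = 1\<close>, and
   comparison with the normal form of \<open>y\<close> gives the increment 1.\<close>
 have "(%s. q (x j + s)) 1 - (%s. q (x j + s)) 0 = (%s. y j + s) 1 - (%s. y j + s) 0"
 proof (rule increment_homotopy_invariant[OF hE[of "n + k + j"] i, where c = 1])
  fix s :: real assume s: "s \<in> {0..1}"
  show "ang ?i (case (0, s) of (t, s) => h (t, edge_pt ?G (n + k + j) s)) = cis (2 * pi * q (x j + s))"
   using j s by (simp add: h(2) Fmap_edge_pt q(2) del: edge_pt_simps)
  show "ang ?i (case (1, s) of (t, s) => h (t, edge_pt ?G (n + k + j) s)) = cis (2 * pi * (y j + s))"
   using j s by (simp add: h(3) Fmap_edge_pt q(2) del: edge_pt_simps)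
 qed (use j in \<open>auto simp: src_Gnk tgt_Gnk intro!: contq continuous_intros\<close>)
 then have "q (x j + 1) = q (x j) + 1" by simp
 then have d: "d = 1" using q(4)[of "x j"] by simp
 \<comment> \<open>Both ends of the stem are fixed during the homotopy, so the angle of its end
   serves as \<open>c\<close>. The outcome \<open>q (x j) = y j\<close> is an equality of real
   numbers, not only mod integers.\<close>
 have "(%s. q (s * x j)) 1 - (%s. q (s * x j)) 0 = (%s. s * y j) 1 - (%s. s * y j) 0"
 proof (rule increment_homotopy_invariant[OF hE[of "n + j"] i, where c = "ang ?i (petal ?i (y j))"])
  fix s :: real assume s: "s \<in> {0..1}"
  show "ang ?i (case (0, s) of (t, s) => h (t, edge_pt ?G (n + j) s)) = cis (2 * pi * q (s * x j))"
   using j s by (simp add: h(2) Fmap_edge_pt q(2) del: edge_pt_simps)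
  show "ang ?i (case (1, s) of (t, s) => h (t, edge_pt ?G (n + j) s)) = cis (2 * pi * (s * y j))"
   using j s by (simp add: h(3) Fmap_edge_pt q(2) del: edge_pt_simps)
 qed (use j in \<open>auto simp: src_Gnk tgt_Gnk h(4,5) intro!: contq continuous_intros\<close>)
 then have qx: "q (x j) = y j" using q(3) by simp
 have q1: "q 1 = 1" using q(4)[of 0] q(3) d by simp
 \<comment> \<open>An integral value of \<open>q\<close> inside the unit interval would give a
   second point sent to the base vertex.\<close>
 have notint: "q z \<notin> \<int>" if z: "0 < z" "z < 1" for z
 proof
  assume "q z \<in> \<int>"
  then have "\<theta> (petal ?i z) = \<theta> (Vert 0)" using q(2)[of z] \<theta>0 by (simp add: petal_Ints)
  then have "petal ?i z = Vert 0" using inj_onD[OF inj\<theta>] petal_in_points[OF i] by simp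
  then show False using Ints_between_0_1[OF z] by (simp add: petal_eq_Vert_iff)
 qed
 have between: "0 < q z \<and> q z < 1" if z: "0 < z" "z < 1" for z
 proof (rule ccontr)
  assume "\<not> (0 < q z \<and> q z < 1)"
  moreover have "q z \<noteq> 0" "q z \<noteq> 1" using notint[OF z] by auto
  ultimately consider "q z < 0" | "1 < q z" by linarith
  then show False
  proof cases
   case 1
   obtain w where "z \<le> w" "w \<le> 1" "q w = 0"
    using IVT'[of q z 0 1] 1 q1 z continuous_on_subset[OF q(1)] by auto
   then show False using notint[of w] z q1 by (cases "w = 1") auto
  next
   case 2
   obtain w where "0 \<le> w" "w \<le> z" "q w = 1"
    using IVT'[of q 0 1 z] 2 q(3) z continuous_on_subset[OF q(1)] by auto
   then show False using notint[of w] z q(3) by (cases "w = 0") auto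
  qed
 qed
 have "q (frac (x j) + of_int \<lfloor>x j\<rfloor>) = q (frac (x j)) + of_int \<lfloor>x j\<rfloor>"
  by (rule periodic_add_int) (use q(4) d in simp)
 then have y: "y j = q (frac (x j)) + of_int \<lfloor>x j\<rfloor>" by (simp add: frac_def qx)
 show ?thesis
 proof (cases "x j \<in> \<int>")
  case True
  then have "frac (x j) = 0" by simp
  have "y j = of_int \<lfloor>x j\<rfloor>" using y q(3) unfolding \<open>frac (x j) = 0\<close> by simp
  then show ?thesis using True by (simp add: same_cell_def)
 next
  case False
  then have "0 < frac (x j)" by (simp add: frac_gt_0_iff)
  from between[OF this frac_lt_1] have b: "0 < q (frac (x j))" "q (frac (x j)) < 1" by auto
  then have "\<lfloor>y j\<rfloor> = \<lfloor>x j\<rfloor>" unfolding y by linarith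
  moreover have "y j \<notin> \<int>"
  proof
   assume "y j \<in> \<int>"
   then have "y j - of_int \<lfloor>x j\<rfloor> \<in> \<int>" by (intro Ints_diff) auto
   then show False using y Ints_between_0_1[OF b] by simp
  qed
  ultimately show ?thesis using False by (simp add: same_cell_def)
 qed
qed

section \<open>Self-maps of the rose given by a profile on each petal\<close>

text \<open>Each petal is reparametrized by its own profile. Injective profiles give homeomorphisms;
  a profile with a flat piece will realize the collapse of an edge.\<close>

definition rose_map :: "(nat => real => real) => gpoint => gpoint" where
 "rose_map m x = (case x of Vert v => Vert 0 | Inner i t => petal i (m i t))"

locale rose_self_map =
 fixes r :: nat and m :: "nat => real => real"
 assumes cont: "!!i. i < r ==> continuous_on {0..1} (m i)"
  and m0: "!!i. i < r ==> m i 0 = 0" and m1: "!!i. i < r ==> m i 1 = 1"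
begin

lemma rose_map_petal: "i < r ==> t \<in> {0..1} ==> rose_map m (petal i t) = petal i (m i t)"
 by (cases "t = 0"; cases "t = 1") (auto simp: rose_map_def petal_Inner m0 m1)

lemma continuous_map_rose_map: "continuous_map (space_of (rose r)) (space_of (rose r)) (rose_map m)"
 unfolding continuous_map_space_of_iff[OF finite_graph_rose]
proof (intro conjI ballI)
 fix e assume "e \<in> edges (rose r)"
 then have e: "e < r" by simp
 have "continuous_map I01 (space_of (rose r)) (%s. petal e (m e s))"
  by (rule continuous_map_petal) (use e cont in auto)
 then show "continuous_map I01 (space_of (rose r)) (%s. rose_map m (edge_pt (rose r) e s))"
  by (rule continuous_map_eq) (use e rose_map_petal in \<open>auto simp: edge_pt_rose\<close>)
qed (auto simp: rose_map_def)

lemma lifts: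
 obtains q where "!!i. i < r ==> continuous_on UNIV (q i)"
  "!!i z. i < r ==> rose_map m (petal i z) = petal i (q i z)" "!!i. i < r ==> q i 0 = 0"
  "!!i z. i < r ==> q i (z + 1) = q i z + (1::real)"
  "!!i z. i < r ==> q i z = of_int \<lfloor>z\<rfloor> + m i (frac z)"
proof -
 have "\<exists>q. continuous_on UNIV q \<and> (\<forall>z. rose_map m (petal i z) = petal i (q z)) \<and> q 0 = 0 \<and>
  (\<forall>z. q (z + 1) = q z + 1) \<and> (\<forall>z. q z = of_int \<lfloor>z\<rfloor> + m i (frac z))" if i: "i < r" for i
 proof -
  have fr: "frac z \<in> {0..1}" for z :: real using frac_ge_0[of z] frac_lt_1[of z] by simp
  have per: "petal i z = petal i (frac z)" for z by (simp add: petal_eq_iff frac_def)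
  have "rose_map m (petal i z) \<in> range (petal i)" for z
   using rose_map_petal[OF i fr[of z]] per[of z] by auto
  moreover have "rose_map m (Vert 0) = Vert 0" by (simp add: rose_map_def)
  ultimately obtain q d where q: "continuous_on UNIV q" "!!z. rose_map m (petal i z) = petal i (q z)" "q 0 = 0"
   "!!z. q (z + 1) = q z + d"
   using lift_self_map[OF continuous_map_rose_map _ i] by blast
  have eq: "q t = m i t" if t: "t \<in> {0..1}" for t
  proof -
   have "q t - q 0 = m i t - m i 0"
   proof (rule lift_unique[OF connected_unit(1) continuous_on_subset[OF q(1)] cont[OF i]])
    fix t :: real assume "t \<in> {0..1}"
    then have "petal i (q t) = petal i (m i t)" using q(2)[of t] rose_map_petal[OF i] by simp
    then show "q t - m i t \<in> \<int>" by (simp add: petal_eq_iff)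
   qed (use t in auto)
   then show ?thesis using q(3) m0[OF i] by simp
  qed
  have "d = 1" using q(4)[of 0] eq[of 1] m1[OF i] q(3) by simp
  then have per1: "q (z + 1) = q z + 1" for z using q(4) by simp
  have "q z = of_int \<lfloor>z\<rfloor> + m i (frac z)" for z
   using periodic_add_int[of q "frac z" "\<lfloor>z\<rfloor>", OF per1] eq[OF fr[of z]] by (simp add: frac_def)
  with q per1 show ?thesis by blast
 qed
 then obtain q where "!!i. i < r ==> continuous_on UNIV (q i) \<and> (\<forall>z. rose_map m (petal i z) = petal i (q i z)) \<and> q i 0 = 0 \<and>
  (\<forall>z. q i (z + 1) = q i z + 1) \<and> (\<forall>z. q i z = of_int \<lfloor>z\<rfloor> + m i (frac z))" by metis
 then show ?thesis using that by blast
qed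

end

lemma rose_map_Vert [simp]: "rose_map m (Vert v) = Vert 0"
 by (simp add: rose_map_def)

lemma Fmap_compose_rose_map:
 assumes "rose_self_map (n + k) m"
 shows "homotopic_rel_circles True n k (rose (n + k)) (rose_map m \<circ> Fmap n k x)
  (Fmap n k (%j. if j < k then of_int \<lfloor>x j\<rfloor> + m (n + j) (frac (x j)) else x j))"
proof -
 obtain q where q: "!!i. i < n + k ==> continuous_on UNIV (q i)"
  "!!i z. i < n + k ==> rose_map m (petal i z) = petal i (q i z)" "!!i. i < n + k ==> q i 0 = 0"
  "!!i z. i < n + k ==> q i (z + 1) = q i z + (1::real)"
  "!!i z. i < n + k ==> q i z = of_int \<lfloor>z\<rfloor> + m i (frac z)"
  using rose_self_map.lifts[OF assms] by blast
 have "homotopic_rel_circles True n k (rose (n + k)) (rose_map m \<circ> Fmap n k x) (Fmap n k (%j. q (n + j) (x j)))"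
  by (rule Fmap_compose_self_map) (use q in auto)
 then show ?thesis
 proof (rule htpy_rel_eq)
  fix y assume "y \<in> points (Gnk n k)"
  then show "Fmap n k (%j. if j < k then of_int \<lfloor>x j\<rfloor> + m (n + j) (frac (x j)) else x j) y
    = Fmap n k (%j. q (n + j) (x j)) y"
   by (intro Fmap_cong) (use q(5) in auto)
 qed simp
qed

text \<open>Two points in the interior of the unit interval are exchanged by a fractional linear map
  fixing 0 and 1. Using such a map on each petal moves all coordinates at once without leaving their
  cells.\<close>

lemma rose_homeomorphism_of_same_cell:
 assumes cells: "!!j. j < k ==> same_cell (x j) (y j)"
 obtains \<theta> where "homeomorphic_map (space_of (rose (n + k))) (space_of (rose (n + k))) \<theta>" "\<theta> (Vert 0) = Vert 0"
  "homotopic_rel_circles True n k (rose (n + k)) (\<theta> \<circ> Fmap n k x) (Fmap n k y)"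
  "!!j. j < k ==> \<theta> (petal (n + j) (x j)) = petal (n + j) (y j)"
proof -
 let ?R = "rose (n + k)"
 \<comment> \<open>This map multiplies the odds \<open>t / (1 - t)\<close> by \<open>c\<close>;
   hence its inverse is the same map with \<open>1 / c\<close>.\<close>
 define \<mu> where "\<mu> c t = c * t / (c * t + (1 - t))" for c t :: real
 have den: "c * t + (1 - t) > 0" if "c > 0" "t \<in> {0..1}" for c t :: real
  using that by (cases "t = 0") (auto intro!: add_pos_nonneg)
 have \<mu>01: "\<mu> c t \<in> {0..1}" if "c > 0" "t \<in> {0..1}" for c t
  using den[OF that] that by (auto simp: \<mu>_def divide_simps)
 have inv: "\<mu> (1 / c) (\<mu> c t) = t" if "c > 0" "t \<in> {0..1}" for c t
 proof -
  let ?D = "c * t + (1 - t)"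
  have D: "?D > 0" by (rule den[OF that])
  have "1 / c * (c * t / ?D) = t / ?D" using that by simp
  moreover have "1 - c * t / ?D = (1 - t) / ?D" using D by (simp add: field_simps)
  ultimately have "\<mu> (1 / c) (\<mu> c t) = (t / ?D) / (t / ?D + (1 - t) / ?D)" by (simp only: \<mu>_def)
  also have "\<dots> = (t / ?D) / (1 / ?D)" by (simp only: add_divide_distrib[symmetric]) simp
  also have "\<dots> = t" using D by simp
  finally show ?thesis .
 qed
 \<comment> \<open>The quotient of the odds of the two fractional parts. Where no point has to be
   moved, \<open>c i = 1\<close> makes the profile the identity.\<close>
 define c where "c i = (if n \<le> i \<and> x (i - n) \<notin> \<int>
  then frac (y (i - n)) * (1 - frac (x (i - n))) / (frac (x (i - n)) * (1 - frac (y (i - n)))) else 1)" for i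
 have c: "c i > 0" if "i < n + k" for i
 proof (cases "n \<le> i \<and> x (i - n) \<notin> \<int>")
  case True
  then have "i - n < k" using that by linarith
  then have "y (i - n) \<notin> \<int>" using cells True by (auto simp: same_cell_def)
  then show ?thesis using True frac_lt_1[of "x (i - n)"] frac_lt_1[of "y (i - n)"]
   by (simp add: c_def frac_gt_0_iff)
 qed (auto simp: c_def)
 have sm: "rose_self_map (n + k) (%i. \<mu> (d i))" if d: "!!i. i < n + k ==> d i > 0" for d
 proof
  fix i assume i: "i < n + k"
  show "continuous_on {0..1} (\<mu> (d i))"
   unfolding \<mu>_def[abs_def] using den[OF d[OF i]] by (intro continuous_intros) force
  show "\<mu> (d i) 0 = 0" by (simp add: \<mu>_def)
  show "\<mu> (d i) 1 = 1" using d[OF i] by (simp add: \<mu>_def)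
 qed
 have c': "1 / c i > 0" if "i < n + k" for i using c[OF that] by simp
 have smc: "rose_self_map (n + k) (%i. \<mu> (c i))" by (rule sm) (rule c)
 have smc': "rose_self_map (n + k) (%i. \<mu> (1 / c i))" by (rule sm) (rule c')
 let ?\<theta> = "rose_map (%i. \<mu> (c i))" and ?\<theta>' = "rose_map (%i. \<mu> (1 / c i))"
 have "homeomorphic_maps (space_of ?R) (space_of ?R) ?\<theta> ?\<theta>'"
  unfolding homeomorphic_maps_def
 proof (intro conjI ballI)
  show "continuous_map (space_of ?R) (space_of ?R) ?\<theta>" "continuous_map (space_of ?R) (space_of ?R) ?\<theta>'"
   using rose_self_map.continuous_map_rose_map[OF smc] rose_self_map.continuous_map_rose_map[OF smc'] by auto
  fix z assume "z \<in> topspace (space_of ?R)"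
  then have z: "z \<in> points ?R" by simp
  from z show "?\<theta>' (?\<theta> z) = z"
  proof (cases rule: rose_point_cases)
   case (2 i t)
   then have t: "t \<in> {0..1}" by simp
   show ?thesis using 2 rose_self_map.rose_map_petal[OF smc \<open>i < n + k\<close> t]
     rose_self_map.rose_map_petal[OF smc' \<open>i < n + k\<close> \<mu>01[OF c[OF \<open>i < n + k\<close>] t]] inv[OF c t] by simp
  qed simp
  from z show "?\<theta> (?\<theta>' z) = z"
  proof (cases rule: rose_point_cases)
   case (2 i t)
   then have t: "t \<in> {0..1}" by simp
   show ?thesis using 2 rose_self_map.rose_map_petal[OF smc' \<open>i < n + k\<close> t]
     rose_self_map.rose_map_petal[OF smc \<open>i < n + k\<close> \<mu>01[OF c'[OF \<open>i < n + k\<close>] t]] inv[OF c' t, of i] by simp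
  qed simp
 qed
 then have 1: "homeomorphic_map (space_of ?R) (space_of ?R) ?\<theta>" using homeomorphic_maps_map by blast
 have val: "\<mu> (c (n + j)) (frac (x j)) = frac (y j)" if j: "j < k" for j
 proof (cases "x j \<in> \<int>")
  case True
  then have "y j \<in> \<int>" using cells[OF j] by (simp add: same_cell_def)
  then have fr: "frac (x j) = 0" "frac (y j) = 0" using True by simp_all
  show ?thesis unfolding fr by (simp add: \<mu>_def)
 next
  case False
  then have "y j \<notin> \<int>" using cells[OF j] by (simp add: same_cell_def)
  define a b where "a = frac (x j)" and "b = frac (y j)"
  have ab: "0 < a" "a < 1" "0 < b" "b < 1"
   using False \<open>y j \<notin> \<int>\<close> by (auto simp: a_def b_def frac_gt_0_iff frac_lt_1)
  have "c (n + j) * a = b * (1 - a) / (1 - b)" using False ab by (simp add: c_def a_def[symmetric] b_def[symmetric])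
  then have "\<mu> (c (n + j)) a = b * (1 - a) / (1 - b) / (b * (1 - a) / (1 - b) + (1 - a))" by (simp add: \<mu>_def)
  also have "b * (1 - a) / (1 - b) + (1 - a) = (1 - a) / (1 - b)" using ab by (simp add: field_simps)
  also have "b * (1 - a) / (1 - b) / ((1 - a) / (1 - b)) = b"
  proof -
   have "b * p / q / (p / q) = b" if "p \<noteq> 0" "q \<noteq> 0" for p q :: real using that by simp
   then show ?thesis using ab by simp
  qed
  finally show ?thesis by (simp add: a_def b_def)
 qed
 have val': "of_int \<lfloor>x j\<rfloor> + \<mu> (c (n + j)) (frac (x j)) = y j" if j: "j < k" for j
  unfolding val[OF j] using cells[OF j] by (simp add: same_cell_def frac_def)
 have 2: "homotopic_rel_circles True n k ?R (?\<theta> \<circ> Fmap n k x) (Fmap n k y)"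
 proof (rule htpy_rel_eq[OF Fmap_compose_rose_map[OF smc, where x = x]])
  fix z assume "z \<in> points (Gnk n k)"
  then show "Fmap n k y z = Fmap n k (%j. if j < k then of_int \<lfloor>x j\<rfloor> + \<mu> (c (n + j)) (frac (x j)) else x j) z"
   by (intro Fmap_cong) (use val' in auto)
 qed simp
 have 3: "?\<theta> (petal (n + j) (x j)) = petal (n + j) (y j)" if j: "j < k" for j
 proof -
  have "petal (n + j) (x j) = petal (n + j) (frac (x j))" "petal (n + j) (y j) = petal (n + j) (frac (y j))"
   by (simp_all add: petal_eq_iff frac_def)
  then show ?thesis
   using rose_self_map.rose_map_petal[OF smc, of "n + j" "frac (x j)"] val[OF j] j
    frac_ge_0[of "x j"] frac_lt_1[of "x j"] by simp
 qed
 show ?thesis by (rule that[OF 1 _ 2 3]) simp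
qed

section \<open>Subdivided roses\<close>

lemma cis_2pi_neq_1: "0 < t ==> t < 1 ==> cis (2 * pi * t) \<noteq> 1"
 using cis_2pi_eq_iff[of t 0] Ints_between_0_1[of t] by simp

lemma petal_range_iff:
 assumes "y \<in> points (rose r)" "i < r"
 shows "y \<in> range (petal i) \<longleftrightarrow> (\<forall>j<r. j \<noteq> i --> ang j y = 1)"
proof
 assume R: "\<forall>j<r. j \<noteq> i --> ang j y = 1"
 from assms(1) show "y \<in> range (petal i)"
 proof (cases rule: rose_point_cases)
  case 1
  then show ?thesis by (metis petal_0 rangeI)
 next
  case (2 j t)
  have "j = i"
  proof (rule ccontr)
   assume "j \<noteq> i"
   then have "ang j y = 1" using R 2 by blast
   then have "cis (2 * pi * t) = cis (2 * pi * 0)" using 2 by simp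
   then show False using Ints_between_0_1[OF 2(2,3)] unfolding cis_2pi_eq_iff by simp
  qed
  then show ?thesis using 2 by blast
 qed
qed auto

text \<open>The shape of all graphs in the fiber. Only the vertices are prescribed; the edges are
  recovered below as the arcs between consecutive vertices on a petal.\<close>

locale subdivided_rose =
 fixes n k :: nat and \<Gamma> :: pgraph and h :: "gpoint => gpoint" and x :: "nat => real"
 assumes fin\<Gamma>: "finite_graph \<Gamma>"
  and homeo: "homeomorphic_map (space_of \<Gamma>) (space_of (rose (n + k))) h"
  and h_base: "h (base_pt \<Gamma>) = Vert 0"
  and h_verts: "h ` Vert ` verts \<Gamma> = insert (Vert 0) ((%j. petal (n + j) (x j)) ` {..<k})"
begin

abbreviation "R \<equiv> rose (n + k)"

lemma top\<Gamma>: "topspace (space_of \<Gamma>) = points \<Gamma>"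
 by (rule topspace_space_of[OF fin\<Gamma>])

lemma cont_h: "continuous_map (space_of \<Gamma>) (space_of R) h"
 using homeo by (rule homeomorphic_imp_continuous_map)

lemma inj_h: "inj_on h (points \<Gamma>)"
 using homeomorphic_imp_injective_map[OF homeo] by (simp add: top\<Gamma>)

lemma surj_h: "h ` points \<Gamma> = points R"
 using homeomorphic_imp_surjective_map[OF homeo] by (simp add: top\<Gamma>)

text \<open>Parameters of the vertices on petal \<open>i\<close>. The base vertex contributes both 0
  and 1, and at most one further parameter occurs.\<close>

definition cut :: "nat => real set" where
 "cut i = {t \<in> {0..1}. petal i t \<in> h ` Vert ` verts \<Gamma>}"

lemma cut_iff:
 "t \<in> cut i \<longleftrightarrow> 0 \<le> t \<and> t \<le> 1 \<and> (t = 0 \<or> t = 1 \<or> (\<exists>j<k. i = n + j \<and> x j \<notin> \<int> \<and> t = frac (x j)))"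
proof -
 have int: "t \<in> \<int> \<longleftrightarrow> t = 0 \<or> t = 1" if "0 \<le> t" "t \<le> 1"
  using Ints_between_0_1[of t] that by (cases "t = 0"; cases "t = 1") auto
 have fr: "t - y \<in> \<int> \<longleftrightarrow> t = frac y" if "0 < t" "t < 1" for y
  unfolding frac_eq_iff_diff[symmetric] using that by (simp add: frac_eq)
 have v: "petal i t = petal (n + j) (x j) \<longleftrightarrow> (if i = n + j then t - x j \<in> \<int> else t \<in> \<int> \<and> x j \<in> \<int>)" for j
  by (cases "i = n + j") (simp_all add: petal_eq_iff petal_eq_petal_neq)
 show ?thesis
 proof (cases "0 \<le> t \<and> t \<le> 1")
  case True
  show ?thesis
  proof (cases "t = 0 \<or> t = 1")
   case True
   then have "petal i t = Vert 0" by auto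
   then show ?thesis using True by (auto simp: cut_def h_verts)
  next
   case False
   then have t: "0 < t" "t < 1" "t \<notin> \<int>" using True int by auto
   have "t = frac (x j) ==> x j \<notin> \<int>" for j using t(1) by auto
   then show ?thesis using t True False by (auto simp: cut_def h_verts v fr petal_eq_Vert_iff image_iff)
  qed
 qed (auto simp: cut_def)
qed

lemma cut_01: "0 \<in> cut i" "1 \<in> cut i"
 by (auto simp: cut_iff)

lemma cut_finite_cases:
 obtains "cut i = {0, 1}" | j where "j < k" "i = n + j" "x j \<notin> \<int>" "cut i = {0, frac (x j), 1}"
proof (cases "\<exists>j<k. i = n + j \<and> x j \<notin> \<int>")
 case True
 then obtain j where j: "j < k" "i = n + j" "x j \<notin> \<int>" by blast
 then have "cut i = {0, frac (x j), 1}"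
  using frac_lt_1[of "x j"] frac_ge_0[of "x j"] by (auto simp: cut_iff)
 with j show ?thesis by (rule that(2))
next
 case False
 then have "cut i = {0, 1}" by (auto simp: cut_iff)
 then show ?thesis by (rule that(1))
qed

text \<open>The parameter interval of an arc between consecutive vertices. Edges are matched with
  gaps bijectively.\<close>

definition gap :: "nat => real => real => bool" where
 "gap i a b \<longleftrightarrow> i < n + k \<and> a < b \<and> a \<in> cut i \<and> b \<in> cut i \<and> {a<..<b} \<inter> cut i = {}"

lemma gap_split:
 assumes "cut i = {0, s, 1}" "0 < s" "s < 1" "i < n + k"
 shows "gap i 0 s" "gap i s 1"
 using assms by (auto simp: gap_def)

lemma gap_bounds: "gap i a b ==> 0 \<le> a \<and> b \<le> 1"
 by (auto simp: gap_def cut_def)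

lemma gap_unique: "gap i a b ==> gap i a' b' ==> t \<in> {a<..<b} ==> t \<in> {a'<..<b'} ==> a = a' \<and> b = b'"
 unfolding gap_def by (metis IntI empty_iff greaterThanLessThan_iff less_trans linorder_neqE_linordered_idom)

lemma Inner_not_vertex: "0 < s ==> s < 1 ==> e \<in> edges \<Gamma> ==> h (Inner e s) \<notin> h ` Vert ` verts \<Gamma>"
 using inj_onD[OF inj_h] by fastforce

text \<open>An open edge contains no vertex, so its image avoids the base vertex and by
  connectedness stays in a single petal; there it lifts to the unit interval.\<close>

lemma edge_lift:
 assumes e: "e \<in> edges \<Gamma>"
 obtains i u where "i < n + k" "continuous_on {0..1} u" "!!s. s \<in> {0..1} ==> h (edge_pt \<Gamma> e s) = petal i (u s)"
  "!!s. s \<in> {0..1} ==> u s \<in> {0..1}" "!!s. s \<in> {0<..<1} ==> u s \<notin> cut i"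
proof -
 define p where "p s = h (edge_pt \<Gamma> e s)" for s
 have contp: "continuous_map I01 (space_of R) p"
  using continuous_map_compose[OF continuous_map_edge_pt[OF fin\<Gamma> e] cont_h] by (simp add: p_def[abs_def] o_def)
 have cang: "continuous_on {0..1} (%s. ang j (p s))" if "j < n + k" for j
  using contp that by (simp add: continuous_map_rose_iff)
 have pR: "p s \<in> points R" if "s \<in> {0..1}" for s
  using edge_pt_in_points[OF fin\<Gamma> e] surj_h by (auto simp: p_def)
 have nv: "p s \<notin> h ` Vert ` verts \<Gamma>" if "s \<in> {0<..<1}" for s
  using Inner_not_vertex[of s e] that e by (simp add: p_def)
 have pne: "p s \<noteq> Vert 0" if "s \<in> {0<..<1}" for s
  using nv[OF that] h_verts by auto
 have half: "p (1/2) \<in> points R" "p (1/2) \<noteq> Vert 0" using pR[of "1/2"] pne[of "1/2"] by auto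
 from half(1) obtain i t0 where i: "i < n + k" and t0: "0 < t0" "t0 < 1" "p (1/2) = petal i t0"
  by (cases rule: rose_point_cases) (use half(2) in auto)
 have single: "\<exists>i<n+k. ang i (p s) \<noteq> 1 \<and> (\<forall>j. j \<noteq> i --> ang j (p s) = 1)" if s: "s \<in> {0<..<1}" for s
 proof -
  have "p s \<in> points R" using pR s by auto
  then show ?thesis
  proof (cases rule: rose_point_cases)
   case (2 i t)
   have "ang i (p s) \<noteq> 1"
   proof
    assume "ang i (p s) = 1"
    then have "cis (2 * pi * t) = cis (2 * pi * 0)" using 2 by simp
    then show False using Ints_between_0_1[OF 2(2,3)] unfolding cis_2pi_eq_iff by simp
   qed
   then show ?thesis using 2 by auto
  qed (use pne[OF s] in simp)
 qed
 have other: "ang j (p s) = 1" if j: "j < n + k" "j \<noteq> i" and s: "s \<in> {0<..<1}" for j s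
 proof (rule ccontr)
  assume "ang j (p s) \<noteq> 1"
  \<comment> \<open>The times spent in the open petal \<open>i\<close> and in the other open petals.
    They are open, disjoint and cover the open interval, so they cannot both be nonempty; the
    midpoint lies in \<open>A\<close>.\<close>
  define A where "A = {0<..<1} \<inter> (%s. ang i (p s)) -` (- {1})"
  define B where "B = (\<Union>j\<in>{j. j < n + k \<and> j \<noteq> i}. {0<..<1} \<inter> (%s. ang j (p s)) -` (- {1}))"
  have op: "open ({0<..<1} \<inter> (%s. ang j (p s)) -` (- {1}))" if "j < n + k" for j
   by (rule continuous_open_preimage[OF continuous_on_subset[OF cang[OF that]]]) auto
  have "connected {0<..<1::real}" by simp
  moreover have "open A" using op[OF i] by (simp add: A_def)
  moreover have "open B" unfolding B_def by (intro open_UN ballI) (use op in auto)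
  moreover have "{0<..<1} \<subseteq> A \<union> B"
  proof
   fix s :: real assume "s \<in> {0<..<1}"
   with single[OF this] show "s \<in> A \<union> B" by (auto simp: A_def B_def)
  qed
  moreover have "A \<inter> B \<inter> {0<..<1} = {}"
  proof -
   have False if "s \<in> A" "s \<in> B" for s
    using that single[of s] unfolding A_def B_def by auto (metis)
   then show ?thesis by blast
  qed
  moreover have "1/2 \<in> A"
   using cis_2pi_neq_1[OF t0(1,2)] by (simp add: A_def t0(3))
  moreover have "s \<in> B" using j s \<open>ang j (p s) \<noteq> 1\<close> by (auto simp: B_def)
  moreover have "A \<subseteq> {0<..<1}" by (auto simp: A_def)
  ultimately show False
   using connectedD[of "{0<..<1::real}" A B] s by blast
 qed
 \<comment> \<open>The ends of the edge are reached by continuity on the closure of the open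
   interval.\<close>
 have other': "ang j (p s) = 1" if "j < n + k" "j \<noteq> i" "s \<in> {0..1}" for j s
  using continuous_constant_on_closure[of "{0<..<1}" "%s. ang j (p s)" 1 s] cang other that by simp
 have "p s \<in> range (petal i)" if "s \<in> {0..1}" for s
  using petal_range_iff[OF pR[OF that] i] other' that by blast
 then obtain u0 where u0: "continuous_on {0..1} u0" "!!s. s \<in> {0..1} ==> p s = petal i (u0 s)"
  using lift_petal[OF contp connected_unit(2) i] by blast
 \<comment> \<open>The integer is chosen so that the midpoint lands in the unit interval; since
   \<open>u\<close> takes no integral value inside the edge, the whole open edge then stays
   there.\<close>
 define u where "u s = u0 s - of_int \<lfloor>u0 (1/2)\<rfloor>" for s
 have u: "continuous_on {0..1} u" "!!s. s \<in> {0..1} ==> p s = petal i (u s)"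
  using u0 by (auto simp: u_def[abs_def] petal_eq_iff intro!: continuous_intros)
 have notint: "u s \<notin> \<int>" if "s \<in> {0<..<1}" for s
  using pne[OF that] u(2)[of s] that by (auto simp: petal_eq_Vert_iff)
 have uhalf: "u (1/2) \<in> {0..1}" by (simp add: u_def) linarith
 have conn: "connected (u ` {0<..<1})"
  by (rule connected_continuous_image[OF continuous_on_subset[OF u(1)]]) auto
 have open01: "0 < u s \<and> u s < 1" if s: "s \<in> {0<..<1}" for s
 proof (rule ccontr)
  assume "\<not> (0 < u s \<and> u s < 1)"
  moreover have "u s \<noteq> 0" "u s \<noteq> 1" using notint[OF s] by auto
  ultimately consider "u s < 0" | "1 < u s" by linarith
  then show False
  proof cases
   case 1
   have "{u s..u (1/2)} \<subseteq> u ` {0<..<1}" by (rule connected_contains_Icc[OF conn]) (use s in auto)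
   moreover have "0 \<in> {u s..u (1/2)}" using 1 uhalf by simp
   ultimately have "0 \<in> u ` {0<..<1}" by blast
   then show False using notint by (metis Ints_0 imageE)
  next
   case 2
   have "{u (1/2)..u s} \<subseteq> u ` {0<..<1}" by (rule connected_contains_Icc[OF conn]) (use s in auto)
   moreover have "1 \<in> {u (1/2)..u s}" using 2 uhalf by simp
   ultimately have "1 \<in> u ` {0<..<1}" by blast
   then show False using notint by (metis Ints_1 imageE)
  qed
 qed
 have closed01: "u s \<in> {0..1}" if "s \<in> {0..1}" for s
 proof -
  have "continuous_on (closure {0<..<1}) u" "s \<in> closure {0<..<1}" using u(1) that by simp_all
  then have "u s \<le> 1" "u s \<ge> 0"
   using continuous_le_on_closure[of "{0<..<1}" u s 1] continuous_ge_on_closure[of "{0<..<1}" u s 0] open01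
   by (auto intro: less_imp_le)
  then show ?thesis by simp
 qed
 have "u s \<notin> cut i" if "s \<in> {0<..<1}" for s
  using nv[OF that] u(2)[of s] that by (auto simp: cut_def)
 with u closed01 i show ?thesis by (intro that[of i u]) (auto simp: p_def)
qed

text \<open>By the intermediate value theorem the path covers everything between its ends, and
  leaving this range would require passing an end value, which is a cut point, at an interior
  time.\<close>

lemma gap_of_path:
 fixes u :: "real => real"
 assumes i: "i < n + k" and u: "continuous_on {0..1} u" "!!s. s \<in> {0<..<1} ==> u s \<notin> cut i"
  and less: "u 0 < u 1" and cut: "u 0 \<in> cut i" "u 1 \<in> cut i"
 shows "gap i (u 0) (u 1) \<and> u ` {0<..<1} = {u 0<..<u 1}"
proof -
 have sub: "{u 0<..<u 1} \<subseteq> u ` {0<..<1}"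
 proof
  fix y assume y: "y \<in> {u 0<..<u 1}"
  then obtain s where s: "0 \<le> s" "s \<le> 1" "u s = y" using IVT'[of u 0 y 1] u(1) by auto
  then have "s \<noteq> 0" "s \<noteq> 1" using y by auto
  then show "y \<in> u ` {0<..<1}" using s by auto
 qed
 moreover have "u ` {0<..<1} \<subseteq> {u 0<..<u 1}"
 proof
  fix y assume "y \<in> u ` {0<..<1}"
  then obtain s where s: "0 < s" "s < 1" "y = u s" by auto
  then have "y \<noteq> u 0" "y \<noteq> u 1" using u(2)[of s] cut by auto
  moreover have "\<not> y < u 0"
  proof
   assume "y < u 0"
   then obtain w where w: "s \<le> w" "w \<le> 1" "u w = u 0"
    using IVT'[of u s "u 0" 1] s less continuous_on_subset[OF u(1)] by auto
   then have "w \<noteq> 1" using less by auto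
   then show False using u(2)[of w] w s cut by auto
  qed
  moreover have "\<not> u 1 < y"
  proof
   assume "u 1 < y"
   then obtain w where w: "0 \<le> w" "w \<le> s" "u w = u 1"
    using IVT'[of u 0 "u 1" s] s less continuous_on_subset[OF u(1)] by auto
   then have "w \<noteq> 0" using less by auto
   then show False using u(2)[of w] w s cut by auto
  qed
  ultimately show "y \<in> {u 0<..<u 1}" by simp
 qed
 ultimately have eq: "u ` {0<..<1} = {u 0<..<u 1}" by blast
 moreover have "{u 0<..<u 1} \<inter> cut i = {}" unfolding eq[symmetric] using u(2) by blast
 ultimately show ?thesis using i less cut by (simp add: gap_def)
qed

definition edge_gap :: "nat => nat => real => real => bool" where
 "edge_gap e i a b \<longleftrightarrow> e \<in> edges \<Gamma> \<and> gap i a b \<and> h ` open_edge e = petal i ` {a<..<b} \<and>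
   (h (Vert (src \<Gamma> e)) = petal i a \<and> h (Vert (tgt \<Gamma> e)) = petal i b \<or>
   h (Vert (src \<Gamma> e)) = petal i b \<and> h (Vert (tgt \<Gamma> e)) = petal i a)"

lemma edge_gap_exists:
 assumes e: "e \<in> edges \<Gamma>"
 obtains i a b where "edge_gap e i a b"
proof -
 obtain i u where i: "i < n + k" and u: "continuous_on {0..1} u" "!!s. s \<in> {0..1} ==> h (edge_pt \<Gamma> e s) = petal i (u s)"
  "!!s. s \<in> {0..1} ==> u s \<in> {0..1}" "!!s. s \<in> {0<..<1} ==> u s \<notin> cut i"
  using edge_lift[OF e] by blast
 have ends: "h (Vert (src \<Gamma> e)) = petal i (u 0)" "h (Vert (tgt \<Gamma> e)) = petal i (u 1)"
  using u(2)[of 0] u(2)[of 1] by simp_all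
 have sv: "src \<Gamma> e \<in> verts \<Gamma>" "tgt \<Gamma> e \<in> verts \<Gamma>" using e fin\<Gamma> by (auto simp: finite_graph_def)
 have cut: "u 0 \<in> cut i" "u 1 \<in> cut i"
  unfolding cut_def using u(3)[of 0] u(3)[of 1] sv ends by (metis (mono_tags, lifting) atLeastAtMost_iff image_eqI
    mem_Collect_eq order_refl zero_le_one)+
 have img: "h ` open_edge e = petal i ` u ` {0<..<1}"
 proof -
  have "h ` open_edge e = (%s. h (edge_pt \<Gamma> e s)) ` {0<..<1}"
   unfolding open_edge_def image_image by (intro image_cong) auto
  also have "\<dots> = (%s. petal i (u s)) ` {0<..<1}" by (intro image_cong) (auto simp: u(2) simp del: edge_pt_simps)
  finally show ?thesis by (simp add: image_image)
 qed
 have inj: "s = s'" if "s \<in> {0<..<1}" "s' \<in> {0<..<1}" "u s = u s'" for s s'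
 proof -
  have "h (edge_pt \<Gamma> e s) = h (edge_pt \<Gamma> e s')" using u(2)[of s] u(2)[of s'] that by (simp del: edge_pt_simps)
  then have "h (Inner e s) = h (Inner e s')" using that by simp
  then show ?thesis using inj_onD[OF inj_h] e that by fastforce
 qed
 \<comment> \<open>With equal ends, the value \<open>d\<close> halfway between \<open>u 0\<close>
   and \<open>u (1/2)\<close> would be taken once in each half of the interval, against injectivity
   on the open edge.\<close>
 have ne: "u 0 \<noteq> u 1"
 proof
  assume eq: "u 0 = u 1"
  define d where "d = (u 0 + u (1/2)) / 2"
  have "u (1/2) \<noteq> u 0" using u(4)[of "1/2"] cut by auto
  have c: "continuous_on {0..1/2} u" "continuous_on {1/2..1} u" using continuous_on_subset[OF u(1)] by auto
  have "\<exists>s s'. 0 \<le> s \<and> s \<le> 1/2 \<and> u s = d \<and> 1/2 \<le> s' \<and> s' \<le> 1 \<and> u s' = d"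
  proof (cases "u 0 < u (1/2)")
   case True
   then have "u 0 \<le> d" "d \<le> u (1/2)" by (auto simp: d_def)
   then show ?thesis using IVT'[of u 0 d "1/2"] IVT2'[of u 1 d "1/2"] c eq by auto
  next
   case False
   then have "d \<le> u 0" "u (1/2) \<le> d" using \<open>u (1/2) \<noteq> u 0\<close> by (auto simp: d_def)
   then show ?thesis using IVT2'[of u "1/2" d 0] IVT'[of u "1/2" d 1] c eq by auto
  qed
  then obtain s s' where s: "0 \<le> s" "s \<le> 1/2" "u s = d" "1/2 \<le> s'" "s' \<le> 1" "u s' = d" by blast
  have "d \<noteq> u 0" "d \<noteq> u 1" "d \<noteq> u (1/2)" using \<open>u (1/2) \<noteq> u 0\<close> eq by (auto simp: d_def)
  then have "s \<noteq> 0" "s \<noteq> 1/2" "s' \<noteq> 1/2" "s' \<noteq> 1" using s by metis+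
  then show False using inj[of s s'] s by auto
 qed
 show ?thesis
 proof (cases "u 0 < u 1")
  case True
  then show ?thesis using gap_of_path[OF i u(1,4) True cut] ends img e
   by (intro that[of i "u 0" "u 1"]) (simp add: edge_gap_def)
 next
  case False
  define w where "w s = u (1 - s)" for s
  have "gap i (w 0) (w 1) \<and> w ` {0<..<1} = {w 0<..<w 1}"
  proof (rule gap_of_path[OF i])
   show "continuous_on {0..1} w" unfolding w_def[abs_def]
    by (rule continuous_on_compose2[OF u(1)]) (auto intro!: continuous_intros)
  qed (use u(4) False ne cut in \<open>auto simp: w_def\<close>)
  moreover have "w ` {0<..<1} = u ` {0<..<1}"
  proof -
   have "y \<in> (%s. 1 - s) ` {0<..<1}" if "y \<in> {0<..<1}" for y :: real
    using that by (intro image_eqI[of _ _ "1 - y"]) auto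
   then have "(%s::real. 1 - s) ` {0<..<1} = {0<..<1}" by auto
   then show ?thesis unfolding w_def[abs_def] by (metis image_image)
  qed
  ultimately show ?thesis using ends img e
   by (intro that[of i "u 1" "u 0"]) (simp add: edge_gap_def w_def)
 qed
qed

text \<open>The midpoint of the gap is not a vertex, hence lies on some open edge; two gaps with a
  common interior point coincide.\<close>

lemma edge_gap_exists':
 assumes g: "gap i a b"
 obtains e where "edge_gap e i a b"
proof -
 define t where "t = (a + b) / 2"
 have t: "t \<in> {a<..<b}" using g by (auto simp: t_def gap_def)
 then have t01: "0 < t" "t < 1" using gap_bounds[OF g] by auto
 have "petal i t \<in> points R" using g by (simp add: gap_def petal_in_points)
 then obtain y where y: "y \<in> points \<Gamma>" "h y = petal i t" using surj_h by (metis imageE)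
 have "t \<notin> cut i" using g t by (auto simp: gap_def)
 then have nv: "petal i t \<notin> h ` Vert ` verts \<Gamma>" using t01 by (auto simp: cut_def)
 from y(1) show ?thesis
 proof (cases rule: points_cases)
  case (1 v)
  then have "petal i t \<in> h ` Vert ` verts \<Gamma>" using y by (metis imageI)
  then show ?thesis using nv by contradiction
 next
  case (2 e s)
  obtain i' a' b' where e: "edge_gap e i' a' b'" using edge_gap_exists 2 by blast
  have "y \<in> open_edge e" using 2 by (auto simp: open_edge_def)
  then have "petal i t \<in> h ` open_edge e" unfolding y(2)[symmetric] by (rule imageI)
  then obtain t' where t': "t' \<in> {a'<..<b'}" "petal i t = petal i' t'" using e by (auto simp: edge_gap_def)
  have "0 < t'" "t' < 1" using t' e gap_bounds[of i' a' b'] by (auto simp: edge_gap_def)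
  then have "i' = i" "t' = t" using t'(2) t01 by (auto simp: petal_Inner)
  then have "a' = a \<and> b' = b" using gap_unique[of i a b a' b' t] g t t' e by (simp add: edge_gap_def)
  then show ?thesis using e that \<open>i' = i\<close> by blast
 qed
qed

lemma edge_gap_unique:
 assumes "edge_gap e i a b" "edge_gap e' i a b"
 shows "e = e'"
proof -
 have sub: "open_edge e \<subseteq> points \<Gamma>" "open_edge e' \<subseteq> points \<Gamma>"
  using assms by (auto simp: edge_gap_def open_edge_def)
 have "h ` open_edge e = h ` open_edge e'" using assms by (simp add: edge_gap_def)
 then have "open_edge e = open_edge e'" using inj_on_image_eq_iff[OF inj_h sub] by simp
 moreover have "Inner e (1/2) \<in> open_edge e" unfolding open_edge_def by (rule image_eqI[of _ _ "1/2"]) auto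
 ultimately show ?thesis by (auto simp: open_edge_def)
qed

lemma edge_gap_same_edge:
 assumes "edge_gap e i a b" "edge_gap e i' a' b'"
 shows "i = i' \<and> a = a' \<and> b = b'"
proof -
 define t where "t = (a + b) / 2"
 have t: "t \<in> {a<..<b}" using assms by (auto simp: t_def gap_def edge_gap_def)
 have g: "gap i a b" "gap i' a' b'" using assms by (auto simp: edge_gap_def)
 have "petal i t \<in> petal i' ` {a'<..<b'}" using assms t by (auto simp: edge_gap_def)
 then obtain t' where t': "t' \<in> {a'<..<b'}" "petal i t = petal i' t'" by auto
 have "0 < t'" "t' < 1" "0 < t" "t < 1" using t t' gap_bounds[OF g(1)] gap_bounds[OF g(2)] by auto
 then have "i' = i" "t' = t" using t'(2) by (auto simp: petal_Inner)
 then show ?thesis using gap_unique[of i a b a' b' t] g t t' by simp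
qed

section \<open>Valences in a subdivided rose\<close>

lemma valence_ge:
 assumes "finite E" "!!e. e \<in> E ==> e \<in> edges \<Gamma> \<and> (src \<Gamma> e = v \<or> tgt \<Gamma> e = v)"
 shows "card E \<le> valence \<Gamma> v"
proof -
 let ?A = "{e \<in> edges \<Gamma>. src \<Gamma> e = v}" and ?B = "{e \<in> edges \<Gamma>. tgt \<Gamma> e = v}"
 have fin: "finite ?A" "finite ?B" using fin\<Gamma> by (auto simp: finite_graph_def)
 have "card E \<le> card (?A \<union> ?B)" by (rule card_mono) (use fin assms in auto)
 also have "\<dots> \<le> card ?A + card ?B" by (rule card_Un_le)
 finally show ?thesis by (simp add: valence_def)
qed

lemma vertex_cases:
 assumes v: "v \<in> verts \<Gamma>" "v \<noteq> base \<Gamma>"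
 obtains j where "j < k" "x j \<notin> \<int>" "h (Vert v) = petal (n + j) (frac (x j))" "0 < frac (x j)" "frac (x j) < 1"
  "cut (n + j) = {0, frac (x j), 1}"
proof -
 have bV: "base \<Gamma> \<in> verts \<Gamma>" using fin\<Gamma> by (simp add: finite_graph_def)
 have "h (Vert v) \<noteq> Vert 0"
 proof
  assume "h (Vert v) = Vert 0"
  then have "Vert v = base_pt \<Gamma>" using inj_onD[OF inj_h, of "Vert v" "base_pt \<Gamma>"] h_base v bV by (simp add: base_pt_def)
  then show False using v by (simp add: base_pt_def)
 qed
 moreover have "h (Vert v) \<in> insert (Vert 0) ((%j. petal (n + j) (x j)) ` {..<k})" using h_verts v by blast
 ultimately obtain j where j: "j < k" "h (Vert v) = petal (n + j) (x j)" by auto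
 then have nint: "x j \<notin> \<int>" using \<open>h (Vert v) \<noteq> Vert 0\<close> petal_Ints[of "x j" "n + j"] by auto
 then have fr: "0 < frac (x j)" "frac (x j) < 1" by (auto simp: frac_gt_0_iff frac_lt_1)
 have "cut (n + j) = {0, frac (x j), 1}"
 proof (rule cut_finite_cases[of "n + j"])
  assume c: "cut (n + j) = {0, 1}"
  have "frac (x j) \<in> cut (n + j)" using j nint fr by (auto simp: cut_iff)
  then show ?thesis using c fr by auto
 next
  fix j' assume "n + j = n + j'" "cut (n + j) = {0, frac (x j'), 1}"
  then show ?thesis by simp
 qed
 moreover have "petal (n + j) (x j) = petal (n + j) (frac (x j))" by (simp add: petal_eq_iff frac_def)
 ultimately show ?thesis using that j nint fr by metis
qed

text \<open>Such a vertex is the middle cut point of its petal, so exactly the two gaps of this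
  petal end there, and each of their edges has its other end at the base vertex.\<close>

lemma valence_nonbase:
 assumes v: "v \<in> verts \<Gamma>" "v \<noteq> base \<Gamma>"
 shows "valence \<Gamma> v = 2"
proof -
 obtain j where j: "j < k" "x j \<notin> \<int>" "h (Vert v) = petal (n + j) (frac (x j))" "0 < frac (x j)" "frac (x j) < 1"
  "cut (n + j) = {0, frac (x j), 1}" by (rule vertex_cases[OF v])
 let ?i = "n + j" and ?s = "frac (x j)"
 have g: "gap ?i 0 ?s" "gap ?i ?s 1" using gap_split[OF j(6,4,5)] j(1) by simp_all
 obtain e1 e2 where e1: "edge_gap e1 ?i 0 ?s" and e2: "edge_gap e2 ?i ?s 1"
  using edge_gap_exists'[OF g(1)] edge_gap_exists'[OF g(2)] by metis
 have ne: "e1 \<noteq> e2" using edge_gap_same_edge[of e1 ?i 0 ?s ?i ?s 1] e1 e2 j by auto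
 have hV: "h (Vert w) = petal ?i ?s \<longleftrightarrow> w = v" if "w \<in> verts \<Gamma>" for w
  using inj_onD[OF inj_h, of "Vert w" "Vert v"] that v j(3) by auto
 have sv: "src \<Gamma> e \<in> verts \<Gamma>" "tgt \<Gamma> e \<in> verts \<Gamma>" if "e \<in> edges \<Gamma>" for e
  using that fin\<Gamma> by (auto simp: finite_graph_def)
 have V0: "petal ?i ?s \<noteq> Vert 0" using j Ints_between_0_1[of ?s] by (simp add: petal_eq_Vert_iff)
 have E: "e1 \<in> edges \<Gamma>" "e2 \<in> edges \<Gamma>" using e1 e2 by (auto simp: edge_gap_def)
 have ends: "(src \<Gamma> e1 = v) \<noteq> (tgt \<Gamma> e1 = v)" "(src \<Gamma> e2 = v) \<noteq> (tgt \<Gamma> e2 = v)"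
  unfolding hV[OF sv(1)[OF E(1)], symmetric] hV[OF sv(2)[OF E(1)], symmetric]
   hV[OF sv(1)[OF E(2)], symmetric] hV[OF sv(2)[OF E(2)], symmetric]
  using e1 e2 V0 by (auto simp: edge_gap_def)
 have only: "e = e1 \<or> e = e2" if e: "e \<in> edges \<Gamma>" "src \<Gamma> e = v \<or> tgt \<Gamma> e = v" for e
 proof -
  obtain i a b where g: "edge_gap e i a b" using edge_gap_exists[OF e(1)] by blast
  then have ab: "a \<in> cut i" "b \<in> cut i" "{a<..<b} \<inter> cut i = {}" "a < b" by (auto simp: edge_gap_def gap_def)
  then have ab01: "0 \<le> a" "a \<le> 1" "0 \<le> b" "b \<le> 1" by (auto simp: cut_def)
  have "petal i a = petal ?i ?s \<or> petal i b = petal ?i ?s" using g e(2) j(3) by (auto simp: edge_gap_def)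
  then have "i = ?i"
   using petal_eq_petal_neq[of i ?i a ?s] petal_eq_petal_neq[of i ?i b ?s] Ints_between_0_1[OF j(4,5)] by auto
  have "a = ?s \<or> b = ?s"
  proof -
   have val: "t = ?s" if "petal i t = petal ?i ?s" "0 \<le> t" "t \<le> 1" for t
   proof -
    have "t \<noteq> 0" "t \<noteq> 1" using that V0 by auto
    then have "0 < t" "t < 1" using that by auto
    then show ?thesis using that(1) j by (simp add: petal_Inner)
   qed
   then show ?thesis using \<open>petal i a = petal ?i ?s \<or> petal i b = petal ?i ?s\<close> ab01 by blast
  qed
  then show ?thesis
  proof
   assume a: "a = ?s"
   then have "b = 1" using ab j \<open>i = ?i\<close> by auto
   then show ?thesis using edge_gap_unique[of e ?i ?s 1 e2] g e2 a \<open>i = ?i\<close> by simp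
  next
   assume b: "b = ?s"
   then have "a = 0" using ab j \<open>i = ?i\<close> by auto
   then show ?thesis using edge_gap_unique[of e ?i 0 ?s e1] g e1 b \<open>i = ?i\<close> by simp
  qed
 qed
 let ?A = "{e \<in> edges \<Gamma>. src \<Gamma> e = v}" and ?B = "{e \<in> edges \<Gamma>. tgt \<Gamma> e = v}"
 have "?A \<union> ?B = {e1, e2}" using only ends E by auto
 moreover have "?A \<inter> ?B = {}" using only ends by auto
 moreover have "finite ?A" "finite ?B" using fin\<Gamma> by (auto simp: finite_graph_def)
 ultimately have "card ?A + card ?B = card {e1, e2}" using card_Un_disjoint[of ?A ?B] by simp
 then show ?thesis using ne by (simp add: valence_def)
qed

text \<open>Petal 0 alone supplies two ends: either it is one loop, counted at its start and at its
  end, or it consists of two edges that both meet the base vertex.\<close>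

lemma valence_base:
 assumes "n + k \<ge> 1"
 shows "valence \<Gamma> (base \<Gamma>) \<ge> 2"
proof -
 have bV: "base \<Gamma> \<in> verts \<Gamma>" using fin\<Gamma> by (simp add: finite_graph_def)
 have hV: "h (Vert w) = Vert 0 \<longleftrightarrow> w = base \<Gamma>" if "w \<in> verts \<Gamma>" for w
  using inj_onD[OF inj_h, of "Vert w" "Vert (base \<Gamma>)"] that bV h_base by (auto simp: base_pt_def)
 have sv: "src \<Gamma> e \<in> verts \<Gamma>" "tgt \<Gamma> e \<in> verts \<Gamma>" if "e \<in> edges \<Gamma>" for e
  using that fin\<Gamma> by (auto simp: finite_graph_def)
 show ?thesis
 proof (rule cut_finite_cases[of 0])
  assume "cut 0 = {0, 1}"
  then have "gap 0 0 1" using assms by (auto simp: gap_def)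
  then obtain e where e: "edge_gap e 0 0 1" using edge_gap_exists' by blast
  then have E: "e \<in> edges \<Gamma>" "src \<Gamma> e = base \<Gamma>" "tgt \<Gamma> e = base \<Gamma>"
   using hV[OF sv(1)] hV[OF sv(2)] by (auto simp: edge_gap_def)
  let ?A = "{e \<in> edges \<Gamma>. src \<Gamma> e = base \<Gamma>}" and ?B = "{e \<in> edges \<Gamma>. tgt \<Gamma> e = base \<Gamma>}"
  have "finite ?A" "finite ?B" using fin\<Gamma> by (auto simp: finite_graph_def)
  then have "card ?A > 0" "card ?B > 0" using E card_gt_0_iff by blast+
  then show ?thesis by (simp add: valence_def)
 next
  fix j assume j: "j < k" "0 = n + j" "x j \<notin> \<int>" and c: "cut 0 = {0, frac (x j), 1}"
  have fr: "0 < frac (x j)" "frac (x j) < 1" using j by (auto simp: frac_gt_0_iff frac_lt_1)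
  have "gap 0 0 (frac (x j))" "gap 0 (frac (x j)) 1"
   using gap_split[OF c fr] assms by (metis One_nat_def Suc_le_eq)+
  then obtain e1 e2 where e1: "edge_gap e1 0 0 (frac (x j))" and e2: "edge_gap e2 0 (frac (x j)) 1"
   using edge_gap_exists' by metis
  have ne: "e1 \<noteq> e2" using edge_gap_same_edge[of e1 0 0 "frac (x j)" 0 "frac (x j)" 1] e1 e2 fr by auto
  have "card {e1, e2} \<le> valence \<Gamma> (base \<Gamma>)"
   by (rule valence_ge) (use e1 e2 hV[OF sv(1)] hV[OF sv(2)] in \<open>auto simp: edge_gap_def\<close>)
  then show ?thesis using ne by simp
 qed
qed

end

section \<open>Path homotopies and the fundamental group\<close>

text \<open>For loops this is the relation behind \<open>loop_class\<close>. It is needed for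
  arbitrary paths because loops will be cut into pieces that are not closed.\<close>

definition path_htpy :: "'a topology => (real => 'a) => (real => 'a) => bool" where
 "path_htpy X p q \<longleftrightarrow> homotopic_with (%r. r 0 = p 0 \<and> r 1 = p 1) I01 X p q"

lemma path_htpy_imp:
 assumes "path_htpy X p q"
 shows "pathin X p" "pathin X q" "q 0 = p 0" "q 1 = p 1"
proof -
 note h = assms[unfolded path_htpy_def]
 show "pathin X p" "pathin X q" using homotopic_with_imp_continuous_maps[OF h] by (simp_all add: pathin_def)
 show "q 0 = p 0" "q 1 = p 1" using homotopic_with_imp_property[OF h] by simp_all
qed

lemma path_htpy_refl: "pathin X p ==> path_htpy X p p"
 by (simp add: path_htpy_def pathin_def)

lemma path_htpy_sym: "path_htpy X p q ==> path_htpy X q p"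
proof -
 assume "path_htpy X p q"
 then show ?thesis
  using homotopic_with_symD path_htpy_imp(3,4)[of X p q] by (simp add: path_htpy_def) blast
qed

lemma path_htpy_trans [trans]: "path_htpy X p q ==> path_htpy X q r ==> path_htpy X p r"
proof -
 assume "path_htpy X p q" "path_htpy X q r"
 then show ?thesis
  using homotopic_with_trans path_htpy_imp(3,4)[of X p q] by (simp add: path_htpy_def) blast
qed

lemma subtopology_top_of_set_Collect:
 "subtopology (top_of_set A) {x \<in> topspace (top_of_set A). P x} = top_of_set {x \<in> A. P x}"
proof -
 have "A \<inter> {x \<in> A. P x} = {x \<in> A. P x}" by blast
 then show ?thesis by (simp add: subtopology_subtopology)
qed

lemma path_htpyI:
 fixes K :: "real => real => 'a"
 assumes "continuous_map (top_of_set ({0..1} \<times> {0..1})) X (%(t, s). K t s)"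
  and "!!s. s \<in> {0..1} ==> K 0 s = p s" "!!s. s \<in> {0..1} ==> K 1 s = q s"
  and "!!t. t \<in> {0..1} ==> K t 0 = p 0" "!!t. t \<in> {0..1} ==> K t 1 = p 1"
 shows "path_htpy X p q"
 unfolding path_htpy_def
proof (rule homotopic_withI)
 show "continuous_map (prod_topology I01 I01) X (%(t, s). K t s)"
  using assms(1) by (simp add: prod_topology_subtopology_eu)
qed (use assms in auto)

text \<open>Two paths that factor through one map on a convex set can be deformed linearly in that
  set. Reparametrizations, straightening in the cover of a petal, and contractions over a square are
  all instances.\<close>

lemma path_htpy_convex:
 fixes u v :: "real => 'b::real_normed_vector"
 assumes C: "convex C" and P: "continuous_map (top_of_set C) X P"
  and u: "continuous_on {0..1} u" "u ` {0..1} \<subseteq> C" and v: "continuous_on {0..1} v" "v ` {0..1} \<subseteq> C"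
  and "u 0 = v 0" "u 1 = v 1"
  and p: "!!s. s \<in> {0..1} ==> p s = P (u s)" and q: "!!s. s \<in> {0..1} ==> q s = P (v s)"
 shows "path_htpy X p q"
proof (rule path_htpyI[where K = "%t s. P ((1 - t) *\<^sub>R u s + t *\<^sub>R v s)"])
 have in_C: "(1 - t) *\<^sub>R u s + t *\<^sub>R v s \<in> C" if "t \<in> {0..1}" "s \<in> {0..1}" for t s
  by (rule convexD[OF C]) (use u v that in auto)
 have cu: "continuous_on ({0..1} \<times> {0..1}) (%z::real\<times>real. u (snd z))"
  by (rule continuous_on_compose2[OF u(1)]) (auto intro!: continuous_intros)
 have cv: "continuous_on ({0..1} \<times> {0..1}) (%z::real\<times>real. v (snd z))"
  by (rule continuous_on_compose2[OF v(1)]) (auto intro!: continuous_intros)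
 have "continuous_map (top_of_set ({0..1} \<times> {0..1})) (top_of_set C) (%z. (1 - fst z) *\<^sub>R u (snd z) + fst z *\<^sub>R v (snd z))"
  unfolding continuous_map_subtopology_eu using in_C
  by (auto intro!: continuous_intros cu cv)
 from continuous_map_compose[OF this P]
 show "continuous_map (top_of_set ({0..1} \<times> {0..1})) X (%(t, s). P ((1 - t) *\<^sub>R u s + t *\<^sub>R v s))"
  by (simp add: o_def case_prod_unfold)
 have self: "(1 - t) *\<^sub>R a + t *\<^sub>R a = a" for t and a :: 'b by (simp add: algebra_simps)
 fix t :: real
 show "P ((1 - t) *\<^sub>R u 0 + t *\<^sub>R v 0) = p 0" "P ((1 - t) *\<^sub>R u 1 + t *\<^sub>R v 1) = p 1"
  using assms by (simp_all add: self)
qed (use p q in auto)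

lemma path_htpy_reparam:
 assumes "pathin X g" "continuous_on {0..1} u" "u ` {0..1} \<subseteq> {0..1}" "continuous_on {0..1} v" "v ` {0..1} \<subseteq> {0..1}"
  and "u 0 = v 0" "u 1 = v 1"
  and "!!s. s \<in> {0..1} ==> p s = g (u s)" "!!s. s \<in> {0..1} ==> q s = g (v s)"
 shows "path_htpy X p q"
 using assms unfolding pathin_def by (intro path_htpy_convex[of "{0..1}" X g u v]) auto

lemma path_htpy_eq:
 assumes "pathin X p" "!!s. s \<in> {0..1} ==> q s = p s"
 shows "path_htpy X p q"
 by (rule path_htpy_reparam[OF assms(1), of "%s. s" "%s. s"]) (use assms(2) in auto)

lemma pathin_concat:
 assumes "pathin X p" "pathin X q" "p 1 = q 0"
 shows "pathin X (loop_concat p q)"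
 unfolding pathin_def loop_concat_def[abs_def]
proof (rule continuous_map_cases_le)
 have 1: "continuous_map (top_of_set {x \<in> {0..1}. x \<le> 1/2}) I01 (%x. 2 * x)"
  by (auto simp: continuous_map_subtopology_eu intro!: continuous_intros)
 have 2: "continuous_map (top_of_set {x \<in> {0..1}. 1/2 \<le> x}) I01 (%x. 2 * x - 1)"
  by (auto simp: continuous_map_subtopology_eu intro!: continuous_intros)
 show "continuous_map (subtopology I01 {x \<in> topspace I01. x \<le> 1/2}) X (%t. p (2 * t))"
  unfolding subtopology_top_of_set_Collect using continuous_map_compose[OF 1 assms(1)[unfolded pathin_def]] by (simp add: o_def)
 show "continuous_map (subtopology I01 {x \<in> topspace I01. 1/2 \<le> x}) X (%t. q (2 * t - 1))"
  unfolding subtopology_top_of_set_Collect using continuous_map_compose[OF 2 assms(2)[unfolded pathin_def]] by (simp add: o_def)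
 fix s :: real assume "s = 1/2"
 then have "2 * s = 1" "2 * s - 1 = 0" by auto
 then show "p (2 * s) = q (2 * s - 1)" using assms(3) by (simp only:)
qed auto

lemma loop_concat_ends [simp]: "loop_concat p q 0 = p 0" "loop_concat p q 1 = q 1"
 by (auto simp: loop_concat_def)

lemma path_htpy_concat:
 assumes p: "path_htpy X p p'" and q: "path_htpy X q q'" and pq: "p 1 = q 0"
 shows "path_htpy X (loop_concat p q) (loop_concat p' q')"
proof -
 obtain K1 where K1: "continuous_map (prod_topology I01 I01) X K1" "!!s. K1 (0, s) = p s" "!!s. K1 (1, s) = p' s"
  "!!t. t \<in> {0..1} ==> K1 (t, 0) = p 0 \<and> K1 (t, 1) = p 1"
  using p unfolding path_htpy_def homotopic_with_def by blast
 obtain K2 where K2: "continuous_map (prod_topology I01 I01) X K2" "!!s. K2 (0, s) = q s" "!!s. K2 (1, s) = q' s"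
  "!!t. t \<in> {0..1} ==> K2 (t, 0) = q 0 \<and> K2 (t, 1) = q 1"
  using q unfolding path_htpy_def homotopic_with_def by blast
 let ?Q = "{0..1::real} \<times> {0..1::real}"
 show ?thesis
 proof (rule path_htpyI[where K = "%t s. if s \<le> 1/2 then K1 (t, 2 * s) else K2 (t, 2 * s - 1)"])
  have "continuous_map (top_of_set ?Q) X (%z. if snd z \<le> 1/2 then K1 (fst z, 2 * snd z) else K2 (fst z, 2 * snd z - 1))"
  proof (rule continuous_map_cases_le)
   have 1: "continuous_map (top_of_set {z \<in> ?Q. snd z \<le> 1/2}) (top_of_set ?Q) (%z. (fst z, 2 * snd z))"
    by (auto simp: continuous_map_subtopology_eu intro!: continuous_intros)
   have 2: "continuous_map (top_of_set {z \<in> ?Q. 1/2 \<le> snd z}) (top_of_set ?Q) (%z. (fst z, 2 * snd z - 1))"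
    by (auto simp: continuous_map_subtopology_eu intro!: continuous_intros)
   show "continuous_map (subtopology (top_of_set ?Q) {z \<in> topspace (top_of_set ?Q). snd z \<le> 1/2}) X (%z. K1 (fst z, 2 * snd z))"
    unfolding subtopology_top_of_set_Collect using continuous_map_compose[OF 1 K1(1)[simplified]] by (simp add: o_def)
   show "continuous_map (subtopology (top_of_set ?Q) {z \<in> topspace (top_of_set ?Q). 1/2 \<le> snd z}) X (%z. K2 (fst z, 2 * snd z - 1))"
    unfolding subtopology_top_of_set_Collect using continuous_map_compose[OF 2 K2(1)[simplified]] by (simp add: o_def)
   fix z assume "z \<in> topspace (top_of_set ?Q)" "snd z = 1/2"
   then obtain t where "t \<in> {0..1}" "z = (t, 1/2)" by (cases z) auto
   then show "K1 (fst z, 2 * snd z) = K2 (fst z, 2 * snd z - 1)" using K1(4)[of t] K2(4)[of t] pq by simp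
  qed (auto simp: continuous_map_subtopology_eu intro!: continuous_intros)
  then show "continuous_map (top_of_set ?Q) X (%(t, s). if s \<le> 1/2 then K1 (t, 2 * s) else K2 (t, 2 * s - 1))"
   by (simp add: case_prod_unfold)
 qed (use K1 K2 in \<open>auto simp: loop_concat_def\<close>)
qed

lemma path_htpy_assoc:
 assumes "pathin X p" "pathin X q" "pathin X r" "p 1 = q 0" "q 1 = r 0"
 shows "path_htpy X (loop_concat (loop_concat p q) r) (loop_concat p (loop_concat q r))"
\<comment> \<open>The piecewise linear change of time that sends the breakpoints 1/4 and 1/2 of the
  left bracketing to the breakpoints 1/2 and 3/4 of the right one.\<close>
proof (rule path_htpy_reparam[where g = "loop_concat p (loop_concat q r)" and v = "%s. s"
   and u = "%s. min (2 * s) (min (s + 1/4) ((s + 1) / 2))"])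
 show "pathin X (loop_concat p (loop_concat q r))" using assms by (intro pathin_concat) auto
 fix s :: real assume s: "s \<in> {0..1}"
 consider "s \<le> 1/4" | "1/4 < s" "s \<le> 1/2" | "1/2 < s" by linarith
 then show "loop_concat (loop_concat p q) r s = loop_concat p (loop_concat q r) (min (2 * s) (min (s + 1/4) ((s + 1) / 2)))"
 proof cases
  case 1
  then have "min (2 * s) (min (s + 1/4) ((s + 1) / 2)) = 2 * s" by auto
  then show ?thesis using 1 by (simp add: loop_concat_def)
 next
  case 2
  then have m: "min (2 * s) (min (s + 1/4) ((s + 1) / 2)) = s + 1/4" by auto
  have "2 * (2 * (s + 1/4) - 1) = 4 * s - 1" "2 * (2 * s) - 1 = 4 * s - 1" by auto
  then show ?thesis unfolding m using 2 by (simp add: loop_concat_def)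
 next
  case 3
  then have m: "min (2 * s) (min (s + 1/4) ((s + 1) / 2)) = (s + 1) / 2" by auto
  have "2 * ((s + 1) / 2) - 1 = s" by (simp add: field_simps)
  then show ?thesis unfolding m using 3 by (simp add: loop_concat_def)
 qed
qed (auto simp: min_le_iff_disj intro!: continuous_intros)

lemma path_htpy_unit_left:
 assumes "pathin X p" "c = p 0"
 shows "path_htpy X (loop_concat (%_. c) p) p"
proof (rule path_htpy_reparam[OF assms(1), of "%s. max 0 (2 * s - 1)" "%s. s"])
 fix s :: real
 show "loop_concat (%_. c) p s = p (max 0 (2 * s - 1))"
  by (cases "s \<le> 1/2") (simp_all add: loop_concat_def assms(2) max_absorb1 max_absorb2)
qed (auto intro!: continuous_intros)

lemma path_htpy_unit_right:
 assumes "pathin X p" "c = p 1"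
 shows "path_htpy X (loop_concat p (%_. c)) p"
proof (rule path_htpy_reparam[OF assms(1), of "%s. min 1 (2 * s)" "%s. s"])
 fix s :: real
 show "loop_concat p (%_. c) s = p (min 1 (2 * s))"
  by (cases "s \<le> 1/2") (simp_all add: loop_concat_def assms(2) min_absorb1 min_absorb2)
qed (auto intro!: continuous_intros)

definition rev_path :: "(real => 'a) => real => 'a" where
 "rev_path p s = p (1 - s)"

lemma rev_path_ends [simp]: "rev_path p 0 = p 1" "rev_path p 1 = p 0"
 by (simp_all add: rev_path_def)

lemma rev_path_rev_path [simp]: "rev_path (rev_path p) = p"
 by (simp add: rev_path_def fun_eq_iff)

lemma pathin_rev: "pathin X p ==> pathin X (rev_path p)"
proof -
 assume p: "pathin X p"
 have "continuous_map I01 I01 (%s. 1 - s)"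
  by (auto simp: continuous_map_subtopology_eu intro!: continuous_intros)
 from continuous_map_compose[OF this p[unfolded pathin_def]] show ?thesis
  by (simp add: pathin_def rev_path_def[abs_def] o_def)
qed

lemma path_htpy_rev_right:
 assumes "pathin X p"
 shows "path_htpy X (loop_concat p (rev_path p)) (%_. p 0)"
proof (rule path_htpy_reparam[OF assms, of "%s. min (2 * s) (2 - 2 * s)" "%s. 0"])
 fix s :: real assume "s \<in> {0..1}"
 show "loop_concat p (rev_path p) s = p (min (2 * s) (2 - 2 * s))"
  by (auto simp: loop_concat_def rev_path_def min_def)
qed (auto intro!: continuous_intros)

lemma path_htpy_rev_left:
 "pathin X p ==> path_htpy X (loop_concat (rev_path p) p) (%_. p 1)"
 using path_htpy_rev_right[OF pathin_rev, of X p] by simp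

lemma pathin_const: "x \<in> topspace X ==> pathin X (%_. x)"
 by (simp add: pathin_def)

lemma path_htpy_cancel_middle:
 assumes "pathin X p" "pathin X c" "pathin X q" "p 1 = c 1" "c 1 = q 0"
 shows "path_htpy X (loop_concat (loop_concat p (rev_path c)) (loop_concat c q)) (loop_concat p q)"
proof -
 note ps = assms pathin_rev[OF assms(2)]
 have "path_htpy X (loop_concat (loop_concat p (rev_path c)) (loop_concat c q))
   (loop_concat p (loop_concat (rev_path c) (loop_concat c q)))"
  by (rule path_htpy_assoc) (use ps in \<open>auto intro!: pathin_concat\<close>)
 also have "path_htpy X \<dots> (loop_concat p (loop_concat (loop_concat (rev_path c) c) q))"
  by (intro path_htpy_concat path_htpy_refl path_htpy_sym[OF path_htpy_assoc]) (use ps in auto)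
 also have "path_htpy X \<dots> (loop_concat p (loop_concat (%_. c 1) q))"
  by (intro path_htpy_concat path_htpy_refl path_htpy_rev_left) (use ps in auto)
 also have "path_htpy X \<dots> (loop_concat p q)"
  by (intro path_htpy_concat path_htpy_refl path_htpy_unit_left) (use ps in auto)
 finally show ?thesis .
qed

section \<open>The fundamental group and its rank\<close>

lemma mem_loop_class_iff:
 assumes "p \<in> loops X x"
 shows "q \<in> loop_class X x p \<longleftrightarrow> path_htpy X p q"
 using assms by (simp add: loop_class_def path_htpy_def loops_def)

lemma loop_class_eq_iff:
 assumes "p \<in> loops X x" "q \<in> loops X x"
 shows "loop_class X x p = loop_class X x q \<longleftrightarrow> path_htpy X p q"
proof
 assume "loop_class X x p = loop_class X x q"
 moreover have "q \<in> loop_class X x q"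
  using assms(2) by (simp add: mem_loop_class_iff path_htpy_refl) (simp add: loops_def path_htpy_refl)
 ultimately show "path_htpy X p q" using mem_loop_class_iff[OF assms(1)] by blast
next
 assume pq: "path_htpy X p q"
 show "loop_class X x p = loop_class X x q"
  using mem_loop_class_iff[OF assms(1)] mem_loop_class_iff[OF assms(2)] path_htpy_trans path_htpy_sym pq by blast
qed

lemma mem_loop_class_imp_loop:
 assumes "p \<in> loops X x" "q \<in> loop_class X x p"
 shows "q \<in> loops X x"
 using assms path_htpy_imp[of X p q] by (auto simp: mem_loop_class_iff loops_def)

lemma loop_self_class: "p \<in> loops X x ==> p \<in> loop_class X x p"
 by (simp add: mem_loop_class_iff) (simp add: loops_def path_htpy_refl)

lemma loops_concat: "p \<in> loops X x ==> q \<in> loops X x ==> loop_concat p q \<in> loops X x"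
 by (auto simp: loops_def intro!: pathin_concat)

text \<open>The union over all representatives in the definition of the product collapses to one
  class, since concatenation respects homotopy.\<close>

lemma pi1_mult:
 assumes "p \<in> loops X x" "q \<in> loops X x"
 shows "loop_class X x p \<otimes>\<^bsub>pi1 X x\<^esub> loop_class X x q = loop_class X x (loop_concat p q)"
proof -
 have "loop_class X x (loop_concat p' q') = loop_class X x (loop_concat p q)"
  if "p' \<in> loop_class X x p" "q' \<in> loop_class X x q" for p' q'
 proof -
  have *: "p' \<in> loops X x" "q' \<in> loops X x" "path_htpy X p p'" "path_htpy X q q'"
   using that mem_loop_class_imp_loop[OF assms(1)] mem_loop_class_imp_loop[OF assms(2)]
   by (simp_all add: mem_loop_class_iff assms)
  have "path_htpy X (loop_concat p q) (loop_concat p' q')"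
   using * assms by (intro path_htpy_concat) (auto simp: loops_def)
  then show ?thesis
   using loop_class_eq_iff[OF loops_concat[OF *(1,2)] loops_concat[OF assms]] path_htpy_sym by blast
 qed
 moreover have "loop_class X x p \<noteq> {}" "loop_class X x q \<noteq> {}" using loop_self_class assms by fast+
 moreover have "(\<Union>a\<in>A. \<Union>b\<in>B. f a b) = C" if "A \<noteq> {}" "B \<noteq> {}" "!!a b. a \<in> A ==> b \<in> B ==> f a b = C"
  for A B and f :: "(real => 'a) => (real => 'a) => (real => 'a) set" and C
  using that by auto
 ultimately show ?thesis by (simp add: pi1_def)
qed

lemma group_pi1:
 assumes "x \<in> topspace X" shows "group (pi1 X x)"
proof (rule groupI)
 let ?G = "pi1 X x" and ?c = "loop_class X x"
 have carr: "carrier ?G = ?c ` loops X x" and one: "\<one>\<^bsub>?G\<^esub> = ?c (%_. x)" by (simp_all add: pi1_def)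
 have constL: "(%_. x) \<in> loops X x" using assms by (simp add: loops_def pathin_const)
 show "\<one>\<^bsub>?G\<^esub> \<in> carrier ?G" using constL by (simp add: carr one)
 show "a \<otimes>\<^bsub>?G\<^esub> b \<in> carrier ?G" if "a \<in> carrier ?G" "b \<in> carrier ?G" for a b
  using that by (auto simp: carr pi1_mult intro: loops_concat)
 show "a \<otimes>\<^bsub>?G\<^esub> b \<otimes>\<^bsub>?G\<^esub> c = a \<otimes>\<^bsub>?G\<^esub> (b \<otimes>\<^bsub>?G\<^esub> c)"
  if abc: "a \<in> carrier ?G" "b \<in> carrier ?G" "c \<in> carrier ?G" for a b c
 proof -
  obtain p q r where "p \<in> loops X x" "q \<in> loops X x" "r \<in> loops X x" "a = ?c p" "b = ?c q" "c = ?c r"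
   using abc unfolding carr by blast
  then show ?thesis
   using path_htpy_assoc[of X p q r] by (simp add: pi1_mult loops_concat loop_class_eq_iff) (simp add: loops_def)
 qed
 show "\<one>\<^bsub>?G\<^esub> \<otimes>\<^bsub>?G\<^esub> a = a" if a: "a \<in> carrier ?G" for a
 proof -
  obtain p where "p \<in> loops X x" "a = ?c p" using a by (auto simp: carr)
  then show ?thesis
   using path_htpy_unit_left[of X p x] constL by (simp add: one pi1_mult loops_concat loop_class_eq_iff) (simp add: loops_def)
 qed
 show "\<exists>b\<in>carrier ?G. b \<otimes>\<^bsub>?G\<^esub> a = \<one>\<^bsub>?G\<^esub>" if a: "a \<in> carrier ?G" for a
 proof -
  obtain p where p: "p \<in> loops X x" "a = ?c p" using a by (auto simp: carr)
  then have "rev_path p \<in> loops X x" by (simp add: loops_def pathin_rev)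
  moreover from this have "?c (rev_path p) \<otimes>\<^bsub>?G\<^esub> a = \<one>\<^bsub>?G\<^esub>"
   using p path_htpy_rev_left[of X p] constL
   by (simp add: one pi1_mult loops_concat loop_class_eq_iff) (simp add: loops_def)
  ultimately show ?thesis by (auto simp: carr)
 qed
qed

lemma pi1_inv:
 assumes "p \<in> loops X x"
 shows "inv\<^bsub>pi1 X x\<^esub> (loop_class X x p) = loop_class X x (rev_path p)"
proof -
 have "x \<in> topspace X"
  using assms path_start_in_topspace[of X p] by (auto simp: loops_def)
 then interpret group "pi1 X x" by (rule group_pi1)
 have r: "rev_path p \<in> loops X x" using assms by (simp add: loops_def pathin_rev)
 have "(%_. x) \<in> loops X x" using \<open>x \<in> topspace X\<close> by (simp add: loops_def pathin_const)
 then have "loop_class X x (rev_path p) \<otimes>\<^bsub>pi1 X x\<^esub> loop_class X x p = \<one>\<^bsub>pi1 X x\<^esub>"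
  using path_htpy_rev_left[of X p] assms r loop_class_eq_iff[OF loops_concat[OF r assms]]
  by (simp add: pi1_mult) (simp add: pi1_def loops_def)
 then show ?thesis
  using assms r by (intro inv_equality) (auto simp: pi1_def)
qed

lemma pi1_carrierE:
 assumes "a \<in> carrier (pi1 X x)"
 obtains p where "p \<in> loops X x" "a = loop_class X x p"
 using assms by (auto simp: pi1_def)

lemma loop_class_in_carrier: "p \<in> loops X x ==> loop_class X x p \<in> carrier (pi1 X x)"
 by (simp add: pi1_def)

lemma has_rank_iso:
 assumes G: "group G" and H: "group H" and f: "f \<in> iso G H" and r: "has_rank G r"
 shows "has_rank H r"
proof -
 have hom: "group_hom G H f" using assms by (auto simp: group_hom_def group_hom_axioms_def iso_def)
 define g where "g = inv_into (carrier G) f"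
 have g: "g \<in> iso H G" unfolding g_def by (rule group.iso_set_sym[OF G f])
 have hom': "group_hom H G g" using assms g by (auto simp: group_hom_def group_hom_axioms_def iso_def)
 have bij: "bij_betw f (carrier G) (carrier H)" "bij_betw g (carrier H) (carrier G)" using f g by (auto simp: iso_def)
 obtain S where S: "S \<subseteq> carrier G" "finite S" "card S = r" "generate G S = carrier G"
  using r by (auto simp: has_rank_def)
 have gen: "generate H (f ` S) = carrier H"
  using group_hom.generate_img[OF hom S(1)] S(4) bij(1) by (simp add: bij_betw_def)
 have "card (f ` S) = r" using S bij(1) by (metis bij_betw_def card_image inj_on_subset)
 have fS: "f ` S \<subseteq> carrier H" using S(1) bij(1) unfolding bij_betw_def by blast
 from \<open>card (f ` S) = r\<close> have 1: "\<exists>S\<subseteq>carrier H. finite S \<and> card S = r \<and> generate H S = carrier H"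
  using S(2) gen fS by (intro exI[of _ "f ` S"]) auto
 have "r \<le> card T" if T: "T \<subseteq> carrier H" "finite T" "generate H T = carrier H" for T
 proof -
  have "generate G (g ` T) = carrier G"
   using group_hom.generate_img[OF hom' T(1)] T(3) bij(2) by (simp add: bij_betw_def)
  moreover have "g ` T \<subseteq> carrier G" using T(1) bij(2) unfolding bij_betw_def by blast
  ultimately have "r \<le> card (g ` T)" using r T(2) by (simp add: has_rank_def)
  also have "\<dots> \<le> card T" by (rule card_image_le[OF T(2)])
  finally show ?thesis .
 qed
 with 1 show ?thesis by (simp add: has_rank_def)
qed

lemma path_htpy_image:
 assumes "path_htpy X p q" "continuous_map X Y f"
 shows "path_htpy Y (f \<circ> p) (f \<circ> q)"
 using assms(1) unfolding path_htpy_def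
 by (rule homotopic_with_compose_continuous_map_left[OF _ assms(2)]) auto

text \<open>The isomorphism is induced by the inverse homeomorphism. It carries the rank known for
  the rose over to graphs homeomorphic to it.\<close>

lemma has_rank_pi1_homeomorphic:
 assumes h: "homeomorphic_map X Y h" and x: "x \<in> topspace X" and r: "has_rank (pi1 Y (h x)) r"
 shows "has_rank (pi1 X x) r"
proof -
 obtain g where g: "homeomorphic_maps X Y h g" using h by (auto simp: homeomorphic_map_maps)
 then have cont: "continuous_map X Y h" "continuous_map Y X g" and gh: "!!z. z \<in> topspace X ==> g (h z) = z"
  and hg: "!!z. z \<in> topspace Y ==> h (g z) = z"
  by (auto simp: homeomorphic_maps_def)
 have y: "h x \<in> topspace Y" using cont(1) x by (auto simp: continuous_map_def)
 define y where "y = h x"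
 have gy: "g y = x" using gh[OF x] by (simp add: y_def)
 have loopsg: "g \<circ> p \<in> loops X x" if "p \<in> loops Y y" for p
  using that gy by (auto simp: loops_def pathin_def intro: continuous_map_compose[OF _ cont(2)])
 have loopsh: "h \<circ> p \<in> loops Y y" if "p \<in> loops X x" for p
  using that y_def by (auto simp: loops_def pathin_def intro: continuous_map_compose[OF _ cont(1)])
 define f where "f a = (\<Union>p\<in>a. loop_class X x (g \<circ> p))" for a
 have f: "f (loop_class Y y p) = loop_class X x (g \<circ> p)" if p: "p \<in> loops Y y" for p
 proof -
  have "loop_class X x (g \<circ> q) = loop_class X x (g \<circ> p)" if "q \<in> loop_class Y y p" for q
  proof -
   have q: "q \<in> loops Y y" using mem_loop_class_imp_loop[OF p that] .
   have "path_htpy Y p q" using that mem_loop_class_iff[OF p] by simp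
   then have "path_htpy X (g \<circ> q) (g \<circ> p)" using path_htpy_sym path_htpy_image[OF _ cont(2)] by blast
   then show ?thesis using loop_class_eq_iff[OF loopsg[OF q] loopsg[OF p]] by simp
  qed
  moreover have "p \<in> loop_class Y y p" by (rule loop_self_class[OF p])
  ultimately show ?thesis unfolding f_def by blast
 qed
 have "f \<in> iso (pi1 Y y) (pi1 X x)"
  unfolding iso_def
 proof (intro CollectI conjI homI)
  fix a assume "a \<in> carrier (pi1 Y y)"
  then obtain p where p: "p \<in> loops Y y" "a = loop_class Y y p" by (rule pi1_carrierE)
  then show "f a \<in> carrier (pi1 X x)" by (simp add: f loopsg loop_class_in_carrier)
  fix b assume "b \<in> carrier (pi1 Y y)"
  then obtain q where q: "q \<in> loops Y y" "b = loop_class Y y q" by (rule pi1_carrierE)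
  have "g \<circ> loop_concat p q = loop_concat (g \<circ> p) (g \<circ> q)" by (simp add: loop_concat_def fun_eq_iff)
  then show "f (a \<otimes>\<^bsub>pi1 Y y\<^esub> b) = f a \<otimes>\<^bsub>pi1 X x\<^esub> f b"
   using p q by (simp add: pi1_mult f loopsg loops_concat)
 next
  show "bij_betw f (carrier (pi1 Y y)) (carrier (pi1 X x))"
   unfolding bij_betw_def
  proof
   show "inj_on f (carrier (pi1 Y y))"
   proof (rule inj_onI)
    fix a b assume ab: "a \<in> carrier (pi1 Y y)" "b \<in> carrier (pi1 Y y)" "f a = f b"
    obtain p where p: "p \<in> loops Y y" "a = loop_class Y y p" using ab(1) by (rule pi1_carrierE)
    obtain q where q: "q \<in> loops Y y" "b = loop_class Y y q" using ab(2) by (rule pi1_carrierE)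
    have "path_htpy X (g \<circ> p) (g \<circ> q)" using ab(3) p q loop_class_eq_iff[OF loopsg loopsg] by (simp add: f)
    from path_htpy_image[OF this cont(1)] have "path_htpy Y (h \<circ> (g \<circ> p)) (h \<circ> (g \<circ> q))" .
    moreover have eq: "path_htpy Y w (h \<circ> (g \<circ> w))" if "w \<in> loops Y y" for w
    proof (rule path_htpy_eq)
     show "pathin Y w" using that by (simp add: loops_def)
     then show "(h \<circ> (g \<circ> w)) s = w s" if "s \<in> {0..1}" for s
      using hg that by (auto simp: pathin_def continuous_map_def Pi_iff)
    qed
    ultimately have "path_htpy Y p q" using p(1) q(1) path_htpy_trans path_htpy_sym by blast
    then show "a = b" using loop_class_eq_iff[OF p(1) q(1)] p(2) q(2) by simp
   qed
   show "f ` carrier (pi1 Y y) = carrier (pi1 X x)"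
   proof
    show "f ` carrier (pi1 Y y) \<subseteq> carrier (pi1 X x)"
     by (auto elim!: pi1_carrierE simp: f loopsg loop_class_in_carrier)
    show "carrier (pi1 X x) \<subseteq> f ` carrier (pi1 Y y)"
    proof
     fix a assume "a \<in> carrier (pi1 X x)"
     then obtain p where p: "p \<in> loops X x" "a = loop_class X x p" by (rule pi1_carrierE)
     have "path_htpy X p (g \<circ> (h \<circ> p))"
     proof (rule path_htpy_eq)
      show "pathin X p" using p by (simp add: loops_def)
      then show "(g \<circ> (h \<circ> p)) s = p s" if "s \<in> {0..1}" for s
       using gh that by (auto simp: pathin_def continuous_map_def Pi_iff)
     qed
     then have "a = f (loop_class Y y (h \<circ> p))"
      using p loop_class_eq_iff[OF p(1) loopsg[OF loopsh[OF p(1)]]] by (simp add: f loopsh)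
     then show "a \<in> f ` carrier (pi1 Y y)" using loop_class_in_carrier[OF loopsh[OF p(1)]] by blast
    qed
   qed
  qed
 qed
 then show ?thesis
  using has_rank_iso[OF group_pi1 group_pi1[OF x]] y r by (simp add: y_def)
qed

section \<open>The rank of the fundamental group of a rose\<close>

lemma ang_neq_1_petal:
 assumes "y \<in> points (rose r)" "ang i y \<noteq> 1" shows "y \<in> range (petal i)"
 using assms(1)
proof (cases rule: rose_point_cases)
 case (2 j t)
 then have "j = i" using assms(2) by (metis ang_petal_other)
 then show ?thesis using 2 by blast
qed (use assms(2) in simp)

lemma rose_point_in_petal:
 assumes "y \<in> points (rose r)" "r \<ge> 1"
 obtains i where "i < r" "y \<in> range (petal i)"
 using assms(1)
proof (cases rule: rose_point_cases)
 case 1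
 have "Vert 0 \<in> range (petal 0)" by (metis petal_0 rangeI)
 then show ?thesis using 1 assms(2) that[of 0] by simp
next
 case (2 i t)
 then show ?thesis using that[of i] by blast
qed

locale rose_pi1 =
 fixes r :: nat
 assumes r: "r \<ge> 1"
begin

abbreviation "X \<equiv> space_of (rose r)"
abbreviation "G \<equiv> pi1 X (Vert 0)"
abbreviation "cls \<equiv> loop_class X (Vert 0)"
abbreviation "L0 \<equiv> loops X (Vert 0)"
abbreviation "gens \<equiv> (%i. cls (petal i)) ` {..<r}"

sublocale group G
 by (rule group_pi1) simp

lemma pathin_petal: "i < r ==> continuous_on {0..1} u ==> pathin X (%s. petal i (u s))"
 unfolding pathin_def by (rule continuous_map_petal) auto

lemma petal_loop: "i < r ==> (%s. petal i (of_int m * s)) \<in> L0"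
 unfolding loops_def by (auto intro!: pathin_petal continuous_intros simp: petal_Ints)

lemma petal_loop1: "i < r ==> petal i \<in> L0"
 using petal_loop[of i 1] by simp

lemma cls_eqI: "p \<in> L0 ==> q \<in> L0 ==> path_htpy X p q ==> cls p = cls q"
 by (simp add: loop_class_eq_iff)

lemma petal_htpy:
 assumes "i < r" "continuous_on {0..1} u" "continuous_on {0..1} v" "u 0 = v 0" "u 1 = v 1"
  "!!s. s \<in> {0..1} ==> p s = petal i (u s)" "!!s. s \<in> {0..1} ==> q s = petal i (v s)"
 shows "path_htpy X p q"
 by (rule path_htpy_convex[of UNIV X "petal i" u v])
  (use assms continuous_map_petal[OF continuous_map_id, of i r] in \<open>auto simp: id_def\<close>)

lemma gens_carrier: "gens \<subseteq> carrier G"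
 using petal_loop1 by (auto intro: loop_class_in_carrier)

lemma petal_power_in_generate:
 assumes i: "i < r" shows "cls (%s. petal i (of_int m * s)) \<in> generate G gens"
proof -
 have nat: "cls (%s. petal i (of_int (int N) * s)) \<in> generate G gens" for N
 proof (induction N)
  case 0
  have "cls (%s. petal i (of_int (int 0) * s)) = \<one>\<^bsub>G\<^esub>" by (simp add: pi1_def)
  then show ?case by (simp add: generate.one)
 next
  case (Suc N)
  have "cls (%s. petal i (of_int (int (Suc N)) * s))
    = cls (loop_concat (%s. petal i (of_int (int N) * s)) (petal i))"
  proof (rule cls_eqI)
   show "path_htpy X (%s. petal i (of_int (int (Suc N)) * s)) (loop_concat (%s. petal i (of_int (int N) * s)) (petal i))"
   proof (rule petal_htpy[OF i, of "%s. of_int (int (Suc N)) * s" "%s. of_int (int N) * min (2 * s) 1 + max 0 (2 * s - 1)"])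
    fix s :: real
    show "loop_concat (%s. petal i (of_int (int N) * s)) (petal i) s
     = petal i (of_int (int N) * min (2 * s) 1 + max 0 (2 * s - 1))"
     by (cases "s \<le> 1/2")
      (auto simp: loop_concat_def min_absorb1 min_absorb2 max_absorb1 max_absorb2 petal_eq_iff)
   qed (auto intro!: continuous_intros)
  qed (use petal_loop[OF i, of "int N"] petal_loop[OF i, of "int (Suc N)"] petal_loop1[OF i] in \<open>auto intro: loops_concat\<close>)
  also have "\<dots> = cls (%s. petal i (of_int (int N) * s)) \<otimes>\<^bsub>G\<^esub> cls (petal i)"
   by (rule pi1_mult[OF petal_loop[OF i] petal_loop1[OF i], symmetric])
  also have "\<dots> \<in> generate G gens"
   by (rule generate.eng[OF Suc generate.incl]) (use i in auto)
  finally show ?case .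
 qed
 show ?thesis
 proof (cases "m \<ge> 0")
  case True
  then show ?thesis using nat[of "nat m"] by simp
 next
  case False
  then have m: "m = - int (nat (- m))" by simp
  have "(%s. petal i (of_int m * s)) = rev_path (%s. petal i (of_int (int (nat (- m))) * s))"
  proof
   fix s :: real
   have "of_int m * s - of_int (int (nat (- m))) * (1 - s) = of_int m"
    using False by (simp add: algebra_simps)
   then show "petal i (of_int m * s) = rev_path (%s. petal i (of_int (int (nat (- m))) * s)) s"
    unfolding rev_path_def petal_eq_iff by (metis Ints_of_int)
  qed
  then have eq: "cls (%s. petal i (of_int m * s)) = inv\<^bsub>G\<^esub> cls (%s. petal i (of_int (int (nat (- m))) * s))"
   using pi1_inv[OF petal_loop[OF i]] by simp
  show ?thesis unfolding eq by (rule generate_m_inv_closed[OF gens_carrier nat])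
 qed
qed

text \<open>Such a loop lifts to a path on the line with integral increment, and the lift can be
  straightened, so the loop represents a power of one generator.\<close>

lemma loop_in_petal_in_generate:
 assumes p: "p \<in> L0" and i: "i < r" and im: "!!s. s \<in> {0..1} ==> p s \<in> range (petal i)"
 shows "cls p \<in> generate G gens"
proof -
 have "continuous_map I01 X p" "p 0 = Vert 0" "p 1 = Vert 0" using p by (auto simp: loops_def pathin_def)
 moreover obtain u where u: "continuous_on {0..1} u" "!!s. s \<in> {0..1} ==> p s = petal i (u s)"
  using lift_petal[OF \<open>continuous_map I01 X p\<close> connected_unit(2) i im] by blast
 ultimately have "petal i (u 0) = Vert 0" "petal i (u 1) = Vert 0" using u(2)[of 0] u(2)[of 1] by auto
 then have int: "u 0 \<in> \<int>" "u 1 - u 0 \<in> \<int>" by (auto simp: petal_eq_Vert_iff intro: Ints_diff)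
 from int(2) obtain m where m: "u 1 - u 0 = of_int m" by (rule Ints_cases)
 have "cls p = cls (%s. petal i (of_int m * s))"
 proof (rule cls_eqI[OF p petal_loop[OF i]])
  show "path_htpy X p (%s. petal i (of_int m * s))"
   by (rule petal_htpy[OF i u(1), of "%s. u 0 + of_int m * s"])
    (use u(2) int m in \<open>auto simp: petal_eq_iff intro!: continuous_intros\<close>)
 qed
 then show ?thesis using petal_power_in_generate[OF i] by simp
qed

text \<open>A canonical path from the base vertex to \<open>y\<close>. It stays in every petal that
  contains \<open>y\<close>, which keeps the loops closed up by such paths inside a petal.\<close>

definition cpath :: "gpoint => real => gpoint" where
 "cpath y s = (case y of Vert v => Vert 0 | Inner i t => petal i (s * t))"

lemma cpath_all:
 assumes "y \<in> points (rose r)"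
 shows "pathin X (cpath y) \<and> cpath y 0 = Vert 0 \<and> cpath y 1 = y \<and>
  (y \<in> range (petal i) --> cpath y s \<in> range (petal i))"
 using assms
proof (cases rule: points_cases)
 case (1 v)
 have "Vert 0 \<in> range (petal i)" by (metis petal_0 rangeI)
 moreover have "cpath y = (%_. Vert 0)" using 1 by (simp add: cpath_def fun_eq_iff)
 ultimately show ?thesis using 1 by (simp add: pathin_const)
next
 case (2 e t)
 then have c: "cpath y = (%s. petal e (s * t))" by (simp add: cpath_def fun_eq_iff)
 have "pathin X (%s. petal e (s * t))" by (rule pathin_petal) (use 2 in \<open>auto intro!: continuous_intros\<close>)
 moreover have "cpath y s \<in> range (petal i)" if y: "y \<in> range (petal i)"
 proof -
  obtain z where "y = petal i z" using y by blast
  then have "petal i z = Inner e t" using 2(4) by simp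
  then have "e = i" by (simp add: petal_eq_Inner_iff)
  then show ?thesis by (simp add: c)
 qed
 moreover have "petal e t = y" using 2 by (simp add: petal_Inner)
 ultimately show ?thesis by (simp add: c)
qed

lemma cpath:
 assumes "y \<in> points (rose r)"
 shows "pathin X (cpath y)" "cpath y 0 = Vert 0" "cpath y 1 = y"
  and "y \<in> range (petal i) ==> cpath y s \<in> range (petal i)"
 by (use cpath_all[OF assms, of i s] in simp_all)

lemma cls_concat_in_generate:
 assumes "p \<in> L0" "q \<in> L0" "cls p \<in> generate G gens" "cls q \<in> generate G gens"
 shows "cls (loop_concat p q) \<in> generate G gens"
 unfolding pi1_mult[OF assms(1,2), symmetric] using assms(3,4) by (rule generate.eng)

definition sub_path :: "(real => gpoint) => real => real => real => gpoint" where
 "sub_path p a b s = p (a + s * (b - a))"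

text \<open>The piece of \<open>p\<close> over an interval, closed up by canonical paths. Adjacent
  pieces multiply, so generation only has to be checked for short pieces.\<close>

definition based :: "(real => gpoint) => real => real => real => gpoint" where
 "based p a b = loop_concat (cpath (p a)) (loop_concat (sub_path p a b) (rev_path (cpath (p b))))"

lemma sub_arg: "a \<le> b ==> s \<in> {0..1} ==> a + s * (b - a) \<in> {a..b}" for a b s :: real
 using mult_left_le_one_le[of "b - a" s] by auto

lemma pathin_points: "pathin X p ==> s \<in> {0..1} ==> p s \<in> points (rose r)"
 by (auto simp: pathin_def continuous_map_def)

lemma sub_path:
 assumes "pathin X p" "0 \<le> a" "a \<le> b" "b \<le> 1"
 shows "pathin X (sub_path p a b)" "sub_path p a b 0 = p a" "sub_path p a b 1 = p b"
proof -
 have "continuous_map I01 I01 (%s. a + s * (b - a))"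
  using sub_arg[OF assms(3)] assms(2,4) by (fastforce simp: continuous_map_subtopology_eu intro!: continuous_intros)
 from continuous_map_compose[OF this assms(1)[unfolded pathin_def]]
 show "pathin X (sub_path p a b)" by (simp add: pathin_def sub_path_def[abs_def] o_def)
qed (simp_all add: sub_path_def)

lemma based_loop:
 assumes "pathin X p" "0 \<le> a" "a \<le> b" "b \<le> 1"
 shows "based p a b \<in> L0"
proof -
 have "p a \<in> points (rose r)" "p b \<in> points (rose r)" using pathin_points[OF assms(1)] assms by auto
 then show ?thesis
  unfolding based_def loops_def using sub_path[OF assms] cpath
  by (auto intro!: pathin_concat pathin_rev)
qed

lemma based_trans:
 assumes p: "pathin X p" and ab: "0 \<le> a" "a \<le> b" "b \<le> c" "c \<le> 1"
 shows "path_htpy X (loop_concat (based p a b) (based p b c)) (based p a c)"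
proof -
 have pts: "p a \<in> points (rose r)" "p b \<in> points (rose r)" "p c \<in> points (rose r)"
  using pathin_points[OF p] ab by auto
 note c = cpath(1-3)[OF pts(1)] cpath(1-3)[OF pts(2)] cpath(1-3)[OF pts(3)]
 have s: "pathin X (sub_path p a b)" "pathin X (sub_path p b c)" "pathin X (sub_path p a c)"
  using sub_path(1)[OF p] ab by auto
 have e: "sub_path p x y 0 = p x" "sub_path p x y 1 = p y" for x y by (simp_all add: sub_path_def)
 let ?A = "cpath (p a)" and ?B = "cpath (p b)" and ?C = "cpath (p c)"
 let ?u = "sub_path p a b" and ?v = "sub_path p b c"
 note P = c s e pathin_rev pathin_concat
 have "path_htpy X (loop_concat (based p a b) (based p b c))
  (loop_concat (loop_concat (loop_concat ?A ?u) (rev_path ?B)) (based p b c))"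
  unfolding based_def by (intro path_htpy_concat path_htpy_refl path_htpy_sym[OF path_htpy_assoc]) (auto simp: P)
 also have "path_htpy X \<dots> (loop_concat (loop_concat ?A ?u) (loop_concat ?v (rev_path ?C)))"
  unfolding based_def by (rule path_htpy_cancel_middle) (auto simp: P)
 also have "path_htpy X \<dots> (loop_concat ?A (loop_concat ?u (loop_concat ?v (rev_path ?C))))"
  by (rule path_htpy_assoc) (auto simp: P)
 also have "path_htpy X \<dots> (loop_concat ?A (loop_concat (loop_concat ?u ?v) (rev_path ?C)))"
  by (intro path_htpy_concat path_htpy_refl path_htpy_sym[OF path_htpy_assoc]) (auto simp: P)
 also have "path_htpy X \<dots> (based p a c)"
  unfolding based_def
 proof (intro path_htpy_concat path_htpy_refl)
  show "path_htpy X (loop_concat ?u ?v) (sub_path p a c)"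
  proof (rule path_htpy_reparam[OF p])
   let ?w = "%s. a + min (2 * s) 1 * (b - a) + max 0 (2 * s - 1) * (c - b)"
   show "?w ` {0..1} \<subseteq> {0..1}"
   proof
    fix y assume "y \<in> ?w ` {0..1}"
    then obtain s where s: "s \<in> {0..1}" "y = ?w s" by blast
    have "0 \<le> min (2 * s) 1 * (b - a)" "min (2 * s) 1 * (b - a) \<le> 1 * (b - a)"
     "0 \<le> max 0 (2 * s - 1) * (c - b)" "max 0 (2 * s - 1) * (c - b) \<le> 1 * (c - b)"
     using s ab mult_right_mono[of "min (2 * s) 1" 1 "b - a"] mult_right_mono[of "max 0 (2 * s - 1)" 1 "c - b"] by auto
    then show "y \<in> {0..1}" using s ab by simp
   qed
   show "(%s. a + s * (c - a)) ` {0..1} \<subseteq> {0..1}" using sub_arg[of a c] ab by fastforce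
   fix s :: real
   show "loop_concat ?u ?v s = p (?w s)"
    by (cases "s \<le> 1/2") (auto simp: loop_concat_def sub_path_def min_absorb1 min_absorb2 max_absorb1 max_absorb2)
   show "sub_path p a c s = p (a + s * (c - a))" by (simp add: sub_path_def)
  qed (auto intro!: continuous_intros)
 qed (auto simp: P)
 finally show ?thesis .
qed

text \<open>Scales the principal argument of the angle by \<open>t\<close>. This contracts the
  complement of the midpoints of the petals to the base vertex; at a midpoint the principal argument
  jumps.\<close>

definition contract :: "real => gpoint => gpoint" where
 "contract t y = (case y of Vert v => Vert 0 | Inner i s => petal i (t * Arg (ang i y) / (2 * pi)))"

lemma ang_contract:
 assumes "y \<in> points (rose r)" shows "ang j (contract t y) = cis (t * Arg (ang j y))"
 using assms
proof (cases rule: points_cases)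
 case (2 i s)
 have "ang j (Inner i s) = 1" if "i \<noteq> j" using that by (simp add: ang_def)
 then show ?thesis using 2 by (cases "i = j") (simp_all add: contract_def)
qed (simp add: contract_def)

lemma contract_in_petal:
 assumes "y \<in> range (petal i)" shows "contract t y \<in> range (petal i)"
proof (cases y)
 case (Vert v)
 have "Vert 0 \<in> range (petal i)" by (metis petal_0 rangeI)
 then show ?thesis by (simp add: contract_def Vert)
next
 case (Inner j s)
 then have "j = i" using assms by (auto simp: petal_def split: if_splits)
 then show ?thesis by (simp add: contract_def Inner)
qed

lemma contract_in_points: "y \<in> points (rose r) ==> contract t y \<in> points (rose r)"
 by (cases rule: points_cases, assumption) (auto simp: contract_def petal_in_points)

lemma contract_0: "contract 0 y = Vert 0"
 by (simp add: contract_def split: gpoint.split)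

lemma contract_1: "y \<in> points (rose r) ==> contract 1 y = y"
 by (rule ang_inject[of _ r]) (auto simp: contract_in_points ang_contract cis_Arg sgn_div_norm)

text \<open>A path that avoids the midpoints of all petals can be replaced, by contraction, with the
  track of its start to the base vertex followed by the reversed track of its end. The closed-up
  loop then splits into two loops, each inside one petal.\<close>

lemma small_path_in_generate:
 assumes p: "pathin X p" and ab: "0 \<le> a" "a \<le> b" "b \<le> 1"
  and small: "!!s i. s \<in> {a..b} ==> i < r ==> ang i (p s) \<noteq> -1"
 shows "cls (based p a b) \<in> generate G gens"
proof -
 define q where "q = sub_path p a b"
 have q: "pathin X q" "q 0 = p a" "q 1 = p b" using sub_path[OF p ab] by (auto simp: q_def)
 have qpts: "q s \<in> points (rose r)" if "s \<in> {0..1}" for s using pathin_points[OF q(1) that] .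
 have qsmall: "ang i (q s) \<noteq> -1" if "s \<in> {0..1}" "i < r" for s i
  using small[OF sub_arg[OF ab(2) that(1)] that(2)] by (simp add: q_def sub_path_def)
 let ?sq = "{0..1::real} \<times> {0..1::real}"
 define K where "K z = contract (fst z) (q (snd z))" for z
 have contK: "continuous_map (top_of_set ?sq) X K"
  unfolding continuous_map_rose_iff
 proof (intro conjI allI impI)
  show "K \<in> topspace (top_of_set ?sq) \<rightarrow> points (rose r)"
   using qpts by (auto simp: K_def contract_in_points)
  fix i assume i: "i < r"
  have cq: "continuous_on {0..1} (%s. ang i (q s))" using q(1) i by (simp add: pathin_def continuous_map_rose_iff)
  have "continuous_on (- \<real>\<^sub>\<le>\<^sub>0) Arg"
   by (intro continuous_at_imp_continuous_on ballI continuous_at_Arg) auto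
  moreover have "(%s. ang i (q s)) ` {0..1} \<subseteq> - \<real>\<^sub>\<le>\<^sub>0"
  proof
   fix z assume "z \<in> (%s. ang i (q s)) ` {0..1}"
   then have z: "norm z = 1" "z \<noteq> -1" using qsmall i by auto
   show "z \<in> - \<real>\<^sub>\<le>\<^sub>0"
   proof
    assume "z \<in> \<real>\<^sub>\<le>\<^sub>0"
    then obtain y where "z = of_real y" "y \<le> 0" by (auto elim: nonpos_Reals_cases)
    then show False using z by auto
   qed
  qed
  ultimately have ca: "continuous_on {0..1} (%s. Arg (ang i (q s)))" using continuous_on_compose2 cq by blast
  have "continuous_on ?sq (%z. Arg (ang i (q (snd z))))"
   by (rule continuous_on_compose2[OF ca]) (auto intro!: continuous_intros)
  moreover have "continuous_on A (%z. cis (fst z * g z))" if "continuous_on A g" for g and A :: "(real \<times> real) set"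
   using that by (intro continuous_intros)
  ultimately have "continuous_on ?sq (%z. cis (fst z * Arg (ang i (q (snd z)))))" by blast
  moreover have "ang i (K z) = cis (fst z * Arg (ang i (q (snd z))))" if "z \<in> ?sq" for z
   using that qpts by (auto simp: K_def ang_contract)
  ultimately have "continuous_on ?sq (%z. ang i (K z))" by (simp cong: continuous_on_cong)
  then show "continuous_map (top_of_set ?sq) euclidean (%z. ang i (K z))" by simp
 qed
 define trk where "trk y s = contract (1 - s) y" for y s
 have trk: "pathin X (trk (q e))" if "e \<in> {0, 1}" for e
 proof -
  have "continuous_map I01 (top_of_set ?sq) (%s. (1 - s, e))"
   using that by (auto simp: continuous_map_subtopology_eu intro!: continuous_intros)
  from continuous_map_compose[OF this contK] show ?thesis
   by (simp add: pathin_def o_def K_def trk_def[abs_def])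
 qed
 have trk_ends: "trk y 1 = Vert 0" "y \<in> points (rose r) ==> trk y 0 = y" for y
  by (simp_all add: trk_def contract_0 contract_1)
 let ?ta = "trk (q 0)" and ?tb = "trk (q 1)" and ?A = "cpath (p a)" and ?B = "cpath (p b)"
 have pts: "p a \<in> points (rose r)" "p b \<in> points (rose r)" using qpts[of 0] qpts[of 1] q by auto
 have tr: "pathin X (trk (p a))" "pathin X (trk (p b))" using trk[of 0] trk[of 1] q by simp_all
 note P = cpath(1-3)[OF pts(1)] cpath(1-3)[OF pts(2)] q tr trk_ends pts pathin_rev pathin_concat
 \<comment> \<open>Three sides of the square of contraction parameters and times: contract at time
   0, run along the side where everything is at the base vertex, expand again at time 1.\<close>
 define \<beta> where "\<beta> s = (max 0 (max (1 - 3 * s) (3 * s - 2)), max 0 (min 1 (3 * s - 1)))" for s :: real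
 have "path_htpy X q (%s. K (\<beta> s))"
 proof (rule path_htpy_convex[OF _ contK, of "%s. (1, s)" \<beta>])
  show "convex ?sq" by (intro convex_Times convex_real_interval)
  show "continuous_on {0..1} (%s::real. (1::real, s))" by (rule continuous_on_Pair[OF continuous_on_const continuous_on_id])
  show "continuous_on {0..1} \<beta>" unfolding \<beta>_def[abs_def] by (auto intro!: continuous_intros)
  show "\<beta> ` {0..1} \<subseteq> ?sq" by (auto simp: \<beta>_def)
  show "q s = K (1, s)" if "s \<in> {0..1}" for s using qpts[OF that] by (simp add: K_def contract_1)
 qed (auto simp: \<beta>_def)
 also have "path_htpy X (%s. K (\<beta> s)) (loop_concat ?ta (rev_path ?tb))"
 proof (rule path_htpy_reparam[where v = "%s. s" and u = "%s. min (3 * s / 2) (max (1/2) ((3 * s - 1) / 2))"])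
  show "pathin X (loop_concat ?ta (rev_path ?tb))" by (rule pathin_concat) (auto simp: P)
  show "continuous_on {0..1} (%s::real. min (3 * s / 2) (max (1/2) ((3 * s - 1) / 2)))"
   by (intro continuous_intros) auto
  fix s :: real assume s: "s \<in> {0..1}"
  consider "s \<le> 1/3" | "1/3 < s" "s \<le> 2/3" | "2/3 < s" by linarith
  then show "K (\<beta> s) = loop_concat ?ta (rev_path ?tb) (min (3 * s / 2) (max (1/2) ((3 * s - 1) / 2)))"
  proof cases
   case 1
   then have "\<beta> s = (1 - 3 * s, 0)" "min (3 * s / 2) (max (1/2) ((3 * s - 1) / 2)) = 3 * s / 2"
    by (auto simp: \<beta>_def)
   then show ?thesis using 1 by (simp add: K_def loop_concat_def trk_def)
  next
   case 2
   then have b: "fst (\<beta> s) = 0" and m: "min (3 * s / 2) (max (1/2) ((3 * s - 1) / 2)) = 1 / 2"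
    by (auto simp: \<beta>_def)
   show ?thesis unfolding m by (simp add: b K_def loop_concat_def contract_0 trk_ends)
  next
   case 3
   then have b: "\<beta> s = (3 * s - 2, 1)" and m: "min (3 * s / 2) (max (1/2) ((3 * s - 1) / 2)) = (3 * s - 1) / 2"
    using s by (auto simp: \<beta>_def)
   define e where "e = (3 * s - 1) / 2"
   have e: "2 * e - 1 = 3 * s - 2" "\<not> e \<le> 1/2" "\<not> e * 2 \<le> 1" using 3 by (auto simp: e_def field_simps)
   show ?thesis unfolding b m unfolding e_def[symmetric] by (simp add: K_def loop_concat_def rev_path_def trk_def e)
  qed
 qed (auto simp: min_le_iff_disj le_max_iff_disj max_def intro!: continuous_intros)
 finally have sq: "path_htpy X q (loop_concat ?ta (rev_path ?tb))" .
 have "path_htpy X (based p a b) (loop_concat ?A (loop_concat (loop_concat ?ta (rev_path ?tb)) (rev_path ?B)))"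
  unfolding based_def q_def[symmetric]
  by (intro path_htpy_concat path_htpy_refl sq) (auto simp: P)
 also have "path_htpy X \<dots> (loop_concat ?A (loop_concat ?ta (loop_concat (rev_path ?tb) (rev_path ?B))))"
  by (intro path_htpy_concat path_htpy_refl path_htpy_assoc) (auto simp: P)
 also have "path_htpy X \<dots> (loop_concat (loop_concat ?A ?ta) (loop_concat (rev_path ?tb) (rev_path ?B)))"
  by (intro path_htpy_sym[OF path_htpy_assoc]) (auto simp: P)
 finally have htpy: "path_htpy X (based p a b) (loop_concat (loop_concat ?A ?ta) (loop_concat (rev_path ?tb) (rev_path ?B)))" .
 have l1: "loop_concat ?A ?ta \<in> L0" and l2: "loop_concat (rev_path ?tb) (rev_path ?B) \<in> L0"
  unfolding loops_def by (auto simp: P)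
 \<comment> \<open>The canonical path and the contraction track of \<open>p a\<close> both stay in a
   petal containing \<open>p a\<close>; the same holds below for \<open>p b\<close>.\<close>
 obtain i where i: "i < r" "p a \<in> range (petal i)" using rose_point_in_petal[OF pts(1) r] by blast
 have 1: "cls (loop_concat ?A ?ta) \<in> generate G gens"
  by (rule loop_in_petal_in_generate[OF l1 i(1)])
   (use cpath(4)[OF pts(1) i(2)] contract_in_petal[OF i(2)] in \<open>auto simp: loop_concat_def trk_def q\<close>)
 obtain i where i: "i < r" "p b \<in> range (petal i)" using rose_point_in_petal[OF pts(2) r] by blast
 have 2: "cls (loop_concat (rev_path ?tb) (rev_path ?B)) \<in> generate G gens"
  by (rule loop_in_petal_in_generate[OF l2 i(1)])
   (use cpath(4)[OF pts(2) i(2)] contract_in_petal[OF i(2)] in \<open>auto simp: loop_concat_def rev_path_def trk_def q\<close>)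
 show ?thesis
  using cls_eqI[OF based_loop[OF p ab] loops_concat[OF l1 l2] htpy] cls_concat_in_generate[OF l1 l2 1 2] by simp
qed

lemma generate_gens: "generate G gens = carrier G"
proof
 show "generate G gens \<subseteq> carrier G" by (rule generate_incl[OF gens_carrier])
 show "carrier G \<subseteq> generate G gens"
 proof
  fix a assume "a \<in> carrier G"
  then obtain p where p: "p \<in> L0" "a = cls p" by (rule pi1_carrierE)
  then have pin: "pathin X p" by (simp add: loops_def)
  define Q where "Q a b \<longleftrightarrow> (0 \<le> a \<and> a \<le> b \<and> b \<le> 1 --> cls (based p a b) \<in> generate G gens)" for a b
  have "Q 0 1"
  \<comment> \<open>Bisection takes the place of a Lebesgue number: \<open>Q\<close> passes from two
    adjacent intervals to their union, and holds for all sufficiently short intervals around each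
    point.\<close>
  proof (rule Bolzano)
   fix a b c :: real assume *: "Q a b" "Q b c" "a \<le> b" "b \<le> c"
   show "Q a c"
    unfolding Q_def
   proof (intro impI, elim conjE)
    assume ac: "0 \<le> a" "a \<le> c" "c \<le> 1"
    have l: "based p a b \<in> L0" "based p b c \<in> L0" "based p a c \<in> L0" using based_loop[OF pin] * ac by auto
    have "cls (based p a c) = cls (loop_concat (based p a b) (based p b c))"
     using cls_eqI[OF loops_concat[OF l(1,2)] l(3) based_trans[OF pin]] * ac by simp
    then show "cls (based p a c) \<in> generate G gens"
     using cls_concat_in_generate[OF l(1,2)] * ac by (simp add: Q_def)
   qed
  next
   fix x :: real assume x: "0 \<le> x" "x \<le> 1"
   then have px: "p x \<in> points (rose r)" using pathin_points[OF pin] by simp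
   have cont: "continuous_on {0..1} (%s. ang i (p s))" if "i < r" for i
    using pin that by (simp add: pathin_def continuous_map_rose_iff)
   from px show "\<exists>d>0. \<forall>a b. a \<le> x \<and> x \<le> b \<and> b - a < d --> Q a b"
   proof (cases rule: rose_point_cases)
    case 1
    \<comment> \<open>At the base vertex all angles are 1, at distance 2 from -1; keeping this sum
      below 2 keeps every angle away from -1 at once.\<close>
    have "continuous_on {0..1} (%s. \<Sum>i<r. norm (ang i (p s) - 1))"
     by (intro continuous_intros cont) auto
    then obtain d where d: "d > 0"
     "!!s. s \<in> {0..1} ==> dist s x < d ==> dist (\<Sum>i<r. norm (ang i (p s) - 1)) (\<Sum>i<r. norm (ang i (p x) - 1)) < 2"
     using x unfolding continuous_on_iff by (metis atLeastAtMost_iff zero_less_numeral)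
    have "Q a b" if ab: "a \<le> x" "x \<le> b" "b - a < d" for a b
     unfolding Q_def
    proof (intro impI, elim conjE)
     assume 01: "0 \<le> a" "a \<le> b" "b \<le> 1"
     show "cls (based p a b) \<in> generate G gens"
     proof (rule small_path_in_generate[OF pin 01])
      fix s i assume s: "s \<in> {a..b}" and i: "i < r"
      have "dist s x < d" using s ab by (simp add: dist_real_def abs_less_iff)
      then have "(\<Sum>i<r. norm (ang i (p s) - 1)) < 2" using d(2)[of s] s 01 1 by (simp add: dist_real_def)
      moreover have "norm (ang i (p s) - 1) \<le> (\<Sum>i<r. norm (ang i (p s) - 1))"
       by (rule member_le_sum) (use i in auto)
      ultimately have "norm (ang i (p s) - 1) < 2" by simp
      then show "ang i (p s) \<noteq> - 1" by auto
     qed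
    qed
    then show ?thesis using d(1) by blast
   next
    case (2 i t)
    \<comment> \<open>Inside a petal it suffices that the angle stays different from 1, since the
      path then remains in that petal.\<close>
    have ne: "ang i (p x) \<noteq> 1" using 2 cis_2pi_neq_1 by simp
    then obtain d where d: "d > 0"
     "!!s. s \<in> {0..1} ==> dist s x < d ==> dist (ang i (p s)) (ang i (p x)) < dist 1 (ang i (p x))"
     using x cont[OF \<open>i < r\<close>] unfolding continuous_on_iff by (metis atLeastAtMost_iff zero_less_dist_iff)
    have "Q a b" if ab: "a \<le> x" "x \<le> b" "b - a < d" for a b
     unfolding Q_def
    proof (intro impI, elim conjE)
     assume 01: "0 \<le> a" "a \<le> b" "b \<le> 1"
     have im: "p s \<in> range (petal i)" if s: "s \<in> {a..b}" for s
     proof (rule ang_neq_1_petal)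
      show "p s \<in> points (rose r)" using pathin_points[OF pin] s 01 by simp
      have "dist s x < d" using s ab by (simp add: dist_real_def abs_less_iff)
      then show "ang i (p s) \<noteq> 1" using d(2)[of s] s 01 by auto
     qed
     have pts: "p a \<in> points (rose r)" "p b \<in> points (rose r)" using pathin_points[OF pin] 01 by auto
     show "cls (based p a b) \<in> generate G gens"
     proof (rule loop_in_petal_in_generate[OF based_loop[OF pin 01] \<open>i < r\<close>])
      fix s :: real assume s: "s \<in> {0..1}"
      have "sub_path p a b s' \<in> range (petal i)" if "s' \<in> {0..1}" for s'
       unfolding sub_path_def by (rule im[OF sub_arg[OF 01(2) that]])
      moreover have "cpath (p a) s' \<in> range (petal i)" "cpath (p b) s' \<in> range (petal i)" for s'
       using cpath(4)[OF pts(1)] cpath(4)[OF pts(2)] im 01 by auto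
      ultimately show "based p a b s \<in> range (petal i)"
       using s by (simp add: based_def loop_concat_def rev_path_def)
     qed
    qed
    then show ?thesis using d(1) by blast
   qed
  qed simp
  then have in_gen: "cls (based p 0 1) \<in> generate G gens" by (simp add: Q_def)
  have p01: "p 0 = Vert 0" "p 1 = Vert 0" using p by (auto simp: loops_def)
  have c: "cpath (Vert 0) = (%_. Vert 0)" "sub_path p 0 1 = p" "rev_path (%_. Vert 0) = (%_. Vert 0)"
   by (simp_all add: cpath_def sub_path_def rev_path_def fun_eq_iff)
  have "path_htpy X (based p 0 1) (loop_concat (%_. Vert 0) p)"
   unfolding based_def p01 c
   by (intro path_htpy_concat path_htpy_refl path_htpy_unit_right pathin_const) (use pin p01 in auto)
  also have "path_htpy X \<dots> p" by (rule path_htpy_unit_left) (use pin p01 in auto)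
  finally have "cls (based p 0 1) = cls p" using cls_eqI[OF based_loop[OF pin] p(1)] by simp
  then show "a \<in> generate G gens" using in_gen p(2) by simp
 qed
qed

section \<open>Winding numbers and the lower bound for the rank\<close>

definition winds :: "nat => (real => gpoint) => int => bool" where
 "winds i p m \<longleftrightarrow> (\<exists>u. continuous_on {0..1} u \<and> (\<forall>s\<in>{0..1}. ang i (p s) = cis (2 * pi * u s)) \<and> u 1 - u 0 = of_int m)"

lemma winds_exists:
 assumes "p \<in> L0" "i < r" obtains m where "winds i p m"
proof -
 have p: "continuous_map I01 X p" "p 0 = Vert 0" "p 1 = Vert 0" using assms by (auto simp: loops_def pathin_def)
 obtain u where u: "continuous_on {0..1} u" "!!s. s \<in> {0..1} ==> ang i (p s) = cis (2 * pi * u s)"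
  using lift_ang[OF p(1) connected_unit(2) assms(2)] by blast
 have "cis (2 * pi * u 1) = cis (2 * pi * u 0)" using u(2)[of 0] u(2)[of 1] p by simp
 then obtain m where "u 1 - u 0 = of_int m" unfolding cis_2pi_eq_iff by (auto elim: Ints_cases)
 then show ?thesis using that u unfolding winds_def by blast
qed

lemma winds_unique:
 assumes p: "p \<in> L0" and i: "i < r" and pq: "path_htpy X p q" and m: "winds i p m" "winds i q m'"
 shows "m = m'"
proof -
 obtain K where K: "continuous_map (prod_topology I01 I01) X K" "!!s. K (0, s) = p s" "!!s. K (1, s) = q s"
  "!!t. t \<in> {0..1} ==> K (t, 0) = p 0 \<and> K (t, 1) = p 1"
  using pq unfolding path_htpy_def homotopic_with_def by blast
 obtain u where u: "continuous_on {0..1} u" "!!s. s \<in> {0..1} ==> ang i (p s) = cis (2 * pi * u s)" "u 1 - u 0 = of_int m"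
  using m(1) unfolding winds_def by blast
 obtain v where v: "continuous_on {0..1} v" "!!s. s \<in> {0..1} ==> ang i (q s) = cis (2 * pi * v s)" "v 1 - v 0 = of_int m'"
  using m(2) unfolding winds_def by blast
 have "u 1 - u 0 = v 1 - v 0"
  by (rule increment_homotopy_invariant[of r K i u v 1])
   (use K u v i p in \<open>auto simp: loops_def prod_topology_subtopology_eu\<close>)
 then show ?thesis using u v by simp
qed

lemma winds_concat:
 assumes "winds i p m" "winds i q m'" "p 1 = q 0"
 shows "winds i (loop_concat p q) (m + m')"
proof -
 obtain u where u: "continuous_on {0..1} u" "!!s. s \<in> {0..1} ==> ang i (p s) = cis (2 * pi * u s)" "u 1 - u 0 = of_int m"
  using assms(1) unfolding winds_def by blast
 obtain v where v: "continuous_on {0..1} v" "!!s. s \<in> {0..1} ==> ang i (q s) = cis (2 * pi * v s)" "v 1 - v 0 = of_int m'"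
  using assms(2) unfolding winds_def by blast
 define w where "w s = u (min (2 * s) 1) + (v (max 0 (2 * s - 1)) - v 0)" for s
 have "cis (2 * pi * u 1) = cis (2 * pi * v 0)" using u(2)[of 1] v(2)[of 0] assms(3) by simp
 then have int: "u 1 - v 0 \<in> \<int>" by (simp add: cis_2pi_eq_iff)
 have "continuous_on {0..1} w"
  unfolding w_def[abs_def]
  by (intro continuous_intros continuous_on_compose2[OF u(1)] continuous_on_compose2[OF v(1)]) auto
 moreover have "ang i (loop_concat p q s) = cis (2 * pi * w s)" if s: "s \<in> {0..1}" for s
 proof (cases "s \<le> 1/2")
  case True
  then show ?thesis using u(2)[of "2 * s"] s by (simp add: loop_concat_def w_def min_absorb1 max_absorb1)
 next
  case False
  have "cis (2 * pi * v (2 * s - 1)) = cis (2 * pi * (u 1 + (v (2 * s - 1) - v 0)))"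
   unfolding cis_2pi_eq_iff using Ints_minus[OF int] by simp
  then show ?thesis using v(2)[of "2 * s - 1"] s False by (simp add: loop_concat_def w_def min_absorb2 max_absorb2)
 qed
 moreover have "w 1 - w 0 = of_int (m + m')" using u(3) v(3) by (simp add: w_def)
 ultimately show ?thesis unfolding winds_def by blast
qed

definition wnum :: "nat => (real => gpoint) set => int" where
 "wnum i a = (THE m. \<exists>p\<in>a. winds i p m)"

lemma wnum_cls:
 assumes "p \<in> L0" "i < r" "winds i p m" shows "wnum i (cls p) = m"
 unfolding wnum_def
proof (rule the_equality)
 show "\<exists>q\<in>cls p. winds i q m" using loop_self_class[OF assms(1)] assms(3) by blast
 fix m' assume "\<exists>q\<in>cls p. winds i q m'"
 then show "m' = m" using winds_unique[OF assms(1,2) _ assms(3)] mem_loop_class_iff[OF assms(1)] by metis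
qed

lemma wnum_mult:
 assumes "a \<in> carrier G" "b \<in> carrier G" "i < r"
 shows "wnum i (a \<otimes>\<^bsub>G\<^esub> b) = wnum i a + wnum i b"
proof -
 obtain p where p: "p \<in> L0" "a = cls p" using assms(1) by (rule pi1_carrierE)
 obtain q where q: "q \<in> L0" "b = cls q" using assms(2) by (rule pi1_carrierE)
 obtain m where m: "winds i p m" using winds_exists[OF p(1) assms(3)] by blast
 obtain m' where m': "winds i q m'" using winds_exists[OF q(1) assms(3)] by blast
 have "winds i (loop_concat p q) (m + m')" by (rule winds_concat[OF m m']) (use p q in \<open>auto simp: loops_def\<close>)
 then show ?thesis
  using p q m m' assms(3) by (simp add: pi1_mult wnum_cls loops_concat)
qed

lemma wnum_gen:
 assumes "i < r" "j < r" shows "wnum i (cls (petal j)) = of_bool (i = j)"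
proof (rule wnum_cls[OF petal_loop1[OF assms(2)] assms(1)])
 show "winds i (petal j) (of_bool (i = j))"
  unfolding winds_def
  by (rule exI[of _ "%s. of_bool (i = j) * s"]) (auto intro!: continuous_intros)
qed

lemma wnum_one: "i < r ==> wnum i \<one>\<^bsub>G\<^esub> = 0"
 using wnum_mult[of "\<one>\<^bsub>G\<^esub>" "\<one>\<^bsub>G\<^esub>" i] by simp

lemma wnum_inv: "a \<in> carrier G ==> i < r ==> wnum i (inv\<^bsub>G\<^esub> a) = - wnum i a"
 using wnum_mult[of "inv\<^bsub>G\<^esub> a" a i] wnum_one[of i] by simp

text \<open>The homomorphism to the elementary abelian 2-group of rank \<open>r\<close> given by
  winding numbers mod 2, with its values written as subsets.\<close>

definition parity :: "(real => gpoint) set => nat set" where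
 "parity a = {i. i < r \<and> odd (wnum i a)}"

lemma parity_subset_attained: "B \<subseteq> {..<r} ==> \<exists>a\<in>carrier G. parity a = B"
proof (induction B rule: infinite_finite_induct)
 case (infinite A)
 then show ?case using finite_subset by blast
next
 case empty
 then show ?case using wnum_one by (intro bexI[of _ "\<one>\<^bsub>G\<^esub>"]) (auto simp: parity_def)
next
 case (insert j B)
 then obtain a where a: "a \<in> carrier G" "parity a = B" by auto
 have j: "j < r" using insert by auto
 have g: "cls (petal j) \<in> carrier G" using petal_loop1[OF j] by (rule loop_class_in_carrier)
 have "i \<in> parity (a \<otimes>\<^bsub>G\<^esub> cls (petal j)) \<longleftrightarrow> i \<in> insert j B" for i
 proof (cases "i < r")
  case True
  have "i \<in> parity (a \<otimes>\<^bsub>G\<^esub> cls (petal j)) \<longleftrightarrow> odd (wnum i a + of_bool (i = j))"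
   using True wnum_mult[OF a(1) g True] wnum_gen[OF True j] by (simp add: parity_def)
  moreover have "i \<in> B \<longleftrightarrow> odd (wnum i a)" using True a(2) by (auto simp: parity_def)
  ultimately show ?thesis using \<open>j \<notin> B\<close> by (cases "i = j") simp_all
 next
  case False
  then have "i \<notin> insert j B" using insert.prems by auto
  then show ?thesis using False by (simp add: parity_def)
 qed
 then have "parity (a \<otimes>\<^bsub>G\<^esub> cls (petal j)) = insert j B" by blast
 then show ?case using a g by (intro bexI[of _ "a \<otimes>\<^bsub>G\<^esub> cls (petal j)"]) auto
qed

text \<open>The parity of a product of generators and inverses depends only on the set of generators
  that occur an odd number of times, so at most \<open>2 ^ card S\<close> parities occur. All
  \<open>2 ^ r\<close> subsets do occur.\<close>

lemma card_generating_set: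
 assumes S: "S \<subseteq> carrier G" "finite S" "generate G S = carrier G"
 shows "r \<le> card S"
proof -
 \<comment> \<open>The parity of a product of the elements of \<open>T\<close>. Multiplication of
   group elements corresponds to the symmetric difference of the sets \<open>T\<close>.\<close>
 define F where "F T = {i. i < r \<and> odd (card {s \<in> T. i \<in> parity s})}" for T
 have par: "\<exists>T\<subseteq>S. parity a = F T" if "a \<in> generate G S" for a
  using that
 proof (induction rule: generate.induct)
  case one
  then show ?case using wnum_one by (intro exI[of _ "{}"]) (auto simp: F_def parity_def)
 next
  case (incl a)
  have "{s \<in> {a}. i \<in> parity s} = (if i \<in> parity a then {a} else {})" for i by auto
  then have "parity a = F {a}" unfolding F_def by (auto simp: parity_def)
  then show ?case using incl by (intro exI[of _ "{a}"]) auto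
 next
  case (inv a)
  have "{s \<in> {a}. i \<in> parity s} = (if i \<in> parity a then {a} else {})" for i by auto
  then have "parity a = F {a}" unfolding F_def by (auto simp: parity_def)
  moreover have "parity (inv\<^bsub>G\<^esub> a) = parity a" using inv S(1) wnum_inv by (auto simp: parity_def)
  ultimately show ?case using inv by (intro exI[of _ "{a}"]) auto
 next
  case (eng a b)
  then obtain T U where T: "T \<subseteq> S" "parity a = F T" and U: "U \<subseteq> S" "parity b = F U" by auto
  have fin: "finite T" "finite U" using finite_subset[OF T(1) S(2)] finite_subset[OF U(1) S(2)] by auto
  have ab: "a \<in> carrier G" "b \<in> carrier G" using eng S(3) by auto
  have parT: "i < r ==> odd (wnum i c) \<longleftrightarrow> odd (card {s \<in> V. i \<in> parity s})" if "parity c = F V" for c V i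
   using that unfolding parity_def[of c] F_def by blast
  have "odd (card {s \<in> (T - U) \<union> (U - T). i \<in> parity s}) \<longleftrightarrow>
    odd (card {s \<in> T. i \<in> parity s} + card {s \<in> U. i \<in> parity s})" for i
  proof -
   let ?A = "{s \<in> T. i \<in> parity s}" and ?B = "{s \<in> U. i \<in> parity s}"
   have "{s \<in> (T - U) \<union> (U - T). i \<in> parity s} = (?A - ?B) \<union> (?B - ?A)" by auto
   moreover have "card ((?A - ?B) \<union> (?B - ?A)) = card (?A - ?B) + card (?B - ?A)"
    by (rule card_Un_disjoint) (use fin in auto)
   moreover have "card ?A = card (?A - ?B) + card (?A \<inter> ?B)" "card ?B = card (?B - ?A) + card (?A \<inter> ?B)"
    using card_Int_Diff[of ?A ?B] card_Int_Diff[of ?B ?A] fin by (simp_all add: Int_commute)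
   ultimately show ?thesis by simp argo
  qed
  note key = this
  have "parity (a \<otimes>\<^bsub>G\<^esub> b) = F ((T - U) \<union> (U - T))"
  proof (rule Set.set_eqI)
   fix i
   show "i \<in> parity (a \<otimes>\<^bsub>G\<^esub> b) \<longleftrightarrow> i \<in> F ((T - U) \<union> (U - T))"
   proof (cases "i < r")
    case True
    have "i \<in> parity (a \<otimes>\<^bsub>G\<^esub> b) \<longleftrightarrow> odd (wnum i a + wnum i b)"
     using True wnum_mult[OF ab True] by (simp add: parity_def)
    also have "\<dots> \<longleftrightarrow> odd (card {s \<in> T. i \<in> parity s} + card {s \<in> U. i \<in> parity s})"
     using parT[OF T(2) True] parT[OF U(2) True] by simp
    also have "\<dots> \<longleftrightarrow> odd (card {s \<in> (T - U) \<union> (U - T). i \<in> parity s})" by (rule key[symmetric])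
    finally show ?thesis unfolding F_def using True by blast
   next
    case False
    then show ?thesis by (simp add: parity_def F_def)
   qed
  qed
  then show ?case using T U by (intro exI[of _ "(T - U) \<union> (U - T)"]) auto
 qed
 have "Pow {..<r} \<subseteq> F ` Pow S"
 proof
  fix B assume "B \<in> Pow {..<r}"
  then obtain a where "a \<in> carrier G" "parity a = B" using parity_subset_attained by blast
  then show "B \<in> F ` Pow S" using par[of a] S(3) by auto
 qed
 then have "card (Pow {..<r}) \<le> card (F ` Pow S)" using S(2) by (intro card_mono) auto
 also have "\<dots> \<le> card (Pow S)" using S(2) by (intro card_image_le) auto
 finally have "2 ^ r \<le> (2::nat) ^ card S" using S(2) by (simp add: card_Pow)
 then show ?thesis by simp
qed

lemma has_rank_pi1_rose: "has_rank G r"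
proof -
 have "inj_on (%i. cls (petal i)) {..<r}"
 proof (rule inj_onI)
  fix i j assume "i \<in> {..<r}" "j \<in> {..<r}" "cls (petal i) = cls (petal j)"
  then show "i = j" using wnum_gen[of i i] wnum_gen[of i j] by (auto split: if_splits)
 qed
 then have "card gens = r" by (simp add: card_image)
 then show ?thesis
  unfolding has_rank_def using gens_carrier generate_gens card_generating_set
  by (intro conjI exI[of _ gens]) auto
qed

end

section \<open>Markings of subdivided roses\<close>

lemma phe_compose:
 assumes f: "pointed_homotopy_equivalence X x Y y f" and g: "pointed_homotopy_equivalence Y y Z z g"
 shows "pointed_homotopy_equivalence X x Z z (g \<circ> f)"
proof -
 obtain f' where f': "continuous_map X Y f" "f x = y" "continuous_map Y X f'" "f' y = x"
  "homotopic_with (%h. h x = x) X X (f' \<circ> f) id" "homotopic_with (%h. h y = y) Y Y (f \<circ> f') id"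
  using f unfolding pointed_homotopy_equivalence_def by blast
 obtain g' where g': "continuous_map Y Z g" "g y = z" "continuous_map Z Y g'" "g' z = y"
  "homotopic_with (%h. h y = y) Y Y (g' \<circ> g) id" "homotopic_with (%h. h z = z) Z Z (g \<circ> g') id"
  using g unfolding pointed_homotopy_equivalence_def by blast
 have "homotopic_with (%h. h x = y) X Y ((g' \<circ> g) \<circ> f) (id \<circ> f)"
  by (rule homotopic_with_compose_continuous_map_right[OF g'(5) f'(1)]) (use f' in auto)
 then have "homotopic_with (%h. h x = x) X X (f' \<circ> ((g' \<circ> g) \<circ> f)) (f' \<circ> (id \<circ> f))"
  by (rule homotopic_with_compose_continuous_map_left[OF _ f'(3)]) (use f' in auto)
 then have 1: "homotopic_with (%h. h x = x) X X ((f' \<circ> g') \<circ> (g \<circ> f)) id"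
  using homotopic_with_trans[OF _ f'(5)] by (simp add: o_assoc)
 have "homotopic_with (%h. h z = y) Z Y ((f \<circ> f') \<circ> g') (id \<circ> g')"
  by (rule homotopic_with_compose_continuous_map_right[OF f'(6) g'(3)]) (use g' in auto)
 then have "homotopic_with (%h. h z = z) Z Z (g \<circ> ((f \<circ> f') \<circ> g')) (g \<circ> (id \<circ> g'))"
  by (rule homotopic_with_compose_continuous_map_left[OF _ g'(1)]) (use g' in auto)
 then have 2: "homotopic_with (%h. h z = z) Z Z ((g \<circ> f) \<circ> (f' \<circ> g')) id"
  using homotopic_with_trans[OF _ g'(6)] by (simp add: o_assoc)
 show ?thesis
  unfolding pointed_homotopy_equivalence_def
  using f' g' 1 2 by (auto intro!: exI[of _ "f' \<circ> g'"] intro: continuous_map_compose)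
qed

lemma phe_homotopic:
 assumes f: "pointed_homotopy_equivalence X x Y y f" and h: "homotopic_with (%h. h x = y) X Y f f2"
 shows "pointed_homotopy_equivalence X x Y y f2"
proof -
 obtain f' where f': "continuous_map X Y f" "f x = y" "continuous_map Y X f'" "f' y = x"
  "homotopic_with (%h. h x = x) X X (f' \<circ> f) id" "homotopic_with (%h. h y = y) Y Y (f \<circ> f') id"
  using f unfolding pointed_homotopy_equivalence_def by blast
 have h': "homotopic_with (%h. h x = y) X Y f2 f" by (rule homotopic_with_symD[OF h])
 have "homotopic_with (%h. h x = x) X X (f' \<circ> f2) (f' \<circ> f)"
  by (rule homotopic_with_compose_continuous_map_left[OF h' f'(3)]) (use f' in auto)
 from homotopic_with_trans[OF this f'(5)] have 1: "homotopic_with (%h. h x = x) X X (f' \<circ> f2) id" .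
 have "homotopic_with (%h. h y = y) Y Y (f2 \<circ> f') (f \<circ> f')"
  by (rule homotopic_with_compose_continuous_map_right[OF h' f'(3)]) (use f' in auto)
 from homotopic_with_trans[OF this f'(6)] have 2: "homotopic_with (%h. h y = y) Y Y (f2 \<circ> f') id" .
 show ?thesis
  unfolding pointed_homotopy_equivalence_def
  using f' 1 2 homotopic_with_imp_continuous_maps[OF h] homotopic_with_imp_property[OF h] by blast
qed

lemma phe_homeomorphic:
 assumes h: "homeomorphic_maps X Y g h" and x: "x \<in> topspace X" "g x = y"
 shows "pointed_homotopy_equivalence X x Y y g"
proof -
 have *: "continuous_map X Y g" "continuous_map Y X h" "!!z. z \<in> topspace X ==> h (g z) = z"
  "!!z. z \<in> topspace Y ==> g (h z) = z"
  using h by (auto simp: homeomorphic_maps_def)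
 have y: "h y = x" using * x by auto
 have "homotopic_with (%h. h x = x) X X (h \<circ> g) id" "homotopic_with (%h. h y = y) Y Y (g \<circ> h) id"
  using * x y by (auto intro!: homotopic_with_equal intro: continuous_map_compose)
 then show ?thesis unfolding pointed_homotopy_equivalence_def using * x y by blast
qed

text \<open>Out along the stem, once around the circle and back. The bracketing assigns the
  parameter intervals from 0 to 1/2, from 1/2 to 3/4 and from 3/4 to 1.\<close>

definition lollipop :: "nat => nat => nat => real => gpoint" where
 "lollipop n k j = loop_concat (edge_pt (Gnk n k) (n + j))
   (loop_concat (edge_pt (Gnk n k) (n + k + j)) (rev_path (edge_pt (Gnk n k) (n + j))))"

lemma lollipop:
 assumes "j < k"
 shows "pathin (space_of (Gnk n k)) (lollipop n k j)"
  and "0 \<le> t ==> t \<le> 1 ==> lollipop n k j (t / 2) = edge_pt (Gnk n k) (n + j) t"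
  and "0 \<le> t ==> t \<le> 1 ==> lollipop n k j (1/2 + t / 4) = edge_pt (Gnk n k) (n + k + j) t"
  and "0 \<le> t ==> t \<le> 1 ==> lollipop n k j (1 - t / 4) = edge_pt (Gnk n k) (n + j) t"
proof -
 have p: "pathin (space_of (Gnk n k)) (edge_pt (Gnk n k) e)" if "e < n + k + k" for e
  unfolding pathin_def by (rule continuous_map_edge_pt) (use that in auto)
 show "pathin (space_of (Gnk n k)) (lollipop n k j)"
  unfolding lollipop_def using assms
  by (intro pathin_concat pathin_rev p) (auto simp: src_Gnk tgt_Gnk)
 show "lollipop n k j (t / 2) = edge_pt (Gnk n k) (n + j) t" if "0 \<le> t" "t \<le> 1"
  using that by (simp add: lollipop_def loop_concat_def)
 show "lollipop n k j (1/2 + t / 4) = edge_pt (Gnk n k) (n + k + j) t" if "0 \<le> t" "t \<le> 1"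
 proof (cases "t = 0")
  case True
  then show ?thesis using assms by (simp add: lollipop_def loop_concat_def src_Gnk tgt_Gnk)
 next
  case False
  have "2 * (2 * (1/2 + t / 4) - 1) = t" "2 * (1/2 + t / 4) - 1 \<le> 1/2" "\<not> 1/2 + t / 4 \<le> 1/2"
   using that False by (auto simp: field_simps)
  then show ?thesis unfolding lollipop_def loop_concat_def by (simp only: if_True if_False)
 qed
 show "lollipop n k j (1 - t / 4) = edge_pt (Gnk n k) (n + j) t" if "0 \<le> t" "t \<le> 1"
 proof (cases "t = 1")
  case True
  then show ?thesis using assms by (simp add: lollipop_def loop_concat_def src_Gnk tgt_Gnk)
 next
  case False
  have "1 - (2 * (2 * (1 - t / 4) - 1) - 1) = t" "\<not> 2 * (1 - t / 4) - 1 \<le> 1/2" "\<not> 1 - t / 4 \<le> 1/2"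
   using that False by (auto simp: field_simps)
  then show ?thesis unfolding lollipop_def loop_concat_def rev_path_def by (simp only: if_True if_False)
 qed
qed

text \<open>A homotopy inverse of the marking that collapses the stems: the petal of the
  \<open>j\<close>-th circle goes to the loop that reaches this circle along its stem.\<close>

definition unmark :: "nat => nat => gpoint => gpoint" where
 "unmark n k y = (case y of Vert v => Vert 0
   | Inner i t => if i < n then Inner i t else lollipop n k (i - n) t)"

lemma unmark_petal:
 assumes "0 \<le> t" "t \<le> 1"
 shows "i < n ==> unmark n k (petal i t) = edge_pt (Gnk n k) i t"
  and "j < k ==> unmark n k (petal (n + j) t) = lollipop n k j t"
proof -
 have "t = 0 \<or> t = 1 \<or> (0 < t \<and> t < 1)" using assms by linarith
 moreover have "lollipop n k j 0 = Vert 0" "lollipop n k j 1 = Vert 0" if "j < k"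
  using lollipop(2)[OF that, of 0 n] lollipop(4)[OF that, of 0 n] that by (simp_all add: src_Gnk)
 ultimately show "i < n ==> unmark n k (petal i t) = edge_pt (Gnk n k) i t"
  "j < k ==> unmark n k (petal (n + j) t) = lollipop n k j t"
  by (auto simp: unmark_def petal_Inner src_Gnk tgt_Gnk)
qed

text \<open>One composite contracts the stems and inserts them as tails of the circles, which is
  undone by letting the stems grow back; the other is a reparametrization of every petal.\<close>

lemma phe_Fmap_0:
 "pointed_homotopy_equivalence (space_of (Gnk n k)) (Vert 0) (space_of (rose (n + k))) (Vert 0) (Fmap n k (%_. 0))"
proof -
 let ?G = "Gnk n k" and ?R = "rose (n + k)" and ?F = "Fmap n k (%_. 0)" and ?s = "unmark n k"
 let ?sq = "{0..1::real} \<times> {0..1::real}"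
 have rose_cases: "i < n \<or> (\<exists>j<k. i = n + j)" if "i < n + k" for i
  using that by (metis add_less_cancel_left le_add_diff_inverse not_le)
 have conts: "continuous_map (space_of ?R) (space_of ?G) ?s"
  unfolding continuous_map_space_of_iff[OF finite_graph_rose]
 proof (intro conjI ballI)
  fix e assume "e \<in> edges ?R"
  then have e: "e < n + k" by simp
  from rose_cases[OF this] show "continuous_map I01 (space_of ?G) (%s. ?s (edge_pt ?R e s))"
  proof
   assume "e < n"
   have "continuous_map I01 (space_of ?G) (edge_pt ?G e)" by (rule continuous_map_edge_pt) (use e in auto)
   then show ?thesis by (rule continuous_map_eq) (use \<open>e < n\<close> in \<open>auto simp: edge_pt_rose unmark_petal\<close>)
  next
   assume "\<exists>j<k. e = n + j"
   then obtain j where j: "j < k" "e = n + j" by blast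
   show ?thesis
    by (rule continuous_map_eq[OF lollipop(1)[OF j(1), unfolded pathin_def]])
     (use j in \<open>auto simp: edge_pt_rose unmark_petal\<close>)
  qed
 qed (auto simp: unmark_def)
 have s0: "?s (Vert 0) = Vert 0" by (simp add: unmark_def)
 have sF: "?s (?F (edge_pt ?G e s)) = (if e < n then edge_pt ?G e s else if e < n + k then Vert 0
   else lollipop n k (e - (n + k)) s)" if "e < n + k + k" "s \<in> {0..1}" for e s
  using that(1)
  by (cases rule: Gnk_edge_cases)
   (use that(2) in \<open>auto simp: Fmap_edge_pt unmark_petal s0 simp del: edge_pt_simps\<close>)
 define V where "V t v = (if v = 0 then Vert 0 else edge_pt ?G (n + (v - 1)) t)" for t v
 \<comment> \<open>At time \<open>t\<close> the circle traverses the lollipop from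
   \<open>t/2\<close> to \<open>1 - t/4\<close>, and both of these points lie at position
   \<open>t\<close> on the stem. So the tail shrinks while the stem grows, until only the circle
   itself is left at \<open>t = 1\<close>.\<close>
 define E where "E e t s = (if e < n then edge_pt ?G e s else if e < n + k then edge_pt ?G e (t * s)
   else lollipop n k (e - (n + k)) (t / 2 + s * (1 - t / 4 - t / 2)))" for e and t s :: real
 have circ_arg: "t / 2 + s * (1 - t / 4 - t / 2) \<in> {0..1}" if "t \<in> {0..1}" "s \<in> {0..1}" for t s :: real
 proof -
  have t: "0 \<le> t" "t \<le> 1" using that by auto
  define d where "d = s * (1 - t / 4 - t / 2)"
  have d0: "0 \<le> d" unfolding d_def using that by (intro mult_nonneg_nonneg) auto
  have d1: "d \<le> 1 - t / 4 - t / 2" unfolding d_def by (rule mult_left_le_one_le) (use that in auto)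
  have "0 \<le> t / 2 + d" using t d0 by linarith
  moreover have "t / 2 + d \<le> 1" using t d1 by linarith
  ultimately show ?thesis by (simp add: d_def)
 qed
 have ends: "E e t 0 = V t (src ?G e) \<and> E e t 1 = V t (tgt ?G e)" if "e < n + k + k" "t \<in> {0..1}" for e t
  using that(1)
 proof (cases rule: Gnk_edge_cases)
  case (3 j)
  have "E e t 0 = lollipop n k j (t / 2)" "E e t 1 = lollipop n k j (1 - t / 4)" using 3 by (simp_all add: E_def)
  then show ?thesis using 3 that(2) by (simp add: lollipop V_def src_Gnk tgt_Gnk)
 qed (auto simp: E_def V_def src_Gnk tgt_Gnk)
 have hom1: "homotopic_with (%h. h (Vert 0) = Vert 0) (space_of ?G) (space_of ?G) (?s \<circ> ?F) id"
 proof (rule homotopic_withI)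
  show "continuous_map (prod_topology I01 (space_of ?G)) (space_of ?G)
    (%(t, y). case y of Vert v => V t v | Inner e s => E e t s)"
  proof (rule continuous_map_edgewise_homotopy[OF finite_graph_Gnk])
   fix v assume v: "v \<in> verts ?G"
   show "continuous_map I01 (space_of ?G) (%t. V t v)"
   proof (cases "v = 0")
    case True
    then show ?thesis by (simp add: V_def)
   next
    case False
    have "continuous_map I01 (space_of ?G) (edge_pt ?G (n + (v - 1)))"
     by (rule continuous_map_edge_pt) (use v False in auto)
    then show ?thesis using False by (simp add: V_def[abs_def])
   qed
  next
   fix e assume "e \<in> edges ?G"
   then have e: "e < n + k + k" by simp
   have ce: "continuous_map I01 (space_of ?G) (edge_pt ?G e)" by (rule continuous_map_edge_pt) (use e in auto)
   from e show "continuous_map (top_of_set ?sq) (space_of ?G) (%(t, s). E e t s)"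
   proof (cases rule: Gnk_edge_cases)
    case 1
    have "continuous_map (top_of_set ?sq) I01 snd"
     by (auto simp: continuous_map_subtopology_eu intro!: continuous_intros)
    from continuous_map_compose[OF this ce] show ?thesis using 1 by (simp add: E_def o_def case_prod_unfold)
   next
    case (2 j)
    have "continuous_map (top_of_set ?sq) I01 (%z. fst z * snd z)"
     by (auto simp: continuous_map_subtopology_eu mult_le_one intro!: continuous_intros)
    from continuous_map_compose[OF this ce] show ?thesis using 2 by (simp add: E_def o_def case_prod_unfold)
   next
    case (3 j)
    have "continuous_map (top_of_set ?sq) I01 (%z. fst z / 2 + snd z * (1 - fst z / 4 - fst z / 2))"
     unfolding continuous_map_subtopology_eu using circ_arg
     by (auto intro!: continuous_intros simp del: atLeastAtMost_iff)
    from continuous_map_compose[OF this lollipop(1)[OF 3(1), unfolded pathin_def]] show ?thesis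
     using 3 by (simp add: E_def o_def case_prod_unfold)
   qed
   fix t :: real assume t: "t \<in> {0..1}"
   show "E e t 0 = V t (src ?G e)" "E e t 1 = V t (tgt ?G e)" using ends[OF e t] by auto
  qed
  fix y assume "y \<in> topspace (space_of ?G)"
  then have y: "y \<in> points ?G" by simp
  from y show "(case y of Vert v => V 0 v | Inner e s => E e 0 s) = (?s \<circ> ?F) y"
  proof (cases rule: points_cases)
   case (1 v)
   then show ?thesis by (cases v) (auto simp: V_def s0 src_Gnk)
  next
   case (2 e s)
   then have e: "e < n + k + k" and s: "s \<in> {0..1}" by auto
   have "(?s \<circ> ?F) y = ?s (?F (edge_pt ?G e s))" using 2 by simp
   moreover from e have "E e 0 s = ?s (?F (edge_pt ?G e s))"
    unfolding sF[OF e s] by (cases rule: Gnk_edge_cases) (auto simp: E_def src_Gnk)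
   ultimately show ?thesis using 2 by simp
  qed
  from y show "(case y of Vert v => V 1 v | Inner e s => E e 1 s) = id y"
  proof (cases rule: points_cases)
   case (1 v)
   then show ?thesis by (cases v) (auto simp: V_def tgt_Gnk)
  next
   case (2 e s)
   then have e: "e < n + k + k" and s: "0 \<le> s" "s \<le> 1" by auto
   from e have "E e 1 s = edge_pt ?G e s"
   proof (cases rule: Gnk_edge_cases)
    case (3 j)
    have "(1::real) / 2 + s * (1 - 1 / 4 - 1 / 2) = 1/2 + s / 4" by simp
    then show ?thesis using 3 lollipop(3)[OF 3(1) s] by (simp only: E_def) simp
   qed (auto simp: E_def)
   then show ?thesis using 2 by simp
  qed
 qed (auto simp: V_def)
 \<comment> \<open>The lift of the composite on petal \<open>i\<close>. A lollipop rests at the base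
   vertex on its stem, so the lift rises from 0 to 1 between 1/2 and 3/4 and is constant
   elsewhere.\<close>
 define c where "c i t = (if i < n then t else max 0 (min 1 (4 * t - 2)))" for i and t :: real
 have Fs: "?F (?s (petal i t)) = petal i (c i t)" if i: "i < n + k" and t: "t \<in> {0..1}" for i t
  using rose_cases[OF i]
 proof
  assume "i < n"
  then show ?thesis using t by (simp add: unmark_petal Fmap_edge_pt c_def del: edge_pt_simps)
 next
  assume "\<exists>j<k. i = n + j"
  then obtain j where j: "j < k" "i = n + j" by blast
  consider "t \<le> 1/2" | "1/2 \<le> t" "t \<le> 3/4" | "3/4 \<le> t" by linarith
  then have "?F (lollipop n k j t) = petal (n + j) (max 0 (min 1 (4 * t - 2)))"
  proof cases
   case 1
   then show ?thesis using lollipop(2)[OF j(1), of "2 * t" n] t j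
    by (simp add: Fmap_edge_pt max_absorb1 min_absorb2 del: edge_pt_simps)
  next
   case 2
   have "1/2 + (4 * t - 2) / 4 = t" by (simp add: field_simps)
   then have "lollipop n k j t = edge_pt ?G (n + k + j) (4 * t - 2)"
    using lollipop(3)[OF j(1), of "4 * t - 2" n] 2 by simp
   then show ?thesis using 2 j
    by (simp add: Fmap_edge_pt max_absorb2 min_absorb2 del: edge_pt_simps)
  next
   case 3
   have "1 - (4 - 4 * t) / 4 = t" by (simp add: field_simps)
   then have "lollipop n k j t = edge_pt ?G (n + j) (4 - 4 * t)"
    using lollipop(4)[OF j(1), of "4 - 4 * t" n] 3 t by simp
   then show ?thesis using 3 t j
    by (simp add: Fmap_edge_pt max_absorb2 min_absorb1 del: edge_pt_simps)
  qed
  then show ?thesis using j t by (simp add: unmark_petal c_def)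
 qed
 have hom2: "homotopic_with (%h. h (Vert 0) = Vert 0) (space_of ?R) (space_of ?R) (?F \<circ> ?s) id"
 proof (rule homotopic_withI)
  let ?E = "%i t s. petal i ((1 - t) * c i s + t * s)"
  show "continuous_map (prod_topology I01 (space_of ?R)) (space_of ?R)
    (%(t, y). case y of Vert v => Vert 0 | Inner i s => ?E i t s)"
  proof (rule continuous_map_edgewise_homotopy[OF finite_graph_rose])
   fix e assume "e \<in> edges ?R"
   then have e: "e < n + k" by simp
   have "continuous_map (top_of_set ?sq) (space_of ?R) (%z. petal e ((1 - fst z) * c e (snd z) + fst z * snd z))"
    by (rule continuous_map_petal[OF _ e], cases "e < n") (auto simp: c_def intro!: continuous_intros)
   then show "continuous_map (top_of_set ?sq) (space_of ?R) (%(t, s). ?E e t s)" by (simp add: case_prod_unfold)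
  qed (auto simp: c_def)
  fix y assume "y \<in> topspace (space_of ?R)"
  then have y: "y \<in> points ?R" by simp
  from y show "(case y of Vert v => Vert 0 | Inner i s => ?E i 0 s) = (?F \<circ> ?s) y"
  proof (cases rule: points_cases)
   case (2 e s)
   then have "petal e s = Inner e s" by (simp add: petal_Inner)
   then show ?thesis using Fs[of e s] 2 by simp
  qed (simp add: s0)
  from y show "(case y of Vert v => Vert 0 | Inner i s => ?E i 1 s) = id y"
   by (cases rule: points_cases) (auto simp: petal_Inner)
 qed auto
 show ?thesis
  unfolding pointed_homotopy_equivalence_def
  using continuous_map_Fmap conts hom1 hom2 s0 by (intro conjI exI[of _ ?s]) auto
qed

lemma phe_Fmap:
 "pointed_homotopy_equivalence (space_of (Gnk n k)) (Vert 0) (space_of (rose (n + k))) (Vert 0) (Fmap n k x)"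
proof (rule phe_homotopic[OF phe_Fmap_0])
 show "homotopic_with (%h. h (Vert 0) = Vert 0) (space_of (Gnk n k)) (space_of (rose (n + k))) (Fmap n k (%_. 0)) (Fmap n k x)"
  using Fmap_homotopic_False[of n k "%_. 0" x] unfolding htpy_rel_alt
  by (rule homotopic_with_mono) (simp add: rel_circles_def)
qed

lemma Fmap_kappa:
 "j < k ==> Fmap n k x (kappa n k j z) = petal (n + j) (x j + Arg2pi z / (2 * pi))"
proof -
 assume j: "j < k"
 have "Arg2pi z / (2 * pi) \<in> {0..1}"
  using Arg2pi_ge_0[of z] Arg2pi_lt_2pi[of z] by (simp add: field_simps)
 then show ?thesis using j by (simp add: kappa_def Fmap_edge_pt del: edge_pt_simps)
qed

text \<open>Every edge of the dual graph contains the node of the common point \<open>c\<close>, so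
  the graph is a star. Three consecutive edges of a cycle have no common node.\<close>

lemma forest_dual_adj:
 assumes "!!i j p. i < k ==> j < k ==> i \<noteq> j ==> p \<in> S i ==> p \<in> S j ==> p = c"
 shows "forest (dual_adj k S)"
 unfolding forest_def
proof
 assume "\<exists>xs. 3 \<le> length xs \<and> distinct xs \<and> (\<forall>i<length xs. dual_adj k S (xs ! i) (xs ! (Suc i mod length xs)))"
 then obtain xs where xs: "3 \<le> length xs" "distinct xs"
  "!!i. i < length xs ==> dual_adj k S (xs ! i) (xs ! (Suc i mod length xs))" by blast
 have adj: "Inr c \<in> {y, z}" if "dual_adj k S y z" for y z
  using that assms unfolding dual_adj_def by (metis insert_iff)
 have l: "0 < length xs" "1 < length xs" "2 < length xs" using xs(1) by auto
 have m: "Suc 0 mod length xs = 1" "Suc 1 mod length xs = 2" "Suc 2 = 3" using l by simp_all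
 have a: "Inr c \<in> {xs ! 0, xs ! 1}" using adj[OF xs(3)[OF l(1)]] unfolding m .
 have b: "Inr c \<in> {xs ! 1, xs ! 2}" using adj[OF xs(3)[OF l(2)]] unfolding m .
 have d: "Inr c \<in> {xs ! 2, xs ! (3 mod length xs)}" using adj[OF xs(3)[OF l(3)]] unfolding m .
 have ne: "xs ! 0 \<noteq> xs ! 1" "xs ! 0 \<noteq> xs ! 2" "xs ! 1 \<noteq> xs ! 2"
  using nth_eq_iff_index_eq[OF xs(2) l(1,2)] nth_eq_iff_index_eq[OF xs(2) l(1,3)]
   nth_eq_iff_index_eq[OF xs(2) l(2,3)] by simp_all
 have m3: "3 mod length xs \<noteq> 1" using xs(1) by (cases "length xs = 3") auto
 have m3': "3 mod length xs < length xs" by (rule mod_less_divisor[OF l(1)])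
 have "xs ! 1 \<noteq> xs ! (3 mod length xs)"
  using nth_eq_iff_index_eq[OF xs(2) l(2) m3'] m3 by simp
 then show False using a b d ne by auto
qed

section \<open>Subdivided roses carry marked graphs\<close>

context subdivided_rose
begin

lemma h_inverse:
 obtains g where "homeomorphic_maps (space_of \<Gamma>) (space_of R) h g"
  "continuous_map (space_of R) (space_of \<Gamma>) g" "!!y. y \<in> points \<Gamma> ==> g (h y) = y"
  "!!y. y \<in> points R ==> h (g y) = y" "!!y. y \<in> points R ==> g y \<in> points \<Gamma>" "g (Vert 0) = base_pt \<Gamma>"
proof -
 obtain g where g: "homeomorphic_maps (space_of \<Gamma>) (space_of R) h g"
  using homeo by (auto simp: homeomorphic_map_maps)
 then have *: "continuous_map (space_of R) (space_of \<Gamma>) g" "!!y. y \<in> points \<Gamma> ==> g (h y) = y"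
  "!!y. y \<in> points R ==> h (g y) = y"
  by (auto simp: homeomorphic_maps_def top\<Gamma>)
 moreover have "g y \<in> points \<Gamma>" if "y \<in> points R" for y
  using *(1) that by (auto simp: continuous_map_def top\<Gamma>)
 moreover have "base_pt \<Gamma> \<in> points \<Gamma>" using fin\<Gamma> by (simp add: base_pt_def finite_graph_def)
 then have "g (Vert 0) = base_pt \<Gamma>" using *(2)[of "base_pt \<Gamma>"] h_base by simp
 ultimately show ?thesis using that g by blast
qed

lemma connectedin_petal: "i < n + k ==> connected S ==> connectedin (space_of R) (petal i ` S)"
 by (rule connectedin_continuous_map_image[of euclideanreal])
  (use continuous_map_petal[OF continuous_map_id, of i "n + k"] in \<open>auto simp: id_def\<close>)

text \<open>The two remaining arcs of petal \<open>i\<close> and all other petals are connected and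
  contain the base vertex. This is what excludes separating edges.\<close>

lemma connected_rose_minus_gap:
 assumes "i < n + k" "0 \<le> a" "b \<le> 1" "a < b"
 shows "connectedin (space_of R) (points R - petal i ` {a<..<b})"
proof -
 define C where "C = insert (petal i ` {0..a}) (insert (petal i ` {b..1}) ((%j. range (petal j)) ` ({..<n+k} - {i})))"
 have V0: "Vert 0 \<in> range (petal j)" for j by (metis petal_0 rangeI)
 have "connectedin (space_of R) (\<Union>C)"
 proof (rule connectedin_Union)
  show "connectedin (space_of R) S" if "S \<in> C" for S
   using that assms(1) connectedin_petal by (auto simp: C_def)
  have "Vert 0 \<in> \<Inter>C"
   using V0 assms by (auto simp: C_def intro: image_eqI[of _ _ 0] image_eqI[of _ _ 1])
  then show "\<Inter>C \<noteq> {}" by blast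
 qed
 moreover have "\<Union>C = points R - petal i ` {a<..<b}"
 proof
  show "\<Union>C \<subseteq> points R - petal i ` {a<..<b}"
  proof -
   have *: "0 < t" "t < 1" "t \<notin> \<int>" if "t \<in> {a<..<b}" for t
    using that assms Ints_between_0_1[of t] by auto
   have "petal i s \<noteq> petal i t" if "s \<in> {0..a} \<union> {b..1}" "t \<in> {a<..<b}" for s t
   proof (cases "s = 0 \<or> s = 1")
    case True
    then show ?thesis using *(3)[OF that(2)] petal_eq_Vert_iff[of i t 0] by auto
   next
    case False
    then have "0 < s" "s < 1" using that assms by auto
    then show ?thesis using *[OF that(2)] that by (auto simp: petal_Inner)
   qed
   moreover have "petal j s \<noteq> petal i t" if "j \<noteq> i" "t \<in> {a<..<b}" for j s t
    using *(3)[OF that(2)] that(1) by (simp add: petal_eq_petal_neq)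
   ultimately show ?thesis using assms(1) by (auto simp: C_def petal_in_points)
  qed
  show "points R - petal i ` {a<..<b} \<subseteq> \<Union>C"
  proof
   fix y assume y: "y \<in> points R - petal i ` {a<..<b}"
   then have "y \<in> points R" by simp
   then show "y \<in> \<Union>C"
   proof (cases rule: rose_point_cases)
    case 1
    have "Vert 0 = petal i 0" by simp
    then show ?thesis using 1 assms by (auto simp: C_def intro!: image_eqI[of _ _ 0])
   next
    case (2 j t)
    show ?thesis
    proof (cases "j = i")
     case True
     then have "t \<notin> {a<..<b}" using y 2 by auto
     then have "t \<in> {0..a} \<or> t \<in> {b..1}" using 2 by auto
     then show ?thesis using 2 True by (auto simp: C_def)
    next
     case False
     then have "range (petal j) \<in> C" using 2 by (auto simp: C_def)
     then show ?thesis using 2(4) by blast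
    qed
   qed
  qed
 qed
 ultimately show ?thesis by simp
qed

lemma nonseparating:
 assumes e: "e \<in> edges \<Gamma>" shows "\<not> separating \<Gamma> e"
proof -
 obtain g where g: "continuous_map (space_of R) (space_of \<Gamma>) g" "!!y. y \<in> points \<Gamma> ==> g (h y) = y"
  "!!y. y \<in> points R ==> h (g y) = y" "!!y. y \<in> points R ==> g y \<in> points \<Gamma>"
  using h_inverse by metis
 obtain i a b where eg: "edge_gap e i a b" using edge_gap_exists[OF e] by blast
 then have gp: "gap i a b" and img: "h ` open_edge e = petal i ` {a<..<b}" by (auto simp: edge_gap_def)
 have "connectedin (space_of R) (points R - petal i ` {a<..<b})"
  by (rule connected_rose_minus_gap) (use gp gap_bounds[OF gp] in \<open>auto simp: gap_def\<close>)
 from connectedin_continuous_map_image[OF g(1) this]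
 have "connectedin (space_of \<Gamma>) (g ` (points R - petal i ` {a<..<b}))" .
 moreover have "g ` (points R - petal i ` {a<..<b}) = points \<Gamma> - open_edge e"
 proof
  show "g ` (points R - petal i ` {a<..<b}) \<subseteq> points \<Gamma> - open_edge e"
  proof
   fix y assume "y \<in> g ` (points R - petal i ` {a<..<b})"
   then obtain w where w: "w \<in> points R" "w \<notin> petal i ` {a<..<b}" "y = g w" by blast
   have "y \<notin> open_edge e"
   proof
    assume "y \<in> open_edge e"
    then have "h (g w) \<in> petal i ` {a<..<b}" unfolding img[symmetric] w(3) by (rule imageI)
    then show False using g(3)[OF w(1)] w(2) by simp
   qed
   then show "y \<in> points \<Gamma> - open_edge e" using g(4)[OF w(1)] w(3) by simp
  qed
  show "points \<Gamma> - open_edge e \<subseteq> g ` (points R - petal i ` {a<..<b})"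
  proof
   fix y assume y: "y \<in> points \<Gamma> - open_edge e"
   have "open_edge e \<subseteq> points \<Gamma>" using e by (auto simp: open_edge_def)
   then have "h y \<notin> h ` open_edge e" using y inj_on_image_mem_iff[OF inj_h, of y "open_edge e"] by blast
   then have "h y \<in> points R - petal i ` {a<..<b}" using y surj_h img by blast
   moreover have "y = g (h y)" using g(2) y by simp
   ultimately show "y \<in> g ` (points R - petal i ` {a<..<b})" by blast
  qed
 qed
 ultimately show ?thesis by (simp add: separating_def)
qed

lemma graph_\<Gamma>:
 assumes "n + k \<ge> 1" shows "graph \<Gamma>"
proof -
 obtain g where g: "continuous_map (space_of R) (space_of \<Gamma>) g" "!!y. y \<in> points \<Gamma> ==> g (h y) = y"
  "!!y. y \<in> points R ==> g y \<in> points \<Gamma>"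
  using h_inverse by metis
 have V0: "Vert 0 \<in> range (petal j)" for j by (metis petal_0 rangeI)
 have "connectedin (space_of R) (\<Union>j\<in>{..<n+k}. range (petal j))"
 proof (rule connectedin_Union)
  show "\<Inter>((%j. range (petal j)) ` {..<n+k}) \<noteq> {}" using V0 by blast
 qed (use connectedin_petal in auto)
 moreover have "(\<Union>j\<in>{..<n+k}. range (petal j)) = points R"
 proof
  show "points R \<subseteq> (\<Union>j\<in>{..<n+k}. range (petal j))"
  proof
   fix y assume "y \<in> points R"
   then obtain i where "i < n + k" "y \<in> range (petal i)" using rose_point_in_petal[OF _ assms] by metis
   then show "y \<in> (\<Union>j\<in>{..<n+k}. range (petal j))" by blast
  qed
 qed (auto simp: petal_in_points)
 ultimately have "connectedin (space_of R) (points R)" by simp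
 from connectedin_continuous_map_image[OF g(1) this] have "connectedin (space_of \<Gamma>) (g ` points R)" .
 moreover have "g ` points R = points \<Gamma>"
 proof
  show "points \<Gamma> \<subseteq> g ` points R"
  proof
   fix y assume y: "y \<in> points \<Gamma>"
   then have "h y \<in> points R" using surj_h by blast
   then show "y \<in> g ` points R" using g(2)[OF y] by (metis imageI)
  qed
 qed (use g(3) in auto)
 ultimately have "connectedin (space_of \<Gamma>) (topspace (space_of \<Gamma>))" by (simp add: top\<Gamma>)
 then show ?thesis by (simp add: graph_iff fin\<Gamma> connectedin_topspace)
qed

text \<open>All requirements are verified on the rose and transported along \<open>h\<close>. The
  images of the circles are whole petals, which pairwise meet only in the base vertex.\<close>

proposition marked:
 assumes nk: "n + k \<ge> 1" and g: "homeomorphic_maps (space_of \<Gamma>) (space_of R) h g"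
 shows "(\<Gamma>, g \<circ> Fmap n k x) \<in> marked True n k"
proof -
 let ?\<phi> = "g \<circ> Fmap n k x"
 have g': "continuous_map (space_of R) (space_of \<Gamma>) g" "!!y. y \<in> points \<Gamma> ==> g (h y) = y"
  "!!y. y \<in> points R ==> h (g y) = y" using g by (auto simp: homeomorphic_maps_def top\<Gamma>)
 have base_pts: "base_pt \<Gamma> \<in> points \<Gamma>" using fin\<Gamma> by (simp add: base_pt_def finite_graph_def)
 have g0: "g (Vert 0) = base_pt \<Gamma>" using g'(2)[OF base_pts] h_base by simp
 have injg: "inj_on g (points R)" using g'(3) by (rule inj_on_inverseI)
 have pin: "petal (n + j) t \<in> points R" if "j < k" for j t using that by (simp add: petal_in_points)
 have kappa: "?\<phi> (kappa n k j z) = g (petal (n + j) (x j + Arg2pi z / (2 * pi)))" if "j < k" for j z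
  using that by (simp add: Fmap_kappa)
 have img: "(%z. ?\<phi> (kappa n k j z)) ` sphere 0 1 = g ` range (petal (n + j))" if "j < k" for j
 proof -
  have "(%z. ?\<phi> (kappa n k j z)) ` sphere 0 1 = g ` Fmap n k x ` circ n k j"
   unfolding circ_def by (simp add: image_image)
  then show ?thesis using Fmap_circ[OF that] by simp
 qed
 have phe: "pointed_homotopy_equivalence (space_of (Gnk n k)) (Vert 0) (space_of \<Gamma>) (base_pt \<Gamma>) ?\<phi>"
  by (rule phe_compose[OF phe_Fmap phe_homeomorphic]) (use g g0 homeomorphic_maps_sym in auto)
 have common: "p = base_pt \<Gamma>" if ij: "i < k" "j < k" "i \<noteq> j" "p \<in> g ` range (petal (n + i))" "p \<in> g ` range (petal (n + j))" for i j p
 proof -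
  obtain s t where st: "p = g (petal (n + i) s)" "p = g (petal (n + j) t)" using ij(4,5) by blast
  then have "petal (n + i) s = petal (n + j) t" using inj_onD[OF injg] pin[OF ij(1)] pin[OF ij(2)] by metis
  then have "s \<in> \<int>" using ij(3) by (simp add: petal_eq_petal_neq)
  then show ?thesis using st g0 by (simp add: petal_Ints)
 qed
 have emb: "embedding_map S1 (space_of \<Gamma>) (?\<phi> \<circ> kappa n k j)" if j: "j < k" for j
 proof (rule continuous_imp_embedding_map)
  have val: "cis (2 * pi * (x j + Arg2pi z / (2 * pi))) = cis (2 * pi * x j) * z" if "z \<in> sphere 0 1" for z
  proof -
   have "cis (Arg2pi z) = z" using Arg2pi_eq[of z] that by (simp add: cis_conv_exp)
   moreover have "2 * pi * (x j + Arg2pi z / (2 * pi)) = 2 * pi * x j + Arg2pi z" by (simp add: field_simps)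
   ultimately show ?thesis by (simp add: cis_mult[symmetric])
  qed
  \<comment> \<open>The function \<open>Arg2pi\<close> jumps at 1. In terms of angles the map is
    multiplication by the constant \<open>cis (2 * pi * x j)\<close>, which shows continuity and,
    below, injectivity.\<close>
  have "continuous_map S1 (space_of R) (%z. petal (n + j) (x j + Arg2pi z / (2 * pi)))"
   unfolding continuous_map_rose_iff
  proof (intro conjI allI impI)
   fix i assume "i < n + k"
   have "continuous_map S1 euclidean (%z. if i = n + j then cis (2 * pi * x j) * z else 1)"
    by (cases "i = n + j") (auto simp: S1_def intro!: continuous_intros)
   then show "continuous_map S1 euclidean (%z. ang i (petal (n + j) (x j + Arg2pi z / (2 * pi))))"
    by (rule continuous_map_eq) (use val in \<open>auto simp: S1_def\<close>)
  qed (use pin[OF j] in auto)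
  from continuous_map_compose[OF this g'(1)]
  show "continuous_map S1 (space_of \<Gamma>) (?\<phi> \<circ> kappa n k j)"
   using kappa[OF j] by (simp add: o_def)
  show "compact_space S1" by (simp add: S1_def compact_space_subtopology)
  show "Hausdorff_space (space_of \<Gamma>)" by (rule Hausdorff_space_space_of[OF fin\<Gamma>])
  show "inj_on (?\<phi> \<circ> kappa n k j) (topspace S1)"
  proof (rule inj_onI)
   fix z w assume zw: "z \<in> topspace S1" "w \<in> topspace S1" "(?\<phi> \<circ> kappa n k j) z = (?\<phi> \<circ> kappa n k j) w"
   then have "petal (n + j) (x j + Arg2pi z / (2 * pi)) = petal (n + j) (x j + Arg2pi w / (2 * pi))"
    using inj_onD[OF injg] pin[OF j] kappa[OF j] by simp
   then have "cis (2 * pi * (x j + Arg2pi z / (2 * pi))) = cis (2 * pi * (x j + Arg2pi w / (2 * pi)))"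
    by (metis ang_petal_same)
   then show "z = w" using val zw by (simp add: S1_def)
  qed
 qed
 have kap1: "?\<phi> (kappa n k j 1) = g (petal (n + j) (x j))" for j
  by (simp add: kappa_1)
 have vtx: "?\<phi> (kappa n k j 1) \<in> Vert ` verts \<Gamma>" if "j < k" for j
 proof -
  have "petal (n + j) (x j) \<in> h ` Vert ` verts \<Gamma>" using h_verts that by blast
  then obtain v where "v \<in> verts \<Gamma>" "petal (n + j) (x j) = h (Vert v)" by blast
  then show ?thesis unfolding kap1 using g'(2)[of "Vert v"] by simp
 qed
 have val: "2 \<le> valence \<Gamma> v \<and> (valence \<Gamma> v = 2 --> v = base \<Gamma> \<or> True \<and> (\<exists>j<k. Vert v = (?\<phi> \<circ> kappa n k j) 1))"
  if v: "v \<in> verts \<Gamma>" for v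
 proof (cases "v = base \<Gamma>")
  case True
  then show ?thesis using valence_base[OF nk] by simp
 next
  case False
  obtain j where j: "j < k" "h (Vert v) = petal (n + j) (frac (x j))" using vertex_cases[OF v False] by metis
  have "petal (n + j) (frac (x j)) = petal (n + j) (x j)" by (simp add: petal_eq_iff frac_def)
  then have "Vert v = (?\<phi> \<circ> kappa n k j) 1" using j g'(2)[of "Vert v"] v kap1[of j] by simp
  then show ?thesis using valence_nonbase[OF v False] j(1) by auto
 qed
 have inter: "\<exists>p. (?\<phi> \<circ> kappa n k i) ` sphere 0 1 \<inter> (?\<phi> \<circ> kappa n k j) ` sphere 0 1 \<subseteq> {p}"
  if "i < k" "j < k" "i \<noteq> j" for i j
  using common[OF that] img[OF that(1)] img[OF that(2)] by (intro exI[of _ "base_pt \<Gamma>"]) (auto simp: comp_def)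
 have forest: "forest (dual_adj k (%j. (?\<phi> \<circ> kappa n k j) ` sphere 0 1))"
  by (rule forest_dual_adj[of _ _ "base_pt \<Gamma>"]) (use common img in \<open>simp add: comp_def\<close>)
 interpret P: rose_pi1 "n + k" by standard (rule nk)
 have "has_rank (pi1 (space_of R) (h (base_pt \<Gamma>))) (n + k)" unfolding h_base by (rule P.has_rank_pi1_rose)
 moreover have "base_pt \<Gamma> \<in> topspace (space_of \<Gamma>)" by (simp add: top\<Gamma> base_pts)
 ultimately have rank: "has_rank (pi1 (space_of \<Gamma>) (base_pt \<Gamma>)) (n + k)"
  by (intro has_rank_pi1_homeomorphic[OF homeo])
 have "nk_graph True n k \<Gamma> (%j. ?\<phi> \<circ> kappa n k j)"
  unfolding nk_graph_def
  using graph_\<Gamma>[OF nk] rank nonseparating emb vtx val inter forest by (intro conjI allI impI ballI) auto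
 then show ?thesis using phe by (simp add: marked_def)
qed

end

section \<open>Coordinates of marked graphs in the fiber\<close>

text \<open>A chart of a marked graph: \<open>h\<close> identifies the graph with the rose, and
  \<open>x\<close> gives a normal form of the resulting marking. Neither is determined by the marked
  graph; only the cell of \<open>x\<close> is.\<close>

definition coord :: "nat => nat => pgraph \<times> (gpoint => gpoint) => (gpoint => gpoint) => (nat => real) => bool" where
 "coord n k m h x \<longleftrightarrow> m \<in> marked True n k \<and> subdivided_rose n k (fst m) h x \<and>
   homotopic_rel_circles True n k (rose (n + k)) (h \<circ> snd m) (Fmap n k x)"

lemma markedD:
 assumes "(\<Gamma>, \<phi>) \<in> marked b n k"
 shows "pointed_homotopy_equivalence (space_of (Gnk n k)) (Vert 0) (space_of \<Gamma>) (base_pt \<Gamma>) \<phi>"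
  and "finite_graph \<Gamma>" and "continuous_map (space_of (Gnk n k)) (space_of \<Gamma>) \<phi>" and "\<phi> (Vert 0) = base_pt \<Gamma>"
  and "base_pt \<Gamma> \<in> points \<Gamma>"
  and "!!y. y \<in> points (Gnk n k) ==> \<phi> y \<in> points \<Gamma>"
proof -
 show p: "pointed_homotopy_equivalence (space_of (Gnk n k)) (Vert 0) (space_of \<Gamma>) (base_pt \<Gamma>) \<phi>"
  using assms by (simp add: marked_def)
 show f: "finite_graph \<Gamma>" using assms by (simp add: marked_def nk_graph_def graph_iff)
 show c: "continuous_map (space_of (Gnk n k)) (space_of \<Gamma>) \<phi>" "\<phi> (Vert 0) = base_pt \<Gamma>"
  using p by (simp_all add: pointed_homotopy_equivalence_def)
 show "base_pt \<Gamma> \<in> points \<Gamma>" using f by (simp add: base_pt_def finite_graph_def)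
 show "\<phi> y \<in> points \<Gamma>" if "y \<in> points (Gnk n k)" for y
  using c(1) that by (auto simp: continuous_map_def topspace_space_of[OF f])
qed

lemma htpy_rel_transport:
 assumes "homotopic_rel_circles b n k \<Gamma> f g" "continuous_map (space_of \<Gamma>) (space_of \<Gamma>') \<psi>"
  "\<psi> (base_pt \<Gamma>) = base_pt \<Gamma>'"
  "!!y. y \<in> points (Gnk n k) ==> f' y = \<psi> (f y)" "!!y. y \<in> points (Gnk n k) ==> g' y = \<psi> (g y)"
 shows "homotopic_rel_circles b n k \<Gamma>' f' g'"
 by (rule htpy_rel_eq[OF htpy_rel_compose_left[OF assms(1-3)]]) (simp_all add: assms(4,5))

lemma graph_iso_inverse:
 assumes "graph_iso \<Gamma> \<Gamma>' \<psi>" "finite_graph \<Gamma>" "finite_graph \<Gamma>'"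
 obtains \<psi>' where "graph_iso \<Gamma>' \<Gamma> \<psi>'" "\<forall>y\<in>points \<Gamma>. \<psi>' (\<psi> y) = y"
proof -
 obtain \<psi>' where p: "homeomorphic_maps (space_of \<Gamma>) (space_of \<Gamma>') \<psi> \<psi>'"
  using assms(1) by (auto simp: graph_iso_def homeomorphic_map_maps)
 then have inv: "!!y. y \<in> points \<Gamma> ==> \<psi>' (\<psi> y) = y" "!!y. y \<in> points \<Gamma>' ==> \<psi> (\<psi>' y) = y"
  by (simp_all add: homeomorphic_maps_def topspace_space_of assms(2,3))
 have sub: "Vert ` verts \<Gamma> \<subseteq> points \<Gamma>" by auto
 have "\<psi>' ` Vert ` verts \<Gamma>' = \<psi>' ` \<psi> ` Vert ` verts \<Gamma>" using assms(1) by (simp add: graph_iso_def)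
 also have "\<dots> = (%y. y) ` Vert ` verts \<Gamma>" unfolding image_image by (rule image_cong) (simp_all add: inv(1))
 finally have v: "\<psi>' ` Vert ` verts \<Gamma>' = Vert ` verts \<Gamma>" by simp
 have "base_pt \<Gamma> \<in> points \<Gamma>" using assms(2) by (simp add: base_pt_def finite_graph_def)
 then have "\<psi>' (base_pt \<Gamma>') = base_pt \<Gamma>" using inv(1) assms(1) by (metis graph_iso_def)
 moreover have "homeomorphic_map (space_of \<Gamma>') (space_of \<Gamma>) \<psi>'"
  using p homeomorphic_maps_sym homeomorphic_maps_map by blast
 ultimately have "graph_iso \<Gamma>' \<Gamma> \<psi>'" using v by (simp add: graph_iso_def)
 then show ?thesis using inv(1) by (intro that[of \<psi>']) simp_all
qed

lemma marked_equivI: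
 assumes "(\<Gamma>1, \<phi>1) \<in> marked b n k" "(\<Gamma>2, \<phi>2) \<in> marked b n k" "graph_iso \<Gamma>1 \<Gamma>2 \<psi>"
  "homotopic_rel_circles b n k \<Gamma>2 (\<psi> \<circ> \<phi>1) \<phi>2"
 shows "((\<Gamma>1, \<phi>1), (\<Gamma>2, \<phi>2)) \<in> marked_equiv b n k"
 using assms by (auto simp: marked_equiv_def)

lemma marked_equivE:
 assumes "((\<Gamma>1, \<phi>1), (\<Gamma>2, \<phi>2)) \<in> marked_equiv b n k"
 obtains \<psi> where "(\<Gamma>1, \<phi>1) \<in> marked b n k" "(\<Gamma>2, \<phi>2) \<in> marked b n k" "graph_iso \<Gamma>1 \<Gamma>2 \<psi>"
  "homotopic_rel_circles b n k \<Gamma>2 (\<psi> \<circ> \<phi>1) \<phi>2"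
 using assms by (auto simp: marked_equiv_def)

lemma graph_iso_cont: "graph_iso \<Gamma> \<Gamma>' \<psi> ==> continuous_map (space_of \<Gamma>) (space_of \<Gamma>') \<psi>"
 and graph_iso_base: "graph_iso \<Gamma> \<Gamma>' \<psi> ==> \<psi> (base_pt \<Gamma>) = base_pt \<Gamma>'"
 by (auto simp: graph_iso_def homeomorphic_imp_continuous_map)

lemma marked_equiv_sym:
 assumes "(m1, m2) \<in> marked_equiv b n k" shows "(m2, m1) \<in> marked_equiv b n k"
proof -
 obtain \<Gamma>1 \<phi>1 \<Gamma>2 \<phi>2 where m: "m1 = (\<Gamma>1, \<phi>1)" "m2 = (\<Gamma>2, \<phi>2)" by (cases m1, cases m2)
 obtain \<psi> where \<psi>: "(\<Gamma>1, \<phi>1) \<in> marked b n k" "(\<Gamma>2, \<phi>2) \<in> marked b n k" "graph_iso \<Gamma>1 \<Gamma>2 \<psi>"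
  "homotopic_rel_circles b n k \<Gamma>2 (\<psi> \<circ> \<phi>1) \<phi>2"
  by (rule marked_equivE[OF assms[unfolded m]])
 note M1 = markedD[OF \<psi>(1)] and M2 = markedD[OF \<psi>(2)]
 obtain \<psi>' where \<psi>': "graph_iso \<Gamma>2 \<Gamma>1 \<psi>'" "\<forall>y\<in>points \<Gamma>1. \<psi>' (\<psi> y) = y"
  by (rule graph_iso_inverse[OF \<psi>(3) M1(2) M2(2)])
 have "homotopic_rel_circles b n k \<Gamma>1 (\<psi>' \<circ> \<phi>2) \<phi>1"
  by (rule htpy_rel_transport[OF htpy_rel_sym[OF \<psi>(4)] graph_iso_cont[OF \<psi>'(1)]
     graph_iso_base[OF \<psi>'(1)]]) (simp_all add: \<psi>'(2) M1(6))
 then show ?thesis unfolding m by (rule marked_equivI[OF \<psi>(2,1) \<psi>'(1)])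
qed

lemma marked_equiv_trans:
 assumes "(m1, m2) \<in> marked_equiv b n k" "(m2, m3) \<in> marked_equiv b n k" shows "(m1, m3) \<in> marked_equiv b n k"
proof -
 obtain \<Gamma>1 \<phi>1 \<Gamma>2 \<phi>2 \<Gamma>3 \<phi>3 where m: "m1 = (\<Gamma>1, \<phi>1)" "m2 = (\<Gamma>2, \<phi>2)" "m3 = (\<Gamma>3, \<phi>3)"
  by (cases m1, cases m2, cases m3)
 obtain \<psi> where \<psi>: "(\<Gamma>1, \<phi>1) \<in> marked b n k" "(\<Gamma>2, \<phi>2) \<in> marked b n k" "graph_iso \<Gamma>1 \<Gamma>2 \<psi>"
  "homotopic_rel_circles b n k \<Gamma>2 (\<psi> \<circ> \<phi>1) \<phi>2"
  by (rule marked_equivE[OF assms(1)[unfolded m]])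
 obtain \<psi>' where \<psi>': "(\<Gamma>2, \<phi>2) \<in> marked b n k" "(\<Gamma>3, \<phi>3) \<in> marked b n k" "graph_iso \<Gamma>2 \<Gamma>3 \<psi>'"
  "homotopic_rel_circles b n k \<Gamma>3 (\<psi>' \<circ> \<phi>2) \<phi>3"
  by (rule marked_equivE[OF assms(2)[unfolded m]])
 have "homotopic_rel_circles b n k \<Gamma>3 (\<psi>' \<circ> (\<psi> \<circ> \<phi>1)) (\<psi>' \<circ> \<phi>2)"
  by (rule htpy_rel_compose_left[OF \<psi>(4) graph_iso_cont[OF \<psi>'(3)] graph_iso_base[OF \<psi>'(3)]])
 from htpy_rel_trans[OF this \<psi>'(4)]
 have "homotopic_rel_circles b n k \<Gamma>3 ((\<psi>' \<circ> \<psi>) \<circ> \<phi>1) \<phi>3" by (simp add: o_assoc)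
 moreover have "graph_iso \<Gamma>1 \<Gamma>3 (\<psi>' \<circ> \<psi>)"
  using \<psi>(3) \<psi>'(3) unfolding graph_iso_def image_comp[symmetric]
  by (auto intro: homeomorphic_map_compose)
 ultimately show ?thesis unfolding m by (intro marked_equivI[OF \<psi>(1) \<psi>'(2)])
qed

lemma marked_equiv_refl:
 assumes "m \<in> marked b n k" shows "(m, m) \<in> marked_equiv b n k"
proof -
 obtain \<Gamma> \<phi> where m: "m = (\<Gamma>, \<phi>)" by (cases m)
 note M = markedD[OF assms[unfolded m]]
 have "homotopic_rel_circles b n k \<Gamma> (id \<circ> \<phi>) \<phi>"
  using htpy_rel_refl[OF M(3,4)] by simp
 moreover have "graph_iso \<Gamma> \<Gamma> id" by (simp add: graph_iso_def)
 ultimately show ?thesis unfolding m by (intro marked_equivI[OF assms[unfolded m] assms[unfolded m]])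
qed

lemma equiv_marked_equiv: "equiv (marked b n k) (marked_equiv b n k)"
proof (rule equivI)
 show "marked_equiv b n k \<subseteq> marked b n k \<times> marked b n k" by (auto simp: marked_equiv_def)
 show "refl_on (marked b n k) (marked_equiv b n k)" by (rule refl_onI) (rule marked_equiv_refl)
 show "sym (marked_equiv b n k)" by (rule symI) (rule marked_equiv_sym)
 show "trans (marked_equiv b n k)" by (rule transI) (rule marked_equiv_trans)
qed

lemma coord_transfer:
 assumes "(m1, m2) \<in> marked_equiv True n k" "coord n k m1 h x"
 obtains h' where "coord n k m2 h' x"
proof -
 obtain \<Gamma>1 \<phi>1 \<Gamma>2 \<phi>2 where m: "m1 = (\<Gamma>1, \<phi>1)" "m2 = (\<Gamma>2, \<phi>2)" by (cases m1, cases m2)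
 obtain \<psi> where \<psi>: "(\<Gamma>1, \<phi>1) \<in> marked True n k" "(\<Gamma>2, \<phi>2) \<in> marked True n k" "graph_iso \<Gamma>1 \<Gamma>2 \<psi>"
  "homotopic_rel_circles True n k \<Gamma>2 (\<psi> \<circ> \<phi>1) \<phi>2"
  by (rule marked_equivE[OF assms(1)[unfolded m]])
 note M1 = markedD[OF \<psi>(1)] and M2 = markedD[OF \<psi>(2)]
 obtain \<psi>' where \<psi>': "graph_iso \<Gamma>2 \<Gamma>1 \<psi>'" "\<forall>y\<in>points \<Gamma>1. \<psi>' (\<psi> y) = y"
  by (rule graph_iso_inverse[OF \<psi>(3) M1(2) M2(2)])
 have sr: "subdivided_rose n k \<Gamma>1 h x" and hom: "homotopic_rel_circles True n k (rose (n + k)) (h \<circ> \<phi>1) (Fmap n k x)"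
  using assms(2) by (simp_all add: coord_def m)
 interpret A: subdivided_rose n k \<Gamma>1 h x by (rule sr)
 let ?h = "h \<circ> \<psi>'"
 have sr': "subdivided_rose n k \<Gamma>2 ?h x"
 proof
  show "finite_graph \<Gamma>2" by (rule M2(2))
  show "homeomorphic_map (space_of \<Gamma>2) (space_of (rose (n + k))) ?h"
   using \<psi>'(1) A.homeo by (auto simp: graph_iso_def intro: homeomorphic_map_compose)
  show "?h (base_pt \<Gamma>2) = Vert 0" using graph_iso_base[OF \<psi>'(1)] A.h_base by simp
  have "?h ` Vert ` verts \<Gamma>2 = h ` Vert ` verts \<Gamma>1" using \<psi>'(1) unfolding graph_iso_def image_comp[symmetric] by simp
  then show "?h ` Vert ` verts \<Gamma>2 = insert (Vert 0) ((%j. petal (n + j) (x j)) ` {..<k})" by (simp only: A.h_verts)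
 qed
 interpret B: subdivided_rose n k \<Gamma>2 ?h x by (rule sr')
 have "homotopic_rel_circles True n k (rose (n + k)) (?h \<circ> \<phi>2) (h \<circ> \<phi>1)"
  by (rule htpy_rel_transport[OF htpy_rel_sym[OF \<psi>(4)] B.cont_h])
   (use B.h_base \<psi>'(2) M1(6) in simp_all)
 from htpy_rel_trans[OF this hom] have "coord n k m2 ?h x"
  using \<psi>(2) sr' by (simp add: coord_def m)
 then show ?thesis by (rule that)
qed

text \<open>Two charts of the same marked graph differ by a homeomorphism of the rose that fixes the
  base vertex.\<close>

lemma coord_unique:
 assumes "coord n k m h x" "coord n k m h' y" "j < k"
 shows "same_cell (x j) (y j)"
proof -
 obtain \<Gamma> \<phi> where m: "m = (\<Gamma>, \<phi>)" by (cases m)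
 have mk: "(\<Gamma>, \<phi>) \<in> marked True n k"
  and hom: "homotopic_rel_circles True n k (rose (n + k)) (h \<circ> \<phi>) (Fmap n k x)"
  and hom': "homotopic_rel_circles True n k (rose (n + k)) (h' \<circ> \<phi>) (Fmap n k y)"
  using assms by (simp_all add: coord_def m)
 interpret A: subdivided_rose n k \<Gamma> h x using assms(1) by (simp add: coord_def m)
 interpret B: subdivided_rose n k \<Gamma> h' y using assms(2) by (simp add: coord_def m)
 note M = markedD[OF mk]
 obtain g where g: "homeomorphic_maps (space_of \<Gamma>) (space_of A.R) h g"
  "continuous_map (space_of A.R) (space_of \<Gamma>) g" "!!y. y \<in> points \<Gamma> ==> g (h y) = y" "g (Vert 0) = base_pt \<Gamma>"
  using A.h_inverse by metis
 let ?\<theta> = "h' \<circ> g"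
 have \<theta>0: "?\<theta> (Vert 0) = Vert 0" using g(4) B.h_base by simp
 have homeo: "homeomorphic_map (space_of A.R) (space_of A.R) ?\<theta>"
  by (rule homeomorphic_map_compose[OF _ B.homeo]) (use g(1) homeomorphic_maps_sym homeomorphic_maps_map in blast)
 have "homotopic_rel_circles True n k (rose (n + k)) (?\<theta> \<circ> Fmap n k x) (h' \<circ> \<phi>)"
  by (rule htpy_rel_transport[OF htpy_rel_sym[OF hom] homeomorphic_imp_continuous_map[OF homeo]])
   (use \<theta>0 g(3) M(6) in simp_all)
 from same_cell_of_homeomorphism[OF homeo \<theta>0 htpy_rel_trans[OF this hom'] assms(3)] show ?thesis .
qed

text \<open>The isomorphism is one chart, followed by a homeomorphism of the rose moving
  \<open>x\<close> to \<open>y\<close> inside its cell, followed by the inverse of the other chart.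
  That the moved points are vertices makes it a graph isomorphism.\<close>

lemma coord_equiv:
 assumes c1: "coord n k m1 h1 x" and c2: "coord n k m2 h2 y" and cells: "!!j. j < k ==> same_cell (x j) (y j)"
 shows "(m1, m2) \<in> marked_equiv True n k"
proof -
 obtain \<Gamma>1 \<phi>1 \<Gamma>2 \<phi>2 where m: "m1 = (\<Gamma>1, \<phi>1)" "m2 = (\<Gamma>2, \<phi>2)" by (cases m1, cases m2)
 have mk1: "(\<Gamma>1, \<phi>1) \<in> marked True n k" and mk2: "(\<Gamma>2, \<phi>2) \<in> marked True n k"
  and hom1: "homotopic_rel_circles True n k (rose (n + k)) (h1 \<circ> \<phi>1) (Fmap n k x)"
  and hom2: "homotopic_rel_circles True n k (rose (n + k)) (h2 \<circ> \<phi>2) (Fmap n k y)"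
  using c1 c2 by (simp_all add: coord_def m)
 interpret A: subdivided_rose n k \<Gamma>1 h1 x using c1 by (simp add: coord_def m)
 interpret B: subdivided_rose n k \<Gamma>2 h2 y using c2 by (simp add: coord_def m)
 note M1 = markedD[OF mk1] and M2 = markedD[OF mk2]
 obtain g where g: "homeomorphic_maps (space_of \<Gamma>2) (space_of A.R) h2 g"
  "continuous_map (space_of A.R) (space_of \<Gamma>2) g" "!!y. y \<in> points \<Gamma>2 ==> g (h2 y) = y" "g (Vert 0) = base_pt \<Gamma>2"
  using B.h_inverse by metis
 have "\<exists>\<theta>. homeomorphic_map (space_of A.R) (space_of A.R) \<theta> \<and> \<theta> (Vert 0) = Vert 0 \<and>
  homotopic_rel_circles True n k A.R (\<theta> \<circ> Fmap n k x) (Fmap n k y) \<and>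
  (\<forall>j<k. \<theta> (petal (n + j) (x j)) = petal (n + j) (y j))"
 proof (rule rose_homeomorphism_of_same_cell[where n = n])
  show "same_cell (x j) (y j)" if "j < k" for j by (rule cells[OF that])
 qed (intro exI conjI allI impI)
 then obtain \<theta> where \<theta>: "homeomorphic_map (space_of A.R) (space_of A.R) \<theta>" "\<theta> (Vert 0) = Vert 0"
  "homotopic_rel_circles True n k A.R (\<theta> \<circ> Fmap n k x) (Fmap n k y)"
  "\<forall>j<k. \<theta> (petal (n + j) (x j)) = petal (n + j) (y j)"
  by (elim exE conjE)
 let ?\<psi> = "g \<circ> (\<theta> \<circ> h1)"
 have gh: "homeomorphic_map (space_of A.R) (space_of \<Gamma>2) g"
  using g(1) homeomorphic_maps_sym homeomorphic_maps_map by blast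
 have iso: "graph_iso \<Gamma>1 \<Gamma>2 ?\<psi>"
  unfolding graph_iso_def
 proof (intro conjI)
  show "homeomorphic_map (space_of \<Gamma>1) (space_of \<Gamma>2) ?\<psi>"
   by (rule homeomorphic_map_compose[OF homeomorphic_map_compose[OF A.homeo \<theta>(1)] gh])
  show "?\<psi> (base_pt \<Gamma>1) = base_pt \<Gamma>2" by (simp add: A.h_base \<theta>(2) g(4))
  have "\<theta> ` h1 ` Vert ` verts \<Gamma>1 = h2 ` Vert ` verts \<Gamma>2"
   unfolding A.h_verts B.h_verts using \<theta>(2,4) by (auto simp: image_image)
  moreover have "g ` h2 ` Vert ` verts \<Gamma>2 = (%y. y) ` Vert ` verts \<Gamma>2"
   unfolding image_image by (rule image_cong) (simp_all add: g(3))
  ultimately show "?\<psi> ` Vert ` verts \<Gamma>1 = Vert ` verts \<Gamma>2" unfolding image_comp[symmetric] by simp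
 qed
 have "homotopic_rel_circles True n k A.R (\<theta> \<circ> (h1 \<circ> \<phi>1)) (\<theta> \<circ> Fmap n k x)"
  by (rule htpy_rel_compose_left[OF hom1 homeomorphic_imp_continuous_map[OF \<theta>(1)]]) (simp add: \<theta>(2))
 from htpy_rel_trans[OF htpy_rel_trans[OF this \<theta>(3)] htpy_rel_sym[OF hom2]]
 have "homotopic_rel_circles True n k \<Gamma>2 (?\<psi> \<circ> \<phi>1) \<phi>2"
  by (rule htpy_rel_transport[OF _ g(2)]) (simp_all add: g(3,4) M2(6))
 then show ?thesis unfolding m by (rule marked_equivI[OF mk1 mk2 iso])
qed

lemma phe_eq:
 assumes "pointed_homotopy_equivalence X x Y y f" "!!z. z \<in> topspace X ==> f' z = f z" "x \<in> topspace X"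
 shows "pointed_homotopy_equivalence X x Y y f'"
proof (rule phe_homotopic[OF assms(1)])
 show "homotopic_with (%h. h x = y) X Y f f'"
  by (rule homotopic_with_equal) (use assms in \<open>auto simp: pointed_homotopy_equivalence_def\<close>)
qed

section \<open>Elements of the fiber are those with coordinates\<close>

lemma subdivided_rose_rose: "subdivided_rose n k (rose (n + k)) id (%_. 0)"
 by standard auto

lemma rose_marked_False:
 assumes nk: "n + k \<ge> 1"
  and phe: "pointed_homotopy_equivalence (space_of (Gnk n k)) (Vert 0) (space_of (rose (n + k))) (Vert 0) f"
  and circ: "!!j. j < k ==> f ` circ n k j = range (petal (n + j))"
  and emb: "!!j. j < k ==> embedding_map S1 (space_of (rose (n + k))) (f \<circ> kappa n k j)"
 shows "(rose (n + k), f) \<in> marked False n k"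
proof -
 interpret A: subdivided_rose n k "rose (n + k)" id "%_. 0" by (rule subdivided_rose_rose)
 interpret P: rose_pi1 "n + k" by standard (rule nk)
 have img: "(f \<circ> kappa n k j) ` sphere 0 1 = range (petal (n + j))" if "j < k" for j
  using circ[OF that] by (simp add: circ_def image_comp)
 have common: "p = Vert 0" if "i < k" "j < k" "i \<noteq> j" "p \<in> range (petal (n + i))" "p \<in> range (petal (n + j))" for i j p
 proof -
  from that(4,5) obtain s t where "p = petal (n + i) s" "p = petal (n + j) t" by (elim rangeE)
  then have "petal (n + i) s = petal (n + j) t" "p = petal (n + i) s" by simp_all
  then show ?thesis using that(3) by (simp add: petal_eq_petal_neq petal_Ints)
 qed
 have "forest (dual_adj k (%j. (f \<circ> kappa n k j) ` sphere 0 1))"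
  by (rule forest_dual_adj[of _ _ "Vert 0"]) (use common img in auto)
 moreover have "\<exists>p. (f \<circ> kappa n k i) ` sphere 0 1 \<inter> (f \<circ> kappa n k j) ` sphere 0 1 \<subseteq> {p}"
  if "i < k" "j < k" "i \<noteq> j" for i j
  unfolding img[OF that(1)] img[OF that(2)] using common[OF that] by (intro exI[of _ "Vert 0"]) auto
 moreover have "2 \<le> valence (rose (n + k)) 0" using A.valence_base[OF nk] by simp
 ultimately have "nk_graph False n k (rose (n + k)) (%j. f \<circ> kappa n k j)"
  unfolding nk_graph_def
  using A.graph_\<Gamma>[OF nk] P.has_rank_pi1_rose A.nonseparating emb by simp
 then show ?thesis using phe by (simp add: marked_def)
qed

lemma marked_embedding: "(\<Gamma>, \<phi>) \<in> marked b n k ==> j < k ==> embedding_map S1 (space_of \<Gamma>) (\<phi> \<circ> kappa n k j)"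
 by (simp add: marked_def nk_graph_def)

lemma rose_marking_marked:
 assumes nk: "n + k \<ge> 1" shows "(rose (n + k), rose_marking n k) \<in> marked False n k"
proof (rule rose_marked_False[OF nk])
 interpret A: subdivided_rose n k "rose (n + k)" id "%_. 0" by (rule subdivided_rose_rose)
 have "homeomorphic_maps (space_of (rose (n + k))) (space_of (rose (n + k))) id id"
  by (simp add: homeomorphic_maps_def)
 from A.marked[OF nk this] have mk: "(rose (n + k), Fmap n k (%_. 0)) \<in> marked True n k" by simp
 show "pointed_homotopy_equivalence (space_of (Gnk n k)) (Vert 0) (space_of (rose (n + k))) (Vert 0) (rose_marking n k)"
  by (rule phe_eq[OF phe_Fmap_0]) (simp_all add: rose_marking_eq)
 fix j assume j: "j < k"
 have "rose_marking n k ` circ n k j = Fmap n k (%_. 0) ` circ n k j"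
 proof (intro image_cong refl)
  fix y assume "y \<in> circ n k j"
  then show "rose_marking n k y = Fmap n k (%_. 0) y"
   using circ_subset_points[OF j, of n] by (intro rose_marking_eq) blast
 qed
 then show "rose_marking n k ` circ n k j = range (petal (n + j))" using Fmap_circ[OF j] by simp
 have "kappa n k j z \<in> points (Gnk n k)" for z using circ_subset_points[OF j] kappa_in_circ by blast
 then have "rose_marking n k \<circ> kappa n k j = Fmap n k (%_. 0) \<circ> kappa n k j"
  by (simp add: fun_eq_iff rose_marking_eq)
 then show "embedding_map S1 (space_of (rose (n + k))) (rose_marking n k \<circ> kappa n k j)"
  using marked_embedding[OF mk j] by simp
qed

lemma coord_special_vertices:
 assumes "coord n k (\<Gamma>, \<phi>) h x"
 shows "{v \<in> verts \<Gamma>. v = base \<Gamma> \<or> valence \<Gamma> v \<noteq> 2} = {base \<Gamma>}"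
proof -
 interpret A: subdivided_rose n k \<Gamma> h x using assms by (simp add: coord_def)
 show ?thesis using A.valence_nonbase A.fin\<Gamma> by (auto simp: finite_graph_def)
qed

lemma coord_homotopic_rose_marking:
 assumes "coord n k (\<Gamma>, \<phi>) h x"
 shows "homotopic_rel_circles False n k (rose (n + k)) (h \<circ> \<phi>) (rose_marking n k)"
proof (rule htpy_rel_eq)
 show "homotopic_rel_circles False n k (rose (n + k)) (h \<circ> \<phi>) (Fmap n k (%_. 0))"
 proof -
  have "homotopic_rel_circles True n k (rose (n + k)) (h \<circ> \<phi>) (Fmap n k x)" using assms by (simp add: coord_def)
  then show ?thesis by (rule htpy_rel_trans[OF htpy_rel_mono Fmap_homotopic_False])
 qed
qed (simp_all add: rose_marking_eq)

text \<open>The rose marking itself lies in the forgotten class. Composing the forgetting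
  homeomorphism with the isomorphism to the rose gives \<open>?h\<close>, and correcting the
  homotopy to one that keeps the basepoints gives \<open>x\<close>.\<close>

lemma Fnk_coord:
 assumes nk: "n + k \<ge> 1" and X: "X \<in> Fnk n k"
 obtains m h x where "m \<in> X" "coord n k m h x"
proof -
 have "(rose (n + k), rose_marking n k) \<in> forget n k X"
  using X marked_equiv_refl[OF rose_marking_marked[OF nk]] by (simp add: Fnk_def)
 then obtain m m0 where m: "m \<in> X" "forgets_to n k m m0" "(m0, (rose (n + k), rose_marking n k)) \<in> marked_equiv False n k"
  unfolding forget_def by blast
 obtain \<Gamma> \<phi> \<Gamma>0 \<phi>0 where mm: "m = (\<Gamma>, \<phi>)" "m0 = (\<Gamma>0, \<phi>0)" by (cases m, cases m0)
 have "X \<in> marked True n k // marked_equiv True n k" using X by (simp add: Fnk_def Lnk_def)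
 then have mk: "(\<Gamma>, \<phi>) \<in> marked True n k"
  using m(1) mm in_quotient_imp_subset[OF equiv_marked_equiv] by blast
 note M = markedD[OF mk]
 obtain h0 where h0: "homeomorphic_map (space_of \<Gamma>) (space_of \<Gamma>0) h0"
  "h0 ` Vert ` {v \<in> verts \<Gamma>. v = base \<Gamma> \<or> valence \<Gamma> v \<noteq> 2} = Vert ` verts \<Gamma>0"
  "h0 (base_pt \<Gamma>) = base_pt \<Gamma>0" "!!y. y \<in> points (Gnk n k) ==> \<phi>0 y = h0 (\<phi> y)"
  using m(2) by (auto simp: forgets_to_def mm)
 obtain \<psi> where \<psi>: "graph_iso \<Gamma>0 (rose (n + k)) \<psi>"
  "homotopic_rel_circles False n k (rose (n + k)) (\<psi> \<circ> \<phi>0) (rose_marking n k)"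
  by (rule marked_equivE[OF m(3)[unfolded mm]])
 let ?h = "\<psi> \<circ> h0"
 have "homotopic_rel_circles False n k (rose (n + k)) (?h \<circ> \<phi>) (Fmap n k (%_. 0))"
  by (rule htpy_rel_eq[OF \<psi>(2)]) (simp_all add: h0(4) rose_marking_eq)
 then obtain x where x: "homotopic_rel_circles True n k (rose (n + k)) (?h \<circ> \<phi>) (Fmap n k x)"
  by (rule homotopic_to_Fmap)
 have special: "?h ` Vert ` {v \<in> verts \<Gamma>. v = base \<Gamma> \<or> valence \<Gamma> v \<noteq> 2} = {Vert 0}"
  using \<psi>(1) unfolding image_comp[symmetric] h0(2) graph_iso_def by simp
 have tracks: "?h (\<phi> (kappa n k j 1)) = petal (n + j) (x j)" if "j < k" for j
  using htpy_rel_imp(6)[OF x that] by (simp add: kappa_1)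
 have nkv: "\<forall>v\<in>verts \<Gamma>. valence \<Gamma> v = 2 --> v = base \<Gamma> \<or> (\<exists>j<k. Vert v = \<phi> (kappa n k j 1))"
  and nkb: "\<forall>j<k. \<phi> (kappa n k j 1) \<in> Vert ` verts \<Gamma>"
  using mk by (simp_all add: marked_def nk_graph_def)
 have "subdivided_rose n k \<Gamma> ?h x"
 proof
  show "finite_graph \<Gamma>" by (rule M(2))
  show "homeomorphic_map (space_of \<Gamma>) (space_of (rose (n + k))) ?h"
   using h0(1) \<psi>(1) by (auto simp: graph_iso_def intro: homeomorphic_map_compose)
  show "?h (base_pt \<Gamma>) = Vert 0" using h0(3) graph_iso_base[OF \<psi>(1)] by simp
  \<comment> \<open>Vertices that survive forgetting go to the base vertex. The others are bivalent,
    hence basepoints of cycles, and these sit at \<open>x j\<close> because the corrected homotopy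
    keeps them fixed.\<close>
  show "?h ` Vert ` verts \<Gamma> = insert (Vert 0) ((%j. petal (n + j) (x j)) ` {..<k})"
  proof
   show "?h ` Vert ` verts \<Gamma> \<subseteq> insert (Vert 0) ((%j. petal (n + j) (x j)) ` {..<k})"
   proof
    fix y assume "y \<in> ?h ` Vert ` verts \<Gamma>"
    then obtain v where v: "v \<in> verts \<Gamma>" "y = ?h (Vert v)" by blast
    show "y \<in> insert (Vert 0) ((%j. petal (n + j) (x j)) ` {..<k})"
    proof (cases "v = base \<Gamma> \<or> valence \<Gamma> v \<noteq> 2")
     case True
     then have "y \<in> ?h ` Vert ` {v \<in> verts \<Gamma>. v = base \<Gamma> \<or> valence \<Gamma> v \<noteq> 2}" using v by blast
     then show ?thesis unfolding special by simp
    next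
     case False
     then obtain j where "j < k" "Vert v = \<phi> (kappa n k j 1)" using nkv v(1) by metis
     then show ?thesis using tracks[of j] v(2) by auto
    qed
   qed
   show "insert (Vert 0) ((%j. petal (n + j) (x j)) ` {..<k}) \<subseteq> ?h ` Vert ` verts \<Gamma>"
   proof (rule insert_subsetI)
    have "Vert 0 \<in> ?h ` Vert ` {v \<in> verts \<Gamma>. v = base \<Gamma> \<or> valence \<Gamma> v \<noteq> 2}" unfolding special by simp
    then show "Vert 0 \<in> ?h ` Vert ` verts \<Gamma>" by (rule rev_subsetD) (intro image_mono Collect_restrict)
    show "(%j. petal (n + j) (x j)) ` {..<k} \<subseteq> ?h ` Vert ` verts \<Gamma>"
    proof
     fix y assume "y \<in> (%j. petal (n + j) (x j)) ` {..<k}"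
     then obtain j where j: "j < k" "y = ?h (\<phi> (kappa n k j 1))" using tracks by auto
     have "\<phi> (kappa n k j 1) \<in> Vert ` verts \<Gamma>" using nkb j(1) by simp
     then show "y \<in> ?h ` Vert ` verts \<Gamma>" unfolding j(2) by (rule imageI)
    qed
   qed
  qed
 qed
 then have "coord n k m ?h x" using mk x by (simp add: coord_def mm)
 then show ?thesis by (rule that[OF m(1)])
qed

text \<open>After forgetting basepoints only the base vertex is left, and in that situation a chart
  is an isomorphism to the rose along which the marking becomes the rose marking up to
  rotation.\<close>

lemma coord_Fnk:
 assumes nk: "n + k \<ge> 1" and X: "X \<in> Lnk True n k" and m: "m \<in> X" "coord n k m h x"
 shows "X \<in> Fnk n k"
proof -
 let ?rm = "(rose (n + k), rose_marking n k)"
 have X': "X \<in> marked True n k // marked_equiv True n k" using X by (simp add: Lnk_def)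
 have rm: "?rm \<in> marked False n k" by (rule rose_marking_marked[OF nk])
 have "forget n k X = marked_equiv False n k `` {?rm}"
 proof
  show "forget n k X \<subseteq> marked_equiv False n k `` {?rm}"
  proof
   fix m' assume "m' \<in> forget n k X"
   then obtain m1 m0 where m1: "m1 \<in> X" "forgets_to n k m1 m0" "(m0, m') \<in> marked_equiv False n k"
    unfolding forget_def by blast
   obtain \<Gamma> \<phi> \<Gamma>0 \<phi>0 where mm: "m1 = (\<Gamma>, \<phi>)" "m0 = (\<Gamma>0, \<phi>0)" by (cases m1, cases m0)
   have "(m, m1) \<in> marked_equiv True n k"
    using quotient_eq_iff[OF equiv_marked_equiv X' X' m(1) m1(1)] by simp
   then obtain h1 where "coord n k m1 h1 x" by (rule coord_transfer[OF _ m(2)])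
   then have h1: "coord n k (\<Gamma>, \<phi>) h1 x" by (simp add: mm)
   interpret A: subdivided_rose n k \<Gamma> h1 x using h1 by (simp add: coord_def)
   have mk: "(\<Gamma>, \<phi>) \<in> marked True n k" using h1 by (simp add: coord_def)
   have mk0: "(\<Gamma>0, \<phi>0) \<in> marked False n k" using m1(3) by (auto simp: marked_equiv_def mm)
   obtain h0 where h0: "homeomorphic_map (space_of \<Gamma>) (space_of \<Gamma>0) h0"
    "h0 ` Vert ` {v \<in> verts \<Gamma>. v = base \<Gamma> \<or> valence \<Gamma> v \<noteq> 2} = Vert ` verts \<Gamma>0"
    "h0 (base_pt \<Gamma>) = base_pt \<Gamma>0" "!!y. y \<in> points (Gnk n k) ==> \<phi>0 y = h0 (\<phi> y)"
    using m1(2) by (auto simp: forgets_to_def mm)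
   obtain g0 where g0: "homeomorphic_maps (space_of \<Gamma>) (space_of \<Gamma>0) h0 g0"
    using h0(1) by (auto simp: homeomorphic_map_maps)
   then have g0h0: "g0 (h0 y) = y" if "y \<in> points \<Gamma>" for y
    using that by (simp add: homeomorphic_maps_def A.top\<Gamma>)
   have g0map: "homeomorphic_map (space_of \<Gamma>0) (space_of \<Gamma>) g0"
    using g0 homeomorphic_maps_sym homeomorphic_maps_map by blast
   have bp: "base_pt \<Gamma> \<in> points \<Gamma>" by (rule markedD(5)[OF mk])
   have V0: "Vert ` verts \<Gamma>0 = {base_pt \<Gamma>0}"
    using h0(2,3) coord_special_vertices[OF h1] by (simp add: base_pt_def)
   have "graph_iso \<Gamma>0 (rose (n + k)) (h1 \<circ> g0)"
    unfolding graph_iso_def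
   proof (intro conjI)
    show "homeomorphic_map (space_of \<Gamma>0) (space_of (rose (n + k))) (h1 \<circ> g0)"
     by (rule homeomorphic_map_compose[OF g0map A.homeo])
    show b: "(h1 \<circ> g0) (base_pt \<Gamma>0) = base_pt (rose (n + k))"
     using g0h0[OF bp] h0(3) A.h_base by simp
    show "(h1 \<circ> g0) ` Vert ` verts \<Gamma>0 = Vert ` verts (rose (n + k))"
     unfolding V0 using b by simp
   qed
   moreover have "homotopic_rel_circles False n k (rose (n + k)) ((h1 \<circ> g0) \<circ> \<phi>0) (rose_marking n k)"
    by (rule htpy_rel_eq[OF coord_homotopic_rose_marking[OF h1]])
     (simp_all add: h0(4) g0h0 markedD(6)[OF mk])
   ultimately have "(m0, ?rm) \<in> marked_equiv False n k" unfolding mm by (intro marked_equivI[OF mk0 rm])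
   from marked_equiv_trans[OF marked_equiv_sym[OF this] m1(3)]
   show "m' \<in> marked_equiv False n k `` {?rm}" by simp
  qed
  show "marked_equiv False n k `` {?rm} \<subseteq> forget n k X"
  proof
   fix m' assume "m' \<in> marked_equiv False n k `` {?rm}"
   then have m': "(?rm, m') \<in> marked_equiv False n k" by simp
   obtain \<Gamma> \<phi> where mm: "m = (\<Gamma>, \<phi>)" by (cases m)
   interpret A: subdivided_rose n k \<Gamma> h x using m(2) by (simp add: coord_def mm)
   have c: "coord n k (\<Gamma>, \<phi>) h x" using m(2) mm by simp
   have mk: "(\<Gamma>, \<phi>) \<in> marked True n k" using c by (simp add: coord_def)
   have hom: "homotopic_rel_circles True n k (rose (n + k)) (h \<circ> \<phi>) (Fmap n k x)" using c by (simp add: coord_def)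
   obtain g where g: "homeomorphic_maps (space_of \<Gamma>) (space_of A.R) h g" using A.h_inverse by metis
   \<comment> \<open>For the other inclusion the rose with the marking
     \<open>h \<circ> \<phi>\<close> is itself an admissible result of forgetting the basepoints of
     \<open>m\<close>.\<close>
   have "(rose (n + k), h \<circ> \<phi>) \<in> marked False n k"
   proof (rule rose_marked_False[OF nk])
    show "pointed_homotopy_equivalence (space_of (Gnk n k)) (Vert 0) (space_of (rose (n + k))) (Vert 0) (h \<circ> \<phi>)"
     by (rule phe_compose[OF markedD(1)[OF mk] phe_homeomorphic[OF g]])
      (use A.h_base markedD(5)[OF mk] A.top\<Gamma> in simp_all)
    fix j assume j: "j < k"
    show "(h \<circ> \<phi>) ` circ n k j = range (petal (n + j))"
     using htpy_rel_imp(5)[OF hom j] Fmap_circ[OF j] by simp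
    have "embedding_map (space_of \<Gamma>) (space_of (rose (n + k))) h"
     using A.homeo surjective_embedding_map by blast
    then have "embedding_map S1 (space_of (rose (n + k))) (h \<circ> (\<phi> \<circ> kappa n k j))"
     by (rule embedding_map_compose[OF marked_embedding[OF mk j]])
    then show "embedding_map S1 (space_of (rose (n + k))) (h \<circ> \<phi> \<circ> kappa n k j)" by (simp add: o_assoc)
   qed
   then have "((rose (n + k), h \<circ> \<phi>), ?rm) \<in> marked_equiv False n k"
    by (rule marked_equivI[OF _ rm, where \<psi> = id])
     (use coord_homotopic_rose_marking[OF c] in \<open>simp_all add: graph_iso_def\<close>)
   from marked_equiv_trans[OF this m'] have "((rose (n + k), h \<circ> \<phi>), m') \<in> marked_equiv False n k" .
   moreover have "forgets_to n k m (rose (n + k), h \<circ> \<phi>)"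
    unfolding forgets_to_def mm
    using A.homeo A.h_base coord_special_vertices[OF c] by (auto simp: base_pt_def)
   ultimately show "m' \<in> forget n k X" unfolding forget_def
    by (intro CollectI bexI[OF _ m(1)] exI[of _ "(rose (n + k), h \<circ> \<phi>)"] conjI)
  qed
 qed
 then show ?thesis using X by (simp add: Fnk_def)
qed

section \<open>Graphs with prescribed coordinates\<close>

text \<open>When \<open>x j\<close> is not an integer, the edge \<open>n + j\<close> stops at the
  extra vertex \<open>Suc j\<close> and the edge \<open>n + k + j\<close> completes the petal;
  otherwise \<open>n + j\<close> is a loop.\<close>

definition model :: "nat => nat => (nat => real) => pgraph" where
 "model n k x = \<lparr>verts = insert 0 (Suc ` {j. j < k \<and> x j \<notin> \<int>}),
   edges = {..<n + k} \<union> (%j. n + k + j) ` {j. j < k \<and> x j \<notin> \<int>},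
   src = (%e. if e < n + k then 0 else Suc (e - (n + k))),
   tgt = (%e. if n \<le> e \<and> e < n + k \<and> x (e - n) \<notin> \<int> then Suc (e - n) else 0),
   base = 0\<rparr>"

text \<open>The value 1 at integers lets the edge \<open>n + j\<close> fill the whole petal, so both
  cases share one formula.\<close>

definition cutpos :: "(nat => real) => nat => real" where
 "cutpos x j = (if x j \<in> \<int> then 1 else frac (x j))"

definition model_pos :: "nat => nat => (nat => real) => nat => real => real" where
 "model_pos n k x e t = (if e < n then t else if e < n + k then cutpos x (e - n) * t
   else cutpos x (e - (n + k)) + (1 - cutpos x (e - (n + k))) * t)"

definition model_map :: "nat => nat => (nat => real) => gpoint => gpoint" where
 "model_map n k x y = (case y of Vert v => if v = 0 then Vert 0 else petal (n + (v - 1)) (x (v - 1))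
   | Inner e t => petal (pidx n k e) (model_pos n k x e t))"

lemma cutpos: "0 < cutpos x j" "cutpos x j \<le> 1" "x j \<notin> \<int> ==> cutpos x j < 1" "petal i (cutpos x j) = petal i (x j)"
 by (auto simp: cutpos_def frac_gt_0_iff frac_lt_1 less_imp_le petal_eq_iff Ints_diff) (simp_all add: frac_def)

lemma model_edge_cases:
 assumes "e \<in> edges (model n k x)"
 obtains "e < n" | j where "j < k" "e = n + j" | j where "j < k" "e = n + k + j" "x j \<notin> \<int>"
proof -
 have "e < n + k + k" using assms by (auto simp: model_def)
 then show ?thesis
 proof (cases rule: Gnk_edge_cases)
  case (3 j)
  then have "x j \<notin> \<int>" using assms by (auto simp: model_def)
  then show ?thesis using 3 that(3) by blast
 qed (use that in blast)+
qed

lemma finite_graph_model: "finite_graph (model n k x)"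
 by (auto simp: finite_graph_def model_def)

text \<open>The map \<open>model_map\<close> is a continuous bijection from a compact to a Hausdorff
  space. For injectivity, the edges \<open>n + j\<close> and \<open>n + k + j\<close> of a cut petal
  lie strictly on the two sides of the cut.\<close>

lemma subdivided_rose_model: "subdivided_rose n k (model n k x) (model_map n k x) x"
proof
 let ?M = "model n k x" and ?h = "model_map n k x" and ?R = "rose (n + k)"
 show fin: "finite_graph ?M" by (rule finite_graph_model)
 show "?h (base_pt ?M) = Vert 0" by (simp add: base_pt_def model_def model_map_def)
 show "?h ` Vert ` verts ?M = insert (Vert 0) ((%j. petal (n + j) (x j)) ` {..<k})"
 proof
  show "?h ` Vert ` verts ?M \<subseteq> insert (Vert 0) ((%j. petal (n + j) (x j)) ` {..<k})"
   by (auto simp: model_def model_map_def)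
  have "petal (n + j) (x j) \<in> ?h ` Vert ` verts ?M" if j: "j < k" for j
  proof (cases "x j \<in> \<int>")
   case True
   then have "petal (n + j) (x j) = ?h (Vert 0)" by (simp add: model_map_def petal_Ints)
   then show ?thesis by (simp add: model_def)
  next
   case False
   then have "petal (n + j) (x j) = ?h (Vert (Suc j))" "Suc j \<in> verts ?M"
    using j by (simp_all add: model_map_def model_def)
   then show ?thesis by (metis imageI)
  qed
  moreover have "Vert 0 \<in> ?h ` Vert ` verts ?M"
  proof -
   have "Vert 0 = ?h (Vert 0)" "0 \<in> verts ?M" by (simp_all add: model_map_def model_def)
   then show ?thesis by (metis imageI)
  qed
  ultimately show "insert (Vert 0) ((%j. petal (n + j) (x j)) ` {..<k}) \<subseteq> ?h ` Vert ` verts ?M" by blast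
 qed
 have pos: "0 < model_pos n k x e t" "model_pos n k x e t < 1" if "e \<in> edges ?M" "0 < t" "t < 1" for e t
 proof -
  have "0 < model_pos n k x e t \<and> model_pos n k x e t < 1"
   using that(1)
  proof (cases rule: model_edge_cases)
   case (2 j)
   have "cutpos x j * t < 1 * 1" by (rule mult_le_less_imp_less) (use cutpos(1,2)[of x j] that in auto)
   then show ?thesis using 2 that cutpos(1)[of x j] by (simp add: model_pos_def)
  next
   case (3 j)
   have "(1 - cutpos x j) * t < (1 - cutpos x j) * 1"
    by (rule mult_strict_left_mono) (use cutpos(3)[where x = x and j = j, OF 3(3)] that in auto)
   moreover have "0 < (1 - cutpos x j) * t" using cutpos(3)[where x = x and j = j, OF 3(3)] that by simp
   ultimately show ?thesis using 3 cutpos(1)[of x j] by (simp add: model_pos_def)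
  qed (use that in \<open>simp add: model_pos_def\<close>)
  then show "0 < model_pos n k x e t" "model_pos n k x e t < 1" by auto
 qed
 have idx: "pidx n k e < n + k" if "e \<in> edges ?M" for e
  using that by (cases rule: model_edge_cases) (auto simp: pidx_def)
 have hedge: "?h (edge_pt ?M e t) = petal (pidx n k e) (model_pos n k x e t)" if e: "e \<in> edges ?M" and t: "t \<in> {0..1}" for e t
 proof -
  have "?h (Vert (src ?M e)) = petal (pidx n k e) (model_pos n k x e 0) \<and>
    ?h (Vert (tgt ?M e)) = petal (pidx n k e) (model_pos n k x e 1)"
   using e
  proof (cases rule: model_edge_cases)
   case 1
   then show ?thesis by (simp add: model_def model_map_def model_pos_def)
  next
   case (2 j)
   then show ?thesis by (auto simp: model_def model_map_def model_pos_def cutpos(4) petal_Ints)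
  next
   case (3 j)
   then show ?thesis by (simp add: model_def model_map_def model_pos_def cutpos(4))
  qed
  then show ?thesis using t by (auto simp: edge_pt_def model_map_def)
 qed
 have cont: "continuous_map (space_of ?M) (space_of ?R) ?h"
  unfolding continuous_map_space_of_iff[OF fin]
 proof (intro conjI ballI)
  fix v assume "v \<in> verts ?M"
  then show "?h (Vert v) \<in> topspace (space_of ?R)" by (auto simp: model_def model_map_def petal_in_points)
 next
  fix e assume e: "e \<in> edges ?M"
  have "continuous_on {0..1} (model_pos n k x e)"
   unfolding model_pos_def[abs_def] by (cases "e < n"; cases "e < n + k") (auto intro!: continuous_intros)
  then have "continuous_map I01 (space_of ?R) (%t. petal (pidx n k e) (model_pos n k x e t))"
   by (intro continuous_map_petal idx[OF e]) auto
  then show "continuous_map I01 (space_of ?R) (%t. ?h (edge_pt ?M e t))"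
   by (rule continuous_map_eq) (use hedge[OF e] in auto)
 qed
 have surj: "y \<in> ?h ` points ?M" if "y \<in> points ?R" for y
  using that
 proof (cases rule: rose_point_cases)
  case 1
  have "Vert 0 \<in> points ?M" "?h (Vert 0) = Vert 0" by (simp_all add: model_def model_map_def)
  then show ?thesis using 1 by (metis imageI)
 next
  case (2 i t)
  have "\<exists>e s. e \<in> edges ?M \<and> s \<in> {0..1} \<and> pidx n k e = i \<and> model_pos n k x e s = t"
  proof (cases "i < n")
   case True
   then show ?thesis using 2 by (intro exI[of _ i] exI[of _ t]) (auto simp: model_def model_pos_def)
  next
   case False
   then obtain j where j: "j < k" "i = n + j" using 2(1) by (metis add_less_cancel_left le_add_diff_inverse not_less)
   show ?thesis
   proof (cases "t \<le> cutpos x j")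
    case True
    then show ?thesis using 2 j cutpos(1)[of x j]
     by (intro exI[of _ "n + j"] exI[of _ "t / cutpos x j"]) (auto simp: model_def model_pos_def)
   next
    case False
    then have "x j \<notin> \<int>" using 2 by (auto simp: cutpos_def)
    then show ?thesis using 2 j False cutpos(3)[where x = x and j = j]
     by (intro exI[of _ "n + k + j"] exI[of _ "(t - cutpos x j) / (1 - cutpos x j)"])
      (auto simp: model_def model_pos_def divide_le_eq)
   qed
  qed
  then obtain e s where es: "e \<in> edges ?M" "s \<in> {0..1}" "pidx n k e = i" "model_pos n k x e s = t" by blast
  then have "y = ?h (edge_pt ?M e s)" using hedge[OF es(1,2)] 2 by simp
  then show ?thesis using edge_pt_in_points[OF fin es(1)] by blast
 qed
 have hInner: "?h (Inner e t) = Inner (pidx n k e) (model_pos n k x e t)" if "e \<in> edges ?M" "0 < t" "t < 1" for e t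
  using pos[OF that] by (simp add: model_map_def petal_Inner)
 have hVert: "?h (Vert v) = (if v = 0 then Vert 0 else Inner (n + (v - 1)) (cutpos x (v - 1)))" if "v \<in> verts ?M" for v
 proof (cases "v = 0")
  case False
  then have "x (v - 1) \<notin> \<int>" using that by (auto simp: model_def)
  then have "petal (n + (v - 1)) (x (v - 1)) = Inner (n + (v - 1)) (cutpos x (v - 1))"
   using cutpos(1)[of x "v - 1"] cutpos(3)[where x = x and j = "v - 1"]
    cutpos(4)[where x = x and j = "v - 1" and i = "n + (v - 1)"] petal_Inner by metis
  then show ?thesis using False by (simp add: model_map_def)
 qed (simp add: model_map_def)
 have notcut: "\<not> (pidx n k e = n + j \<and> model_pos n k x e t = cutpos x j)"
  if e: "e \<in> edges ?M" and t: "0 < t" "t < 1" and j: "j < k" "x j \<notin> \<int>" for e t j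
  using e
 proof (cases rule: model_edge_cases)
  case (2 i)
  have "cutpos x j * t < cutpos x j * 1" by (rule mult_strict_left_mono) (use cutpos(1)[of x j] t in auto)
  then show ?thesis using 2 by (auto simp: model_pos_def)
 next
  case (3 i)
  have "0 < (1 - cutpos x j) * t" using cutpos(3)[where x = x and j = j, OF j(2)] t by simp
  then show ?thesis using 3 by (auto simp: model_pos_def)
 qed (auto simp: model_pos_def)
 have edge_inj: "e = e' \<and> t = t'" if e: "e \<in> edges ?M" "0 < t" "t < 1" and e': "e' \<in> edges ?M" "0 < t'" "t' < 1"
  and eq: "pidx n k e = pidx n k e'" "model_pos n k x e t = model_pos n k x e' t'" for e e' t t'
 proof -
  have lo: "model_pos n k x (n + j) t < cutpos x j" if "j < k" "0 < t" "t < 1" for j t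
  proof -
   have "cutpos x j * t < cutpos x j * 1" by (rule mult_strict_left_mono) (use cutpos(1)[of x j] that in auto)
   then show ?thesis using that by (simp add: model_pos_def)
  qed
  have hi: "cutpos x j < model_pos n k x (n + k + j) t" if "x j \<notin> \<int>" "0 < t" "t < 1" for j t
  proof -
   have "0 < (1 - cutpos x j) * t" using cutpos(3)[where x = x and j = j, OF that(1)] that by simp
   then show ?thesis by (simp add: model_pos_def)
  qed
  have ee: "e = e'"
   using e(1)
  proof (cases rule: model_edge_cases)
   case 1
   from e'(1) show ?thesis by (cases rule: model_edge_cases) (use 1 eq in auto)
  next
   case (2 j)
   note e2 = this
   from e'(1) show ?thesis
   proof (cases rule: model_edge_cases)
    case (3 i)
    then have "i = j" using eq e2 by simp
    then show ?thesis using lo[of j t] hi[of i t'] 3 e2 e e' eq by simp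
   qed (use eq e2 in auto)
  next
   case (3 j)
   note e3 = this
   from e'(1) show ?thesis
   proof (cases rule: model_edge_cases)
    case (2 i)
    then have "i = j" using eq e3 by simp
    then show ?thesis using lo[of j t'] hi[of j t] 2 e3 e e' eq by simp
   qed (use eq e3 in auto)
  qed
  moreover have "t = t'"
   using e(1)
  proof (cases rule: model_edge_cases)
   case 1
   then show ?thesis using eq(2) ee by (simp add: model_pos_def)
  next
   case (2 j)
   then show ?thesis using eq(2) ee cutpos(1)[of x j] by (simp add: model_pos_def)
  next
   case (3 j)
   then show ?thesis using eq(2) ee cutpos(3)[where x = x and j = j] by (simp add: model_pos_def)
  qed
  ultimately show ?thesis by blast
 qed
 have inj: "inj_on ?h (points ?M)"
 proof (rule inj_onI)
  fix y z assume y: "y \<in> points ?M" and z: "z \<in> points ?M" and eq: "?h y = ?h z"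
  have vv: "v = 0 \<or> (v - 1 < k \<and> x (v - 1) \<notin> \<int>)" if "v \<in> verts ?M" for v using that by (auto simp: model_def)
  have mixed: False if v: "v \<in> verts ?M" and e: "e \<in> edges ?M" "0 < t" "t < 1" and eq: "?h (Vert v) = ?h (Inner e t)" for v e t
  proof (cases "v = 0")
   case True
   then show ?thesis using eq hVert[OF v] hInner[OF e] by simp
  next
   case False
   then show ?thesis using eq hVert[OF v] hInner[OF e] notcut[OF e, of "v - 1"] vv[OF v] by auto
  qed
  from y show "y = z"
  proof (cases rule: points_cases)
   case (1 v)
   note yv = this
   from z show ?thesis
   proof (cases rule: points_cases)
    case (1 w)
    then show ?thesis using yv eq hVert[OF yv(1)] hVert[OF 1(1)] by (auto split: if_splits)
   next
    case (2 e t)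
    then show ?thesis using mixed[of v e t] yv eq by simp
   qed
  next
   case (2 e t)
   note ye = this
   from z show ?thesis
   proof (cases rule: points_cases)
    case (1 w)
    then show ?thesis using mixed[of w e t] ye eq by simp
   next
    case (2 e' t')
    then show ?thesis using edge_inj[of e t e' t'] ye eq hInner[OF ye(1-3)] hInner[OF 2(1-3)] by simp
   qed
  qed
 qed
 show "homeomorphic_map (space_of ?M) (space_of ?R) ?h"
 proof (rule continuous_imp_homeomorphic_map[OF cont])
  show "compact_space (space_of ?M)" by (rule compact_space_space_of[OF fin])
  show "Hausdorff_space (space_of ?R)" by (rule Hausdorff_space_space_of) simp
  have "?h ` points ?M \<subseteq> points ?R"
   using continuous_map_image_subset_topspace[OF cont] by (simp add: topspace_space_of[OF fin])
  then show "?h ` topspace (space_of ?M) = topspace (space_of ?R)"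
   using surj by (auto simp: topspace_space_of[OF fin])
  show "inj_on ?h (topspace (space_of ?M))" using inj by (simp add: topspace_space_of[OF fin])
 qed
qed

lemma subdivided_rose_coord:
 assumes nk: "n + k \<ge> 1" and sr: "subdivided_rose n k \<Gamma> h x" and g: "homeomorphic_maps (space_of \<Gamma>) (space_of (rose (n + k))) h g"
 shows "coord n k (\<Gamma>, g \<circ> Fmap n k x) h x"
proof -
 interpret A: subdivided_rose n k \<Gamma> h x by (rule sr)
 have hg: "h (g y) = y" if "y \<in> points A.R" for y using g that by (simp add: homeomorphic_maps_def)
 have pts: "Fmap n k x y \<in> points A.R" if "y \<in> points (Gnk n k)" for y
  using continuous_map_Fmap[of n k x] that by (auto simp: continuous_map_def)
 have "homotopic_rel_circles True n k (rose (n + k)) (h \<circ> (g \<circ> Fmap n k x)) (Fmap n k x)"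
  by (rule htpy_rel_eq[OF htpy_rel_refl[OF continuous_map_Fmap]]) (simp_all add: hg pts)
 then show ?thesis using A.marked[OF nk g] sr by (simp add: coord_def)
qed

lemma coord_exists:
 assumes "n + k \<ge> 1" obtains m h where "coord n k m h x"
proof -
 interpret A: subdivided_rose n k "model n k x" "model_map n k x" x by (rule subdivided_rose_model)
 obtain g where "homeomorphic_maps (space_of (model n k x)) (space_of A.R) (model_map n k x) g"
  using A.h_inverse by metis
 from subdivided_rose_coord[OF assms subdivided_rose_model this] show ?thesis by (rule that)
qed

section \<open>Collapses in coordinates\<close>

lemma rep_singleton:
 "rep \<Gamma> {e} v = (if v = src \<Gamma> e \<or> v = tgt \<Gamma> e then min (src \<Gamma> e) (tgt \<Gamma> e) else v)"
proof -
 let ?p = "src \<Gamma> e" and ?q = "tgt \<Gamma> e"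
 let ?r = "{(?p, ?q), (?q, ?p)}"
 have rel: "(v, w) \<in> ?r\<^sup>* \<longleftrightarrow> v = w \<or> (v \<in> {?p, ?q} \<and> w \<in> {?p, ?q})" for w
 proof
  assume "(v, w) \<in> ?r\<^sup>*"
  then show "v = w \<or> (v \<in> {?p, ?q} \<and> w \<in> {?p, ?q})" by induction auto
 next
  have "(v, w) \<in> ?r\<^sup>*" if "(v, w) \<in> ?r" using that by (rule r_into_rtrancl)
  then show "(v, w) \<in> ?r\<^sup>*" if "v = w \<or> (v \<in> {?p, ?q} \<and> w \<in> {?p, ?q})" using that by auto
 qed
 have "rep \<Gamma> {e} v = (LEAST w. v = w \<or> (v \<in> {?p, ?q} \<and> w \<in> {?p, ?q}))"
  using rel by (simp add: rep_def)
 also have "\<dots> = (if v = ?p \<or> v = ?q then min ?p ?q else v)"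
  by (rule Least_equality) (auto split: if_splits)
 finally show ?thesis .
qed

lemma collapse_map_edge_pt:
 "collapse_map \<Gamma> {e} (edge_pt \<Gamma> e' s) =
   (if e' = e then Vert (min (src \<Gamma> e) (tgt \<Gamma> e)) else edge_pt (collapse \<Gamma> {e}) e' s)"
 by (auto simp: edge_pt_def collapse_map_def collapse_def rep_singleton)

lemma collapse_map_Vert: "collapse_map \<Gamma> A (Vert v) = Vert (rep \<Gamma> A v)"
 by (simp add: collapse_map_def)

lemma finite_graph_collapse: "finite_graph \<Gamma> ==> finite_graph (collapse \<Gamma> A)"
 by (auto simp: finite_graph_def collapse_def)

lemma collapse_map_in_points:
 assumes "finite_graph \<Gamma>" "e \<in> edges \<Gamma>" "z \<in> points \<Gamma>"
 shows "collapse_map \<Gamma> {e} z \<in> points (collapse \<Gamma> {e})"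
 using assms by (auto elim!: points_cases simp: collapse_map_def collapse_def finite_graph_def)

text \<open>Outside the closed edge \<open>e\<close> the collapse changes nothing, and the point to
  which this edge is sent lies on it.\<close>

lemma collapse_map_eqD:
 assumes fin: "finite_graph \<Gamma>" and z: "z \<in> points \<Gamma>" "z' \<in> points \<Gamma>"
  and eq: "collapse_map \<Gamma> {e} z = collapse_map \<Gamma> {e} z'"
 shows "z = z' \<or> (z \<in> edge_pt \<Gamma> e ` {0..1} \<and> z' \<in> edge_pt \<Gamma> e ` {0..1})"
proof -
 let ?E = "edge_pt \<Gamma> e ` {0..1}"
 let ?m = "Vert (min (src \<Gamma> e) (tgt \<Gamma> e))"
 have E: "Vert (src \<Gamma> e) \<in> ?E" "Vert (tgt \<Gamma> e) \<in> ?E"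
  by (rule image_eqI[of _ _ 0], simp_all) (rule image_eqI[of _ _ 1], simp_all)
 have Inner_E: "Inner e t \<in> ?E" if "0 < t" "t < 1" for t
  by (rule image_eqI[of _ _ t]) (use that in simp_all)
 have mE: "?m \<in> ?E" using E by (simp add: min_def)
 have cases: "(y \<in> ?E \<and> collapse_map \<Gamma> {e} y = ?m) \<or> (y \<notin> ?E \<and> collapse_map \<Gamma> {e} y = y)" if "y \<in> points \<Gamma>" for y
  using that
 proof (cases rule: points_cases)
  case (1 v)
  have "Vert v \<in> ?E \<longleftrightarrow> v = src \<Gamma> e \<or> v = tgt \<Gamma> e"
   using E by (auto simp: edge_pt_def split: if_splits)
  then show ?thesis using 1 by (auto simp: collapse_map_Vert rep_singleton)
 next
  case (2 e' t)
  have "Inner e' t \<in> ?E \<longleftrightarrow> e' = e"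
   using Inner_E[OF 2(2,3)] by (auto simp: edge_pt_def split: if_splits)
  then show ?thesis using 2 by (auto simp: collapse_map_def rep_singleton)
 qed
 show ?thesis using cases[OF z(1)] cases[OF z(2)] eq mE by metis
qed

lemma collapse_map_surj:
 assumes fin: "finite_graph \<Gamma>" and y: "y \<in> points (collapse \<Gamma> {e})"
 obtains z where "z \<in> points \<Gamma>" "collapse_map \<Gamma> {e} z = y"
 using y
proof (cases rule: points_cases)
 case (1 v)
 then obtain w where "w \<in> verts \<Gamma>" "v = rep \<Gamma> {e} w" by (auto simp: collapse_def)
 then show ?thesis using 1 that[of "Vert w"] by (simp add: collapse_map_Vert)
next
 case (2 e' t)
 then show ?thesis using that[of "Inner e' t"] by (simp add: collapse_map_def collapse_def)
qed

text \<open>The profile is constant on the collapsed part and stretches the other part of the unit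
  interval linearly over the whole of it. The two alternatives round the cut point \<open>s\<close>
  down to 0 or up to 1.\<close>

lemma collapse_profile:
 fixes s a b c :: real
 assumes s: "0 < s" "s < 1" and side: "(a = 0 \<and> b = s \<and> c = 0) \<or> (a = s \<and> b = 1 \<and> c = 1)"
 obtains g where "continuous_on {0..1} g" "g 0 = 0" "g 1 = 1" "g s = c"
  "\<forall>t\<in>{a..b}. g t = c" "\<forall>t. 0 < t \<and> t < 1 \<and> t \<notin> {a..b} --> 0 < g t \<and> g t < 1"
  "\<forall>t t'. 0 < t \<and> t < 1 \<and> t \<notin> {a..b} \<and> 0 < t' \<and> t' < 1 \<and> t' \<notin> {a..b} \<and> g t = g t' --> t = t'"
 using side
proof (elim disjE conjE)
 assume ab: "a = 0" "b = s" "c = 0"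
 let ?g = "%t. max 0 ((t - s) / (1 - s))"
 have g: "?g t = (t - s) / (1 - s) \<and> 0 < (t - s) / (1 - s) \<and> (t - s) / (1 - s) < 1" if "s < t" "t < 1" for t
  using that s by (simp add: divide_less_eq)
 have g0: "?g t = 0" if "t \<le> s" for t using that s by (simp add: max_def divide_le_0_iff zero_le_divide_iff)
 show ?thesis
 proof (rule that[of ?g])
  show "continuous_on {0..1} ?g" using s by (intro continuous_intros) auto
  show "?g 0 = 0" "?g s = c" using g0 s ab by simp_all
  show "?g 1 = 1" using s by simp
  show "\<forall>t\<in>{a..b}. ?g t = c" using g0 ab by simp
  show "\<forall>t. 0 < t \<and> t < 1 \<and> t \<notin> {a..b} --> 0 < ?g t \<and> ?g t < 1" using g ab by (auto simp: not_le)
  show "\<forall>t t'. 0 < t \<and> t < 1 \<and> t \<notin> {a..b} \<and> 0 < t' \<and> t' < 1 \<and> t' \<notin> {a..b} \<and> ?g t = ?g t' --> t = t'"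
  proof (intro allI impI)
   fix t t' assume *: "0 < t \<and> t < 1 \<and> t \<notin> {a..b} \<and> 0 < t' \<and> t' < 1 \<and> t' \<notin> {a..b} \<and> ?g t = ?g t'"
   have st: "s < t" "s < t'" "t < 1" "t' < 1" using * ab by auto
   have gt: "?g t = (t - s) / (1 - s)" "?g t' = (t' - s) / (1 - s)" using conjunct1[OF g[OF st(1) st(3)]] conjunct1[OF g[OF st(2) st(4)]] .
   have eq: "?g t = ?g t'" by (rule conjunct2[OF conjunct2[OF conjunct2[OF conjunct2[OF conjunct2[OF conjunct2[OF *]]]]]])
   have "(t - s) / (1 - s) = (t' - s) / (1 - s)" by (rule trans[OF trans[OF gt(1)[symmetric] eq] gt(2)])
   then show "t = t'" using s by simp
  qed
 qed
next
 assume ab: "a = s" "b = 1" "c = 1"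
 let ?g = "%t. min 1 (t / s)"
 have g: "?g t = t / s \<and> 0 < t / s \<and> t / s < 1" if "0 < t" "t < s" for t
  using that s by simp
 have g0: "?g t = 1" if "s \<le> t" for t using that s by (simp add: min_def divide_le_eq)
 show ?thesis
 proof (rule that[of ?g])
  show "continuous_on {0..1} ?g" using s by (intro continuous_intros) auto
  show "?g 1 = 1" "?g s = c" using g0 s ab by simp_all
  show "?g 0 = 0" using s by simp
  show "\<forall>t\<in>{a..b}. ?g t = c" using g0 ab by simp
  show "\<forall>t. 0 < t \<and> t < 1 \<and> t \<notin> {a..b} --> 0 < ?g t \<and> ?g t < 1" using g ab by (auto simp: not_le)
  show "\<forall>t t'. 0 < t \<and> t < 1 \<and> t \<notin> {a..b} \<and> 0 < t' \<and> t' < 1 \<and> t' \<notin> {a..b} \<and> ?g t = ?g t' --> t = t'"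
  proof (intro allI impI)
   fix t t' assume *: "0 < t \<and> t < 1 \<and> t \<notin> {a..b} \<and> 0 < t' \<and> t' < 1 \<and> t' \<notin> {a..b} \<and> ?g t = ?g t'"
   have st: "t < s" "t' < s" "0 < t" "0 < t'" using * ab by auto
   have gt: "?g t = t / s" "?g t' = t' / s" using conjunct1[OF g[OF st(3) st(1)]] conjunct1[OF g[OF st(4) st(2)]] .
   have eq: "?g t = ?g t'" by (rule conjunct2[OF conjunct2[OF conjunct2[OF conjunct2[OF conjunct2[OF conjunct2[OF *]]]]]])
   have "t / s = t' / s" by (rule trans[OF trans[OF gt(1)[symmetric] eq] gt(2)])
   then show "t = t'" using s by simp
  qed
 qed
qed

context subdivided_rose
begin

lemma gap_cases:
 assumes "gap i a b"
 obtains "a = 0" "b = 1" | j where "j < k" "i = n + j" "x j \<notin> \<int>" "a = 0 \<and> b = frac (x j) \<or> a = frac (x j) \<and> b = 1"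
proof (rule cut_finite_cases[of i])
 assume "cut i = {0, 1}"
 then show ?thesis using assms that(1) by (auto simp: gap_def)
next
 fix j assume j: "j < k" "i = n + j" "x j \<notin> \<int>" "cut i = {0, frac (x j), 1}"
 obtain s where s: "s = frac (x j)" "0 < s" "s < 1" using j(3) frac_lt_1[of "x j"] by (simp add: frac_gt_0_iff)
 have "a \<in> {0, s, 1}" "b \<in> {0, s, 1}" "a < b" "s \<notin> {a<..<b}"
  using assms j(4) s(1) by (auto simp: gap_def)
 then have "a = 0 \<and> b = s \<or> a = s \<and> b = 1" using s(2,3) by auto
 then have "a = 0 \<and> b = frac (x j) \<or> a = frac (x j) \<and> b = 1" unfolding s(1) .
 then show ?thesis by (rule that(2)[OF j(1-3)])
qed

lemma edge_gap_closed_image: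
 assumes g: "edge_gap e i a b"
 shows "h ` edge_pt \<Gamma> e ` {0..1} = petal i ` {a..b}"
proof -
 have ab: "a < b" using g by (simp add: edge_gap_def gap_def)
 have "{0..1::real} = {0<..<1} \<union> {0, 1}" "{a..b} = {a<..<b} \<union> {a, b}" using ab by auto
 moreover have "edge_pt \<Gamma> e ` {0<..<1} = open_edge e"
  unfolding open_edge_def by (rule image_cong) simp_all
 moreover have "h ` edge_pt \<Gamma> e ` {0, 1} = petal i ` {a, b}"
  using g unfolding edge_gap_def by auto
 moreover have "h ` open_edge e = petal i ` {a<..<b}" using g by (simp add: edge_gap_def)
 ultimately show ?thesis by (simp only: image_Un)
qed

text \<open>The self-map of the rose that flattens the gap of \<open>e\<close> identifies exactly
  the points that the collapse of \<open>e\<close> identifies. It therefore induces a homeomorphism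
  from the collapsed graph to the rose, with the \<open>j\<close>-th coordinate rounded to an
  integer.\<close>

lemma collapse_gap:
 fixes c :: real
 assumes e: "edge_gap e (n + j) a b" and j: "j < k" "x j \<notin> \<int>"
  and side: "(a = 0 \<and> b = frac (x j) \<and> c = 0) \<or> (a = frac (x j) \<and> b = 1 \<and> c = 1)"
 obtains h' m where "rose_self_map (n + k) m" "subdivided_rose n k (collapse \<Gamma> {e}) h' (x(j := of_int \<lfloor>x j\<rfloor> + c))"
  "\<forall>z\<in>points \<Gamma>. h' (collapse_map \<Gamma> {e} z) = rose_map m (h z)"
  "homotopic_rel_circles True n k R (rose_map m \<circ> Fmap n k x) (Fmap n k (x(j := of_int \<lfloor>x j\<rfloor> + c)))"
  "\<not> is_loop \<Gamma> e"
proof -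
 let ?i = "n + j" and ?s = "frac (x j)" and ?\<Gamma> = "collapse \<Gamma> {e}" and ?cm = "collapse_map \<Gamma> {e}"
 let ?x = "x(j := of_int \<lfloor>x j\<rfloor> + c)"
 let ?C = "petal ?i ` {a..b}" and ?E = "edge_pt \<Gamma> e ` {0..1}"
 have s: "0 < ?s" "?s < 1" using j(2) frac_lt_1[of "x j"] by (simp_all add: frac_gt_0_iff)
 have eE: "e \<in> edges \<Gamma>" using e by (simp add: edge_gap_def)
 have i: "?i < n + k" using j by simp
 have c: "c \<in> \<int>" using side by auto
 obtain g where g: "continuous_on {0..1} g" "g 0 = 0" "g 1 = 1" "g ?s = c" "\<forall>t\<in>{a..b}. g t = c"
  "\<forall>t. 0 < t \<and> t < 1 \<and> t \<notin> {a..b} --> 0 < g t \<and> g t < 1"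
  "\<forall>t t'. 0 < t \<and> t < 1 \<and> t \<notin> {a..b} \<and> 0 < t' \<and> t' < 1 \<and> t' \<notin> {a..b} \<and> g t = g t' --> t = t'"
  by (rule collapse_profile[OF s side])
 define m where "m i = (if i = ?i then g else (%t. t))" for i
 have m: "rose_self_map (n + k) m"
  by standard (use g(1-3) in \<open>auto simp: m_def\<close>)
 interpret M: rose_self_map "n + k" m by (rule m)
 let ?c = "rose_map m"
 have ab: "a < b" "{a..b} \<subseteq> {0..1}" using side s by auto
 have C0: "Vert 0 \<in> ?C"
 proof (cases "a = 0")
  case True
  then show ?thesis using ab by (intro image_eqI[of _ _ 0]) auto
 next
  case False
  then show ?thesis using ab side by (intro image_eqI[of _ _ 1]) auto
 qed
 have c_in: "?c y = Vert 0" if yC: "y \<in> ?C" for y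
 proof -
  obtain t where t: "t \<in> {a..b}" "y = petal ?i t" using yC by blast
  then have "?c y = petal ?i c" using M.rose_map_petal[OF i, of t] ab(2) g(5) by (auto simp: m_def)
  then show ?thesis using c by (simp add: petal_Ints)
 qed
 have c_out: "\<exists>l t. l < n + k \<and> 0 < t \<and> t < 1 \<and> y = petal l t \<and> ?c y = Inner l (m l t) \<and> (l = ?i --> t \<notin> {a..b})"
  if "y \<in> points R" "y \<notin> ?C" for y
  using that(1)
 proof (cases rule: rose_point_cases)
  case 1
  then show ?thesis using C0 that(2) by simp
 next
  case (2 l t)
  have t: "l = ?i --> t \<notin> {a..b}" using 2 that(2) by auto
  then have "0 < m l t \<and> m l t < 1" using g(6) 2 by (auto simp: m_def)
  then have "?c y = Inner l (m l t)" using M.rose_map_petal[OF 2(1), of t] 2 by (simp add: petal_Inner)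
  then show ?thesis using 2 t by blast
 qed
 have c_inj: "y = y' \<or> (y \<in> ?C \<and> y' \<in> ?C)" if y: "y \<in> points R" "y' \<in> points R" and eq: "?c y = ?c y'" for y y'
 proof (cases "y \<in> ?C")
  case True
  then have "?c y' = Vert 0" using c_in eq by simp
  then have "y' \<in> ?C" using c_out[OF y(2)] by force
  then show ?thesis using True by blast
 next
  case False
  then obtain l t where l: "0 < t" "t < 1" "y = petal l t" "?c y = Inner l (m l t)" "l = ?i --> t \<notin> {a..b}"
   using c_out[OF y(1)] by blast
  then have "y' \<notin> ?C" using c_in eq by force
  then obtain l' t' where l': "0 < t'" "t' < 1" "y' = petal l' t'" "?c y' = Inner l' (m l' t')" "l' = ?i --> t' \<notin> {a..b}"
   using c_out[OF y(2)] by blast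
  have ll: "l' = l" "m l t = m l t'" using l(4) l'(4) eq by auto
  have "t = t'"
  proof (cases "l = ?i")
   case True
   then show ?thesis using g(7) l l' ll by (simp add: m_def)
  next
   case False
   then show ?thesis using ll by (simp add: m_def)
  qed
  then show ?thesis using l l' ll by simp
 qed
 have hE: "h ` ?E = ?C" by (rule edge_gap_closed_image[OF e])
 have E_sub: "?E \<subseteq> points \<Gamma>" using edge_pt_in_points[OF fin\<Gamma> eE] by auto
 have well: "?c (h z) = ?c (h z')" if "z \<in> points \<Gamma>" "z' \<in> points \<Gamma>" "?cm z = ?cm z'" for z z'
  using collapse_map_eqD[OF fin\<Gamma> that]
 proof
  assume "z \<in> ?E \<and> z' \<in> ?E"
  then have "h z \<in> ?C" "h z' \<in> ?C" using hE by blast+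
  then show ?thesis using c_in by simp
 qed simp
 \<comment> \<open>The choice of a preimage is harmless by \<open>well\<close>; injectivity of
   \<open>h'\<close> comes from \<open>c_inj\<close>.\<close>
 define h' where "h' y = ?c (h (SOME z. z \<in> points \<Gamma> \<and> ?cm z = y))" for y
 have h': "h' (?cm z) = ?c (h z)" if "z \<in> points \<Gamma>" for z
 proof -
  have "(SOME z'. z' \<in> points \<Gamma> \<and> ?cm z' = ?cm z) \<in> points \<Gamma> \<and> ?cm (SOME z'. z' \<in> points \<Gamma> \<and> ?cm z' = ?cm z) = ?cm z"
   by (rule someI[of _ z]) (use that in simp)
  then show ?thesis unfolding h'_def using well that by blast
 qed
 have fin': "finite_graph ?\<Gamma>" by (rule finite_graph_collapse[OF fin\<Gamma>])
 have bp: "base_pt \<Gamma> \<in> points \<Gamma>" using fin\<Gamma> by (simp add: base_pt_def finite_graph_def)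
 have cm_base: "?cm (base_pt \<Gamma>) = base_pt ?\<Gamma>" by (simp add: base_pt_def collapse_map_Vert collapse_def)
 have h_pts: "h z \<in> points R" if "z \<in> points \<Gamma>" for z using surj_h that by blast
 have c_pts: "?c y \<in> points R" if "y \<in> points R" for y
  using M.continuous_map_rose_map that by (auto simp: continuous_map_def)
 have cont_ch: "continuous_map (space_of \<Gamma>) (space_of R) (?c \<circ> h)"
  by (rule continuous_map_compose[OF cont_h M.continuous_map_rose_map])
 have cont': "continuous_map (space_of ?\<Gamma>) (space_of R) h'"
  unfolding continuous_map_space_of_iff[OF fin']
 proof (intro conjI ballI)
  fix v assume "v \<in> verts ?\<Gamma>"
  then have "Vert v \<in> points ?\<Gamma>" by simp
  then obtain z where z: "z \<in> points \<Gamma>" "?cm z = Vert v" by (rule collapse_map_surj[OF fin\<Gamma>])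
  then have "h' (Vert v) = ?c (h z)" using h'[OF z(1)] by simp
  then show "h' (Vert v) \<in> topspace (space_of R)" using c_pts h_pts z(1) by simp
 next
  fix e' assume "e' \<in> edges ?\<Gamma>"
  then have e': "e' \<in> edges \<Gamma>" "e' \<noteq> e" by (auto simp: collapse_def)
  have "h' (edge_pt ?\<Gamma> e' t) = (?c \<circ> h) (edge_pt \<Gamma> e' t)" for t
   using h'[OF edge_pt_in_points[OF fin\<Gamma> e'(1)], of t] e'(2) by (simp add: collapse_map_edge_pt)
  moreover have "continuous_map I01 (space_of R) ((?c \<circ> h) \<circ> edge_pt \<Gamma> e')"
   by (rule continuous_map_compose[OF continuous_map_edge_pt[OF fin\<Gamma> e'(1)] cont_ch])
  ultimately show "continuous_map I01 (space_of R) (%t. h' (edge_pt ?\<Gamma> e' t))" by (simp add: comp_def)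
 qed
 have c_petal: "?c (petal l t) = petal l (m l (frac t))" if "l < n + k" for l t
 proof -
  have "petal l t = petal l (frac t)" by (simp add: petal_eq_iff frac_def)
  moreover have "frac t \<in> {0..1}" using frac_lt_1[of t] frac_ge_0[of t] by simp
  ultimately show ?thesis using M.rose_map_petal[OF that, of "frac t"] by simp
 qed
 have "subdivided_rose n k ?\<Gamma> h' ?x"
 proof
  show "finite_graph ?\<Gamma>" by (rule fin')
  show "h' (base_pt ?\<Gamma>) = Vert 0" using h'[OF bp] h_base by (simp add: cm_base)
  have "h' ` Vert ` verts ?\<Gamma> = h' ` ?cm ` Vert ` verts \<Gamma>"
   by (simp add: collapse_def image_image collapse_map_Vert)
  also have "\<dots> = ?c ` h ` Vert ` verts \<Gamma>"
   unfolding image_image by (rule image_cong) (simp_all add: h')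
  also have "\<dots> = insert (Vert 0) ((%l. ?c (petal (n + l) (x l))) ` {..<k})"
   unfolding h_verts by (simp add: image_image)
  also have "(%l. ?c (petal (n + l) (x l))) ` {..<k} = (%l. petal (n + l) (?x l)) ` {..<k}"
  proof (rule image_cong[OF refl])
   fix l assume "l \<in> {..<k}"
   then have "?c (petal (n + l) (x l)) = petal (n + l) (m (n + l) (frac (x l)))" by (intro c_petal) simp
   also have "\<dots> = petal (n + l) (?x l)"
    using c g(4) by (auto simp: m_def petal_eq_iff frac_def)
   finally show "?c (petal (n + l) (x l)) = petal (n + l) (?x l)" .
  qed
  finally show "h' ` Vert ` verts ?\<Gamma> = insert (Vert 0) ((%l. petal (n + l) (?x l)) ` {..<k})" .
  show "homeomorphic_map (space_of ?\<Gamma>) (space_of R) h'"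
  proof (rule continuous_imp_homeomorphic_map[OF cont'])
   show "compact_space (space_of ?\<Gamma>)" by (rule compact_space_space_of[OF fin'])
   show "Hausdorff_space (space_of R)" by (rule Hausdorff_space_space_of) simp
   have surj_c: "\<exists>y'\<in>points R. ?c y' = y" if "y \<in> points R" for y
    using that
   proof (cases rule: rose_point_cases)
    case 1
    then show ?thesis by (intro bexI[of _ "Vert 0"]) simp_all
   next
    case (2 l t)
    show ?thesis
    proof (cases "l = ?i")
     case True
     obtain u where u: "0 \<le> u" "u \<le> 1" "g u = t"
      using IVT'[of g 0 t 1] g(1-3) 2 by auto
     then have "?c (petal ?i u) = petal ?i t" using M.rose_map_petal[OF i, of u] by (simp add: m_def)
     then show ?thesis using 2 True petal_in_points[OF i] by blast
    next
     case False
     then have "?c (petal l t) = petal l t" using M.rose_map_petal[OF 2(1), of t] 2 by (simp add: m_def)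
     then show ?thesis using 2 that by blast
    qed
   qed
   show "h' ` topspace (space_of ?\<Gamma>) = topspace (space_of R)"
   proof
    show "h' ` topspace (space_of ?\<Gamma>) \<subseteq> topspace (space_of R)"
     by (rule continuous_map_image_subset_topspace[OF cont'])
    show "topspace (space_of R) \<subseteq> h' ` topspace (space_of ?\<Gamma>)"
    proof
     fix y assume "y \<in> topspace (space_of R)"
     then have "y \<in> points R" by simp
     from surj_c[OF this] obtain y' where y': "y' \<in> points R" "?c y' = y" by (rule bexE)
     then have "y' \<in> h ` points \<Gamma>" by (simp only: surj_h)
     then obtain z where z: "y' = h z" "z \<in> points \<Gamma>" by (rule imageE)
     then have "y = h' (?cm z)" using h'[OF z(2)] y' by simp
     moreover have "?cm z \<in> topspace (space_of ?\<Gamma>)"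
      using collapse_map_in_points[OF fin\<Gamma> eE z(2)] by (simp only: topspace_space_of[OF fin'])
     ultimately show "y \<in> h' ` topspace (space_of ?\<Gamma>)" by (rule image_eqI)
    qed
   qed
   show "inj_on h' (topspace (space_of ?\<Gamma>))"
   proof (rule inj_onI)
    fix y y' assume "y \<in> topspace (space_of ?\<Gamma>)" "y' \<in> topspace (space_of ?\<Gamma>)" and eq: "h' y = h' y'"
    then have "y \<in> points ?\<Gamma>" "y' \<in> points ?\<Gamma>" by (simp_all add: topspace_space_of[OF fin'])
    note yy = this
    obtain z where z1: "z \<in> points \<Gamma>" "?cm z = y" by (rule collapse_map_surj[OF fin\<Gamma> yy(1)])
    obtain z' where z2: "z' \<in> points \<Gamma>" "?cm z' = y'" by (rule collapse_map_surj[OF fin\<Gamma> yy(2)])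
    note z = z1 z2
    have "?c (h z) = ?c (h z')" using h'[OF z(1)] h'[OF z(3)] z eq by simp
    then consider "h z = h z'" | "h z \<in> h ` ?E" "h z' \<in> h ` ?E"
     using c_inj[OF h_pts[OF z(1)] h_pts[OF z(3)]] hE by auto
    then show "y = y'"
    proof cases
     case 1
     then have "z = z'" by (rule inj_onD[OF inj_h _ z(1,3)])
     then show ?thesis using z(2,4) by (simp only:)
    next
     case 2
     then have "z \<in> ?E" "z' \<in> ?E"
      by (simp_all only: inj_on_image_mem_iff[OF inj_h z(1) E_sub] inj_on_image_mem_iff[OF inj_h z(3) E_sub])
     then obtain t t' where "z = edge_pt \<Gamma> e t" "z' = edge_pt \<Gamma> e t'" by blast
     then show ?thesis using z(2,4) by (simp add: collapse_map_edge_pt)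
    qed
   qed
  qed
 qed
 moreover have "homotopic_rel_circles True n k R (?c \<circ> Fmap n k x) (Fmap n k ?x)"
 proof (rule htpy_rel_eq[OF Fmap_compose_rose_map[OF m]])
  fix y assume y: "y \<in> points (Gnk n k)"
  show "Fmap n k ?x y = Fmap n k (%l. if l < k then of_int \<lfloor>x l\<rfloor> + m (n + l) (frac (x l)) else x l) y"
   by (rule Fmap_cong[OF _ y]) (auto simp: m_def g(4), simp add: frac_def)
 qed simp
 moreover have "\<not> is_loop \<Gamma> e"
 proof
  assume "is_loop \<Gamma> e"
  then have "petal ?i a = petal ?i b" using e by (auto simp: edge_gap_def is_loop_def)
  then have "a - b \<in> \<int>" by (simp add: petal_eq_iff)
  then have "- ?s \<in> \<int> \<or> ?s - 1 \<in> \<int>" using side by auto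
  then have "?s \<in> \<int>" by (metis Ints_minus Ints_add Ints_1 diff_add_cancel minus_minus)
  then show False using Ints_between_0_1[OF s] by simp
 qed
 ultimately show ?thesis using h' by (intro that[OF m]) auto
qed

end

lemma coord_collapse_homotopic:
 assumes c: "coord n k (\<Gamma>, \<phi>) h x" and m: "rose_self_map (n + k) m"
  and h': "\<forall>z\<in>points \<Gamma>. h' (collapse_map \<Gamma> {e} z) = rose_map m (h z)"
  and hom: "homotopic_rel_circles True n k (rose (n + k)) (rose_map m \<circ> Fmap n k x) (Fmap n k x')"
 shows "homotopic_rel_circles True n k (rose (n + k)) (h' \<circ> (collapse_map \<Gamma> {e} \<circ> \<phi>)) (Fmap n k x')"
proof -
 interpret M: rose_self_map "n + k" m by (rule m)
 have mk: "(\<Gamma>, \<phi>) \<in> marked True n k" and h: "homotopic_rel_circles True n k (rose (n + k)) (h \<circ> \<phi>) (Fmap n k x)"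
  using c by (simp_all add: coord_def)
 have "homotopic_rel_circles True n k (rose (n + k)) (h' \<circ> (collapse_map \<Gamma> {e} \<circ> \<phi>)) (rose_map m \<circ> Fmap n k x)"
  by (rule htpy_rel_transport[OF h M.continuous_map_rose_map]) (use h' markedD(6)[OF mk] in simp_all)
 then show ?thesis by (rule htpy_rel_trans[OF _ hom])
qed

definition coord_below :: "real => real => bool" where
 "coord_below y x \<longleftrightarrow> y = x \<or> (x \<notin> \<int> \<and> (y = of_int \<lfloor>x\<rfloor> \<or> y = of_int \<lfloor>x\<rfloor> + 1))"

text \<open>An edge that fills a whole petal is a loop and cannot be collapsed. Any other edge lies
  between the base vertex and a cut point, so its collapse rounds one coordinate.\<close>

lemma coord_edge_collapse:
 assumes c: "coord n k m h x" and mm: "(m, m') \<in> edge_collapse True n k"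
 obtains h' j y where "coord n k m' h' (x(j := y))" "coord_below y (x j)"
proof -
 obtain \<Gamma> \<phi> \<Gamma>' \<phi>' where m: "m = (\<Gamma>, \<phi>)" "m' = (\<Gamma>', \<phi>')" by (cases m, cases m')
 interpret A: subdivided_rose n k \<Gamma> h x using c by (simp add: coord_def m)
 have mk': "(\<Gamma>', \<phi>') \<in> marked True n k" using mm by (simp add: edge_collapse_def m)
 obtain e where e: "e \<in> edges \<Gamma>" "\<not> is_loop \<Gamma> e" "\<Gamma>' = collapse \<Gamma> {e}"
  "homotopic_rel_circles True n k \<Gamma>' (collapse_map \<Gamma> {e} \<circ> \<phi>) \<phi>'"
  using mm by (auto simp: edge_collapse_def m)
 obtain i a b where g: "A.edge_gap e i a b" by (rule A.edge_gap_exists[OF e(1)])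
 have gap: "A.gap i a b" using g by (simp add: A.edge_gap_def)
 from gap show ?thesis
 proof (cases rule: A.gap_cases)
  case 1
  then have "h (Vert (src \<Gamma> e)) = h (Vert (tgt \<Gamma> e))" using g by (auto simp: A.edge_gap_def)
  moreover have "Vert (src \<Gamma> e) \<in> points \<Gamma>" "Vert (tgt \<Gamma> e) \<in> points \<Gamma>"
   using A.fin\<Gamma> e(1) by (auto simp: finite_graph_def)
  ultimately have "Vert (src \<Gamma> e) = Vert (tgt \<Gamma> e)" using A.inj_h by (metis inj_onD)
  then show ?thesis using e(1,2) by (simp add: is_loop_def)
 next
  case (2 j)
  obtain cc :: real where side: "(a = 0 \<and> b = frac (x j) \<and> cc = 0) \<or> (a = frac (x j) \<and> b = 1 \<and> cc = 1)"
   using 2(4) by blast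
  let ?x = "x(j := of_int \<lfloor>x j\<rfloor> + cc)"
  obtain h' \<mu> where h': "rose_self_map (n + k) \<mu>" "subdivided_rose n k (collapse \<Gamma> {e}) h' ?x"
   "\<forall>z\<in>points \<Gamma>. h' (collapse_map \<Gamma> {e} z) = rose_map \<mu> (h z)"
   "homotopic_rel_circles True n k A.R (rose_map \<mu> \<circ> Fmap n k x) (Fmap n k ?x)"
   by (rule A.collapse_gap[OF g[unfolded 2(2)] 2(1,3) side])
  interpret B: subdivided_rose n k \<Gamma>' h' ?x using h'(2) e(3) by simp
  have 1: "homotopic_rel_circles True n k A.R (h' \<circ> (collapse_map \<Gamma> {e} \<circ> \<phi>)) (Fmap n k ?x)"
   by (rule coord_collapse_homotopic[OF c[unfolded m] h'(1,3,4)])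
  have "homotopic_rel_circles True n k A.R (h' \<circ> \<phi>') (h' \<circ> (collapse_map \<Gamma> {e} \<circ> \<phi>))"
   by (rule htpy_rel_compose_left[OF htpy_rel_sym[OF e(4)] B.cont_h]) (simp add: B.h_base)
  from htpy_rel_trans[OF this 1] have "coord n k m' h' ?x"
   using mk' h'(2) e(3) by (simp add: coord_def m)
  moreover have "coord_below (of_int \<lfloor>x j\<rfloor> + cc) (x j)" using side 2(3) by (auto simp: coord_below_def)
  ultimately show ?thesis by (rule that)
 qed
qed

text \<open>Rounding down collapses the edge before the cut point, rounding up the edge after
  it.\<close>

lemma coord_collapsible:
 assumes nk: "n + k \<ge> 1" and c: "coord n k m h x" and j: "j < k" and y: "coord_below y (x j)"
 obtains m' h' where "(m, m') \<in> (edge_collapse True n k)\<^sup>*" "coord n k m' h' (x(j := y))"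
proof (cases "y = x j")
 case True
 then show ?thesis using c by (intro that[of m h]) simp_all
next
 case False
 then have xj: "x j \<notin> \<int>" and yc: "y = of_int \<lfloor>x j\<rfloor> \<or> y = of_int \<lfloor>x j\<rfloor> + 1" using y by (auto simp: coord_below_def)
 obtain \<Gamma> \<phi> where m: "m = (\<Gamma>, \<phi>)" by (cases m)
 have mk: "(\<Gamma>, \<phi>) \<in> marked True n k" and hom: "homotopic_rel_circles True n k (rose (n + k)) (h \<circ> \<phi>) (Fmap n k x)"
  using c by (simp_all add: coord_def m)
 note M = markedD[OF mk]
 interpret A: subdivided_rose n k \<Gamma> h x using c by (simp add: coord_def m)
 let ?s = "frac (x j)"
 have s: "0 < ?s" "?s < 1" using xj frac_lt_1[of "x j"] by (simp_all add: frac_gt_0_iff)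
 have "A.cut (n + j) = {0, ?s, 1}" using xj j s by (auto simp: A.cut_iff)
 then have gaps: "A.gap (n + j) 0 ?s" "A.gap (n + j) ?s 1" using A.gap_split[OF _ s] j by simp_all
 obtain a b cc :: real where abc: "A.gap (n + j) a b" "y = of_int \<lfloor>x j\<rfloor> + cc"
  "(a = 0 \<and> b = ?s \<and> cc = 0) \<or> (a = ?s \<and> b = 1 \<and> cc = 1)"
  using yc gaps by (metis add.right_neutral)
 obtain e where e: "A.edge_gap e (n + j) a b" by (rule A.edge_gap_exists'[OF abc(1)])
 obtain h' \<mu> where h': "rose_self_map (n + k) \<mu>" "subdivided_rose n k (collapse \<Gamma> {e}) h' (x(j := y))"
  "\<forall>z\<in>points \<Gamma>. h' (collapse_map \<Gamma> {e} z) = rose_map \<mu> (h z)"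
  "homotopic_rel_circles True n k A.R (rose_map \<mu> \<circ> Fmap n k x) (Fmap n k (x(j := y)))" "\<not> is_loop \<Gamma> e"
  unfolding abc(2) by (rule A.collapse_gap[OF e j xj abc(3)])
 let ?\<Gamma> = "collapse \<Gamma> {e}"
 interpret B: subdivided_rose n k ?\<Gamma> h' "x(j := y)" by (rule h'(2))
 obtain g where g: "homeomorphic_maps (space_of ?\<Gamma>) (space_of A.R) h' g"
  "continuous_map (space_of A.R) (space_of ?\<Gamma>) g" "!!z. z \<in> points ?\<Gamma> ==> g (h' z) = z" "g (Vert 0) = base_pt ?\<Gamma>"
  using B.h_inverse by metis
 have eE: "e \<in> edges \<Gamma>" using e by (simp add: A.edge_gap_def)
 have c': "coord n k (?\<Gamma>, g \<circ> Fmap n k (x(j := y))) h' (x(j := y))"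
  by (rule subdivided_rose_coord[OF nk h'(2) g(1)])
 have "homotopic_rel_circles True n k ?\<Gamma> (collapse_map \<Gamma> {e} \<circ> \<phi>) (g \<circ> Fmap n k (x(j := y)))"
  by (rule htpy_rel_transport[OF coord_collapse_homotopic[OF c[unfolded m] h'(1,3,4)] g(2)])
   (simp_all add: g(3,4) collapse_map_in_points[OF A.fin\<Gamma> eE] M(6))
 \<comment> \<open>The edge lies on the \<open>j\<close>-th cycle, so it disappears in
   \<open>hat\<close> and cannot be a loop there.\<close>
 moreover have "e \<in> cycle_edges n k \<Gamma> \<phi>"
 proof -
  have sub: "\<phi> ` circ n k j \<subseteq> points \<Gamma>" using circ_subset_points[OF j] M(6) by blast
  have img: "h ` \<phi> ` circ n k j = range (petal (n + j))"
   using htpy_rel_imp(5)[OF hom j] Fmap_circ[OF j] unfolding image_comp by simp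
  have "edge_pt \<Gamma> e ` {0..1} \<subseteq> \<phi> ` circ n k j"
  proof
   fix z assume z: "z \<in> edge_pt \<Gamma> e ` {0..1}"
   then have "z \<in> points \<Gamma>" using edge_pt_in_points[OF A.fin\<Gamma> eE] by auto
   moreover have "h z \<in> h ` \<phi> ` circ n k j"
    using A.edge_gap_closed_image[OF e] z unfolding img by blast
   ultimately show "z \<in> \<phi> ` circ n k j" using inj_on_image_mem_iff[OF A.inj_h _ sub] by blast
  qed
  then show ?thesis using eE j unfolding cycle_edges_def by blast
 qed
 then have "\<not> is_loop (hat n k \<Gamma> \<phi>) e" by (simp add: is_loop_def hat_def collapse_def)
 ultimately have "(m, (?\<Gamma>, g \<circ> Fmap n k (x(j := y)))) \<in> edge_collapse True n k"
  using mk c' h'(5) eE by (auto simp: edge_collapse_def m coord_def)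
 then show ?thesis using c' by (intro that[OF r_into_rtrancl])
qed

text \<open>The relation \<open>coord_below\<close> is transitive because nothing but the integer
  itself lies below an integer.\<close>

lemma coord_collapses:
 assumes "(m, m') \<in> (edge_collapse True n k)\<^sup>*" "coord n k m h x"
 obtains h' y where "coord n k m' h' y" "!!i. coord_below (y i) (x i)"
proof -
 from assms(1) have "\<exists>h' y. coord n k m' h' y \<and> (\<forall>i. coord_below (y i) (x i))"
 proof induction
  case base
  show ?case by (intro exI[of _ h] exI[of _ x]) (simp add: assms(2) coord_below_def)
 next
  case (step m1 m2)
  then obtain h1 y where y: "coord n k m1 h1 y" "\<forall>i. coord_below (y i) (x i)" by blast
  obtain h2 j w where w: "coord n k m2 h2 (y(j := w))" "coord_below w (y j)"
   by (rule coord_edge_collapse[OF y(1) step(2)])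
  have "coord_below w (x j)" using w(2) spec[OF y(2), of j] by (auto simp: coord_below_def)
  then have "\<forall>i. coord_below ((y(j := w)) i) (x i)" using y(2) by simp
  then show ?case by (intro exI[of _ h2] exI[of _ "y(j := w)"] conjI w(1))
 qed
 then show ?thesis using that by blast
qed

text \<open>The coordinates are rounded one after the other, each collapse leaving the remaining
  coordinates untouched.\<close>

lemma coord_collapsible_all:
 assumes nk: "n + k \<ge> 1" and c: "coord n k m h x" and y: "!!j. j < k ==> coord_below (y j) (x j)"
 obtains m' h' y' where "(m, m') \<in> (edge_collapse True n k)\<^sup>*" "coord n k m' h' y'" "!!j. j < k ==> y' j = y j"
proof -
 have "\<exists>m' h'. (m, m') \<in> (edge_collapse True n k)\<^sup>* \<and> coord n k m' h' (%i. if i < l then y i else x i)" if "l \<le> k" for l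
  using that
 proof (induction l)
  case 0
  show ?case by (intro exI[of _ m] exI[of _ h]) (simp add: c)
 next
  case (Suc l)
  let ?x = "%i. if i < l then y i else x i"
  obtain m1 h1 where 1: "(m, m1) \<in> (edge_collapse True n k)\<^sup>*" "coord n k m1 h1 ?x" using Suc by auto
  have l: "l < k" "coord_below (y l) (?x l)" using y[of l] Suc by simp_all
  obtain m2 h2 where 2: "(m1, m2) \<in> (edge_collapse True n k)\<^sup>*" "coord n k m2 h2 (?x(l := y l))"
   by (rule coord_collapsible[OF nk 1(2) l])
  have "?x(l := y l) = (%i. if i < Suc l then y i else x i)" by (auto simp: fun_eq_iff less_Suc_eq)
  then show ?case using 1 2 rtrancl_trans by (metis (no_types, lifting))
 qed
 from this[of k] show ?thesis using that by auto
qed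

section \<open>The poset isomorphism\<close>

text \<open>The sign compensates the inverse in the definition of the action. The open interval from
  \<open>l\<close> to \<open>l + 1\<close> gets the integer \<open>- l - 1\<close>, and its ends
  \<open>l + 1\<close> and \<open>l\<close> get \<open>- l - 1\<close> and \<open>- l\<close>, as
  the order on \<open>ZP k\<close> demands.\<close>

definition code :: "nat => (nat => real) => (nat => int) \<times> (nat => nat)" where
 "code k x = (%i. if i < k then \<lfloor>- x i\<rfloor> else 0, %i. if i < k \<and> x i \<notin> \<int> then 1 else 0)"

lemma floor_minus_cases: "\<lfloor>- x\<rfloor> = (if x \<in> \<int> then - \<lfloor>x\<rfloor> else - \<lfloor>x\<rfloor> - 1)" for x :: real
proof -
 have "\<lceil>x\<rceil> = (if x = of_int \<lfloor>x\<rfloor> then \<lfloor>x\<rfloor> else \<lfloor>x\<rfloor> + 1)" by (rule ceiling_altdef)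
 moreover have "x = of_int \<lfloor>x\<rfloor> \<longleftrightarrow> x \<in> \<int>" by (metis Ints_cases Ints_of_int floor_of_int)
 moreover have "\<lfloor>- x\<rfloor> = - \<lceil>x\<rceil>" by (simp add: ceiling_def)
 ultimately show ?thesis by simp
qed

lemma same_cell_iff: "same_cell a b \<longleftrightarrow> \<lfloor>- a\<rfloor> = \<lfloor>- b\<rfloor> \<and> (a \<in> \<int> \<longleftrightarrow> b \<in> \<int>)"
 by (auto simp: same_cell_def floor_minus_cases)

lemma code_eq_iff: "code k x = code k y \<longleftrightarrow> (\<forall>i<k. same_cell (x i) (y i))"
 by (auto simp: code_def same_cell_iff fun_eq_iff split: if_splits)

lemma code_in_ZP: "code k x \<in> ZP k"
 by (auto simp: code_def ZP_def Zk_def)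

lemma code_le_iff:
 "ZP_le k (code k y) (code k x) \<longleftrightarrow> (\<forall>i<k. same_cell (y i) (x i) \<or> coord_below (y i) (x i))"
proof -
 have "(same_cell a b \<or> (a \<in> \<int> \<and> b \<notin> \<int> \<and> (\<lfloor>- a\<rfloor> = \<lfloor>- b\<rfloor> \<or> \<lfloor>- a\<rfloor> = \<lfloor>- b\<rfloor> + 1))) \<longleftrightarrow>
   same_cell a b \<or> coord_below a b" for a b :: real
 proof (cases "a \<in> \<int> \<and> b \<notin> \<int>")
  case True
  then obtain l where "a = of_int l" by (auto elim: Ints_cases)
  then show ?thesis using True by (auto simp: coord_below_def same_cell_def floor_minus_cases)
 next
  case False
  then show ?thesis by (auto simp: coord_below_def same_cell_def)
 qed
 then show ?thesis by (auto simp: ZP_le_def code_def same_cell_iff)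
qed

lemma code_surj:
 assumes "c \<in> ZP k" obtains x where "code k x = c"
proof -
 obtain z p where c: "c = (z, p)" by (cases c)
 have z: "z i = 0" and p: "p i = 0" if "k \<le> i" for i using assms that by (auto simp: c ZP_def Zk_def)
 have p01: "p i = 0 \<or> p i = 1" for i using assms p by (cases "i < k") (auto simp: c ZP_def)
 \<comment> \<open>The representative is the integer \<open>- z i\<close> or the midpoint of the
   interval, according to \<open>p i\<close>.\<close>
 define x where "x i = - (of_int (z i) + real (p i) / 2)" for i
 have half: "of_int l + 1 / 2 \<notin> (\<int> :: real set)" for l
 proof
  assume "of_int l + 1 / 2 \<in> (\<int> :: real set)"
  then have "1 / 2 \<in> (\<int> :: real set)" by (metis Ints_of_int Ints_diff add_diff_cancel_left')
  then show False using Ints_between_0_1[of "1/2"] by simp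
 qed
 have x: "x i \<in> \<int> \<longleftrightarrow> p i = 0" "\<lfloor>- x i\<rfloor> = z i" for i
  using p01[of i] half[of "z i"] by (auto simp: x_def floor_eq_iff)
 have "(if i < k then \<lfloor>- x i\<rfloor> else 0) = z i" "(if i < k \<and> x i \<notin> \<int> then 1 else 0) = p i" for i
  using x[of i] z[of i] p[of i] p01[of i] by auto
 then have "code k x = c" by (simp add: code_def c)
 then show ?thesis by (rule that)
qed

definition fiber_code :: "nat => nat => (pgraph \<times> (gpoint => gpoint)) set => (nat => int) \<times> (nat => nat)" where
 "fiber_code n k X = (SOME c. \<exists>m\<in>X. \<exists>h x. coord n k m h x \<and> c = code k x)"

lemma Fnk_quotient: "X \<in> Fnk n k ==> X \<in> marked True n k // marked_equiv True n k"
 by (simp add: Fnk_def Lnk_def)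

lemma Fnk_related: "X \<in> Fnk n k ==> m \<in> X ==> m' \<in> X ==> (m, m') \<in> marked_equiv True n k"
 using quotient_eq_iff[OF equiv_marked_equiv Fnk_quotient Fnk_quotient] by blast

lemma fiber_code_eq:
 assumes X: "X \<in> Fnk n k" and m: "m \<in> X" "coord n k m h x"
 shows "fiber_code n k X = code k x"
proof -
 have "\<exists>m\<in>X. \<exists>h x. coord n k m h x \<and> fiber_code n k X = code k x"
  unfolding fiber_code_def by (rule someI[of _ "code k x"]) (use m in blast)
 then obtain m' h' x' where m': "m' \<in> X" "coord n k m' h' x'" "fiber_code n k X = code k x'" by blast
 obtain h'' where "coord n k m h'' x'" by (rule coord_transfer[OF Fnk_related[OF X m'(1) m(1)] m'(2)])
 then show ?thesis using coord_unique[OF _ m(2)] m'(3) by (simp add: code_eq_iff)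
qed

text \<open>A sequence of collapses rounds coordinates, which is the order on codes. Conversely
  coordinates that are to become integral are rounded, and equality of cells turns the result into
  an equivalent marked graph.\<close>

lemma F_le_iff:
 assumes nk: "n + k \<ge> 1" and X: "X \<in> Fnk n k" and Y: "Y \<in> Fnk n k"
 shows "F_le n k X Y \<longleftrightarrow> ZP_le k (fiber_code n k X) (fiber_code n k Y)"
proof -
 obtain mX hX x where x: "mX \<in> X" "coord n k mX hX x" by (rule Fnk_coord[OF nk X])
 obtain mY hY y where y: "mY \<in> Y" "coord n k mY hY y" by (rule Fnk_coord[OF nk Y])
 have codes: "fiber_code n k X = code k x" "fiber_code n k Y = code k y"
  using fiber_code_eq[OF X x] fiber_code_eq[OF Y y] by simp_all
 show ?thesis
 proof
  assume "F_le n k X Y"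
  then obtain m1 m2 m where m: "m1 \<in> X" "m2 \<in> Y" "(m2, m) \<in> (edge_collapse True n k)\<^sup>*" "(m, m1) \<in> marked_equiv True n k"
   unfolding L_le_def by blast
  obtain h2 where h2: "coord n k m2 h2 y" by (rule coord_transfer[OF Fnk_related[OF Y y(1) m(2)] y(2)])
  obtain h3 w where w: "coord n k m h3 w" "!!i. coord_below (w i) (y i)" by (rule coord_collapses[OF m(3) h2]) blast
  obtain h4 where "coord n k m1 h4 w" by (rule coord_transfer[OF m(4) w(1)])
  then have "code k x = code k w" using fiber_code_eq[OF X m(1)] codes by simp
  then show "ZP_le k (fiber_code n k X) (fiber_code n k Y)" using w(2) unfolding codes by (simp add: code_le_iff)
 next
  assume "ZP_le k (fiber_code n k X) (fiber_code n k Y)"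
  then have le: "same_cell (x i) (y i) \<or> coord_below (x i) (y i)" if "i < k" for i
   using that unfolding codes code_le_iff by blast
  \<comment> \<open>Where the cells already agree no collapse must take place, so \<open>y i\<close>
    is kept; elsewhere \<open>x i\<close> is one of the integers next to \<open>y i\<close>.\<close>
  define w where "w i = (if same_cell (x i) (y i) then y i else x i)" for i
  have "coord_below (w i) (y i)" if "i < k" for i using le[OF that] by (auto simp: w_def coord_below_def)
  then obtain m h w' where w': "(mY, m) \<in> (edge_collapse True n k)\<^sup>*" "coord n k m h w'" "!!j. j < k ==> w' j = w j"
   by (rule coord_collapsible_all[OF nk y(2)]) blast+
  have "(m, mX) \<in> marked_equiv True n k"
   by (rule coord_equiv[OF w'(2) x(2)]) (auto simp: w'(3) w_def same_cell_def)
  then show "F_le n k X Y" using x(1) y(1) w'(1) unfolding L_le_def by blast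
 qed
qed

lemma quotient_coord_Fnk:
 assumes nk: "n + k \<ge> 1" and c: "coord n k m h x"
 shows "marked_equiv True n k `` {m} \<in> Fnk n k" "m \<in> marked_equiv True n k `` {m}"
proof -
 have m: "m \<in> marked True n k" using c by (simp add: coord_def)
 show mem: "m \<in> marked_equiv True n k `` {m}" using marked_equiv_refl[OF m] by simp
 show "marked_equiv True n k `` {m} \<in> Fnk n k"
  by (rule coord_Fnk[OF nk _ mem c]) (unfold Lnk_def, rule quotientI[OF m])
qed

lemma bij_betw_fiber_code:
 assumes nk: "n + k \<ge> 1" shows "bij_betw (fiber_code n k) (Fnk n k) (ZP k)"
proof (rule bij_betw_imageI)
 show "inj_on (fiber_code n k) (Fnk n k)"
 proof (rule inj_onI)
  fix X Y assume X: "X \<in> Fnk n k" and Y: "Y \<in> Fnk n k" and eq: "fiber_code n k X = fiber_code n k Y"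
  obtain mX hX x where x: "mX \<in> X" "coord n k mX hX x" by (rule Fnk_coord[OF nk X])
  obtain mY hY y where y: "mY \<in> Y" "coord n k mY hY y" by (rule Fnk_coord[OF nk Y])
  have "code k x = code k y" using fiber_code_eq[OF X x] fiber_code_eq[OF Y y] eq by simp
  then have "same_cell (x i) (y i)" if "i < k" for i using that by (simp add: code_eq_iff)
  then have "(mX, mY) \<in> marked_equiv True n k" by (rule coord_equiv[OF x(2) y(2)])
  then show "X = Y" using quotient_eqI[OF equiv_marked_equiv Fnk_quotient[OF X] Fnk_quotient[OF Y] x(1) y(1)] by blast
 qed
 show "fiber_code n k ` Fnk n k = ZP k"
 proof
  show "fiber_code n k ` Fnk n k \<subseteq> ZP k"
  proof
   fix c assume "c \<in> fiber_code n k ` Fnk n k"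
   then obtain X where X: "X \<in> Fnk n k" "c = fiber_code n k X" by blast
   obtain m h x where "m \<in> X" "coord n k m h x" by (rule Fnk_coord[OF nk X(1)])
   then show "c \<in> ZP k" using fiber_code_eq[OF X(1)] X(2) code_in_ZP by simp
  qed
  show "ZP k \<subseteq> fiber_code n k ` Fnk n k"
  proof
   fix c assume "c \<in> ZP k"
   then obtain x where x: "code k x = c" by (rule code_surj)
   obtain m h where m: "coord n k m h x" by (rule coord_exists[OF nk])
   show "c \<in> fiber_code n k ` Fnk n k"
    using fiber_code_eq[OF quotient_coord_Fnk[OF nk m] m] quotient_coord_Fnk(1)[OF nk m] x by (metis imageI)
  qed
 qed
qed

section \<open>Winding a stem around its circle\<close>

text \<open>Coordinates on a stem together with its circle: \<open>u\<close> is the position on the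
  stem and \<open>y\<close> the part of the circle that has been passed, in the direction chosen by
  \<open>d\<close>.\<close>

definition stem_circle :: "nat => nat => nat => bool => real => real => gpoint" where
 "stem_circle n k j d u y = (if y = 0 then edge_pt (Gnk n k) (n + j) u
   else edge_pt (Gnk n k) (n + k + j) (if d then y else 1 - y))"

definition stem_map :: "nat => nat => nat => bool => (real => real) => (real => real) => gpoint => gpoint" where
 "stem_map n k j d u y x = (case x of Vert v => Vert v
   | Inner e s => if e = n + j then stem_circle n k j d (u s) (y s) else edge_pt (Gnk n k) e s)"

lemma stem_ends:
 "j < k ==> edge_pt (Gnk n k) (n + j) 0 = Vert 0" "j < k ==> edge_pt (Gnk n k) (n + j) 1 = Vert (Suc j)"
 "edge_pt (Gnk n k) (n + k + j) 0 = Vert (Suc j)" "edge_pt (Gnk n k) (n + k + j) 1 = Vert (Suc j)"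
 by (simp_all add: src_Gnk tgt_Gnk)

lemma stem_circle_simps:
 "stem_circle n k j d u 0 = edge_pt (Gnk n k) (n + j) u"
 "j < k ==> stem_circle n k j d 1 y = edge_pt (Gnk n k) (n + k + j) (if d then y else 1 - y)"
 by (auto simp: stem_circle_def stem_ends simp del: edge_pt_simps)

text \<open>The condition that \<open>u\<close> is 1 or \<open>y\<close> is 0 confines the pair to
  the two segments that parametrize the stem and the circle; their closed preimages cover the square
  and are pasted.\<close>

lemma continuous_map_stem_circle:
 fixes u y :: "real \<times> real => real"
 assumes j: "j < k" and u: "continuous_on ({0..1} \<times> {0..1}) u" and y: "continuous_on ({0..1} \<times> {0..1}) y"
  and ran: "!!p. p \<in> {0..1} \<times> {0..1} ==> u p \<in> {0..1} \<and> y p \<in> {0..1} \<and> (u p = 1 \<or> y p = 0)"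
 shows "continuous_map (top_of_set ({0..1} \<times> {0..1})) (space_of (Gnk n k)) (%p. stem_circle n k j d (u p) (y p))"
proof -
 let ?Q = "{0..1} \<times> {0..1} :: (real \<times> real) set" and ?G = "Gnk n k"
 let ?f = "%p. stem_circle n k j d (u p) (y p)"
 have cl: "closed ?Q" by (intro closed_Times closed_atLeastAtMost)
 let ?U = "{p \<in> ?Q. u p = 1}" and ?Y = "{p \<in> ?Q. y p = 0}"
 have UY: "closedin (top_of_set ?Q) ?U" "closedin (top_of_set ?Q) ?Y"
  by (rule continuous_closedin_preimage_constant[OF u]) (rule continuous_closedin_preimage_constant[OF y])
 have QUY: "?Q = ?U \<union> ?Y" using ran by blast
 have stem: "n + j \<in> edges ?G" and circle: "n + k + j \<in> edges ?G" using j by simp_all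
 have cu: "continuous_map (top_of_set ?Y) I01 u"
  using u ran by (auto simp: continuous_on_subset)
 have cy: "continuous_map (top_of_set ?U) I01 (%p. if d then y p else 1 - y p)"
 proof (cases d)
  case True
  then show ?thesis using y ran by (auto simp: continuous_on_subset)
 next
  case False
  have "continuous_on ?U (%p. 1 - y p)" by (intro continuous_intros continuous_on_subset[OF y]) auto
  then show ?thesis using False ran by auto
 qed
 have "continuous_map (top_of_set ?Y) (space_of ?G) (edge_pt ?G (n + j) \<circ> u)"
  by (rule continuous_map_compose[OF cu continuous_map_edge_pt[OF _ stem]]) simp
 then have 1: "continuous_map (top_of_set ?Y) (space_of ?G) ?f"
  by (rule continuous_map_eq) (simp add: stem_circle_simps)
 have "continuous_map (top_of_set ?U) (space_of ?G) (edge_pt ?G (n + k + j) \<circ> (%p. if d then y p else 1 - y p))"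
  by (rule continuous_map_compose[OF cy continuous_map_edge_pt[OF _ circle]]) simp
 then have 2: "continuous_map (top_of_set ?U) (space_of ?G) ?f"
  by (rule continuous_map_eq) (simp add: stem_circle_simps j)
 have sub: "subtopology (top_of_set ?Q) ?U = top_of_set ?U" "subtopology (top_of_set ?Q) ?Y = top_of_set ?Y"
  by (simp_all add: subtopology_subtopology Int_absorb1)
 show ?thesis
 proof (rule pasting_lemma_closed[where I = "{True, False}" and T = "%i. if i then ?U else ?Y" and f = "%_. ?f"])
  show "closedin (top_of_set ?Q) (if i then ?U else ?Y)" for i using UY by simp
  show "continuous_map (subtopology (top_of_set ?Q) (if i then ?U else ?Y)) (space_of ?G) ?f" for i
   using 1 2 unfolding sub[symmetric] by (cases i) simp_all
  show "\<exists>i. i \<in> {True, False} \<and> p \<in> (if i then ?U else ?Y) \<and> ?f p = ?f p" if "p \<in> topspace (top_of_set ?Q)" for p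
   using that QUY by auto
 qed simp_all
qed

lemma fixes_circles_cong:
 assumes fg: "!!x. x \<in> points (Gnk n k) ==> f x = g x"
 shows "fixes_circles n k f \<longleftrightarrow> fixes_circles n k g"
proof -
 have "f x = g x" if "i < k" "x \<in> circ n k i" for i x
  using that(2) by (intro fg subsetD[OF circ_subset_points[OF that(1), of n]])
 moreover have "f (Vert 0) = g (Vert 0)" by (rule fg) simp
 ultimately show ?thesis by (simp add: fixes_circles_def)
qed

text \<open>Reduces homotopies of self-maps that only change one stem to homotopies of the pair
  \<open>(u, y)\<close>. The end value of \<open>y\<close> may be 0 or 1, since both are the vertex
  of the circle.\<close>

lemma homotopic_stem_maps:
 fixes u y :: "real => real => real"
 assumes j: "j < k" and u: "continuous_on ({0..1} \<times> {0..1}) (%(t, s). u t s)"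
  and y: "continuous_on ({0..1} \<times> {0..1}) (%(t, s). y t s)"
  and ran: "!!t s. t \<in> {0..1} ==> s \<in> {0..1} ==> u t s \<in> {0..1} \<and> y t s \<in> {0..1} \<and> (u t s = 1 \<or> y t s = 0)"
  and start: "!!t. t \<in> {0..1} ==> u t 0 = 0" and final: "!!t. t \<in> {0..1} ==> u t 1 = 1 \<and> y t 1 \<in> {0, 1}"
 shows "homotopic_with (fixes_circles n k) (space_of (Gnk n k)) (space_of (Gnk n k))
  (stem_map n k j d (u 0) (y 0)) (stem_map n k j d (u 1) (y 1))"
proof (rule homotopic_withI[where K = "%t. stem_map n k j d (u t) (y t)"])
 let ?G = "Gnk n k"
 let ?E = "%e t s. if e = n + j then stem_circle n k j d (u t s) (y t s) else edge_pt ?G e s"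
 have y0: "y t 0 = 0" if "t \<in> {0..1}" for t using ran[OF that, of 0] start[OF that] by simp
 have "continuous_map (prod_topology I01 (space_of ?G)) (space_of ?G)
   (%(t, x). case x of Vert v => Vert v | Inner e s => ?E e t s)"
 proof (rule continuous_map_edgewise_homotopy)
  fix e assume e: "e \<in> edges ?G"
  show "continuous_map (top_of_set ({0..1} \<times> {0..1})) (space_of ?G) (%(t, s). ?E e t s)"
  proof (cases "e = n + j")
   case True
   have "continuous_map (top_of_set ({0..1} \<times> {0..1})) (space_of ?G)
     (%p. stem_circle n k j d (case p of (t, s) => u t s) (case p of (t, s) => y t s))"
   proof (rule continuous_map_stem_circle[OF j u y])
    fix p :: "real \<times> real" assume "p \<in> {0..1} \<times> {0..1}"
    then obtain t s where "p = (t, s)" "t \<in> {0..1}" "s \<in> {0..1}" by blast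
    then show "(case p of (t, s) => u t s) \<in> {0..1} \<and> (case p of (t, s) => y t s) \<in> {0..1} \<and>
      ((case p of (t, s) => u t s) = 1 \<or> (case p of (t, s) => y t s) = 0)"
     using ran[of t s] by simp
   qed
   then show ?thesis using True by (simp add: case_prod_unfold)
  next
   case False
   have "continuous_map (top_of_set ({0..1} \<times> {0..1})) I01 (snd :: real \<times> real => real)"
    by (auto intro!: continuous_intros)
   then have "continuous_map (top_of_set ({0..1} \<times> {0..1})) (space_of ?G) (edge_pt ?G e \<circ> (snd :: real \<times> real => real))"
    by (rule continuous_map_compose[OF _ continuous_map_edge_pt[OF _ e]]) simp
   then show ?thesis using False by (simp add: case_prod_unfold comp_def)
  qed
  fix t :: real assume t: "t \<in> {0..1}"
  show "?E e t 0 = Vert (src ?G e)"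
   using start[OF t] y0[OF t] by (simp add: stem_circle_simps)
  show "?E e t 1 = Vert (tgt ?G e)"
  proof (cases "e = n + j")
   case True
   then have "?E e t 1 = Vert (Suc j)"
    using final[OF t] j by (auto simp: stem_circle_simps stem_ends simp del: edge_pt_simps)
   then show ?thesis using True j by (simp add: tgt_Gnk)
  qed simp
 qed simp_all
 then show "continuous_map (prod_topology I01 (space_of ?G)) (space_of ?G) (%(t, x). stem_map n k j d (u t) (y t) x)"
  by (simp add: stem_map_def)
 show "fixes_circles n k (stem_map n k j d (u t) (y t))" if "t \<in> {0..1}" for t
 proof -
  have "stem_map n k j d (u t) (y t) (edge_pt ?G (n + k + i) s) = edge_pt ?G (n + k + i) s" if "i < k" "s \<in> {0..1}" for i s
   using that j by (auto simp: stem_map_def edge_pt_def)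
  then show ?thesis by (auto simp: fixes_circles_def circ_eq) (simp add: stem_map_def)
 qed
 show "fixes_circles n k f = fixes_circles n k g" if "!!x. x \<in> topspace (space_of ?G) ==> f x = g x" for f g
  by (rule fixes_circles_cong) (rule that, simp)
qed simp_all

lemma homotopic_stem_map_refl:
 assumes "j < k" "continuous_on {0..1} u" "continuous_on {0..1} y"
  "!!s. s \<in> {0..1} ==> u s \<in> {0..1} \<and> y s \<in> {0..1} \<and> (u s = 1 \<or> y s = 0)" "u 0 = 0" "u 1 = 1 \<and> y 1 \<in> {0, 1}"
 shows "homotopic_with (fixes_circles n k) (space_of (Gnk n k)) (space_of (Gnk n k))
  (stem_map n k j d u y) (stem_map n k j d u y)"
proof -
 have *: "continuous_on ({0..1::real} \<times> {0..1}) (%(t, s). f s)" if "continuous_on {0..1} f" for f :: "real => real"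
  unfolding case_prod_unfold
  by (rule continuous_on_compose2[OF that]) (auto intro!: continuous_intros)
 show ?thesis
  by (rule homotopic_stem_maps[where u = "%_. u" and y = "%_. y"]) (use assms * in auto)
qed

definition wind_dir :: "nat => nat => nat => bool => gpoint => gpoint" where
 "wind_dir n k j d = stem_map n k j d (%s. min 1 (2 * s)) (%s. max 0 (2 * s - 1))"

lemma wind_dir_homotopic_refl:
 assumes "j < k"
 shows "homotopic_with (fixes_circles n k) (space_of (Gnk n k)) (space_of (Gnk n k)) (wind_dir n k j d) (wind_dir n k j d)"
 unfolding wind_dir_def
proof (rule homotopic_stem_map_refl[OF assms])
 show "continuous_on {0..1} (%s::real. min 1 (2 * s))" "continuous_on {0..1} (%s::real. max 0 (2 * s - 1))"
  by (intro continuous_intros)+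
qed auto

lemma wind_eq_wind_dir:
 assumes "x \<in> points (Gnk n k)" shows "wind n k j x = wind_dir n k j True x"
 using assms
proof (cases rule: points_cases)
 case (2 e t)
 then show ?thesis by (auto simp: wind_def wind_dir_def stem_map_def stem_circle_def)
qed (simp add: wind_def wind_dir_def stem_map_def)

text \<open>Going around the circle and back is contracted to the vertex of the circle; what remains
  is a reparametrization of the stem.\<close>

lemma wind_dir_inverse:
 assumes j: "j < k"
 shows "homotopic_with (fixes_circles n k) (space_of (Gnk n k)) (space_of (Gnk n k)) (wind_dir n k j d \<circ> wind_dir n k j (\<not> d)) id"
proof -
 let ?G = "Gnk n k" and ?X = "space_of (Gnk n k)" and ?P = "fixes_circles n k"
 \<comment> \<open>The composite runs along the stem until 1/4, around the circle until 1/2 and back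
   until 1. Scaling \<open>?y\<close> down to 0 removes the excursion, after which \<open>?u\<close>
   is interpolated to the identity.\<close>
 let ?u = "%s::real. min 1 (4 * s)" and ?y = "%s::real. max 0 (min (4 * s - 1) (2 - 2 * s))"
 let ?S = "stem_map n k j d"
 have "homotopic_with ?P ?X ?X (?S ?u (%s. (1 - 0) * ?y s)) (?S ?u (%s. (1 - 1) * ?y s))"
 proof (rule homotopic_stem_maps[OF j, where u = "%_. ?u" and y = "%t s. (1 - t) * ?y s"])
  show "continuous_on ({0..1} \<times> {0..1}) (%(t :: real, s). ?u s)"
   unfolding case_prod_unfold by (intro continuous_intros)
  show "continuous_on ({0..1} \<times> {0..1}) (%(t, s). (1 - t) * ?y s)"
   unfolding case_prod_unfold by (intro continuous_intros)
  fix t :: real assume t: "t \<in> {0..1}"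
  show "?u 1 = 1 \<and> (1 - t) * ?y 1 \<in> {0, 1}" by simp
  show "?u 0 = 0" by simp
  fix s :: real assume s: "s \<in> {0..1}"
  have y: "0 \<le> ?y s" "?y s \<le> 1" using s by (auto simp: max_def min_def)
  have "(1 - t) * ?y s \<le> 1 * 1" by (rule mult_mono) (use t y in auto)
  moreover have "0 \<le> (1 - t) * ?y s" by (rule mult_nonneg_nonneg) (use t y in auto)
  moreover have "?u s = 1 \<or> ?y s = 0" by (auto simp: max_def min_def)
  ultimately show "?u s \<in> {0..1} \<and> (1 - t) * ?y s \<in> {0..1} \<and> (?u s = 1 \<or> (1 - t) * ?y s = 0)"
   using s by auto
 qed
 moreover have "homotopic_with ?P ?X ?X (?S (%s. (1 - 0) * ?u s + 0 * s) (%s. 0)) (?S (%s. (1 - 1) * ?u s + 1 * s) (%s. 0))"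
 proof (rule homotopic_stem_maps[OF j, where u = "%t s. (1 - t) * ?u s + t * s" and y = "%t s. 0"])
  show "continuous_on ({0..1} \<times> {0..1}) (%(t, s). (1 - t) * ?u s + t * s)"
   unfolding case_prod_unfold by (intro continuous_intros)
  fix t :: real assume t: "t \<in> {0..1}"
  fix s :: real assume s: "s \<in> {0..1}"
  have "(1 - t) * ?u s + t * s \<le> (1 - t) * 1 + t * 1" by (intro add_mono mult_left_mono) (use t s in auto)
  moreover have "0 \<le> (1 - t) * ?u s + t * s" by (intro add_nonneg_nonneg mult_nonneg_nonneg) (use t s in auto)
  ultimately show "(1 - t) * ?u s + t * s \<in> {0..1} \<and> (0::real) \<in> {0..1} \<and> ((1 - t) * ?u s + t * s = 1 \<or> (0::real) = 0)" by simp
 qed (simp_all add: case_prod_unfold)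
 ultimately have hom: "homotopic_with ?P ?X ?X (?S ?u ?y) (?S (%s. s) (%s. 0))"
  by (simp add: homotopic_with_trans)
 have 1: "(wind_dir n k j d \<circ> wind_dir n k j (\<not> d)) x = ?S ?u ?y x" if "x \<in> points ?G" for x
  using that
 proof (cases rule: points_cases)
  case (1 v)
  then show ?thesis by (simp add: wind_dir_def stem_map_def)
 next
  case (2 e s)
  show ?thesis
  proof (cases "e = n + j")
   case False
   then show ?thesis using 2 by (simp add: wind_dir_def stem_map_def)
  next
   case True
   consider "s < 1/2" | "s = 1/2" | "1/2 < s" by linarith
   then show ?thesis
   proof cases
    case 1
    then have a: "wind_dir n k j (\<not> d) x = Inner (n + j) (2 * s)"
     using 2 True by (simp add: wind_dir_def stem_map_def stem_circle_def)
    have "min (4 * s - 1) (2 - 2 * s) = 4 * s - 1" using 1 by simp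
    then show ?thesis using a 2 True by (simp add: wind_dir_def stem_map_def)
   next
    case half: 2
    then have a: "wind_dir n k j (\<not> d) x = Vert (Suc j)"
     using 2 True j by (simp add: wind_dir_def stem_map_def stem_circle_def stem_ends del: edge_pt_simps)
    have "?S ?u ?y x = stem_circle n k j d 1 1" using 2 half True by (simp add: stem_map_def)
    then show ?thesis using a j
     by (simp add: stem_circle_simps stem_ends wind_dir_def stem_map_def del: edge_pt_simps)
   next
    case 3
    then have a: "wind_dir n k j (\<not> d) x = Inner (n + k + j) (if d then 2 - 2 * s else 2 * s - 1)"
     using 2 True by (simp add: wind_dir_def stem_map_def stem_circle_def)
    have b: "?u s = 1" "?y s = 2 - 2 * s" using 3 2 by (auto simp: max_def min_def)
    have "?S ?u ?y x = Inner (n + k + j) (if d then 2 - 2 * s else 2 * s - 1)"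
     using 2 3 True by (simp add: stem_map_def stem_circle_def b)
    moreover have "wind_dir n k j d (Inner (n + k + j) t) = Inner (n + k + j) t" if "0 < t" "t < 1" for t
     using that j by (simp add: wind_dir_def stem_map_def)
    ultimately show ?thesis using a 2 3 by simp
   qed
  qed
 qed
 have 2: "id x = ?S (%s. s) (%s. 0) x" if "x \<in> points ?G" for x
  using that by (cases rule: points_cases) (simp_all add: stem_map_def stem_circle_def)
 show ?thesis
 proof (rule homotopic_with_eq[OF hom])
  show "(wind_dir n k j d \<circ> wind_dir n k j (\<not> d)) x = ?S ?u ?y x" "id x = ?S (%s. s) (%s. 0) x"
   if "x \<in> topspace ?X" for x using that 1[of x] 2[of x] by simp_all
  show "fixes_circles n k f = fixes_circles n k g" if "!!x. x \<in> topspace ?X ==> f x = g x" for f g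
   by (rule fixes_circles_cong) (rule that, simp)
 qed
qed

section \<open>The group \<open>A\<^sub>n\<^sub>,\<^sub>k\<close> and its central subgroup\<close>

abbreviation A_homotopic :: "nat => nat => (gpoint => gpoint) => (gpoint => gpoint) => bool" where
 "A_homotopic n k \<equiv> homotopic_with (fixes_circles n k) (space_of (Gnk n k)) (space_of (Gnk n k))"

lemma A_mapsD:
 assumes "f \<in> A_maps n k"
 shows "continuous_map (space_of (Gnk n k)) (space_of (Gnk n k)) f" "fixes_circles n k f" "f (Vert 0) = Vert 0"
  "pointed_homotopy_equivalence (space_of (Gnk n k)) (Vert 0) (space_of (Gnk n k)) (Vert 0) f"
 using assms by (simp_all add: A_maps_def pointed_homotopy_equivalence_def fixes_circles_def)

lemma fixes_circles_compose:
 "fixes_circles n k f ==> fixes_circles n k g ==> fixes_circles n k (f \<circ> g)"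
 by (simp add: fixes_circles_def)

lemma A_homotopic_refl: "f \<in> A_maps n k ==> A_homotopic n k f f"
 using A_mapsD by simp

lemma A_homotopic_compose:
 assumes "A_homotopic n k f f'" "A_homotopic n k g g'"
 shows "A_homotopic n k (f \<circ> g) (f' \<circ> g')"
proof -
 note c = homotopic_with_imp_continuous_maps[OF assms(1)] homotopic_with_imp_continuous_maps[OF assms(2)]
 note p = homotopic_with_imp_property[OF assms(1)] homotopic_with_imp_property[OF assms(2)]
 have "A_homotopic n k (f \<circ> g) (f \<circ> g')"
  by (rule homotopic_with_compose_continuous_map_left[OF assms(2)]) (use c p fixes_circles_compose in auto)
 moreover have "A_homotopic n k (f \<circ> g') (f' \<circ> g')"
  by (rule homotopic_with_compose_continuous_map_right[OF assms(1)]) (use c p fixes_circles_compose in auto)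
 ultimately show ?thesis by (rule homotopic_with_trans)
qed

lemma A_class_eq_iff:
 assumes "A_homotopic n k g g"
 shows "A_class n k f = A_class n k g \<longleftrightarrow> A_homotopic n k f g"
proof
 assume "A_class n k f = A_class n k g"
 then show "A_homotopic n k f g" using assms unfolding A_class_def by blast
next
 assume fg: "A_homotopic n k f g"
 have "A_homotopic n k f h \<longleftrightarrow> A_homotopic n k g h" for h
  using homotopic_with_trans[OF homotopic_with_symD[OF fg]] homotopic_with_trans[OF fg] by blast
 then show "A_class n k f = A_class n k g" by (simp add: A_class_def)
qed

lemma A_maps_homotopic:
 assumes "f \<in> A_maps n k" "A_homotopic n k f g" shows "g \<in> A_maps n k"
proof -
 have "homotopic_with (%h. h (Vert 0) = Vert 0) (space_of (Gnk n k)) (space_of (Gnk n k)) f g"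
  by (rule homotopic_with_mono[OF assms(2)]) (simp add: fixes_circles_def)
 from phe_homotopic[OF A_mapsD(4)[OF assms(1)] this] show ?thesis
  using homotopic_with_imp_property[OF assms(2)] by (simp add: A_maps_def)
qed

lemma id_A_maps: "id \<in> A_maps n k"
proof -
 have "homeomorphic_maps (space_of (Gnk n k)) (space_of (Gnk n k)) id id" by (simp add: homeomorphic_maps_def)
 from phe_homeomorphic[OF this, of "Vert 0" "Vert 0"] show ?thesis
  by (simp add: A_maps_def fixes_circles_def)
qed

lemma compose_A_maps:
 assumes f: "f \<in> A_maps n k" and g: "g \<in> A_maps n k" shows "f \<circ> g \<in> A_maps n k"
 using phe_compose[OF A_mapsD(4)[OF g] A_mapsD(4)[OF f]]
  fixes_circles_compose[OF A_mapsD(2)[OF f] A_mapsD(2)[OF g]] unfolding A_maps_def by simp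

lemma A_mult:
 assumes f: "f \<in> A_maps n k" and g: "g \<in> A_maps n k"
 shows "A_class n k f \<otimes>\<^bsub>A_group n k\<^esub> A_class n k g = A_class n k (f \<circ> g)"
proof -
 have eq: "A_class n k (f' \<circ> g') = A_class n k (f \<circ> g)" if "f' \<in> A_class n k f" "g' \<in> A_class n k g" for f' g'
 proof -
  have "A_homotopic n k f f'" "A_homotopic n k g g'" using that by (simp_all only: A_class_def mem_Collect_eq)
  then have "A_homotopic n k (f \<circ> g) (f' \<circ> g')" by (rule A_homotopic_compose)
  then show ?thesis
   unfolding A_class_eq_iff[OF A_homotopic_refl[OF compose_A_maps[OF f g]]] by (rule homotopic_with_symD)
 qed
 have mem: "f \<in> A_class n k f" "g \<in> A_class n k g"
  using A_homotopic_refl[OF f] A_homotopic_refl[OF g] by (simp_all only: A_class_def mem_Collect_eq)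
 have "(\<Union>f'\<in>A_class n k f. \<Union>g'\<in>A_class n k g. A_class n k (f' \<circ> g')) =
   (\<Union>f'\<in>A_class n k f. \<Union>g'\<in>A_class n k g. A_class n k (f \<circ> g))"
  by (intro SUP_cong refl) (rule eq)
 also have "\<dots> = A_class n k (f \<circ> g)" using mem by auto
 finally show ?thesis by (simp add: A_group_def)
qed

lemma A_carrier: "a \<in> carrier (A_group n k) \<longleftrightarrow> (\<exists>f\<in>A_maps n k. a = A_class n k f)"
 by (auto simp: A_group_def)

lemma A_one: "\<one>\<^bsub>A_group n k\<^esub> = A_class n k id"
 by (simp add: A_group_def)

lemma monoid_A_group: "Group.monoid (A_group n k)"
proof
 fix a b assume "a \<in> carrier (A_group n k)" "b \<in> carrier (A_group n k)"
 then obtain f g where fg: "f \<in> A_maps n k" "g \<in> A_maps n k" "a = A_class n k f" "b = A_class n k g"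
  unfolding A_carrier by (elim bexE)
 show "a \<otimes>\<^bsub>A_group n k\<^esub> b \<in> carrier (A_group n k)"
  unfolding A_carrier fg(3,4) A_mult[OF fg(1,2)] by (rule bexI[OF refl compose_A_maps[OF fg(1,2)]])
 fix c assume "c \<in> carrier (A_group n k)"
 then obtain h where h: "h \<in> A_maps n k" "c = A_class n k h" unfolding A_carrier by (elim bexE)
 show "a \<otimes>\<^bsub>A_group n k\<^esub> b \<otimes>\<^bsub>A_group n k\<^esub> c = a \<otimes>\<^bsub>A_group n k\<^esub> (b \<otimes>\<^bsub>A_group n k\<^esub> c)"
  unfolding fg(3,4) h(2) A_mult[OF fg(1,2)] A_mult[OF fg(2) h(1)]
   A_mult[OF compose_A_maps[OF fg(1,2)] h(1)] A_mult[OF fg(1) compose_A_maps[OF fg(2) h(1)]] by (simp add: comp_assoc)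
next
 show "\<one>\<^bsub>A_group n k\<^esub> \<in> carrier (A_group n k)" unfolding A_carrier A_one by (rule bexI[OF refl id_A_maps])
 fix a assume "a \<in> carrier (A_group n k)"
 then obtain f where f: "f \<in> A_maps n k" "a = A_class n k f" unfolding A_carrier by (elim bexE)
 show "\<one>\<^bsub>A_group n k\<^esub> \<otimes>\<^bsub>A_group n k\<^esub> a = a" "a \<otimes>\<^bsub>A_group n k\<^esub> \<one>\<^bsub>A_group n k\<^esub> = a"
  unfolding f(2) A_one A_mult[OF id_A_maps f(1)] A_mult[OF f(1) id_A_maps] by simp_all
qed

text \<open>The map \<open>w\<close> is the identity on the circles, so the images of circles and
  basepoints are the same before and after the composition.\<close>

lemma htpy_rel_precompose:
 assumes h: "homotopic_rel_circles b n k \<Gamma> f g" and w: "w \<in> A_maps n k"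
 shows "homotopic_rel_circles b n k \<Gamma> (f \<circ> w) (g \<circ> w)"
proof -
 have fix_c: "w x = x" if "j < k" "x \<in> circ n k j" for j x using A_mapsD(2)[OF w] that by (simp add: fixes_circles_def)
 have c: "(%x. h (w x)) ` circ n k j = h ` circ n k j" if "j < k" for h :: "gpoint => gpoint" and j
  by (rule image_cong[OF refl]) (simp add: fix_c[OF that])
 have v: "w (kappa n k j 1) = kappa n k j 1" if "j < k" for j using fix_c[OF that kappa_in_circ] .
 show ?thesis
  using h unfolding homotopic_rel_circles_def
  by (rule homotopic_with_compose_continuous_map_right[OF _ A_mapsD(1)[OF w]])
   (use A_mapsD(3)[OF w] in \<open>simp add: comp_def c v\<close>)
qed

lemma htpy_rel_of_A_homotopic:
 assumes "A_homotopic n k u v" "continuous_map (space_of (Gnk n k)) (space_of \<Gamma>) f" "f (Vert 0) = base_pt \<Gamma>"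
 shows "homotopic_rel_circles b n k \<Gamma> (f \<circ> u) (f \<circ> v)"
 unfolding homotopic_rel_circles_def
proof (rule homotopic_with_compose_continuous_map_left[OF assms(1,2)])
 have v: "fixes_circles n k v" using homotopic_with_imp_property[OF assms(1)] by blast
 fix h assume h: "fixes_circles n k h"
 have fix_c: "h x = x \<and> v x = x" if "j < k" "x \<in> circ n k j" for j x using h v that by (simp add: fixes_circles_def)
 have "(f \<circ> h) ` circ n k j = (f \<circ> v) ` circ n k j" if "j < k" for j
  unfolding comp_def by (rule image_cong[OF refl]) (simp add: fix_c[OF that])
 moreover have "(f \<circ> h) (kappa n k j 1) = (f \<circ> v) (kappa n k j 1)" if "j < k" for j
  using fix_c[OF that kappa_in_circ] by simp
 moreover have "(f \<circ> h) (base_pt (Gnk n k)) = base_pt \<Gamma>" using h assms(3) by (simp add: fixes_circles_def)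
 ultimately show "(f \<circ> h) (base_pt (Gnk n k)) = base_pt \<Gamma> \<and> (\<forall>j<k. (f \<circ> h) ` circ n k j = (f \<circ> v) ` circ n k j \<and>
   (b --> (f \<circ> h) (kappa n k j 1) = (f \<circ> v) (kappa n k j 1)))" by blast
qed

text \<open>Precomposition with \<open>w\<close> translates the coordinates of every normal form by
  \<open>m\<close>. This is the only property of an element of the central subgroup that the
  computation of the action uses.\<close>

definition shifts :: "nat => nat => (gpoint => gpoint) => (nat => int) => bool" where
 "shifts n k w m \<longleftrightarrow> w \<in> A_maps n k \<and>
   (\<forall>x. homotopic_rel_circles True n k (rose (n + k)) (Fmap n k x \<circ> w) (Fmap n k (%i. x i + of_int (m i))))"

text \<open>Only the monoid laws of \<open>A_group\<close> are established, so being a unit is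
  carried along; it gives the inverses and integral powers their meaning.\<close>

definition shift_class :: "nat => nat => (gpoint => gpoint) set => (nat => int) => bool" where
 "shift_class n k a m \<longleftrightarrow> a \<in> Units (A_group n k) \<and> (\<exists>w. a = A_class n k w \<and> shifts n k w m)"

lemma shifts_compose:
 assumes f: "shifts n k f l" and g: "shifts n k g m"
 shows "shifts n k (f \<circ> g) (%i. l i + m i)"
 unfolding shifts_def
proof (intro conjI allI)
 show "f \<circ> g \<in> A_maps n k" by (rule compose_A_maps) (use f g in \<open>simp_all only: shifts_def\<close>)
 fix x
 have "homotopic_rel_circles True n k (rose (n + k)) ((Fmap n k x \<circ> f) \<circ> g) (Fmap n k (%i. x i + of_int (l i)) \<circ> g)"
  using f g by (intro htpy_rel_precompose) (simp_all add: shifts_def)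
 moreover have "homotopic_rel_circles True n k (rose (n + k)) (Fmap n k (%i. x i + of_int (l i)) \<circ> g)
   (Fmap n k (%i. (x i + of_int (l i)) + of_int (m i)))"
  using g by (simp add: shifts_def)
 ultimately have "homotopic_rel_circles True n k (rose (n + k)) ((Fmap n k x \<circ> f) \<circ> g)
   (Fmap n k (%i. (x i + of_int (l i)) + of_int (m i)))" by (rule htpy_rel_trans)
 then show "homotopic_rel_circles True n k (rose (n + k)) (Fmap n k x \<circ> (f \<circ> g)) (Fmap n k (%i. x i + of_int (l i + m i)))"
  by (simp add: comp_assoc add.assoc)
qed

text \<open>The shift property of \<open>f\<close> is applied to the coordinates
  \<open>x - m\<close> and composed with \<open>g\<close>; the composite of \<open>f\<close> and
  \<open>g\<close> is then cancelled.\<close>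

lemma shifts_inverse:
 assumes f: "shifts n k f m" and g: "g \<in> A_maps n k" and fg: "A_homotopic n k (f \<circ> g) id"
 shows "shifts n k g (%i. - m i)"
 unfolding shifts_def
proof (intro conjI allI)
 show "g \<in> A_maps n k" by (rule g)
 fix x
 let ?y = "%i. x i + real_of_int (- m i)"
 have "homotopic_rel_circles True n k (rose (n + k)) (Fmap n k ?y \<circ> f) (Fmap n k (%i. ?y i + of_int (m i)))"
  using f by (simp only: shifts_def)
 then have "homotopic_rel_circles True n k (rose (n + k)) (Fmap n k ?y \<circ> f) (Fmap n k x)" by simp
 from htpy_rel_sym[OF htpy_rel_precompose[OF this g]]
 have "homotopic_rel_circles True n k (rose (n + k)) (Fmap n k x \<circ> g) (Fmap n k ?y \<circ> (f \<circ> g))" by (simp only: comp_assoc)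
 moreover have "homotopic_rel_circles True n k (rose (n + k)) (Fmap n k ?y \<circ> (f \<circ> g)) (Fmap n k ?y \<circ> id)"
  by (rule htpy_rel_of_A_homotopic[OF fg continuous_map_Fmap]) simp
 ultimately have "homotopic_rel_circles True n k (rose (n + k)) (Fmap n k x \<circ> g) (Fmap n k ?y \<circ> id)"
  by (rule htpy_rel_trans)
 then show "homotopic_rel_circles True n k (rose (n + k)) (Fmap n k x \<circ> g) (Fmap n k ?y)" by simp
qed

lemma shift_class_one: "shift_class n k \<one>\<^bsub>A_group n k\<^esub> (%_. 0)"
proof -
 have "shifts n k id (%_. 0)"
  using id_A_maps by (simp add: shifts_def htpy_rel_refl continuous_map_Fmap)
 then show ?thesis using Group.monoid.Units_one_closed[OF monoid_A_group] A_one unfolding shift_class_def by blast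
qed

lemma shift_class_mult:
 assumes "shift_class n k a l" "shift_class n k b m"
 shows "shift_class n k (a \<otimes>\<^bsub>A_group n k\<^esub> b) (%i. l i + m i)"
proof -
 obtain f where f: "a = A_class n k f" "shifts n k f l" using assms(1) by (auto simp: shift_class_def)
 obtain g where g: "b = A_class n k g" "shifts n k g m" using assms(2) by (auto simp: shift_class_def)
 have "f \<in> A_maps n k" "g \<in> A_maps n k" using f(2) g(2) by (simp_all only: shifts_def)
 then have "a \<otimes>\<^bsub>A_group n k\<^esub> b = A_class n k (f \<circ> g)" unfolding f(1) g(1) by (rule A_mult)
 moreover have "a \<otimes>\<^bsub>A_group n k\<^esub> b \<in> Units (A_group n k)"
  using assms Group.monoid.Units_m_closed[OF monoid_A_group] by (simp add: shift_class_def)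
 ultimately show ?thesis using shifts_compose[OF f(2) g(2)] unfolding shift_class_def by blast
qed

lemma shift_class_inv:
 assumes "shift_class n k a m"
 shows "shift_class n k (inv\<^bsub>A_group n k\<^esub> a) (%i. - m i)"
proof -
 obtain f where f: "a = A_class n k f" "shifts n k f m" using assms by (auto simp: shift_class_def)
 have U: "a \<in> Units (A_group n k)" using assms by (simp add: shift_class_def)
 have "inv\<^bsub>A_group n k\<^esub> a \<in> carrier (A_group n k)" by (rule Group.monoid.Units_inv_closed[OF monoid_A_group U])
 then obtain g where g: "g \<in> A_maps n k" "inv\<^bsub>A_group n k\<^esub> a = A_class n k g" unfolding A_carrier by (elim bexE)
 have fm: "f \<in> A_maps n k" using f(2) by (simp add: shifts_def)
 have "a \<otimes>\<^bsub>A_group n k\<^esub> A_class n k g = \<one>\<^bsub>A_group n k\<^esub>"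
  using Group.monoid.Units_r_inv[OF monoid_A_group U] unfolding g(2) .
 then have "A_class n k (f \<circ> g) = A_class n k id" unfolding f(1) A_mult[OF fm g(1)] A_one .
 then have "A_homotopic n k (f \<circ> g) id" using A_class_eq_iff[OF A_homotopic_refl[OF id_A_maps]] by blast
 from shifts_inverse[OF f(2) g(1) this] show ?thesis
  using g(2) Group.monoid.Units_inv_Units[OF monoid_A_group U] unfolding shift_class_def by blast
qed

lemma shift_class_nat_pow:
 assumes "shift_class n k a m"
 shows "shift_class n k (a [^]\<^bsub>A_group n k\<^esub> (l::nat)) (%i. int l * m i)"
proof (induction l)
 case 0
 then show ?case using shift_class_one by simp
next
 case (Suc l)
 from shift_class_mult[OF Suc assms] show ?case by (simp add: algebra_simps)
qed

lemma shift_class_int_pow: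
 assumes "shift_class n k a m"
 shows "shift_class n k (a [^]\<^bsub>A_group n k\<^esub> (l::int)) (%i. l * m i)"
proof (cases "l < 0")
 case True
 have "shift_class n k (inv\<^bsub>A_group n k\<^esub> (a [^]\<^bsub>A_group n k\<^esub> nat (- l))) (%i. - (int (nat (- l)) * m i))"
  by (rule shift_class_inv[OF shift_class_nat_pow[OF assms]])
 then show ?thesis using True by (simp add: int_pow_def)
next
 case False
 have "shift_class n k (a [^]\<^bsub>A_group n k\<^esub> nat l) (%i. int (nat l) * m i)" by (rule shift_class_nat_pow[OF assms])
 then show ?thesis using False by (simp add: int_pow_def)
qed

text \<open>The lift of the wound stem runs to \<open>x j\<close> and then one unit further. Its end
  moves by an integer, so the circle may keep its old lift.\<close>

lemma shift_class_wind:
 assumes j: "j < k"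
 shows "shift_class n k (A_class n k (wind n k j)) (%i. if i = j then 1 else 0)"
proof -
 let ?X = "space_of (Gnk n k)" and ?w = "wind_dir n k j"
 have refl: "A_homotopic n k (?w d) (?w d)" for d by (rule wind_dir_homotopic_refl[OF j])
 have wA: "?w d \<in> A_maps n k" for d
 proof -
  have mono: "homotopic_with (%h. h (Vert 0) = Vert 0) ?X ?X (?w d \<circ> ?w (\<not> d)) id" for d
   by (rule homotopic_with_mono[OF wind_dir_inverse[OF j]]) (simp add: fixes_circles_def)
  have props: "continuous_map ?X ?X (?w d)" "fixes_circles n k (?w d)" for d
   using homotopic_with_imp_continuous_maps[OF refl] homotopic_with_imp_property[OF refl] by blast+
  then have "?w d (Vert 0) = Vert 0" for d by (simp add: fixes_circles_def)
  then have "pointed_homotopy_equivalence ?X (Vert 0) ?X (Vert 0) (?w d)"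
   unfolding pointed_homotopy_equivalence_def
   using props mono[of d] mono[of "\<not> d"] by (intro conjI exI[of _ "?w (\<not> d)"]) simp_all
  then show ?thesis using props by (simp add: A_maps_def)
 qed
 have idr: "A_homotopic n k id id" by (rule A_homotopic_refl[OF id_A_maps])
 have inv: "A_class n k (?w d) \<otimes>\<^bsub>A_group n k\<^esub> A_class n k (?w (\<not> d)) = \<one>\<^bsub>A_group n k\<^esub>" for d
  unfolding A_mult[OF wA wA] A_one A_class_eq_iff[OF idr] by (rule wind_dir_inverse[OF j])
 have "A_class n k (?w True) \<in> Units (A_group n k)"
  unfolding Units_def
 proof (intro CollectI conjI bexI)
  show "A_class n k (?w True) \<in> carrier (A_group n k)" "A_class n k (?w False) \<in> carrier (A_group n k)"
   using wA unfolding A_carrier by blast+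
  show "A_class n k (?w False) \<otimes>\<^bsub>A_group n k\<^esub> A_class n k (?w True) = \<one>\<^bsub>A_group n k\<^esub>"
   "A_class n k (?w True) \<otimes>\<^bsub>A_group n k\<^esub> A_class n k (?w False) = \<one>\<^bsub>A_group n k\<^esub>"
   using inv[of False] inv[of True] by simp_all
 qed
 moreover have cls: "A_class n k (wind n k j) = A_class n k (?w True)"
 proof -
  have "A_homotopic n k (wind n k j) (?w True)"
  proof (rule homotopic_with_eq[OF refl])
   show "fixes_circles n k f = fixes_circles n k g" if "!!x. x \<in> topspace ?X ==> f x = g x" for f g
    by (rule fixes_circles_cong) (rule that, simp)
  qed (simp_all add: wind_eq_wind_dir)
  then show ?thesis using A_class_eq_iff[OF refl] by blast
 qed
 moreover have "shifts n k (?w True) (%i. if i = j then 1 else 0)"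
  unfolding shifts_def
 proof (intro conjI allI)
  show "?w True \<in> A_maps n k" by (rule wA)
  fix x :: "nat => real"
  \<comment> \<open>The lift of the wound stem, which \<open>?L\<close> interpolates linearly to the
    lift \<open>s * (x j + 1)\<close> with the same ends.\<close>
  let ?W = "%s. min 1 (2 * s) * x j + max 0 (2 * s - 1)"
  let ?L = "%t e s. if e = n + j then (1 - t) * ?W s + t * (s * (x j + 1)) else Fdata n k x e s"
  let ?x = "%i. x i + of_int (if i = j then 1 else 0)"
  have ld: "lift_data n k (?L t)" for t
  proof -
   have "(1 - t) * (x j + 1) + t * (x j + 1) - x j = 1" by (simp add: algebra_simps)
   then show ?thesis using j lift_data_Fdata[of n k x] by (auto simp: lift_data_def)
  qed
  show "homotopic_rel_circles True n k (rose (n + k)) (Fmap n k x \<circ> ?w True) (Fmap n k ?x)"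
  proof (rule htpy_rel_lmap[where L = ?L])
   show "lift_data n k (?L t)" for t by (rule ld)
   fix e
   show "continuous_on ({0..1} \<times> {0..1}) (%(t, s). ?L t e s)"
   proof (cases "e = n + j")
    case True
    then show ?thesis unfolding case_prod_unfold by (auto intro!: continuous_intros)
   next
    case False
    have "continuous_on ({0..1::real} \<times> {0..1}) (%p. Fdata n k x e (snd p))"
     by (rule continuous_on_compose2[OF continuous_on_Fdata]) (auto intro!: continuous_intros)
    then show ?thesis using False unfolding case_prod_unfold by simp
   qed
  next
   fix t :: real and i :: nat
   show "?L t (n + k + i) 0 - ?L 1 (n + k + i) 0 \<in> \<int>" using j by simp
  next
   fix y assume y: "y \<in> points (Gnk n k)"
   show "(Fmap n k x \<circ> ?w True) y = lmap n k (?L 0) y"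
    using y
   proof (cases rule: points_cases)
    case (1 v)
    then show ?thesis using j by (cases v) (simp_all add: wind_dir_def stem_map_def)
   next
    case (2 e s)
    then have y': "y = edge_pt (Gnk n k) e s" "e < n + k + k" "s \<in> {0..1}" by simp_all
    show ?thesis
    proof (cases "e = n + j")
     case False
     then have "?w True y = y" using 2 by (simp add: wind_dir_def stem_map_def)
     then show ?thesis using False y'(2,3) unfolding y'(1)
      by (simp add: Fmap_edge_pt lmap_edge_pt[OF ld] del: edge_pt_simps)
    next
     case True
     have L: "lmap n k (?L 0) y = petal (n + j) (?W s)"
      using True y'(2,3) j unfolding y'(1) by (simp add: lmap_edge_pt[OF ld] del: edge_pt_simps)
     show ?thesis
     proof (cases "s \<le> 1/2")
      case s: True
      then have "?w True y = edge_pt (Gnk n k) (n + j) (2 * s)"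
       using 2 True by (simp add: wind_dir_def stem_map_def stem_circle_def)
      then show ?thesis using L s 2 j Fmap_edge_pt[of "n + j" n k "2 * s" x] by simp
     next
      case s: False
      then have "?w True y = edge_pt (Gnk n k) (n + k + j) (2 * s - 1)"
       using 2 True by (simp add: wind_dir_def stem_map_def stem_circle_def)
      then show ?thesis using L s 2 j Fmap_edge_pt[of "n + k + j" n k "2 * s - 1" x] by (simp del: edge_pt_simps)
     qed
    qed
   qed
   show "Fmap n k ?x y = lmap n k (?L 1) y"
    using y
   proof (cases rule: points_cases)
    case (1 v)
    then show ?thesis using j by (cases v) (simp_all add: petal_eq_iff)
   next
    case (2 e s)
    then have y': "y = edge_pt (Gnk n k) e s" "e < n + k + k" "s \<in> {0..1}" by simp_all
    have "petal (pidx n k e) (Fdata n k ?x e s) = petal (pidx n k e) (?L 1 e s)"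
     using y'(2) by (cases rule: Gnk_edge_cases) (use j in \<open>auto simp: petal_eq_iff\<close>)
    then show ?thesis using y'(2,3) unfolding y'(1)
     by (simp add: Fmap_edge_pt lmap_edge_pt[OF ld] del: edge_pt_simps)
   qed
  qed
 qed
 ultimately show ?thesis unfolding shift_class_def by metis
qed

text \<open>The induction runs over lists of distinct indices; each factor contributes its power in
  its own coordinate only.\<close>

lemma shift_class_Zk_to_A:
 assumes "m \<in> Zk k" shows "shift_class n k (Zk_to_A n k m) m"
proof -
 have "shift_class n k (foldr (%j a. (A_class n k (wind n k j) [^]\<^bsub>A_group n k\<^esub> m j) \<otimes>\<^bsub>A_group n k\<^esub> a) js \<one>\<^bsub>A_group n k\<^esub>)
   (%i. if i \<in> set js then m i else 0)" if "set js \<subseteq> {..<k}" "distinct js" for js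
  using that
 proof (induction js)
  case Nil
  then show ?case using shift_class_one by simp
 next
  case (Cons j js)
  then have "shift_class n k (A_class n k (wind n k j) [^]\<^bsub>A_group n k\<^esub> m j) (%i. m j * (if i = j then 1 else 0))"
   by (intro shift_class_int_pow shift_class_wind) simp
  from shift_class_mult[OF this Cons.IH] Cons.prems
  have "shift_class n k (foldr (%j a. (A_class n k (wind n k j) [^]\<^bsub>A_group n k\<^esub> m j) \<otimes>\<^bsub>A_group n k\<^esub> a) (j # js) \<one>\<^bsub>A_group n k\<^esub>)
   (%i. m j * (if i = j then 1 else 0) + (if i \<in> set js then m i else 0))" by simp
  moreover have "(%i. m j * (if i = j then 1 else 0) + (if i \<in> set js then m i else 0)) =
    (%i. if i \<in> set (j # js) then m i else 0)" using Cons.prems by (auto simp: fun_eq_iff)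
  ultimately show ?case by simp
 qed
 from this[of "[0..<k]"] have "shift_class n k (Zk_to_A n k m) (%i. if i < k then m i else 0)"
  by (simp add: Zk_to_A_def atLeast0LessThan)
 moreover have "(%i. if i < k then m i else 0) = m" using assms by (auto simp: Zk_def fun_eq_iff)
 ultimately show ?thesis by simp
qed

section \<open>The action on coordinates\<close>

lemma nk_graph_cong:
 assumes "!!j. j < k ==> l j = l' j" "nk_graph b n k \<Gamma> l" shows "nk_graph b n k \<Gamma> l'"
proof -
 have "dual_adj k (%j. l j ` sphere 0 1) = dual_adj k (%j. l' j ` sphere 0 1)"
  unfolding dual_adj_def fun_eq_iff using assms(1) by (metis (no_types, lifting))
 moreover have "(\<exists>j<k. Vert v = l j 1) \<longleftrightarrow> (\<exists>j<k. Vert v = l' j 1)" for v using assms(1) by auto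
 ultimately show ?thesis using assms(2) unfolding nk_graph_def by (simp add: assms(1))
qed

text \<open>The chart \<open>h\<close> is unchanged: an integral translation of \<open>x\<close>
  does not move the vertices on the petals, it only changes the normal form of the marking.\<close>

lemma coord_precompose:
 assumes c: "coord n k (\<Gamma>, \<phi>) h x" and w: "shifts n k w m" and g: "g \<in> A_class n k w"
 shows "coord n k (\<Gamma>, \<phi> \<circ> g) h (%i. x i + of_int (m i))"
proof -
 have mk: "(\<Gamma>, \<phi>) \<in> marked True n k" and sr: "subdivided_rose n k \<Gamma> h x"
  and hom: "homotopic_rel_circles True n k (rose (n + k)) (h \<circ> \<phi>) (Fmap n k x)"
  using c by (simp_all add: coord_def)
 interpret A: subdivided_rose n k \<Gamma> h x by (rule sr)
 have wg: "A_homotopic n k w g" using g by (simp add: A_class_def)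
 have gA: "g \<in> A_maps n k" using A_maps_homotopic[OF _ wg] w by (simp add: shifts_def)
 have "\<phi> \<circ> kappa n k j = \<phi> \<circ> g \<circ> kappa n k j" if "j < k" for j
  using A_mapsD(2)[OF gA] that kappa_in_circ by (simp add: fixes_circles_def fun_eq_iff)
 then have "nk_graph True n k \<Gamma> (%j. \<phi> \<circ> g \<circ> kappa n k j)"
  by (rule nk_graph_cong) (use mk in \<open>simp_all add: marked_def\<close>)
 then have "(\<Gamma>, \<phi> \<circ> g) \<in> marked True n k"
  using phe_compose[OF A_mapsD(4)[OF gA] markedD(1)[OF mk]] by (simp add: marked_def)
 moreover have "subdivided_rose n k \<Gamma> h (%i. x i + of_int (m i))"
 proof
  have "petal i (x l + of_int (m l)) = petal i (x l)" for i l by (simp add: petal_eq_iff)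
  then show "h ` Vert ` verts \<Gamma> = insert (Vert 0) ((%j. petal (n + j) (x j + of_int (m j))) ` {..<k})"
   by (simp add: A.h_verts)
 qed (use A.fin\<Gamma> A.homeo A.h_base in auto)
 moreover have "homotopic_rel_circles True n k (rose (n + k)) (h \<circ> (\<phi> \<circ> g)) (Fmap n k (%i. x i + of_int (m i)))"
 proof -
  have 1: "homotopic_rel_circles True n k (rose (n + k)) ((h \<circ> \<phi>) \<circ> g) (Fmap n k x \<circ> g)"
   by (rule htpy_rel_precompose[OF hom gA])
  have 2: "homotopic_rel_circles True n k (rose (n + k)) (Fmap n k x \<circ> g) (Fmap n k x \<circ> w)"
   by (rule htpy_rel_of_A_homotopic[OF homotopic_with_symD[OF wg] continuous_map_Fmap]) simp
  have 3: "homotopic_rel_circles True n k (rose (n + k)) (Fmap n k x \<circ> w) (Fmap n k (%i. x i + of_int (m i)))"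
   using w by (simp add: shifts_def)
  show ?thesis unfolding comp_assoc[symmetric]
   by (rule htpy_rel_trans[OF 1 htpy_rel_trans[OF 2 3]])
 qed
 ultimately show ?thesis by (simp add: coord_def)
qed

definition translate :: "(nat => int) => (nat => int) \<times> (nat => nat) => (nat => int) \<times> (nat => nat)" where
 "translate m c = (%i. fst c i + m i, snd c)"

lemma code_translate:
 assumes "m \<in> Zk k" shows "code k (%i. x i + of_int (- m i)) = translate m (code k x)"
proof -
 have "\<lfloor>- (x i + of_int (- m i))\<rfloor> = \<lfloor>- x i\<rfloor> + m i" for i
 proof -
  have "- (x i + of_int (- m i)) = - x i + of_int (m i)" by simp
  then show ?thesis by (simp only: floor_add_int)
 qed
 moreover have "x i + of_int (- m i) \<in> \<int> \<longleftrightarrow> x i \<in> \<int>" for i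
  by (metis Ints_add Ints_diff Ints_of_int add_diff_cancel)
 ultimately show ?thesis using assms by (auto simp: code_def translate_def Zk_def fun_eq_iff)
qed

text \<open>By definition the action collects the results over all representatives of the element
  and of the inverse. All of them have coordinates in the same cells, so they form a single
  class.\<close>

lemma Zk_act_Fnk:
 assumes nk: "n + k \<ge> 1" and m: "m \<in> Zk k" and X: "X \<in> Fnk n k"
 shows "Zk_act n k m X \<in> Fnk n k" "fiber_code n k (Zk_act n k m X) = translate m (fiber_code n k X)"
proof -
 let ?a = "Zk_to_A n k m" and ?E = "marked_equiv True n k"
 obtain m0 h x where m0: "m0 \<in> X" "coord n k m0 h x" by (rule Fnk_coord[OF nk X])
 obtain \<Gamma>0 \<phi>0 where mm: "m0 = (\<Gamma>0, \<phi>0)" by (cases m0)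
 let ?x = "%i. x i + of_int (- m i)"
 obtain w where w: "inv\<^bsub>A_group n k\<^esub> ?a = A_class n k w" "shifts n k w (%i. - m i)"
  using shift_class_inv[OF shift_class_Zk_to_A[OF m]] unfolding shift_class_def by blast
 have "w \<in> A_maps n k" using w(2) by (simp add: shifts_def)
 then have w_mem: "w \<in> A_class n k w" using A_homotopic_refl by (simp only: A_class_def mem_Collect_eq)
 let ?m = "(\<Gamma>0, \<phi>0 \<circ> w)"
 have c: "coord n k ?m h ?x" by (rule coord_precompose[OF m0(2)[unfolded mm] w(2) w_mem])
 have "Zk_act n k m X = ?E `` {?m}"
 proof (intro Set.set_eqI iffI)
  fix m' assume "m' \<in> Zk_act n k m X"
  then obtain \<Gamma> \<phi> g where g: "(\<Gamma>, \<phi>) \<in> X" "g \<in> A_class n k w" "((\<Gamma>, \<phi> \<circ> g), m') \<in> ?E"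
   unfolding Zk_act_def act_def w(1) by blast
  obtain h1 where h1: "coord n k (\<Gamma>, \<phi>) h1 x" by (rule coord_transfer[OF Fnk_related[OF X m0(1) g(1)] m0(2)])
  have "(?m, (\<Gamma>, \<phi> \<circ> g)) \<in> ?E"
   by (rule coord_equiv[OF c coord_precompose[OF h1 w(2) g(2)]]) (simp add: same_cell_def)
  from marked_equiv_trans[OF this g(3)] show "m' \<in> ?E `` {?m}" by simp
 next
  fix m' assume "m' \<in> ?E `` {?m}"
  then show "m' \<in> Zk_act n k m X"
   unfolding Zk_act_def act_def w(1) using m0(1) w_mem unfolding mm by blast
 qed
 then show X': "Zk_act n k m X \<in> Fnk n k" and "fiber_code n k (Zk_act n k m X) = translate m (fiber_code n k X)"
  using quotient_coord_Fnk[OF nk c] fiber_code_eq[OF quotient_coord_Fnk[OF nk c] c] fiber_code_eq[OF X m0]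
   code_translate[OF m] by simp_all
qed

lemma translate_ZP: "m \<in> Zk k ==> c \<in> ZP k ==> translate m c \<in> ZP k"
 by (auto simp: translate_def ZP_def Zk_def)

lemma ZP_le_translate: "ZP_le k (translate m c) (translate m c') \<longleftrightarrow> ZP_le k c c'"
 by (auto simp: translate_def ZP_le_def case_prod_unfold)

lemma poset_iso_Zk_act:
 assumes nk: "n + k \<ge> 1" and m: "m \<in> Zk k"
 shows "poset_iso (Fnk n k) (F_le n k) (Fnk n k) (F_le n k) (Zk_act n k m)"
 unfolding poset_iso_def
proof (intro conjI ballI)
 note act = Zk_act_Fnk[OF nk m]
 note inj = inj_onD[OF bij_betw_imp_inj_on[OF bij_betw_fiber_code[OF nk]]]
 show "bij_betw (Zk_act n k m) (Fnk n k) (Fnk n k)"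
 proof (rule bij_betw_imageI)
  show "inj_on (Zk_act n k m) (Fnk n k)"
  proof (rule inj_onI)
   fix X Y assume X: "X \<in> Fnk n k" and Y: "Y \<in> Fnk n k" and "Zk_act n k m X = Zk_act n k m Y"
   then have "translate m (fiber_code n k X) = translate m (fiber_code n k Y)" using act(2)[OF X] act(2)[OF Y] by simp
   then have "fiber_code n k X = fiber_code n k Y" by (simp add: translate_def fun_eq_iff prod_eq_iff)
   then show "X = Y" by (rule inj[OF _ X Y])
  qed
  show "Zk_act n k m ` Fnk n k = Fnk n k"
  proof
   show "Zk_act n k m ` Fnk n k \<subseteq> Fnk n k" using act(1) by blast
   show "Fnk n k \<subseteq> Zk_act n k m ` Fnk n k"
   proof
    fix Y assume Y: "Y \<in> Fnk n k"
    let ?c = "translate (%i. - m i) (fiber_code n k Y)"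
    have "fiber_code n k Y \<in> ZP k" using bij_betw_apply[OF bij_betw_fiber_code[OF nk] Y] .
    then have "?c \<in> ZP k" by (rule translate_ZP[rotated]) (use m in \<open>simp add: Zk_def\<close>)
    then obtain X where X: "X \<in> Fnk n k" "fiber_code n k X = ?c"
     using bij_betw_imp_surj_on[OF bij_betw_fiber_code[OF nk]] by (metis imageE)
    have "fiber_code n k (Zk_act n k m X) = fiber_code n k Y"
     using act(2)[OF X(1)] X(2) by (simp add: translate_def)
    then have "Zk_act n k m X = Y" by (rule inj[OF _ act(1)[OF X(1)] Y])
    then show "Y \<in> Zk_act n k m ` Fnk n k" using X(1) by blast
   qed
  qed
 qed
 fix X Y assume X: "X \<in> Fnk n k" and Y: "Y \<in> Fnk n k"
 show "F_le n k X Y \<longleftrightarrow> F_le n k (Zk_act n k m X) (Zk_act n k m Y)"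
  unfolding F_le_iff[OF nk X Y] F_le_iff[OF nk act(1)[OF X] act(1)[OF Y]] act(2)[OF X] act(2)[OF Y] ZP_le_translate ..
qed

section \<open>The realization of \<open>\<int>\<^sup>k \<times> (\<int>/2)\<^sup>k\<close>\<close>

text \<open>The levels at which the superlevel set of the coordinates of \<open>a\<close> is
  \<open>A\<close>. As the level grows these sets shrink, so those that occur form a chain.\<close>

definition level_set :: "nat => (nat => real) => nat set => real set" where
 "level_set k a A = {s. 0 < s \<and> s \<le> 1 \<and> (\<forall>i\<in>{..<k}. s \<le> a i \<longleftrightarrow> i \<in> A)}"

text \<open>The layer cake formula: for a point \<open>a\<close> of the unit cube these are its
  barycentric coordinates in the triangulation of the cube by chains of subsets.\<close>

definition level_weight :: "nat => (nat => real) => nat set => real" where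
 "level_weight k a A = measure lborel (level_set k a A)"

lemma level_set_fmeasurable: "level_set k a A \<in> fmeasurable lborel"
proof (rule fmeasurableI)
 have "{s \<in> space lborel. 0 < s \<and> s \<le> 1 \<and> (\<forall>i\<in>{..<k}. s \<le> a i \<longleftrightarrow> i \<in> A)} \<in> sets lborel" by measurable
 then show sets: "level_set k a A \<in> sets lborel" by (simp add: level_set_def)
 have "emeasure lborel (level_set k a A) \<le> emeasure lborel {0<..1::real}"
  by (rule emeasure_mono) (auto simp: level_set_def)
 also have "\<dots> < \<infinity>" by simp
 finally show "emeasure lborel (level_set k a A) < \<infinity>" .
qed

lemma sum_level_weight:
 assumes "Q \<subseteq> Pow {..<k}"
 shows "sum (level_weight k a) Q = measure lborel (\<Union>A\<in>Q. level_set k a A)"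
 unfolding level_weight_def
proof (rule measure_finite_Union[symmetric])
 show "finite Q" using assms by (rule finite_subset) simp
 show "level_set k a ` Q \<subseteq> sets lborel" using level_set_fmeasurable[of k a] by (auto simp: fmeasurable_def)
 show "emeasure lborel (level_set k a A) \<noteq> \<infinity>" for A
  using level_set_fmeasurable[of k a A] by (auto simp: fmeasurable_def)
 show "disjoint_family_on (level_set k a) Q"
  unfolding disjoint_family_on_def
 proof (intro ballI impI)
  fix A B assume AB: "A \<in> Q" "B \<in> Q" "A \<noteq> B"
  have False if "s \<in> level_set k a A" "s \<in> level_set k a B" for s
  proof -
   have "i \<in> A \<longleftrightarrow> i \<in> B" if "i < k" for i
    using that \<open>s \<in> level_set k a A\<close> \<open>s \<in> level_set k a B\<close> by (simp add: level_set_def)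
   moreover have "A \<subseteq> {..<k}" "B \<subseteq> {..<k}" using AB assms by auto
   ultimately have "A = B" by (intro Set.set_eqI) auto
   then show False using AB by simp
  qed
  then show "level_set k a A \<inter> level_set k a B = {}" by blast
 qed
qed

lemma sum_level_weight_all: "sum (level_weight k a) (Pow {..<k}) = 1"
proof -
 have "(\<Union>A\<in>Pow {..<k}. level_set k a A) = {0<..1}"
 proof
  show "{0<..1} \<subseteq> (\<Union>A\<in>Pow {..<k}. level_set k a A)"
  proof
   fix s :: real assume "s \<in> {0<..1}"
   then have "s \<in> level_set k a {i \<in> {..<k}. s \<le> a i}" by (auto simp: level_set_def)
   then show "s \<in> (\<Union>A\<in>Pow {..<k}. level_set k a A)" by (rule UN_I[rotated]) auto
  qed
 qed (auto simp: level_set_def)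
 then show ?thesis by (simp add: sum_level_weight)
qed

text \<open>The levels whose set contains \<open>i\<close> are precisely those up to
  \<open>a i\<close>, an interval of length \<open>a i\<close>.\<close>

lemma sum_level_weight_mem:
 assumes "i < k" "0 \<le> a i" "a i \<le> 1"
 shows "sum (level_weight k a) {A \<in> Pow {..<k}. i \<in> A} = a i"
proof -
 have "(\<Union>A\<in>{A \<in> Pow {..<k}. i \<in> A}. level_set k a A) = {0<..a i}"
 proof
  show "{0<..a i} \<subseteq> (\<Union>A\<in>{A \<in> Pow {..<k}. i \<in> A}. level_set k a A)"
  proof
   fix s assume s: "s \<in> {0<..a i}"
   then have "s \<in> level_set k a {i \<in> {..<k}. s \<le> a i}" using assms by (auto simp: level_set_def)
   then show "s \<in> (\<Union>A\<in>{A \<in> Pow {..<k}. i \<in> A}. level_set k a A)" by (rule UN_I[rotated]) (use s assms(1) in auto)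
  qed
 qed (use assms(1) in \<open>auto simp: level_set_def\<close>)
 moreover have "sum (level_weight k a) {A \<in> Pow {..<k}. i \<in> A} =
   measure lborel (\<Union>A\<in>{A \<in> Pow {..<k}. i \<in> A}. level_set k a A)" by (rule sum_level_weight) auto
 ultimately show ?thesis using assms by simp
qed

lemma level_weight_nonneg: "0 \<le> level_weight k a A"
 by (simp add: level_weight_def)

lemma level_weight_ge:
 assumes "l \<le> r" "{l<..r} \<subseteq> level_set k a A" shows "r - l \<le> level_weight k a A"
proof -
 have "measure lborel {l<..r} \<le> measure lborel (level_set k a A)"
  by (rule measure_mono_fmeasurable[OF assms(2) _ level_set_fmeasurable]) simp
 then show ?thesis using assms(1) by (simp add: level_weight_def)
qed

text \<open>It is 0 at integers, 1 at midpoints and linear in between: the barycentric weight of the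
  midpoint on the half interval containing \<open>v\<close>, whose other end is the integer
  \<open>\<lfloor>v + 1 / 2\<rfloor>\<close>.\<close>

definition tent :: "real => real" where
 "tent v = 1 - 2 * \<bar>v - of_int \<lfloor>v\<rfloor> - 1 / 2\<bar>"

lemma floor_half_cases:
 obtains r :: real where "v = of_int \<lfloor>v\<rfloor> + r" "0 \<le> r" "r < 1 / 2" "\<lfloor>v + 1 / 2\<rfloor> = \<lfloor>v\<rfloor>" "tent v = 2 * r"
 | r :: real where "v = of_int \<lfloor>v\<rfloor> + r" "1 / 2 \<le> r" "r < 1" "\<lfloor>v + 1 / 2\<rfloor> = \<lfloor>v\<rfloor> + 1" "tent v = 2 - 2 * r"
proof -
 define r where "r = v - of_int \<lfloor>v\<rfloor>"
 have r: "0 \<le> r" "r < 1" unfolding r_def by linarith+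
 have tent: "tent v = 1 - 2 * \<bar>r - 1 / 2\<bar>" by (simp add: tent_def r_def)
 show ?thesis
 proof (cases "r < 1 / 2")
  case True
  then have "\<lfloor>v + 1 / 2\<rfloor> = \<lfloor>v\<rfloor>" using r unfolding r_def by linarith
  moreover have "tent v = 2 * r" using True unfolding tent by (simp add: abs_if)
  ultimately show ?thesis using True r by (intro that(1)[of r]) (simp_all add: r_def)
 next
  case False
  then have "\<lfloor>v + 1 / 2\<rfloor> = \<lfloor>v\<rfloor> + 1" using r unfolding r_def by linarith
  moreover have "tent v = 2 - 2 * r" using False unfolding tent by (simp add: abs_if)
  ultimately show ?thesis using False r by (intro that(2)[of r]) (simp_all add: r_def)
 qed
qed

lemma tent_bounds: "0 \<le> tent v" "tent v \<le> 1"
 by (cases rule: floor_half_cases[of v]; simp)+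

lemma tent_convex: "tent v * (of_int \<lfloor>v\<rfloor> + 1 / 2) + (1 - tent v) * of_int \<lfloor>v + 1 / 2\<rfloor> = v"
proof (cases rule: floor_half_cases[of v])
 case (1 r)
 have "tent v * (of_int \<lfloor>v\<rfloor> + 1 / 2) + (1 - tent v) * of_int \<lfloor>v + 1 / 2\<rfloor> = of_int \<lfloor>v\<rfloor> + r"
  unfolding 1(4,5) by (simp add: algebra_simps)
 then show ?thesis using 1(1) by simp
next
 case (2 r)
 have "tent v * (of_int \<lfloor>v\<rfloor> + 1 / 2) + (1 - tent v) * of_int \<lfloor>v + 1 / 2\<rfloor> = of_int \<lfloor>v\<rfloor> + r"
  unfolding 2(4,5) by (simp add: algebra_simps)
 then show ?thesis using 2(1) by simp
qed

text \<open>The open segment from a midpoint to an adjacent integer lies in one open half interval,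
  on which both floors are constant. At the ends of the segment only one of the two vertices could
  be recovered, hence the strict bounds on \<open>\<alpha>\<close>.\<close>

lemma tent_convex_unique:
 fixes q z :: int
 assumes "0 < \<alpha>" "\<alpha> < 1" "z = q \<or> z = q + 1"
 defines "v \<equiv> \<alpha> * (of_int q + 1 / 2) + (1 - \<alpha>) * of_int z"
 shows "\<lfloor>v\<rfloor> = q" "\<lfloor>v + 1 / 2\<rfloor> = z" "tent v = \<alpha>"
proof -
 have *: "\<lfloor>v\<rfloor> = q \<and> \<lfloor>v + 1 / 2\<rfloor> = z \<and> tent v = \<alpha>"
  using assms(3)
 proof
  assume z: "z = q"
  have v: "v = of_int q + \<alpha> / 2" unfolding v_def z by (simp add: algebra_simps)
  have "\<lfloor>v\<rfloor> = q" unfolding v using assms(1,2) by linarith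
  moreover have "\<lfloor>v + 1 / 2\<rfloor> = q" unfolding v using assms(1,2) by linarith
  ultimately show ?thesis using assms(1,2) unfolding tent_def z v by (auto simp: abs_if)
 next
  assume z: "z = q + 1"
  have v: "v = of_int q + 1 - \<alpha> / 2" unfolding v_def z by (simp add: algebra_simps)
  have "\<lfloor>v\<rfloor> = q" unfolding v using assms(1,2) by linarith
  moreover have "\<lfloor>v + 1 / 2\<rfloor> = q + 1" unfolding v using assms(1,2) by linarith
  ultimately show ?thesis using assms(1,2) unfolding tent_def z v by (auto simp: abs_if)
 qed
 then show "\<lfloor>v\<rfloor> = q" "\<lfloor>v + 1 / 2\<rfloor> = z" "tent v = \<alpha>" by simp_all
qed

lemma tent_int: "tent (of_int z) = 0" "\<lfloor>of_int z + 1 / 2 :: real\<rfloor> = z"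
 and tent_half: "tent (of_int z + 1 / 2) = 1"
proof -
 show f: "\<lfloor>of_int z + 1 / 2 :: real\<rfloor> = z" by linarith
 show "tent (of_int z) = 0" by (simp add: tent_def)
 show "tent (of_int z + 1 / 2) = 1" unfolding tent_def f by simp
qed

section \<open>Barycentric coordinates for the subdivided cubes\<close>

type_synonym zp = "(nat => int) \<times> (nat => nat)"

text \<open>The barycenter of the cube coded by \<open>c\<close>: an integer where \<open>p\<close>
  is 0 and a midpoint where \<open>p\<close> is 1.\<close>

definition zp_val :: "zp => nat => real" where
 "zp_val c i = of_int (fst c i) + of_nat (snd c i) / 2"

definition bary :: "(zp => real) => nat => real" where
 "bary \<xi> i = (\<Sum>c\<in>{c. \<xi> c \<noteq> 0}. \<xi> c * zp_val c i)"

definition odd_set :: "nat => zp => nat set" where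
 "odd_set k c = {i. i < k \<and> snd c i = 1}"

text \<open>Among the vertices around \<open>v\<close>, the one with midpoints exactly in the
  directions in \<open>A\<close> and nearest integers, by rounding, in the other directions.\<close>

definition zp_vertex :: "nat => (nat => real) => nat set => zp" where
 "zp_vertex k v A = (%i. if i < k then if i \<in> A then \<lfloor>v i\<rfloor> else \<lfloor>v i + 1 / 2\<rfloor> else 0,
   %i. if i \<in> A then 1 else 0)"

text \<open>The inverse of \<open>bary\<close>: the vertex with odd set \<open>A\<close> gets the
  level weight of \<open>A\<close> for the tent coordinates of \<open>v\<close>, and all other
  vertices get 0.\<close>

definition unbary :: "nat => (nat => real) => zp => real" where
 "unbary k v c = (if c = zp_vertex k v (odd_set k c) then level_weight k (%i. tent (v i)) (odd_set k c) else 0)"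

lemma ZP_snd: "c \<in> ZP k ==> snd c i = 0 \<or> snd c i = 1"
 by (cases "i < k") (auto simp: ZP_def)

lemma ZP_ge: "c \<in> ZP k ==> k \<le> i ==> fst c i = 0 \<and> snd c i = 0"
 by (auto simp: ZP_def Zk_def)

lemma odd_set_vertex: "A \<subseteq> {..<k} ==> odd_set k (zp_vertex k v A) = A"
 by (auto simp: odd_set_def zp_vertex_def)

lemma ZP_leD:
 assumes "ZP_le k c d" "i < k"
 shows "(snd c i = snd d i \<and> fst c i = fst d i) \<or> (snd c i < snd d i \<and> (fst c i = fst d i \<or> fst c i = fst d i + 1))"
 using assms by (auto simp: ZP_le_def case_prod_unfold)

lemma ZP_le_refl: "ZP_le k c c"
 by (simp add: ZP_le_def case_prod_unfold)

lemma poset_chainsD: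
 assumes "\<sigma> \<in> poset_chains P r"
 shows "\<sigma> \<subseteq> P" "finite \<sigma>" "\<sigma> \<noteq> {}" "c \<in> \<sigma> ==> d \<in> \<sigma> ==> r c d \<or> r d c"
 using assms by (auto simp: poset_chains_def)

lemma simplex_ofD:
 assumes "\<xi> \<in> simplex_of \<sigma>"
 shows "0 \<le> \<xi> c" "c \<notin> \<sigma> ==> \<xi> c = 0" "sum \<xi> \<sigma> = 1"
 using assms by (cases "c \<in> \<sigma>"; auto simp: simplex_of_def)+

lemma bary_simplex:
 assumes "finite \<sigma>" "\<xi> \<in> simplex_of \<sigma>"
 shows "bary \<xi> i = (\<Sum>c\<in>\<sigma>. \<xi> c * zp_val c i)"
 unfolding bary_def
 by (rule sum.mono_neutral_left) (use assms simplex_ofD(2)[OF assms(2)] in auto)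

lemma if_eq_0I: "(P ==> x = 0) ==> (if P then x else 0) = 0"
 by simp

text \<open>The point determines, coordinate by coordinate, which vertex of the chain has a given
  odd set. Each weight is then at most the corresponding level weight; as the weights already add up
  to 1, equality holds throughout.\<close>

lemma unbary_bary:
 assumes \<sigma>: "\<sigma> \<in> poset_chains (ZP k) (ZP_le k)" and \<xi>: "\<xi> \<in> simplex_of \<sigma>"
 shows "unbary k (bary \<xi>) = \<xi>"
proof -
 note chain = poset_chainsD[OF \<sigma>] and simp = simplex_ofD[OF \<xi>]
 define v where "v = bary \<xi>"
 define S where "S = {c \<in> \<sigma>. \<xi> c \<noteq> 0}"
 have finS: "finite S" using chain(2) by (simp add: S_def)
 have SZP: "c \<in> ZP k" if "c \<in> S" for c using that chain(1) by (auto simp: S_def)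
 have pos: "0 < \<xi> c" if "c \<in> S" for c using that simp(1)[of c] by (simp add: S_def less_le)
 have S\<sigma>: "S \<subseteq> \<sigma>" "!!c. c \<in> \<sigma> - S ==> \<xi> c = 0" by (simp_all add: S_def)
 have "sum \<xi> \<sigma> = sum \<xi> S" by (rule sum.mono_neutral_right[OF chain(2) S\<sigma>(1)]) (intro ballI S\<sigma>(2))
 then have sumS: "sum \<xi> S = 1" by (simp only: simp(3))
 have vS: "v i = (\<Sum>c\<in>S. \<xi> c * zp_val c i)" for i
  unfolding v_def bary_simplex[OF chain(2) \<xi>]
  by (rule sum.mono_neutral_right[OF chain(2) S\<sigma>(1)]) (simp add: S\<sigma>(2))
 have comp: "ZP_le k c d \<or> ZP_le k d c" if "c \<in> S" "d \<in> S" for c d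
  by (rule chain(4)[OF subsetD[OF S\<sigma>(1) that(1)] subsetD[OF S\<sigma>(1) that(2)]])
 \<comment> \<open>In a chain all vertices with a midpoint in direction \<open>i\<close> have the
   same one, and likewise for integers, and the two are adjacent. So \<open>v i\<close> is a convex
   combination of two known points, from which weight and vertices are recovered.\<close>
 have coordinate: "tent (v i) = (\<Sum>c | c \<in> S \<and> snd c i = 1. \<xi> c) \<and>
   (\<forall>c\<in>S. fst c i = (if snd c i = 1 then \<lfloor>v i\<rfloor> else \<lfloor>v i + 1 / 2\<rfloor>))" if i: "i < k" for i
 proof -
  let ?O = "{c \<in> S. snd c i = 1}" and ?E = "{c \<in> S. snd c i \<noteq> 1}"
  let ?\<alpha> = "sum \<xi> ?O"
  have same: "fst c i = fst d i" if "c \<in> S" "d \<in> S" "snd c i = snd d i" for c d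
   using comp[OF that(1,2)]
  proof
   assume "ZP_le k c d"
   from ZP_leD[OF this i] show ?thesis using that(3) by auto
  next
   assume "ZP_le k d c"
   from ZP_leD[OF this i] show ?thesis using that(3) by auto
  qed
  have E0: "snd c i = 0" if "c \<in> ?E" for c using that ZP_snd[OF SZP, of c i] by auto
  have split: "(\<Sum>c\<in>S. f c) = (\<Sum>c\<in>?O. f c) + (\<Sum>c\<in>?E. f c)" for f :: "zp => real"
  proof -
   have "(\<Sum>c\<in>?O \<union> ?E. f c) = (\<Sum>c\<in>?O. f c) + (\<Sum>c\<in>?E. f c)" by (rule sum.union_disjoint) (use finS in auto)
   moreover have "?O \<union> ?E = S" by blast
   ultimately show ?thesis by (simp only:)
  qed
  have \<alpha>E: "sum \<xi> ?E = 1 - ?\<alpha>" using split[of \<xi>] sumS by simp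
  have O_sum: "(\<Sum>c\<in>?O. \<xi> c * zp_val c i) = ?\<alpha> * (of_int q + 1 / 2)" if "!!c. c \<in> ?O ==> fst c i = q" for q
   unfolding sum_distrib_right
  proof (rule sum.cong[OF refl])
   fix c assume c: "c \<in> ?O"
   then have "zp_val c i = of_int q + 1 / 2" using that[OF c] by (simp add: zp_val_def)
   then show "\<xi> c * zp_val c i = \<xi> c * (of_int q + 1 / 2)" by (simp only:)
  qed
  have E_sum: "(\<Sum>c\<in>?E. \<xi> c * zp_val c i) = (1 - ?\<alpha>) * of_int z" if z: "!!c. c \<in> ?E ==> fst c i = z" for z
   unfolding \<alpha>E[symmetric] sum_distrib_right
  proof (rule sum.cong[OF refl])
   fix c assume c: "c \<in> ?E"
   have "zp_val c i = of_int z" unfolding zp_val_def z[OF c] E0[OF c] by simp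
   then show "\<xi> c * zp_val c i = \<xi> c * of_int z" by (simp only:)
  qed
  have v_split: "v i = (\<Sum>c\<in>?O. \<xi> c * zp_val c i) + (\<Sum>c\<in>?E. \<xi> c * zp_val c i)"
   unfolding vS by (rule split)
  consider "?O = {}" | "?E = {}" | co ce where "co \<in> ?O" "ce \<in> ?E" by blast
  then show ?thesis
  proof cases
   case 1
   have "S \<noteq> {}" using sumS by auto
   then obtain c where c: "c \<in> ?E" using 1 by blast
   let ?z = "fst c i"
   have z: "fst d i = ?z" if "d \<in> ?E" for d using same[of d c] that c E0[of d] E0[of c] by simp
   have O0: "sum f ?O = 0" for f :: "zp => real" unfolding 1 by (rule sum.empty)
   have "(\<Sum>c\<in>?E. \<xi> c * zp_val c i) = (1 - ?\<alpha>) * of_int ?z" by (rule E_sum) (rule z)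
   then have vi: "v i = of_int ?z" using v_split O0[of "%c. \<xi> c * zp_val c i"] O0[of \<xi>] by (metis (no_types) add.left_neutral diff_zero mult_1)
   show ?thesis unfolding vi tent_int O0
   proof (intro conjI refl ballI)
    fix d assume "d \<in> S"
    then have "d \<in> ?E" using 1 by blast
    then show "fst d i = (if snd d i = 1 then \<lfloor>real_of_int ?z\<rfloor> else ?z)" using z[of d] by simp
   qed
  next
   case 2
   have "S \<noteq> {}" using sumS by auto
   then obtain c where c: "c \<in> ?O" using 2 by blast
   let ?q = "fst c i"
   have q: "fst d i = ?q" if "d \<in> ?O" for d using same[of d c] that c by simp
   have E0': "sum f ?E = 0" for f :: "zp => real" unfolding 2 by (rule sum.empty)
   have a1: "?\<alpha> = 1" using \<alpha>E unfolding E0' by simp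
   have "(\<Sum>c\<in>?O. \<xi> c * zp_val c i) = ?\<alpha> * (of_int ?q + 1 / 2)" by (rule O_sum) (rule q)
   then have vi: "v i = of_int ?q + 1 / 2" using v_split E0'[of "%c. \<xi> c * zp_val c i"] a1 by (metis (no_types) add.right_neutral mult_1)
   have fl: "\<lfloor>of_int ?q + 1 / 2 :: real\<rfloor> = ?q" by (rule tent_int(2))
   show ?thesis unfolding vi tent_half a1 fl
   proof (intro conjI refl ballI)
    fix d assume "d \<in> S"
    then have "d \<in> ?O" using 2 by blast
    then show "fst d i = (if snd d i = 1 then ?q else \<lfloor>real_of_int ?q + 1 / 2 + 1 / 2\<rfloor>)" using q[of d] by simp
   qed
  next
   case (3 co ce)
   let ?q = "fst co i" and ?z = "fst ce i"
   have q: "fst d i = ?q" if "d \<in> ?O" for d using same[of d co] that 3 by simp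
   have z: "fst d i = ?z" if "d \<in> ?E" for d using same[of d ce] that 3 E0[of d] E0[of ce] by simp
   have v: "v i = ?\<alpha> * (of_int ?q + 1 / 2) + (1 - ?\<alpha>) * of_int ?z"
   proof -
    have "(\<Sum>c\<in>?O. \<xi> c * zp_val c i) = ?\<alpha> * (of_int ?q + 1 / 2)" by (rule O_sum) (rule q)
    moreover have "(\<Sum>c\<in>?E. \<xi> c * zp_val c i) = (1 - ?\<alpha>) * of_int ?z" by (rule E_sum) (rule z)
    ultimately show ?thesis by (simp only: v_split)
   qed
   have "\<xi> co \<le> ?\<alpha>" by (rule member_le_sum) (use 3 finS simp(1) in auto)
   then have a0: "0 < ?\<alpha>" using pos[of co] 3 by simp
   have "\<xi> ce \<le> sum \<xi> ?E" by (rule member_le_sum) (use 3 finS simp(1) in auto)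
   then have a1: "?\<alpha> < 1" using pos[of ce] 3 \<alpha>E by simp
   have snds: "snd co i = 1" "snd ce i = 0" and mem: "co \<in> S" "ce \<in> S" using 3 E0[of ce] by simp_all
   have "?z = ?q \<or> ?z = ?q + 1"
    using comp[OF mem]
   proof
    assume "ZP_le k co ce"
    from ZP_leD[OF this i] show ?thesis using snds by auto
   next
    assume "ZP_le k ce co"
    from ZP_leD[OF this i] show ?thesis using snds by auto
   qed
   note u = tent_convex_unique[OF a0 a1 this, folded v]
   show ?thesis unfolding u
   proof (intro conjI refl ballI)
    fix d assume "d \<in> S"
    then show "fst d i = (if snd d i = 1 then ?q else ?z)" using q[of d] z[of d] by simp
   qed
  qed
 qed
 let ?a = "%i. tent (v i)"
 have vertex: "c = zp_vertex k v (odd_set k c)" if "c \<in> S" for c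
 proof -
  have "fst c i = (if i < k then if i \<in> odd_set k c then \<lfloor>v i\<rfloor> else \<lfloor>v i + 1 / 2\<rfloor> else 0)" for i
   using coordinate[of i] that ZP_ge[OF SZP[OF that], of i] by (auto simp: odd_set_def)
  moreover have "snd c i = (if i \<in> odd_set k c then 1 else 0)" for i
   using ZP_ge[OF SZP[OF that], of i] ZP_snd[OF SZP[OF that], of i] by (auto simp: odd_set_def)
  ultimately show ?thesis by (simp add: zp_vertex_def prod_eq_iff fun_eq_iff)
 qed
 have inj: "inj_on (odd_set k) S"
 proof (rule inj_onI)
  fix c d assume c: "c \<in> S" and d: "d \<in> S" and eq: "odd_set k c = odd_set k d"
  have "zp_vertex k v (odd_set k c) = zp_vertex k v (odd_set k d)" by (simp only: eq)
  then show "c = d" by (rule trans[OF trans[OF vertex[OF c]] vertex[OF d, symmetric]])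
 qed
 \<comment> \<open>The interval of length \<open>\<xi> c\<close> that ends at the total weight of
   \<open>?U\<close> consists of levels of the odd set of \<open>c\<close>: a direction odd in
   \<open>c\<close> is odd in all of \<open>?U\<close>, and one even in \<open>c\<close> is odd only
   strictly above \<open>c\<close>.\<close>
 have le: "\<xi> c \<le> level_weight k ?a (odd_set k c)" if c: "c \<in> S" for c
 proof -
  let ?U = "{d \<in> S. ZP_le k c d}"
  have finU: "finite ?U" and cU: "c \<in> ?U" using finS c ZP_le_refl by auto
  have U: "sum \<xi> ?U = \<xi> c + sum \<xi> (?U - {c})" by (rule sum.remove[OF finU cU])
  have rest: "0 \<le> sum \<xi> (?U - {c})" by (rule sum_nonneg) (rule simp(1))
  have U1: "sum \<xi> ?U \<le> 1" unfolding sumS[symmetric] by (rule sum_mono2[OF finS]) (use simp(1) in auto)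
  have "{sum \<xi> (?U - {c})<..sum \<xi> ?U} \<subseteq> level_set k ?a (odd_set k c)"
  proof
   fix s assume s: "s \<in> {sum \<xi> (?U - {c})<..sum \<xi> ?U}"
   have "s \<le> ?a i \<longleftrightarrow> i \<in> odd_set k c" if i: "i < k" for i
   proof (cases "snd c i = 1")
    case True
    have "?U \<subseteq> {d \<in> S. snd d i = 1}"
    proof
     fix d assume d: "d \<in> ?U"
     then have "snd d i = 1" using ZP_leD[of k c d i] i True ZP_snd[OF SZP, of d i] by auto
     then show "d \<in> {d \<in> S. snd d i = 1}" using d by simp
    qed
    then have "sum \<xi> ?U \<le> ?a i"
     unfolding conjunct1[OF coordinate[OF i]] by (rule sum_mono2[rotated]) (use finS simp(1) in auto)
    then show ?thesis using s i True by (simp add: odd_set_def)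
   next
    case False
    have "{d \<in> S. snd d i = 1} \<subseteq> ?U - {c}"
    proof
     fix d assume d: "d \<in> {d \<in> S. snd d i = 1}"
     have c0: "snd c i = 0" using False ZP_snd[OF SZP[OF c], of i] by simp
     have "\<not> ZP_le k d c"
     proof
      assume "ZP_le k d c"
      from ZP_leD[OF this i] show False using d c0 by auto
     qed
     then show "d \<in> ?U - {c}" using comp[OF c, of d] d False by auto
    qed
    then have "?a i \<le> sum \<xi> (?U - {c})"
     unfolding conjunct1[OF coordinate[OF i]] by (rule sum_mono2[rotated]) (use finU simp(1) in auto)
    then show ?thesis using s i False by (simp add: odd_set_def)
   qed
   then show "s \<in> level_set k ?a (odd_set k c)" using s rest U1 by (auto simp: level_set_def)
  qed
  from level_weight_ge[OF _ this] show ?thesis using U simp(1)[of c] by simp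
 qed
 let ?w = "level_weight k ?a" and ?AS = "odd_set k ` S"
 have AS: "?AS \<subseteq> Pow {..<k}" by (auto simp: odd_set_def)
 have total: "sum ?w ?AS + sum ?w (Pow {..<k} - ?AS) = 1"
  using sum.subset_diff[OF AS, of ?w] sum_level_weight_all[of k ?a] by simp
 have rest0: "0 \<le> sum ?w (Pow {..<k} - ?AS)" by (rule sum_nonneg) (rule level_weight_nonneg)
 have img: "sum ?w ?AS = (\<Sum>c\<in>S. ?w (odd_set k c))" by (simp add: sum.reindex[OF inj])
 have ge1: "1 \<le> sum ?w ?AS" unfolding img sumS[symmetric] by (rule sum_mono) (rule le)
 \<comment> \<open>The level weights on \<open>?AS\<close> sum to at most 1 and dominate weights
   with sum 1, so the nonnegative differences vanish; the level weights outside \<open>?AS\<close>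
   vanish too.\<close>
 have eqS: "?w (odd_set k c) = \<xi> c" if c: "c \<in> S" for c
 proof -
  have "(\<Sum>c\<in>S. ?w (odd_set k c) - \<xi> c) = 0" using ge1 rest0 total img sumS by (simp add: sum_subtractf)
  then have "\<forall>c\<in>S. ?w (odd_set k c) - \<xi> c = 0"
   by (subst (asm) sum_nonneg_eq_0_iff) (use finS le in auto)
  then show ?thesis using c by simp
 qed
 have zero: "?w A = 0" if "A \<in> Pow {..<k} - ?AS" for A
 proof -
  have "sum ?w (Pow {..<k} - ?AS) = 0" using ge1 rest0 total by simp
  then have "\<forall>A\<in>Pow {..<k} - ?AS. ?w A = 0"
   by (subst (asm) sum_nonneg_eq_0_iff) (use level_weight_nonneg in auto)
  then show ?thesis using that by blast
 qed
 show ?thesis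
 proof
  fix c
  show "unbary k (bary \<xi>) c = \<xi> c"
  proof (cases "c \<in> S")
   case True
   show ?thesis unfolding unbary_def v_def[symmetric]
    by (subst if_P[OF vertex[OF True]]) (rule eqS[OF True])
  next
   case False
   then have \<xi>0: "\<xi> c = 0" using simp(2)[of c] by (auto simp: S_def)
   have "?w (odd_set k c) = 0" if "c = zp_vertex k v (odd_set k c)"
   proof (rule zero)
    have "odd_set k c \<notin> ?AS"
    proof
     assume "odd_set k c \<in> ?AS"
     then obtain d where d: "d \<in> S" "odd_set k c = odd_set k d" by blast
     have "c = zp_vertex k v (odd_set k d)" by (subst d(2)[symmetric]) (rule that)
     then have "c = d" by (rule trans[OF _ vertex[OF d(1), symmetric]])
     then show False using d(1) False by simp
    qed
    then show "odd_set k c \<in> Pow {..<k} - ?AS" by (auto simp: odd_set_def)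
   qed
   then show ?thesis unfolding unbary_def v_def[symmetric] \<xi>0 by (rule if_eq_0I)
  qed
 qed
qed

lemma zp_vertex_ZP: "A \<subseteq> {..<k} ==> zp_vertex k v A \<in> ZP k"
 by (auto simp: zp_vertex_def ZP_def Zk_def)

text \<open>The vertices with positive level weight form a chain, and the sum of the level weights
  of sets containing \<open>i\<close> is \<open>tent (v i)\<close>. Hence the barycenter in
  direction \<open>i\<close> is the convex combination that represents \<open>v i\<close>.\<close>

lemma bary_unbary:
 assumes v: "!!i. k \<le> i ==> v i = 0"
 obtains \<sigma> where "\<sigma> \<in> poset_chains (ZP k) (ZP_le k)" "unbary k v \<in> simplex_of \<sigma>" "bary (unbary k v) = v"
proof -
 let ?a = "%i. tent (v i)"
 let ?w = "level_weight k ?a"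
 let ?Q = "{A \<in> Pow {..<k}. ?w A \<noteq> 0}"
 define \<sigma> where "\<sigma> = zp_vertex k v ` ?Q"
 have finQ: "finite ?Q" by simp
 have inj: "inj_on (zp_vertex k v) ?Q"
  by (rule inj_on_inverseI[where g = "odd_set k"]) (simp add: odd_set_vertex)
 have wt: "unbary k v (zp_vertex k v A) = ?w A" if "A \<in> ?Q" for A
  using that odd_set_vertex[of A k v] by (simp add: unbary_def)
 have sumQ: "(\<Sum>A\<in>?Q. ?w A * f A) = (\<Sum>A\<in>Pow {..<k}. ?w A * f A)" for f
  by (rule sum.mono_neutral_left) auto
 have Q1: "sum ?w ?Q = 1" using sumQ[of "%_. 1"] sum_level_weight_all[of k ?a] by simp
 have chain: "\<sigma> \<in> poset_chains (ZP k) (ZP_le k)"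
  unfolding poset_chains_def
 proof (intro CollectI conjI ballI)
  show "\<sigma> \<subseteq> ZP k" unfolding \<sigma>_def using zp_vertex_ZP by auto
  show "finite \<sigma>" unfolding \<sigma>_def using finQ by simp
  have "?Q \<noteq> {}" using Q1 by (metis sum.empty zero_neq_one)
  then show "\<sigma> \<noteq> {}" unfolding \<sigma>_def image_is_empty .
  have level: "\<exists>s. s \<in> level_set k ?a A" if "A \<in> ?Q" for A
  proof (rule ccontr)
   assume "\<nexists>s. s \<in> level_set k ?a A"
   then have "level_set k ?a A = {}" by blast
   then show False using that by (simp add: level_weight_def)
  qed
  \<comment> \<open>A higher level has a smaller odd set, and making midpoints into adjacent
    integers goes down in the poset.\<close>
  have le: "ZP_le k (zp_vertex k v B) (zp_vertex k v A)"
   if st: "s \<in> level_set k ?a A" "t \<in> level_set k ?a B" "s \<le> t" for A B s t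
  proof -
   have sub: "i \<in> A" if "i \<in> B" "i < k" for i
   proof -
    have "t \<le> ?a i" using that st(2) by (simp add: level_set_def)
    then have "s \<le> ?a i" using st(3) by simp
    then show "i \<in> A" using that st(1) by (simp add: level_set_def)
   qed
   have "\<lfloor>v i + 1 / 2\<rfloor> = \<lfloor>v i\<rfloor> \<or> \<lfloor>v i + 1 / 2\<rfloor> = \<lfloor>v i\<rfloor> + 1" for i by (cases rule: floor_half_cases[of "v i"]) auto
   then show ?thesis using sub by (auto simp: ZP_le_def zp_vertex_def)
  qed
  fix c d assume "c \<in> \<sigma>" "d \<in> \<sigma>"
  then obtain A B where AB: "A \<in> ?Q" "B \<in> ?Q" "c = zp_vertex k v A" "d = zp_vertex k v B" unfolding \<sigma>_def by blast
  obtain s t where st: "s \<in> level_set k ?a A" "t \<in> level_set k ?a B" using level AB by meson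
  show "ZP_le k c d \<or> ZP_le k d c"
   using le[OF st] le[OF st(2,1)] AB(3,4) by (cases "s \<le> t") auto
 qed
 have off: "unbary k v c = 0" if "c \<notin> \<sigma>" for c
 proof (rule ccontr)
  assume "unbary k v c \<noteq> 0"
  note nz = this
  have c: "c = zp_vertex k v (odd_set k c)"
   by (rule ccontr) (use nz in \<open>simp add: unbary_def\<close>)
  have "unbary k v c = ?w (odd_set k c)" unfolding unbary_def by (rule if_P[OF c])
  then have "odd_set k c \<in> ?Q" using nz by (simp add: odd_set_def subset_iff)
  then have "zp_vertex k v (odd_set k c) \<in> \<sigma>" unfolding \<sigma>_def by (rule imageI)
  then show False using that by (simp only: c[symmetric])
 qed
 have sum_\<sigma>: "(\<Sum>c\<in>\<sigma>. unbary k v c * f c) = (\<Sum>A\<in>Pow {..<k}. ?w A * f (zp_vertex k v A))" for f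
  unfolding \<sigma>_def sum.reindex[OF inj] comp_def sumQ[symmetric] by (rule sum.cong[OF refl]) (simp only: wt)
 have simp: "unbary k v \<in> simplex_of \<sigma>"
 proof -
  have "0 \<le> unbary k v c" for c by (simp add: unbary_def level_weight_nonneg)
  moreover have "sum (unbary k v) \<sigma> = 1" using sum_\<sigma>[of "%_. 1"] sum_level_weight_all[of k ?a] by simp
  ultimately show ?thesis using off by (simp add: simplex_of_def)
 qed
 have "bary (unbary k v) i = v i" for i
 proof (cases "i < k")
  case False
  then have "zp_val (zp_vertex k v A) i = 0" if "A \<in> Pow {..<k}" for A using that by (auto simp: zp_val_def zp_vertex_def)
  then have "bary (unbary k v) i = 0"
   unfolding bary_simplex[OF poset_chainsD(2)[OF chain] simp] sum_\<sigma> by (simp add: sum.neutral)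
  then show ?thesis using v[of i] False by simp
 next
  case True
  let ?I = "{A \<in> Pow {..<k}. i \<in> A}" and ?J = "{A \<in> Pow {..<k}. i \<notin> A}"
  have un: "Pow {..<k} = ?I \<union> ?J" by blast
  have disj: "(\<Sum>A\<in>Pow {..<k}. f A) = (\<Sum>A\<in>?I. f A) + (\<Sum>A\<in>?J. f A)" for f :: "nat set => real"
  proof -
   have "(\<Sum>A\<in>?I \<union> ?J. f A) = (\<Sum>A\<in>?I. f A) + (\<Sum>A\<in>?J. f A)" by (rule sum.union_disjoint) auto
   then show ?thesis using un by (simp only:)
  qed
  have I: "sum ?w ?I = ?a i" by (rule sum_level_weight_mem[OF True]) (rule tent_bounds)+
  have J: "sum ?w ?J = 1 - ?a i" using disj[of ?w] I sum_level_weight_all[of k ?a] by simp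
  have "(\<Sum>A\<in>?I. ?w A * zp_val (zp_vertex k v A) i) = (\<Sum>A\<in>?I. ?w A * (of_int \<lfloor>v i\<rfloor> + 1 / 2))"
   by (rule sum.cong[OF refl]) (use True in \<open>auto simp: zp_val_def zp_vertex_def\<close>)
  moreover have "(\<Sum>A\<in>?J. ?w A * zp_val (zp_vertex k v A) i) = (\<Sum>A\<in>?J. ?w A * of_int \<lfloor>v i + 1 / 2\<rfloor>)"
   by (rule sum.cong[OF refl]) (use True in \<open>auto simp: zp_val_def zp_vertex_def\<close>)
  ultimately have "bary (unbary k v) i = ?a i * (of_int \<lfloor>v i\<rfloor> + 1 / 2) + (1 - ?a i) * of_int \<lfloor>v i + 1 / 2\<rfloor>"
   unfolding bary_simplex[OF poset_chainsD(2)[OF chain] simp] sum_\<sigma> disj sum_distrib_right[symmetric] I J by simp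
  then show ?thesis by (simp only: tent_convex)
 qed
 then have "bary (unbary k v) = v" by (rule ext)
 then show ?thesis by (rule that[OF chain simp])
qed

section \<open>The realization as a topological space\<close>

lemma topspace_realization: "topspace (realization P r) = (\<Union>\<sigma>\<in>poset_chains P r. simplex_of \<sigma>)"
proof -
 let ?U = "\<Union>\<sigma>\<in>poset_chains P r. simplex_of \<sigma>"
 have "openin (top_of_set (simplex_of \<sigma>)) (?U \<inter> simplex_of \<sigma>)" if "\<sigma> \<in> poset_chains P r" for \<sigma>
 proof -
  have "?U \<inter> simplex_of \<sigma> = simplex_of \<sigma>" using that by blast
  then show ?thesis by (simp only: openin_subtopology_self openin_subtopology_refl) simp
 qed
 then have "openin (realization P r) ?U" by (simp add: openin_realization)
 then have "?U \<subseteq> topspace (realization P r)" by (rule openin_subset)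
 moreover have "topspace (realization P r) \<subseteq> ?U"
  using openin_topspace[of "realization P r"] by (subst (asm) openin_realization) (rule conjunct1)
 ultimately show ?thesis by (rule antisym[rotated])
qed

lemma closedin_realizationD:
 assumes "closedin (realization P r) C" "\<sigma> \<in> poset_chains P r"
 shows "closedin (top_of_set (simplex_of \<sigma>)) (C \<inter> simplex_of \<sigma>)"
proof -
 have "openin (top_of_set (simplex_of \<sigma>)) ((topspace (realization P r) - C) \<inter> simplex_of \<sigma>)"
  using assms by (simp add: closedin_def openin_realization)
 moreover have "(topspace (realization P r) - C) \<inter> simplex_of \<sigma> = simplex_of \<sigma> - (C \<inter> simplex_of \<sigma>)"
  unfolding topspace_realization using assms(2) by blast
 ultimately show ?thesis by (simp add: closedin_def)
qed

lemma continuous_map_realization: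
 assumes "!!\<sigma>. \<sigma> \<in> poset_chains P r ==> continuous_map (top_of_set (simplex_of \<sigma>)) Y f"
 shows "continuous_map (realization P r) Y f"
 unfolding continuous_map_def
proof (intro conjI allI impI)
 show "f \<in> topspace (realization P r) \<rightarrow> topspace Y"
 proof (rule Pi_I)
  fix x assume "x \<in> topspace (realization P r)"
  then obtain \<sigma> where \<sigma>: "\<sigma> \<in> poset_chains P r" "x \<in> simplex_of \<sigma>" unfolding topspace_realization by (rule UN_E)
  show "f x \<in> topspace Y"
   by (rule funcset_mem[OF continuous_map_funspace[OF assms[OF \<sigma>(1)]]]) (use \<sigma>(2) in simp)
 qed
 fix U assume U: "openin Y U"
 let ?V = "{x \<in> topspace (realization P r). f x \<in> U}"
 have "openin (top_of_set (simplex_of \<sigma>)) (?V \<inter> simplex_of \<sigma>)" if \<sigma>: "\<sigma> \<in> poset_chains P r" for \<sigma>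
 proof -
  have "?V \<inter> simplex_of \<sigma> = {x \<in> topspace (top_of_set (simplex_of \<sigma>)). f x \<in> U}"
   unfolding topspace_realization using \<sigma> by auto
  then show ?thesis using openin_continuous_map_preimage[OF assms[OF \<sigma>] U] by (simp only:)
 qed
 then show "openin (realization P r) ?V" unfolding openin_realization by (auto simp: topspace_realization)
qed

lemma compact_simplex_of:
 assumes "finite \<sigma>" shows "compact (simplex_of \<sigma>)"
proof -
 have coord: "continuous_on UNIV (%t::'a => real. t x)" for x by (rule continuous_on_product_coordinates)
 have "compactin (product_topology (%_. euclideanreal) (UNIV :: 'a set)) (PiE UNIV (%_. {0..1}))"
  unfolding compactin_PiE by auto
 then have cube: "compact (PiE UNIV (%_::'a. {0..1::real}))"
  by (simp add: euclidean_product_topology)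
 have "closed (\<Inter>x\<in>\<sigma>. {t::'a => real. 0 \<le> t x})" by (intro closed_INT ballI closed_Collect_le continuous_on_const coord)
 moreover have "closed (\<Inter>x\<in>-\<sigma>. {t::'a => real. t x = 0})" by (intro closed_INT ballI closed_Collect_eq continuous_on_const coord)
 moreover have "closed {t::'a => real. sum t \<sigma> = 1}" by (intro closed_Collect_eq continuous_on_sum continuous_on_const coord)
 moreover have "simplex_of \<sigma> = (\<Inter>x\<in>\<sigma>. {t. 0 \<le> t x}) \<inter> ((\<Inter>x\<in>-\<sigma>. {t. t x = 0}) \<inter> {t. sum t \<sigma> = 1})"
  by (auto simp: simplex_of_def)
 ultimately have closed: "closed (simplex_of \<sigma>)" by (simp only: closed_Int)
 have "simplex_of \<sigma> \<subseteq> PiE UNIV (%_. {0..1})"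
 proof
  fix t :: "'a => real" assume t: "t \<in> simplex_of \<sigma>"
  have "0 \<le> t x \<and> t x \<le> 1" for x
  proof (cases "x \<in> \<sigma>")
   case True
   have "t x \<le> sum t \<sigma>" by (rule member_le_sum[OF True _ assms]) (rule simplex_ofD(1)[OF t])
   then show ?thesis using simplex_ofD[OF t] by simp
  next
   case False
   then show ?thesis using simplex_ofD(2)[OF t] by simp
  qed
  then show "t \<in> PiE UNIV (%_. {0..1})" by auto
 qed
 then have "simplex_of \<sigma> = PiE UNIV (%_. {0..1}) \<inter> simplex_of \<sigma>" by blast
 then show ?thesis using compact_Int_closed[OF cube closed] by (simp only:)
qed

lemma topspace_Euclidean: "topspace (Euclidean_space k) = {v. \<forall>i\<ge>k. v i = 0}"
 by (simp add: Euclidean_space_def)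

lemma continuous_map_bary:
 "continuous_map (realization (ZP k) (ZP_le k)) (Euclidean_space k) bary"
proof (rule continuous_map_realization)
 fix \<sigma> assume \<sigma>: "\<sigma> \<in> poset_chains (ZP k) (ZP_le k)"
 note chain = poset_chainsD[OF \<sigma>]
 have eq: "bary \<xi> i = (\<Sum>c\<in>\<sigma>. \<xi> c * zp_val c i)" if "\<xi> \<in> simplex_of \<sigma>" for \<xi> i
  by (rule bary_simplex[OF chain(2) that])
 have "continuous_map (top_of_set (simplex_of \<sigma>)) euclideanreal (%\<xi>. bary \<xi> i)" for i
 proof (rule continuous_map_eq)
  have "continuous_on (simplex_of \<sigma>) (%\<xi>. \<Sum>c\<in>\<sigma>. \<xi> c * zp_val c i)"
   by (intro continuous_on_sum continuous_on_mult continuous_on_const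
     continuous_on_subset[OF continuous_on_product_coordinates] subset_UNIV)
  then show "continuous_map (top_of_set (simplex_of \<sigma>)) euclideanreal (%\<xi>. \<Sum>c\<in>\<sigma>. \<xi> c * zp_val c i)" by simp
 qed (simp add: eq)
 then have "continuous_map (top_of_set (simplex_of \<sigma>)) (powertop_real UNIV) bary"
  by (simp add: continuous_map_componentwise_UNIV)
 moreover have "bary \<xi> i = 0" if "\<xi> \<in> simplex_of \<sigma>" "k \<le> i" for \<xi> i
  unfolding eq[OF that(1)]
 proof (rule sum.neutral, rule ballI)
  fix c assume "c \<in> \<sigma>"
  then have "c \<in> ZP k" using chain(1) by blast
  from ZP_ge[OF this that(2)] show "\<xi> c * zp_val c i = 0" by (simp add: zp_val_def)
 qed
 ultimately show "continuous_map (top_of_set (simplex_of \<sigma>)) (Euclidean_space k) bary"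
  unfolding Euclidean_space_def continuous_map_in_subtopology by auto
qed

text \<open>Comparable vertices differ by at most 1 in each direction, and the point is a convex
  combination of vertices of the chain.\<close>

lemma bary_near_vertices:
 assumes \<sigma>: "\<sigma> \<in> poset_chains (ZP k) (ZP_le k)" and \<xi>: "\<xi> \<in> simplex_of \<sigma>" and c: "c \<in> \<sigma>" and i: "i < k"
 shows "\<bar>bary \<xi> i - zp_val c i\<bar> \<le> 1"
proof -
 note chain = poset_chainsD[OF \<sigma>] and simp = simplex_ofD[OF \<xi>]
 have near: "\<bar>zp_val d i - zp_val c i\<bar> \<le> 1" if d: "d \<in> \<sigma>" for d
 proof -
  have "c \<in> ZP k" "d \<in> ZP k" using chain(1) c d by auto
  then have "snd c i = 0 \<or> snd c i = 1" "snd d i = 0 \<or> snd d i = 1" using ZP_snd by blast+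
  then show ?thesis using chain(4)[OF c d] ZP_leD[OF _ i, of c d] ZP_leD[OF _ i, of d c] by (auto simp: zp_val_def)
 qed
 have "zp_val c i = (\<Sum>d\<in>\<sigma>. \<xi> d * zp_val c i)" using simp(3) by (simp flip: sum_distrib_right)
 then have "bary \<xi> i - zp_val c i = (\<Sum>d\<in>\<sigma>. \<xi> d * (zp_val d i - zp_val c i))"
  by (simp add: bary_simplex[OF chain(2) \<xi>] right_diff_distrib sum_subtractf)
 also have "\<bar>\<dots>\<bar> \<le> (\<Sum>d\<in>\<sigma>. \<xi> d)"
 proof (rule order_trans[OF sum_abs], rule sum_mono)
  fix d assume d: "d \<in> \<sigma>"
  have "\<xi> d * \<bar>zp_val d i - zp_val c i\<bar> \<le> \<xi> d * 1" by (rule mult_left_mono[OF near[OF d] simp(1)])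
  then show "\<bar>\<xi> d * (zp_val d i - zp_val c i)\<bar> \<le> \<xi> d" using simp(1)[of d] by (simp add: abs_mult)
 qed
 finally show ?thesis using simp(3) by simp
qed

lemma finite_bounded_ZP: "finite {c \<in> ZP k. \<forall>i<k. \<bar>zp_val c i - v i\<bar> \<le> 2}"
proof -
 \<comment> \<open>One finite set of integers serves all directions. Subtracting the half leaves
   integers between \<open>v i - 3\<close> and \<open>v i + 2\<close>, so the margin 4 around the
   floor suffices.\<close>
 let ?B = "\<Union>i<k. {\<lfloor>v i\<rfloor> - 4..\<lfloor>v i\<rfloor> + 4}"
 let ?Z = "{f. \<forall>i. (i \<in> {..<k} --> f i \<in> ?B) \<and> (i \<notin> {..<k} --> f i = 0)}"
 let ?P = "{f. \<forall>i. (i \<in> {..<k} --> f i \<in> {0, 1::nat}) \<and> (i \<notin> {..<k} --> f i = 0)}"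
 have "finite ?Z" "finite ?P" by (rule finite_set_of_finite_funs; simp)+
 then have "finite (?Z \<times> ?P)" by (rule finite_cartesian_product)
 moreover have "{c \<in> ZP k. \<forall>i<k. \<bar>zp_val c i - v i\<bar> \<le> 2} \<subseteq> ?Z \<times> ?P"
 proof
  fix c assume c: "c \<in> {c \<in> ZP k. \<forall>i<k. \<bar>zp_val c i - v i\<bar> \<le> 2}"
  then have ZP: "c \<in> ZP k" by simp
  have "fst c i \<in> {\<lfloor>v i\<rfloor> - 4..\<lfloor>v i\<rfloor> + 4}" if "i < k" for i
  proof -
   have "\<bar>of_int (fst c i) + of_nat (snd c i) / 2 - v i\<bar> \<le> 2" using c that by (simp add: zp_val_def)
   then have "of_int (fst c i) \<le> v i + 2" "v i - 3 \<le> of_int (fst c i)" using ZP_snd[OF ZP, of i] by auto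
   then show ?thesis by (simp, linarith)
  qed
  then have "fst c \<in> ?Z" using ZP_ge[OF ZP] by auto
  moreover have "snd c \<in> ?P" using ZP_ge[OF ZP] ZP_snd[OF ZP] by auto
  ultimately show "c \<in> ?Z \<times> ?P" by (simp only: mem_Times_iff)
 qed
 ultimately show ?thesis by (rule finite_subset[rotated])
qed

text \<open>The inverse is not shown continuous directly. The map is closed, because a closed set is
  the union of its traces on simplices, whose images are compact and form a locally finite
  family.\<close>

lemma homeomorphic_map_bary:
 "homeomorphic_map (realization (ZP k) (ZP_le k)) (Euclidean_space k) bary"
proof (rule bijective_closed_imp_homeomorphic_map[OF continuous_map_bary])
 let ?X = "realization (ZP k) (ZP_le k)" and ?E = "Euclidean_space k" and ?C = "poset_chains (ZP k) (ZP_le k)"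
 have sub: "bary ` topspace ?X \<subseteq> topspace ?E" by (rule continuous_map_image_subset_topspace[OF continuous_map_bary])
 show "bary ` topspace ?X = topspace ?E"
 proof (rule equalityI[OF sub], rule subsetI)
  fix v assume "v \<in> topspace ?E"
  then have "v i = 0" if "k \<le> i" for i using that by (simp add: topspace_Euclidean)
  then obtain \<sigma> where \<sigma>: "\<sigma> \<in> ?C" "unbary k v \<in> simplex_of \<sigma>" "bary (unbary k v) = v" by (rule bary_unbary)
  have "unbary k v \<in> (\<Union>\<sigma>\<in>?C. simplex_of \<sigma>)" by (rule UN_I[OF \<sigma>(1)]) (rule \<sigma>(2))
  then have "bary (unbary k v) \<in> bary ` (\<Union>\<sigma>\<in>?C. simplex_of \<sigma>)" by (rule imageI)
  then show "v \<in> bary ` topspace ?X" by (simp only: \<sigma>(3) topspace_realization)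
 qed
 show "inj_on bary (topspace ?X)"
 proof (rule inj_on_inverseI)
  fix \<xi> assume "\<xi> \<in> topspace ?X"
  then obtain \<sigma> where "\<sigma> \<in> ?C" "\<xi> \<in> simplex_of \<sigma>" unfolding topspace_realization by (rule UN_E)
  then show "unbary k (bary \<xi>) = \<xi>" by (rule unbary_bary)
 qed
 have haus: "Hausdorff_space ?E"
  unfolding Euclidean_space_def by (intro Hausdorff_space_subtopology) (simp add: Hausdorff_space_product_topology)
 show "closed_map ?X ?E bary"
  unfolding closed_map_def
 proof (intro allI impI)
  fix C assume C: "closedin ?X C"
  let ?F = "(%\<sigma>. bary ` (C \<inter> simplex_of \<sigma>)) ` ?C"
  have CU: "C \<subseteq> topspace ?X" by (rule closedin_subset[OF C])
  have "C = C \<inter> (\<Union>\<sigma>\<in>?C. simplex_of \<sigma>)" using CU by (simp only: topspace_realization Int_absorb2)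
  then have "bary ` C = bary ` (C \<inter> (\<Union>\<sigma>\<in>?C. simplex_of \<sigma>))" by (rule arg_cong)
  also have "\<dots> = \<Union>?F" by (simp only: Int_UN_distrib image_UN)
  finally have bC: "bary ` C = \<Union>?F" .
  have "closedin ?E (\<Union>?F)"
  proof (rule closedin_locally_finite_Union)
   show "closedin ?E S" if S: "S \<in> ?F" for S
   proof -
    from S obtain \<sigma> where \<sigma>': "S = bary ` (C \<inter> simplex_of \<sigma>)" "\<sigma> \<in> ?C" by (rule imageE)
    note \<sigma> = \<sigma>'(2,1)
    have "compact (simplex_of \<sigma>)" by (rule compact_simplex_of[OF poset_chainsD(2)[OF \<sigma>(1)]])
    then have "compact_space (top_of_set (simplex_of \<sigma>))" by (simp add: compact_space_subtopology)
    from closedin_compact_space[OF this closedin_realizationD[OF C \<sigma>(1)]]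
    have comp: "compactin (top_of_set (simplex_of \<sigma>)) (C \<inter> simplex_of \<sigma>)" .
    have incl: "continuous_map (top_of_set (simplex_of \<sigma>)) ?X id"
    proof -
     have "openin (top_of_set (simplex_of \<sigma>)) {x \<in> topspace (top_of_set (simplex_of \<sigma>)). id x \<in> U}" if "openin ?X U" for U
     proof -
      have "openin (top_of_set (simplex_of \<sigma>)) (U \<inter> simplex_of \<sigma>)" using that \<sigma>(1) by (simp add: openin_realization)
      moreover have "{x \<in> topspace (top_of_set (simplex_of \<sigma>)). id x \<in> U} = U \<inter> simplex_of \<sigma>" by auto
      ultimately show ?thesis by (simp only:)
     qed
     moreover have "id \<in> topspace (top_of_set (simplex_of \<sigma>)) \<rightarrow> topspace ?X"
      unfolding topspace_realization using \<sigma>(1) by auto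
     ultimately show ?thesis unfolding continuous_map_def by blast
    qed
    have "continuous_map (top_of_set (simplex_of \<sigma>)) ?E (bary \<circ> id)"
     by (rule continuous_map_compose[OF incl continuous_map_bary])
    then have "compactin ?E ((bary \<circ> id) ` (C \<inter> simplex_of \<sigma>))" by (rule image_compactin[OF comp])
    then show ?thesis using compactin_imp_closedin[OF haus] \<sigma>(2) by simp
   qed
   show "locally_finite_in ?E ?F"
    unfolding locally_finite_in_def
   proof (intro conjI ballI)
    have "bary ` C \<subseteq> topspace ?E" by (rule subset_trans[OF image_mono[OF CU] sub])
    then show "\<Union>?F \<subseteq> topspace ?E" by (simp only: bC)
    fix v assume v: "v \<in> topspace ?E"
    let ?V = "\<Inter>i\<in>{..<k}. {y \<in> topspace ?E. y i \<in> ball (v i) 1}"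
    let ?V' = "{y \<in> topspace ?E. \<forall>i<k. y i \<in> ball (v i) 1}"
    have coord: "continuous_map ?E euclideanreal (%y. y i)" for i
     unfolding Euclidean_space_def
     by (rule continuous_map_from_subtopology) (rule continuous_map_product_projection, simp)
    have open_i: "openin ?E {y \<in> topspace ?E. y i \<in> ball (v i) 1}" for i
     by (rule openin_continuous_map_preimage[OF coord]) simp
    have "openin ?E ?V'"
    proof (cases "k = 0")
     case True
     then show ?thesis by simp
    next
     case False
     then have "?V' = ?V" by auto
     moreover have "openin ?E ?V" using False open_i by (intro openin_INT2) auto
     ultimately show ?thesis by (simp only:)
    qed
    moreover have "v \<in> ?V'" using v by simp
    moreover have "finite {U \<in> ?F. U \<inter> ?V' \<noteq> {}}"
    proof (rule finite_subset)
     \<comment> \<open>The bound 2 is the radius 1 of the neighbourhood plus the distance 1 between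
       a point of a simplex and its vertices.\<close>
     let ?B = "{c \<in> ZP k. \<forall>i<k. \<bar>zp_val c i - v i\<bar> \<le> 2}"
     show "finite ((%\<sigma>. bary ` (C \<inter> simplex_of \<sigma>)) ` Pow ?B)" by (intro finite_imageI finite_Pow_iff[THEN iffD2] finite_bounded_ZP)
     show "{U \<in> ?F. U \<inter> ?V' \<noteq> {}} \<subseteq> (%\<sigma>. bary ` (C \<inter> simplex_of \<sigma>)) ` Pow ?B"
     proof
      fix U assume "U \<in> {U \<in> ?F. U \<inter> ?V' \<noteq> {}}"
      then have U: "U \<in> ?F \<and> U \<inter> ?V' \<noteq> {}" by (rule CollectD)
      obtain \<sigma> where \<sigma>1: "U = bary ` (C \<inter> simplex_of \<sigma>)" "\<sigma> \<in> ?C" using conjunct1[OF U] by (rule imageE)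
      obtain y where y: "y \<in> U \<inter> ?V'" using conjunct2[OF U] by (meson all_not_in_conv)
      then have "y \<in> U" by (rule IntD1)
      then obtain \<xi> where \<xi>: "y = bary \<xi>" "\<xi> \<in> C \<inter> simplex_of \<sigma>" unfolding \<sigma>1(1) by (rule imageE)
      have "bary \<xi> \<in> ?V'" unfolding \<xi>(1)[symmetric] using y by (rule IntD2)
      note \<sigma>3 = IntD2[OF \<xi>(2)] this
      note \<sigma> = \<sigma>1(2,1) \<sigma>3
      have "\<sigma> \<subseteq> ?B"
      proof
       fix c assume c: "c \<in> \<sigma>"
       have "\<bar>zp_val c i - v i\<bar> \<le> 2" if i: "i < k" for i
       proof -
        have "\<bar>v i - bary \<xi> i\<bar> < 1" using \<sigma>(4) i by (simp add: dist_real_def)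
        then show ?thesis using bary_near_vertices[OF \<sigma>(1,3) c i] by linarith
       qed
       then show "c \<in> ?B" using poset_chainsD(1)[OF \<sigma>(1)] c by blast
      qed
      then have P: "\<sigma> \<in> Pow ?B" by (rule PowI)
      show "U \<in> (%\<sigma>. bary ` (C \<inter> simplex_of \<sigma>)) ` Pow ?B"
       by (rule image_eqI[where f = "%\<sigma>. bary ` (C \<inter> simplex_of \<sigma>)", OF _ P]) (rule \<sigma>(2))
     qed
    qed
    ultimately show "\<exists>V. openin ?E V \<and> v \<in> V \<and> finite {U \<in> ?F. U \<inter> V \<noteq> {}}"
     by (intro exI[of _ ?V'] conjI)
   qed
  qed
  then show "closedin ?E (bary ` C)" by (simp only: bC)
 qed
qed

section \<open>Induced maps of realizations and equivariance\<close>

lemma realization_map_inj: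
 assumes "inj_on f {x. \<xi> x \<noteq> 0}"
 shows "{y. realization_map f \<xi> y \<noteq> 0} = f ` {x. \<xi> x \<noteq> 0}"
  and "\<xi> x \<noteq> 0 ==> realization_map f \<xi> (f x) = \<xi> x"
proof -
 have val: "realization_map f \<xi> (f x) = \<xi> x" if "\<xi> x \<noteq> 0" for x
 proof -
  have "{x'. \<xi> x' \<noteq> 0 \<and> f x' = f x} = {x}" using assms that by (auto dest: inj_onD)
  then show ?thesis by (simp add: realization_map_def)
 qed
 then show "\<xi> x \<noteq> 0 ==> realization_map f \<xi> (f x) = \<xi> x" .
 show "{y. realization_map f \<xi> y \<noteq> 0} = f ` {x. \<xi> x \<noteq> 0}"
 proof (intro Set.set_eqI iffI)
  fix y assume "y \<in> {y. realization_map f \<xi> y \<noteq> 0}"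
  then have "realization_map f \<xi> y \<noteq> 0" by (rule CollectD)
  then have "{x. \<xi> x \<noteq> 0 \<and> f x = y} \<noteq> {}" unfolding realization_map_def by (metis (no_types) sum.empty)
  then show "y \<in> f ` {x. \<xi> x \<noteq> 0}" by blast
 next
  fix y assume "y \<in> f ` {x. \<xi> x \<noteq> 0}"
  then show "y \<in> {y. realization_map f \<xi> y \<noteq> 0}" using val by auto
 qed
qed

lemma bary_realization_map:
 assumes "inj_on f {x. \<xi> x \<noteq> 0}"
 shows "bary (realization_map f \<xi>) i = (\<Sum>x\<in>{x. \<xi> x \<noteq> 0}. \<xi> x * zp_val (f x) i)"
 unfolding bary_def realization_map_inj(1)[OF assms] sum.reindex[OF assms] comp_def
 by (rule sum.cong[OF refl]) (simp add: realization_map_inj(2)[OF assms])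

text \<open>Injective maps of vertices carry the weights along unchanged. Every vertex is moved by
  the same vector, and the weights sum to 1, so the barycenter moves by that vector.\<close>

lemma bary_equivariant:
 fixes m :: "nat => int"
 assumes f: "inj_on f P" and g: "inj_on g P" "g ` P \<subseteq> P" and \<xi>: "\<xi> \<in> topspace (realization P r)"
  and shift: "!!x. x \<in> P ==> zp_val (f (g x)) i = zp_val (f x) i + of_int (m i)"
 shows "bary (realization_map f (realization_map g \<xi>)) i = bary (realization_map f \<xi>) i + of_int (m i)"
proof -
 let ?S = "{x. \<xi> x \<noteq> 0}"
 obtain \<sigma> where \<sigma>: "\<sigma> \<in> poset_chains P r" "\<xi> \<in> simplex_of \<sigma>" using \<xi> unfolding topspace_realization by blast
 note chain = poset_chainsD[OF \<sigma>(1)] and simp = simplex_ofD[OF \<sigma>(2)]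
 have S\<sigma>: "?S \<subseteq> \<sigma>" using simp(2) by auto
 then have SP: "?S \<subseteq> P" using chain(1) by blast
 have S1: "sum \<xi> ?S = 1" unfolding simp(3)[symmetric] by (rule sum.mono_neutral_left[OF chain(2) S\<sigma>]) auto
 have gS: "inj_on g ?S" by (rule inj_on_subset[OF g(1) SP])
 have supp: "{y. realization_map g \<xi> y \<noteq> 0} = g ` ?S" by (rule realization_map_inj(1)[OF gS])
 have "inj_on f {y. realization_map g \<xi> y \<noteq> 0}"
  unfolding supp by (rule inj_on_subset[OF f]) (use SP g(2) in blast)
 from bary_realization_map[OF this]
 have "bary (realization_map f (realization_map g \<xi>)) i = (\<Sum>x\<in>?S. realization_map g \<xi> (g x) * zp_val (f (g x)) i)"
  unfolding supp sum.reindex[OF gS] comp_def .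
 also have "\<dots> = (\<Sum>x\<in>?S. \<xi> x * zp_val (f x) i + \<xi> x * of_int (m i))"
 proof (rule sum.cong[OF refl])
  fix x assume x: "x \<in> ?S"
  then have "realization_map g \<xi> (g x) = \<xi> x" by (intro realization_map_inj(2)[OF gS]) simp
  moreover have "zp_val (f (g x)) i = zp_val (f x) i + of_int (m i)" by (rule shift) (use SP x in blast)
  ultimately show "realization_map g \<xi> (g x) * zp_val (f (g x)) i = \<xi> x * zp_val (f x) i + \<xi> x * of_int (m i)"
   by (simp add: distrib_left)
 qed
 also have "\<dots> = bary (realization_map f \<xi>) i + of_int (m i)"
  unfolding sum.distrib sum_distrib_right[symmetric] S1 bary_realization_map[OF inj_on_subset[OF f SP]] by simp
 finally show ?thesis .
qed

section \<open>The theorem\<close>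

theorem proposition6p4:
  fixes n k :: nat
  assumes "n + k \<ge> 1"
  shows "\<exists>f h. poset_iso (Fnk n k) (F_le n k) (ZP k) (ZP_le k) f \<and>
     homeomorphic_map (realization (ZP k) (ZP_le k)) (Euclidean_space k) h \<and>
     (\<forall>m\<in>Zk k. poset_iso (Fnk n k) (F_le n k) (Fnk n k) (F_le n k) (Zk_act n k m) \<and>
        (\<forall>\<xi>\<in>topspace (realization (Fnk n k) (F_le n k)).
           h (realization_map f (realization_map (Zk_act n k m) \<xi>)) =
             (\<lambda>i. h (realization_map f \<xi>) i + of_int (m i))))"
proof (rule exI[of _ "fiber_code n k"], rule exI[of _ bary], intro conjI ballI)
  show "poset_iso (Fnk n k) (F_le n k) (ZP k) (ZP_le k) (fiber_code n k)"
    unfolding poset_iso_def using bij_betw_fiber_code[OF assms] F_le_iff[OF assms] by simp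
  show "homeomorphic_map (realization (ZP k) (ZP_le k)) (Euclidean_space k) bary"
    by (rule homeomorphic_map_bary)
  fix m assume m: "m \<in> Zk k"
  show iso: "poset_iso (Fnk n k) (F_le n k) (Fnk n k) (F_le n k) (Zk_act n k m)"
    by (rule poset_iso_Zk_act[OF assms m])
  fix \<xi> assume \<xi>: "\<xi> \<in> topspace (realization (Fnk n k) (F_le n k))"
  have bij: "bij_betw (Zk_act n k m) (Fnk n k) (Fnk n k)" using iso by (simp add: poset_iso_def)
  show "bary (realization_map (fiber_code n k) (realization_map (Zk_act n k m) \<xi>)) =
      (\<lambda>i. bary (realization_map (fiber_code n k) \<xi>) i + of_int (m i))"
  proof (rule ext, rule bary_equivariant[OF _ _ _ \<xi>])
    show "inj_on (fiber_code n k) (Fnk n k)" by (rule bij_betw_imp_inj_on[OF bij_betw_fiber_code[OF assms]])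
    show "inj_on (Zk_act n k m) (Fnk n k)" by (rule bij_betw_imp_inj_on[OF bij])
    show "Zk_act n k m ` Fnk n k \<subseteq> Fnk n k" using bij_betw_imp_surj_on[OF bij] by simp
    fix X i assume "X \<in> Fnk n k"
    from Zk_act_Fnk(2)[OF assms m this]
    show "zp_val (fiber_code n k (Zk_act n k m X)) i = zp_val (fiber_code n k X) i + of_int (m i)"
      by (simp add: zp_val_def translate_def)
  qed
qed

end
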